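(* Let $A_1\in\mathbb C^{n_1\times n_1}$, $A_2\in\mathbb C^{n_2\times n_2}$ with $\sigma(A_1)\cup\sigma(A_2)\subset\mathbb D$, let $C\in\mathbb C^{m\times n}$, $n=n_1+n_2$, let $M,N$ be as in the context and let $P\in\mathbb C^{n\times n}$ be a Hermitian solution of $M^*PM-N^*PN=C^*j_{pq}C$. If $s\in\widehat{\mathcal S}_\kappa(A_1,A_2,C,P)$, then $P_s=P$, and hence $$\widehat{\mathcal S}_\kappa(A_1,A_2,C,P)=\mathcal S_\kappa(A_1,A_2,C,P).$$
   Context: Notation. $p,q\ge1$, $m=p+q$, $j_{pq}=\begin{bmatrix}I_p&0\\0&-I_q\end{bmatrix}$, $\mathbb D=\{|\lambda|<1\}$, $\mathbb T=\partial\mathbb D$, "mvf" = matrix valued function. $L_2^k$ is the space of $\mathbb C^k$-valued square integrable functions on $\mathbb T$ with $\langle f,g\rangle=\frac1{2\pi}\int_0^{2\pi}g(e^{i\theta})^*f(e^{i\theta})\,d\theta$; $H_2^k\subset L_2^k$ is the Hardy space of $\mathbb D$, $(H_2^k)^\perp=L_2^k\ominus H_2^k$, and $P_+,P_-$ are the orthogonal projections onto $H_2^k$, $(H_2^k)^\perp$. Generalized Schur class. $\mathcal S_\kappa^{p\times q}$ is the set of $p\times q$ mvf's $s$ meromorphic in $\mathbb D$ for which the kernel $\frac{I_p-s(\lambda)s(\omega)^*}{1-\lambda\overline\omega}$ has $\kappa$ negative squares on the domain of holomorphy of $s$ in $\mathbb D$ (all the associated finite Hermitian Gram matrices have at most $\kappa$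 negative eigenvalues, and some has exactly $\kappa$). $\mathcal S^{p\times q}=\mathcal S_0^{p\times q}$ is the Schur class. A Blaschke–Potapov product of degree $\kappa$ is, up to a constant unitary factor, a product of $\kappa$ factors $I-\Pi+\frac{\lambda-\alpha}{1-\overline\alpha\lambda}\Pi$ with $\alpha\in\mathbb D$, $\Pi$ a rank one orthogonal projection. Every $s\in\mathcal S_\kappa^{p\times q}$ has Kreĭn–Langer factorizations $s=b_\ell^{-1}s_\ell=s_rb_r^{-1}$ with $b_\ell$ ($p\times p$), $b_r$ ($q\times q$) Blaschke–Potapov products of degree $\kappa$, $s_\ell,s_r\in\mathcal S^{p\times q}$, $\operatorname{rank}[b_\ell\ s_\ell]=p$ and $\operatorname{rank}[b_r^*\ s_r^*]=q$ at every point of $\mathbb D$. The boundary values of $s$ on $\mathbb T$ exist a.e. and are contractive. Data. $n_1,n_2\ge0$, $n=n_1+n_2\ge1$, $M=\begin{bmatrix}A_1&0\\0&I_{n_2}\end{bmatrix}$, $N=\begin{bmatrix}I_{n_1}&0\\0&A_2\end{bmatrix}$, $F(\lambda)=C(M-\lambda N)^{-1}$. (If $n_1=0$ or $n_2=0$ the corresponding blocks are absent.) The matrix $P_s$. For $s\in\mathcal S_\kappa^{p\times q}$ let $\Delta_s=\begin{bmatrix}I_p&-s\\-s^*&I_q\end{bmatrix}$ on $\mathbb T$, $\mathcal H(b_r)=H_2^q\ominus b_rH_2^q$, $\mathcal H_*(b_\ell)=(H_2^p)^\perp\ominus b_\ell^*(H_2^p)^\perp$. The operator $Y_\ell:h\in\mathcal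 H_*(b_\ell)\mapsto P_+s^*h$ is a bijection onto $\mathcal H(b_r)$; put $\Gamma_\ell f=Y_\ell^{-1}P_{\mathcal H(b_r)}f$ for $f\in L_2^q$ (with $P_{\mathcal H(b_r)}$ the orthogonal projection), so $\Gamma_\ell:L_2^q\to\mathcal H_*(b_\ell)\subset L_2^p$, with adjoint $\Gamma_\ell^*$. The matrix $P_s\in\mathbb C^{n\times n}$ is defined by $$v^*P_su=\Big\langle\Big\{\Delta_s+\Delta_s\begin{bmatrix}0&\Gamma_\ell\\\Gamma_\ell^*&0\end{bmatrix}\Delta_s\Big\}Fu,Fv\Big\rangle,\quad u,v\in\mathbb C^n.$$ Solution sets. $\widehat{\mathcal S}_\kappa(A_1,A_2,C,P)$ is the set of $s\in\mathcal S_\kappa^{p\times q}$ such that for every $u\in\mathbb C^n$ one has $[b_\ell\ \ -s_\ell]Fu\in H_2^p$ and $[-s_r^*\ \ b_r^*]Fu\in(H_2^q)^\perp$, and such that $P_s\le P$. $\mathcal S_\kappa(A_1,A_2,C,P)$ is the set of $s\in\widehat{\mathcal S}_\kappa(A_1,A_2,C,P)$ with $P_s=P$. *)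

theory Defs
  imports
    "HOL-Complex_Analysis.Complex_Analysis"
    "Jordan_Normal_Form.Schur_Decomposition"
    "Jordan_Normal_Form.Spectral_Radius"
    "Jordan_Normal_Form.DL_Rank"
begin

unbundle no vec_syntax and no inner_syntax

text \<open>
  A matrix valued function (mvf) on the disc is an object of type \<open>complex \<Rightarrow> complex mat\<close>; only its
  values on the open unit disc \<open>ball 0 1\<close> (or on the unit circle \<open>sphere 0 1\<close>, for functions on the
  circle) are ever inspected. The conjugate transpose is \<^const>\<open>mat_adjoint\<close>, and \<open>v \<bullet>c w\<close> is
  $w^* v$.
\<close>

type_synonym mvf = "complex \<Rightarrow> complex mat"
type_synonym vvf = "complex \<Rightarrow> complex vec"

definition hcat :: "complex mat \<Rightarrow> complex mat \<Rightarrow> complex mat" where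
  "hcat A B = four_block_mat A B (0\<^sub>m 0 (dim_col A)) (0\<^sub>m 0 (dim_col B))"

definition loewner_le :: "nat \<Rightarrow> complex mat \<Rightarrow> complex mat \<Rightarrow> bool" where
  \<comment> \<open>The order on \<^typ>\<open>complex\<close> makes \<open>0 \<le> z\<close> say that \<open>z\<close> is real and nonnegative.\<close>
  "loewner_le n A B \<longleftrightarrow> (\<forall>x \<in> carrier_vec n. 0 \<le> ((B - A) *\<^sub>v x) \<bullet>c x)"

definition j_pq :: "nat \<Rightarrow> nat \<Rightarrow> complex mat" where
  "j_pq p q = four_block_mat (1\<^sub>m p) (0\<^sub>m p q) (0\<^sub>m q p) (- 1\<^sub>m q)"


section \<open>Generalized Schur classes\<close>

definition hol_domain :: "nat \<Rightarrow> nat \<Rightarrow> mvf \<Rightarrow> complex set" where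
  "hol_domain p q s =
     {z \<in> ball 0 1. \<forall>i<p. \<forall>j<q. (\<lambda>w. s w $$ (i, j)) analytic_on {z}}"

definition schur_kernel :: "nat \<Rightarrow> mvf \<Rightarrow> complex \<Rightarrow> complex \<Rightarrow> complex mat" where
  "schur_kernel p s z \<omega> =
     (1 / (1 - z * cnj \<omega>)) \<cdot>\<^sub>m (1\<^sub>m p - s z * mat_adjoint (s \<omega>))"

definition gram_mat ::
  "(complex \<Rightarrow> complex \<Rightarrow> complex mat) \<Rightarrow> nat \<Rightarrow> (nat \<Rightarrow> complex) \<Rightarrow> (nat \<Rightarrow> complex vec) \<Rightarrow> complex mat"
where
  "gram_mat K N x u = mat N N (\<lambda>(i, j). (K (x i) (x j) *\<^sub>v u j) \<bullet>c u i)"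

text \<open>Number of negative eigenvalues with multiplicity; \<open>z < 0\<close> for complex \<open>z\<close> includes
  that \<open>z\<close> is real.\<close>

definition neg_eigenvalues :: "complex mat \<Rightarrow> nat" where
  "neg_eigenvalues G = size {# z \<in># proots (char_poly G). z < 0 #}"

definition has_neg_squares ::
  "nat \<Rightarrow> (complex \<Rightarrow> complex \<Rightarrow> complex mat) \<Rightarrow> complex set \<Rightarrow> nat \<Rightarrow> bool" where
  "has_neg_squares p K D \<kappa> \<longleftrightarrow>
     (\<forall>N x u. (\<forall>i<N. x i \<in> D \<and> u i \<in> carrier_vec p) \<longrightarrow>
        neg_eigenvalues (gram_mat K N x u) \<le> \<kappa>) \<and>
     (\<exists>N x u. (\<forall>i<N. x i \<in> D \<and> u i \<in> carrier_vec p) \<and>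
        neg_eigenvalues (gram_mat K N x u) = \<kappa>)"

text \<open>\<open>nicely_meromorphic_on\<close> fixes the value \<open>0\<close> at poles and excludes removable singularities
  with a wrong value, i.e. it selects the canonical representative of a meromorphic function.\<close>

definition gen_schur :: "nat \<Rightarrow> nat \<Rightarrow> nat \<Rightarrow> mvf set" where
  "gen_schur p q \<kappa> = {s.
     (\<forall>z \<in> ball 0 1. s z \<in> carrier_mat p q) \<and>
     (\<forall>i<p. \<forall>j<q. (\<lambda>z. s z $$ (i, j)) nicely_meromorphic_on ball 0 1) \<and>
     has_neg_squares p (schur_kernel p s) (hol_domain p q s) \<kappa>}"

abbreviation schur :: "nat \<Rightarrow> nat \<Rightarrow> mvf set" where
  "schur p q \<equiv> gen_schur p q 0"

definition bp_factor :: "nat \<Rightarrow> complex \<times> complex mat \<Rightarrow> mvf" where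
  "bp_factor k = (\<lambda>(\<alpha>, Q) z. 1\<^sub>m k - Q + ((z - \<alpha>) / (1 - cnj \<alpha> * z)) \<cdot>\<^sub>m Q)"

definition rank_one_projection :: "nat \<Rightarrow> complex mat \<Rightarrow> bool" where
  "rank_one_projection k Q \<longleftrightarrow>
     Q \<in> carrier_mat k k \<and> Q * Q = Q \<and> mat_adjoint Q = Q \<and> vec_space.rank k Q = 1"

text \<open>A product is required to have the given form on the closed disc, so that its boundary
  values are its values on the circle. Constant unitary factors in other positions can be moved
  to the front.\<close>

definition blaschke_potapov :: "nat \<Rightarrow> nat \<Rightarrow> mvf \<Rightarrow> bool" where
  "blaschke_potapov k \<kappa> b \<longleftrightarrow>
     (\<exists>U fs. U \<in> carrier_mat k k \<and> mat_adjoint U * U = 1\<^sub>m k \<and> length fs = \<kappa> \<and>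
        (\<forall>(\<alpha>, Q) \<in> set fs. \<alpha> \<in> ball 0 1 \<and> rank_one_projection k Q) \<and>
        (\<forall>z \<in> cball 0 1. b z = U * foldr (\<lambda>f X. bp_factor k f z * X) fs (1\<^sub>m k)))"

text \<open>Krein--Langer factorizations. The identities $s = b_\ell^{-1} s_\ell$ and $s = s_r b_r^{-1}$
  between meromorphic functions are stated after clearing the inverse, on the domain of
  holomorphy of \<open>s\<close>.\<close>

definition left_KL :: "nat \<Rightarrow> nat \<Rightarrow> nat \<Rightarrow> mvf \<Rightarrow> mvf \<Rightarrow> mvf \<Rightarrow> bool" where
  "left_KL p q \<kappa> s bl sl \<longleftrightarrow>
     blaschke_potapov p \<kappa> bl \<and> sl \<in> schur p q \<and>
     (\<forall>z \<in> hol_domain p q s. bl z * s z = sl z) \<and>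
     (\<forall>z \<in> ball 0 1. vec_space.rank p (hcat (bl z) (sl z)) = p)"

definition right_KL :: "nat \<Rightarrow> nat \<Rightarrow> nat \<Rightarrow> mvf \<Rightarrow> mvf \<Rightarrow> mvf \<Rightarrow> bool" where
  "right_KL p q \<kappa> s br sr \<longleftrightarrow>
     blaschke_potapov q \<kappa> br \<and> sr \<in> schur p q \<and>
     (\<forall>z \<in> hol_domain p q s. s z * br z = sr z) \<and>
     (\<forall>z \<in> ball 0 1.
        vec_space.rank q (hcat (mat_adjoint (br z)) (mat_adjoint (sr z))) = q)"

text \<open>Boundary values are radial limits, which exist almost everywhere on the circle for the
  functions considered here.\<close>

definition bdry :: "nat \<Rightarrow> nat \<Rightarrow> mvf \<Rightarrow> mvf" where
  "bdry p q s = (\<lambda>\<zeta>. mat p q (\<lambda>(i, j). Lim (at_left 1) (\<lambda>r::real. s (of_real r * \<zeta>) $$ (i, j))))"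


section \<open>Function spaces on the unit circle\<close>

text \<open>Elements of $L_2^k$ are represented by functions (not equivalence classes), so every
  subspace below is closed under changing representatives on null sets, and operators are
  determined up to equality almost everywhere. The circle is parametrized by \<^const>\<open>cis\<close> on
  $[0, 2\pi]$.\<close>

abbreviation arc :: "real measure" where
  "arc \<equiv> lebesgue_on {0..2 * pi}"

definition L2 :: "nat \<Rightarrow> vvf set" where
  "L2 k = {f. (\<forall>\<zeta> \<in> sphere 0 1. f \<zeta> \<in> carrier_vec k) \<and>
     (\<forall>i<k. (\<lambda>\<theta>. f (cis \<theta>) $ i) \<in> borel_measurable arc \<and>
            integrable arc (\<lambda>\<theta>. (cmod (f (cis \<theta>) $ i))\<^sup>2))}"

definition L2_inner :: "vvf \<Rightarrow> vvf \<Rightarrow> complex" where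
  "L2_inner f g = (1 / (2 * pi)) * (LINT \<theta>|arc. f (cis \<theta>) \<bullet>c g (cis \<theta>))"

definition L2_eq :: "vvf \<Rightarrow> vvf \<Rightarrow> bool" where
  "L2_eq f g \<longleftrightarrow> (AE \<theta> in arc. f (cis \<theta>) = g (cis \<theta>))"

text \<open>The Hardy space as a subspace of $L_2^k$: all Fourier coefficients of index
  \<open>-j < 0\<close> vanish.\<close>

definition H2 :: "nat \<Rightarrow> vvf set" where
  "H2 k = {f \<in> L2 k. \<forall>j::nat. j > 0 \<longrightarrow>
     (\<forall>i<k. (LINT \<theta>|arc. f (cis \<theta>) $ i * cis \<theta> ^ j) = 0)}"

definition ominus :: "vvf set \<Rightarrow> vvf set \<Rightarrow> vvf set" where
  "ominus V W = {f \<in> V. \<forall>g \<in> W. L2_inner f g = 0}"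

definition H2_perp :: "nat \<Rightarrow> vvf set" where
  "H2_perp k = ominus (L2 k) (H2 k)"

definition mv_mult :: "mvf \<Rightarrow> vvf \<Rightarrow> vvf" where
  "mv_mult X f = (\<lambda>\<zeta>. X \<zeta> *\<^sub>v f \<zeta>)"

definition mvf_adj :: "mvf \<Rightarrow> mvf" where
  "mvf_adj X = (\<lambda>\<zeta>. mat_adjoint (X \<zeta>))"

definition vv_add :: "vvf \<Rightarrow> vvf \<Rightarrow> vvf" where
  "vv_add f g = (\<lambda>\<zeta>. f \<zeta> + g \<zeta>)"

definition vv_diff :: "vvf \<Rightarrow> vvf \<Rightarrow> vvf" where
  "vv_diff f g = (\<lambda>\<zeta>. f \<zeta> - g \<zeta>)"

definition orth_proj :: "vvf set \<Rightarrow> vvf \<Rightarrow> vvf" where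
  "orth_proj V f = (SOME g. g \<in> V \<and> (\<forall>h \<in> V. L2_inner (vv_diff f g) h = 0))"

definition H_b :: "nat \<Rightarrow> mvf \<Rightarrow> vvf set" where
  "H_b q br = ominus (H2 q) (mv_mult br ` H2 q)"

definition H_star_b :: "nat \<Rightarrow> mvf \<Rightarrow> vvf set" where
  "H_star_b p bl = ominus (H2_perp p) (mv_mult (mvf_adj bl) ` H2_perp p)"


section \<open>The matrix $P_s$\<close>

definition Delta :: "nat \<Rightarrow> nat \<Rightarrow> mvf \<Rightarrow> mvf" where
  "Delta p q s = (\<lambda>\<zeta>. four_block_mat (1\<^sub>m p) (- bdry p q s \<zeta>)
                        (- mat_adjoint (bdry p q s \<zeta>)) (1\<^sub>m q))"

definition Y_left :: "nat \<Rightarrow> nat \<Rightarrow> mvf \<Rightarrow> vvf \<Rightarrow> vvf" where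
  "Y_left p q s h = orth_proj (H2 q) (mv_mult (mvf_adj (bdry p q s)) h)"

definition Gamma_left :: "nat \<Rightarrow> nat \<Rightarrow> mvf \<Rightarrow> mvf \<Rightarrow> mvf \<Rightarrow> vvf \<Rightarrow> vvf" where
  \<comment> \<open>the preimage under \<open>Y_left\<close> in \<open>H_star_b p bl\<close> of the projection of \<open>f\<close> to \<open>H_b q br\<close>\<close>
  "Gamma_left p q s bl br f =
     (SOME h. h \<in> H_star_b p bl \<and> L2_eq (Y_left p q s h) (orth_proj (H_b q br) f))"

definition Gamma_left_adj :: "nat \<Rightarrow> nat \<Rightarrow> mvf \<Rightarrow> mvf \<Rightarrow> mvf \<Rightarrow> vvf \<Rightarrow> vvf" where
  "Gamma_left_adj p q s bl br g =
     (SOME h. h \<in> L2 q \<and> (\<forall>f \<in> L2 q. L2_inner (Gamma_left p q s bl br f) g = L2_inner f h))"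

definition Gamma_block :: "nat \<Rightarrow> nat \<Rightarrow> mvf \<Rightarrow> mvf \<Rightarrow> mvf \<Rightarrow> vvf \<Rightarrow> vvf" where
  \<comment> \<open>the operator $[0 \; \Gamma_\ell; \Gamma_\ell^* \; 0]$ on $L_2^{p+q}$\<close>
  "Gamma_block p q s bl br f =
     (\<lambda>\<zeta>. Gamma_left p q s bl br (\<lambda>z. vec_last (f z) q) \<zeta> @\<^sub>v
          Gamma_left_adj p q s bl br (\<lambda>z. vec_first (f z) p) \<zeta>)"

definition P_operator :: "nat \<Rightarrow> nat \<Rightarrow> mvf \<Rightarrow> mvf \<Rightarrow> mvf \<Rightarrow> vvf \<Rightarrow> vvf" where
  "P_operator p q s bl br f =
     vv_add (mv_mult (Delta p q s) f)
       (mv_mult (Delta p q s) (Gamma_block p q s bl br (mv_mult (Delta p q s) f)))"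

definition M_mat :: "nat \<Rightarrow> nat \<Rightarrow> complex mat \<Rightarrow> complex mat" where
  "M_mat n1 n2 A1 = four_block_mat A1 (0\<^sub>m n1 n2) (0\<^sub>m n2 n1) (1\<^sub>m n2)"

definition N_mat :: "nat \<Rightarrow> nat \<Rightarrow> complex mat \<Rightarrow> complex mat" where
  "N_mat n1 n2 A2 = four_block_mat (1\<^sub>m n1) (0\<^sub>m n1 n2) (0\<^sub>m n2 n1) A2"

definition F_fun ::
  "nat \<Rightarrow> nat \<Rightarrow> complex mat \<Rightarrow> complex mat \<Rightarrow> complex mat \<Rightarrow> mvf" where
  "F_fun n1 n2 A1 A2 C =
     (\<lambda>z. C * the (mat_inverse (M_mat n1 n2 A1 - z \<cdot>\<^sub>m N_mat n1 n2 A2)))"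

definition F_vec ::
  "nat \<Rightarrow> nat \<Rightarrow> complex mat \<Rightarrow> complex mat \<Rightarrow> complex mat \<Rightarrow> complex vec \<Rightarrow> vvf" where
  "F_vec n1 n2 A1 A2 C u = (\<lambda>\<zeta>. F_fun n1 n2 A1 A2 C \<zeta> *\<^sub>v u)"

text \<open>The Blaschke--Potapov factors $b_\ell, b_r$ of \<open>s\<close> are unique up to a constant unitary factor
  on the left, resp. right, so the spaces \<open>H_star_b p bl\<close> and \<open>H_b q br\<close> depend on \<open>s\<close> only. Hence
  any choice of factors yields the same matrix.\<close>

definition KL_factors :: "nat \<Rightarrow> nat \<Rightarrow> nat \<Rightarrow> mvf \<Rightarrow> mvf \<times> mvf" where
  "KL_factors p q \<kappa> s =
     (SOME (bl, br). (\<exists>sl. left_KL p q \<kappa> s bl sl) \<and> (\<exists>sr. right_KL p q \<kappa> s br sr))"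

definition P_s ::
  "nat \<Rightarrow> nat \<Rightarrow> nat \<Rightarrow> nat \<Rightarrow> nat \<Rightarrow> complex mat \<Rightarrow> complex mat \<Rightarrow> complex mat \<Rightarrow> mvf \<Rightarrow> complex mat"
where
  "P_s p q \<kappa> n1 n2 A1 A2 C s =
     (let (bl, br) = KL_factors p q \<kappa> s in
      THE X. X \<in> carrier_mat (n1 + n2) (n1 + n2) \<and>
        (\<forall>u \<in> carrier_vec (n1 + n2). \<forall>v \<in> carrier_vec (n1 + n2).
           (X *\<^sub>v u) \<bullet>c v =
             L2_inner (P_operator p q s bl br (F_vec n1 n2 A1 A2 C u)) (F_vec n1 n2 A1 A2 C v)))"


section \<open>Solution sets\<close>

definition S_hat ::
  "nat \<Rightarrow> nat \<Rightarrow> nat \<Rightarrow> nat \<Rightarrow> nat \<Rightarrow> complex mat \<Rightarrow> complex mat \<Rightarrow> complex mat \<Rightarrow> complex mat \<Rightarrow> mvf set"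
where
  "S_hat p q \<kappa> n1 n2 A1 A2 C P = {s \<in> gen_schur p q \<kappa>.
     (\<exists>bl sl br sr. left_KL p q \<kappa> s bl sl \<and> right_KL p q \<kappa> s br sr \<and>
        (\<forall>u \<in> carrier_vec (n1 + n2).
           mv_mult (\<lambda>\<zeta>. hcat (bl \<zeta>) (- bdry p q sl \<zeta>)) (F_vec n1 n2 A1 A2 C u) \<in> H2 p \<and>
           mv_mult (\<lambda>\<zeta>. hcat (- mat_adjoint (bdry p q sr \<zeta>)) (mat_adjoint (br \<zeta>)))
             (F_vec n1 n2 A1 A2 C u) \<in> H2_perp q)) \<and>
     loewner_le (n1 + n2) (P_s p q \<kappa> n1 n2 A1 A2 C s) P}"

definition S_sol ::
  "nat \<Rightarrow> nat \<Rightarrow> nat \<Rightarrow> nat \<Rightarrow> nat \<Rightarrow> complex mat \<Rightarrow> complex mat \<Rightarrow> complex mat \<Rightarrow> complex mat \<Rightarrow> mvf set"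
where
  "S_sol p q \<kappa> n1 n2 A1 A2 C P =
     {s \<in> S_hat p q \<kappa> n1 n2 A1 A2 C P. P_s p q \<kappa> n1 n2 A1 A2 C s = P}"

end

theory Submission imports Defs begin

text \<open>
  Write $S$ for the boundary values of $s$, and for $f = (f_1, f_2) \in L_2^{p+q}$ put
  $\Delta_s f = (g, h)$, so $g = f_1 - S f_2$ and $h = f_2 - S^* f_1$. The form
  $\langle \{\Delta_s + \Delta_s \Gamma \Delta_s\} f, f' \rangle$ defining $P_s$ then splits as
  $\langle \Delta_s f, f'\rangle + \langle \Gamma_\ell h, g'\rangle + \langle g, \Gamma_\ell h'\rangle$.

  The whole statement rests on one observation: $P_s$ itself solves the equation
  $M^* X M - N^* X N = C^* j_{pq} C$ that $P$ is assumed to solve. Granted this, $D = P - P_s \ge 0$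
  satisfies $M^* D M = N^* D N$. On vectors $(x, 0)$ this makes the quadratic form of $D$ invariant under
  $A_1$, on vectors $(0, y)$ invariant under $A_2$; since the powers of $A_1$ and $A_2$ tend to zero, the form
  vanishes on both kinds of vectors, and a nonnegative form that vanishes on two spanning subspaces is
  zero (lemma \<open>psd_displacement_zero\<close>). Hence $P_s = P$.

  The equation for $P_s$ comes from $F(\lambda) M u = C u + \lambda F(\lambda) N u$. Let
  $e = F M u$, $f = F N u$, $c = C u$, so $e = c + \zeta f$ on the circle. The interpolation
  conditions enter through the following characterization of the $\Gamma_\ell$ part: they say exactly that
  $g \in H_2^p + S H_2^q$ and $h \in (H_2^q)^\perp + S^* (H_2^p)^\perp$, and for such $g = a + S b$ and $h$,
  every $x \in (H_2^p)^\perp$ with $h - S^* x \in (H_2^q)^\perp$ satisfies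
  $\langle x, g \rangle = \langle h, b \rangle$; the element $\Gamma_\ell h$ is one such $x$ (lemmas \<open>Gamma_spH\<close>
  and \<open>inner_spG\<close>). So $\Gamma_\ell h_f$ may be replaced by $\overline\zeta (\Gamma_\ell h_e + c_1)$, which
  solves the problem for $f$ because $\Gamma_\ell h_e$ solves it for $e$, and the difference of the two forms collapses to
  $\langle j_{pq} c, c\rangle$ (lemma \<open>form_displacement\<close>).

  The same characterization shows that the form does not depend on the choice of the Krein--Langer
  factors and is Hermitian, so that the matrix $P_s$ exists. What remains is Hardy space theory. The
  coprimeness conditions $\operatorname{rank} [b_\ell \; s_\ell] = p$ and $\operatorname{rank} [b_r^* \; s_r^*] = q$
  are turned into the identities $H_2^p = b_\ell H_2^p + s_\ell H_2^q$ and
  $(H_2^q)^\perp = b_r^* (H_2^q)^\perp + s_r^* (H_2^p)^\perp$ by removing one zero of the Blaschke--Potapov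
  product at a time (lemmas \<open>corona_H2\<close> and \<open>corona_H2_perp\<close>). Boundary values are radial limits, so Fatou's
  theorem for bounded holomorphic functions is proved as well, by way of the Poisson integral and the
  Lebesgue density theorem.
\<close>

section \<open>The Lebesgue density theorem on the line\<close>

text \<open>
  Cover the bad points inside an open set $U$ that exceeds the complement of $N$ in the ball by little. The intervals on
  which $N$ has density at least $\epsilon$ form a Vitali cover, and disjoint ones among them have total length
  at most $2/\epsilon$ times the measure of $N \cap U$, which is as small as desired.
\<close>

lemma negligible_upper_density_points:
  fixes N :: "real set"
  assumes N: "N \<in> sets lebesgue" and \<epsilon>: "\<epsilon> > 0"
  shows "negligible {x \<in> ball 0 R. x \<notin> N \<and>
           (\<forall>d0>0. \<exists>d. 0 < d \<and> d < d0 \<and> \<epsilon> * d \<le> measure lebesgue (N \<inter> ball x d))}"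
    (is "negligible ?A")
  unfolding negligible_outer_le
proof (intro allI impI)
  fix e :: real assume e: "e > 0"
  let ?\<mu> = "measure lebesgue"
  define E where "E = ball 0 R - N"
  have "E \<in> sets lebesgue" using N by (auto simp: E_def)
  from sets_lebesgue_outer_open[OF this, of "\<epsilon> * e / 2"] e \<epsilon>
  obtain T where T: "open T" "E \<subseteq> T" "T - E \<in> lmeasurable"
    and mT: "emeasure lebesgue (T - E) < ennreal (\<epsilon> * e / 2)" by auto
  define U where "U = T \<inter> ball 0 R"
  have "open U" using T by (auto simp: U_def)
  define K where "K = {(x,d). x \<in> ?A \<and> 0 < d \<and> ball x d \<subseteq> U \<and> \<epsilon> * d \<le> ?\<mu> (N \<inter> ball x d)}"
  obtain C where C: "countable C" "C \<subseteq> K"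
      and pw: "pairwise (\<lambda>i j. disjnt (ball (fst i) (snd i)) (ball (fst j) (snd j))) C"
      and neg: "negligible (?A - (\<Union>i \<in> C. ball (fst i) (snd i)))"
  proof (rule Vitali_covering_theorem_balls[of ?A K fst snd])
    fix x d :: real assume x: "x \<in> ?A" and d: "d > 0"
    then have "x \<in> U" using T by (auto simp: U_def E_def)
    then obtain k where k: "k > 0" "ball x k \<subseteq> U" using \<open>open U\<close> openE by blast
    from x d k obtain r where r: "0 < r" "r < min d k" "\<epsilon> * r \<le> ?\<mu> (N \<inter> ball x r)"
      by (auto dest: spec[of _ "min d k"])
    have "ball x r \<subseteq> U" using r k by (meson less_imp_le min_less_iff_conj subset_ball subset_trans)
    then have "(x,r) \<in> K" using r x by (simp add: K_def)
    then show "\<exists>i. i \<in> K \<and> x \<in> ball (fst i) (snd i) \<and> snd i < d"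
      using r by (intro exI[of _ "(x,r)"]) auto
  qed
  have NU: "N \<inter> U \<subseteq> T - E" by (auto simp: U_def E_def)
  have NUm: "N \<inter> U \<in> lmeasurable"
    using NU T N \<open>open U\<close> by (meson fmeasurableI2 lborelD sets.Int sets_completionI_sets borel_open)
  have "?\<mu> (N \<inter> U) \<le> ?\<mu> (T - E)"
    using NU NUm T by (intro measure_mono_fmeasurable) auto
  also have "\<dots> \<le> \<epsilon> * e / 2"
    using mT e \<epsilon> unfolding emeasure_eq_measure2[OF T(3)]
    by (subst (asm) ennreal_less_iff) auto
  finally have mNU: "?\<mu> (N \<inter> U) \<le> \<epsilon> * e / 2" .
  have fin: "?\<mu> (\<Union>i\<in>I. ball (fst i) (snd i)) \<le> e" if I: "I \<subseteq> C" "finite I" for I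
  proof -
    have pwI: "pairwise (\<lambda>i j. disjnt (ball (fst i) (snd i)) (ball (fst j) (snd j))) I"
      using pw I by (auto elim: pairwise_mono)
    have "(\<Sum>i\<in>I. ?\<mu> (N \<inter> ball (fst i) (snd i))) = ?\<mu> (\<Union>i\<in>I. N \<inter> ball (fst i) (snd i))"
    proof (rule measure_UNION'[symmetric])
      show "finite I" by fact
      show "N \<inter> ball (fst i) (snd i) \<in> lmeasurable" for i
        by (rule fmeasurableI2[of "ball (fst i) (snd i)"]) (use N in auto)
      show "pairwise (\<lambda>i j. disjnt (N \<inter> ball (fst i) (snd i)) (N \<inter> ball (fst j) (snd j))) I"
        using pwI unfolding pairwise_def disjnt_def by blast
    qed
    also have "\<dots> \<le> ?\<mu> (N \<inter> U)"
    proof (rule measure_mono_fmeasurable)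
      show "(\<Union>i\<in>I. N \<inter> ball (fst i) (snd i)) \<subseteq> N \<inter> U"
        using I C unfolding K_def by fastforce
      show "(\<Union>i\<in>I. N \<inter> ball (fst i) (snd i)) \<in> sets lebesgue"
        using I N by (intro sets.finite_UN) auto
    qed fact
    finally have NI: "(\<Sum>i\<in>I. ?\<mu> (N \<inter> ball (fst i) (snd i))) \<le> ?\<mu> (N \<inter> U)" .
    have "?\<mu> (\<Union>i\<in>I. ball (fst i) (snd i)) \<le> (\<Sum>i\<in>I. ?\<mu> (ball (fst i) (snd i)))"
      using I by (intro measure_UNION_le) auto
    also have "\<dots> \<le> (\<Sum>i\<in>I. (2/\<epsilon>) * ?\<mu> (N \<inter> ball (fst i) (snd i)))"
    proof (rule sum_mono)
      fix i assume "i \<in> I"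
      then have "i \<in> K" using I C by auto
      then have "0 < snd i" "\<epsilon> * snd i \<le> ?\<mu> (N \<inter> ball (fst i) (snd i))" by (auto simp: K_def)
      then show "?\<mu> (ball (fst i) (snd i)) \<le> (2/\<epsilon>) * ?\<mu> (N \<inter> ball (fst i) (snd i))"
        using \<epsilon> by (simp add: ball_eq_greaterThanLessThan field_simps)
    qed
    also have "\<dots> = (2/\<epsilon>) * (\<Sum>i\<in>I. ?\<mu> (N \<inter> ball (fst i) (snd i)))"
      by (simp add: sum_distrib_left)
    also have "\<dots> \<le> (2/\<epsilon>) * ?\<mu> (N \<inter> U)"
      using NI \<epsilon> by (intro mult_left_mono) auto
    also have "\<dots> \<le> (2/\<epsilon>) * (\<epsilon> * e / 2)"
      using mNU \<epsilon> by (intro mult_left_mono) auto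
    also have "\<dots> = e" using \<epsilon> by simp
    finally show ?thesis .
  qed
  let ?B = "\<Union>i\<in>C. ball (fst i) (snd i)"
  have B: "?B \<in> lmeasurable" "?\<mu> ?B \<le> e"
    by (rule fmeasurable_UN_bound measure_UN_bound; use C(1) fin in \<open>auto\<close>)+
  show "\<exists>T. ?A \<subseteq> T \<and> T \<in> lmeasurable \<and> ?\<mu> T \<le> e"
  proof (intro exI conjI)
    let ?T = "(?A - ?B) \<union> ?B"
    show "?A \<subseteq> ?T" by auto
    show "?T \<in> lmeasurable" by (intro fmeasurable.Un negligible_imp_measurable neg B)
    have "?\<mu> ?T = ?\<mu> ?B"
      by (rule measure_negligible_symdiff[OF B(1)]) (rule negligible_subset[OF neg], auto)
    then show "?\<mu> ?T \<le> e" using B by simp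
  qed
qed

lemma Lebesgue_density:
  fixes N :: "real set"
  assumes N: "N \<in> sets lebesgue"
  shows "negligible {x. x \<notin> N \<and>
           \<not> ((\<lambda>d. measure lebesgue (N \<inter> ball x d) / d) \<longlongrightarrow> 0) (at_right 0)}"
proof (rule negligible_subset)
  let ?A = "\<lambda>\<epsilon> R. {x \<in> ball 0 R. x \<notin> N \<and>
           (\<forall>d0>0. \<exists>d. 0 < d \<and> d < d0 \<and> \<epsilon> * d \<le> measure lebesgue (N \<inter> ball x d))}"
  show "negligible (\<Union>n. ?A (1 / real (Suc n)) (real n))" (is "negligible ?U")
    using N by (intro negligible_Union_nat negligible_upper_density_points) auto
  show "{x. x \<notin> N \<and> \<not> ((\<lambda>d. measure lebesgue (N \<inter> ball x d) / d) \<longlongrightarrow> 0) (at_right 0)} \<subseteq> ?U"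
  proof clarify
    fix x assume x: "x \<notin> N"
    assume nt: "\<not> ((\<lambda>d. measure lebesgue (N \<inter> ball x d) / d) \<longlongrightarrow> 0) (at_right 0)"
    then obtain e where e: "e > 0"
      "\<not> (\<forall>\<^sub>F d in at_right 0. dist (measure lebesgue (N \<inter> ball x d) / d) 0 < e)"
      unfolding tendsto_iff by blast
    obtain n where n: "real n > \<bar>x\<bar>" "1 / real (Suc n) < e"
    proof -
      obtain n1 where n1: "real n1 > \<bar>x\<bar>" using reals_Archimedean2 by blast
      obtain n2 where n2: "1 / real (Suc n2) < e" using e nat_approx_posE by blast
      have "1 / real (Suc (max n1 n2)) \<le> 1 / real (Suc n2)" by (intro divide_left_mono) auto
      then show ?thesis using n1 n2 by (intro that[of "max n1 n2"]) auto
    qed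
    have "\<exists>d. 0 < d \<and> d < d0 \<and> 1 / real (Suc n) * d \<le> measure lebesgue (N \<inter> ball x d)"
      if d0: "d0 > 0" for d0 :: real
    proof -
      have "\<not> (\<forall>y>0. y < d0 \<longrightarrow> dist (measure lebesgue (N \<inter> ball x y) / y) 0 < e)"
        using e(2) d0 unfolding eventually_at_right_field by metis
      then obtain d where d: "0 < d" "d < d0" "\<not> dist (measure lebesgue (N \<inter> ball x d) / d) 0 < e"
        by metis
      then have "e * d \<le> measure lebesgue (N \<inter> ball x d)" by (simp add: field_simps)
      moreover have "1 / real (Suc n) * d \<le> e * d" using n d by (intro mult_right_mono) auto
      ultimately show ?thesis using d by fastforce
    qed
    then have "x \<in> ?A (1 / real (Suc n)) (real n)" using x n by auto
    then show "x \<in> ?U" by blast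
  qed
qed

section \<open>Integration over the circle\<close>

definition cmean :: "(complex \<Rightarrow> complex) \<Rightarrow> complex" where
  "cmean f = (LINT \<theta>|arc. f (cis \<theta>)) / (2 * pi)"

lemma finite_arc: "finite_measure arc"
  by (rule finite_measure_lebesgue_on) auto

lemma measure_arc: "measure arc (space arc) = 2 * pi"
  by (simp add: measure_restrict_space space_restrict_space)

lemma cis_measurable [measurable]: "cis \<in> borel_measurable arc"
  by (rule continuous_imp_measurable_on_sets_lebesgue) (auto intro!: continuous_intros)

lemma cis_range: "cis \<theta> \<in> sphere 0 1" by simp

lemma measurable_arc_continuous:
  fixes f :: "complex \<Rightarrow> complex"
  assumes "continuous_on (sphere 0 1) f"
  shows "(\<lambda>\<theta>. f (cis \<theta>)) \<in> borel_measurable arc"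
proof (rule continuous_imp_measurable_on_sets_lebesgue)
  show "continuous_on {0..2*pi} (\<lambda>\<theta>. f (cis \<theta>))"
    by (rule continuous_on_compose2[OF assms]) (auto intro!: continuous_intros)
qed auto

lemma integrable_arc_bounded:
  fixes f :: "real \<Rightarrow> 'b :: {banach, second_countable_topology}"
  assumes "f \<in> borel_measurable arc" "AE \<theta> in arc. norm (f \<theta>) \<le> B"
  shows "integrable arc f"
  using finite_measure.integrable_const_bound[OF finite_arc assms(2,1)] .

lemma integrable_arc_continuous:
  fixes f :: "complex \<Rightarrow> complex"
  assumes "continuous_on (sphere 0 1) f"
  shows "integrable arc (\<lambda>\<theta>. f (cis \<theta>))"
proof -
  have "bounded (f ` sphere 0 1)"
    by (intro compact_imp_bounded compact_continuous_image assms) simp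
  then obtain B where "\<forall>x\<in>f ` sphere 0 1. norm x \<le> B" unfolding bounded_iff by blast
  then show ?thesis
    by (intro integrable_arc_bounded[where B=B] measurable_arc_continuous assms AE_I2) auto
qed

lemma cmean_holomorphic:
  assumes "continuous_on (cball 0 1) f" "f holomorphic_on ball 0 1"
  shows "cmean f = f 0"
proof -
  have "((\<lambda>u. f u/(u-0)) has_contour_integral (2 * of_real pi * \<i> * f 0)) (circlepath 0 1)"
    by (rule Cauchy_integral_circlepath) (use assms in auto)
  then have "contour_integral (part_circlepath 0 1 0 (2*pi)) (\<lambda>u. f u / u) = 2 * of_real pi * \<i> * f 0"
    using contour_integral_unique by (simp add: circlepath_def)
  then have "integral {0..2*pi} (\<lambda>t. f (cis t) / cis t * \<i> * cis t) = 2 * of_real pi * \<i> * f 0"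
    by (subst (asm) contour_integral_part_circlepath_eq) auto
  also have "(\<lambda>t. f (cis t) / cis t * \<i> * cis t) = (\<lambda>t. \<i> * f (cis t))"
    by (auto simp: field_simps)
  also have "integral {0..2*pi} (\<lambda>t. \<i> * f (cis t)) = (LINT t|arc. \<i> * f (cis t))"
    by (rule lebesgue_integral_eq_integral[symmetric])
       (intro integrable_mult_right integrable_arc_continuous continuous_on_subset[OF assms(1)], auto)
  finally show ?thesis by (simp add: cmean_def)
qed

lemma power_series_integral:
  fixes h :: "real \<Rightarrow> complex" and b :: "nat \<Rightarrow> complex"
  assumes h: "integrable arc h" and b: "summable (\<lambda>n. norm (b n))"
  shows "(\<lambda>n. b n * (LINT \<theta>|arc. cis \<theta> ^ n * h \<theta>)) sums
         (LINT \<theta>|arc. (\<Sum>n. b n * cis \<theta> ^ n) * h \<theta>)"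
proof -
  have int: "integrable arc (\<lambda>\<theta>. cis \<theta> ^ n * h \<theta>)" for n
    by (rule Bochner_Integration.integrable_bound[OF h])
       (use h in \<open>auto simp: norm_mult norm_power\<close>)
  have "(\<lambda>n. LINT \<theta>|arc. b n * (cis \<theta> ^ n * h \<theta>)) sums
         (LINT \<theta>|arc. (\<Sum>n. b n * (cis \<theta> ^ n * h \<theta>)))"
  proof (rule sums_integral)
    show "integrable arc (\<lambda>\<theta>. b n * (cis \<theta> ^ n * h \<theta>))" for n
      using int by (rule integrable_mult_right)
    show "AE \<theta> in arc. summable (\<lambda>n. norm (b n * (cis \<theta> ^ n * h \<theta>)))"
      using b by (auto simp: norm_mult norm_power intro: summable_mult2)
    have "(LINT \<theta>|arc. norm (b n * (cis \<theta> ^ n * h \<theta>))) = norm (b n) * (LINT \<theta>|arc. norm (h \<theta>))" for n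
      by (simp add: norm_mult norm_power)
    then show "summable (\<lambda>n. LINT \<theta>|arc. norm (b n * (cis \<theta> ^ n * h \<theta>)))"
      using b by (simp add: summable_mult2)
  qed
  moreover have "(\<Sum>n. b n * (cis \<theta> ^ n * h \<theta>)) = (\<Sum>n. b n * cis \<theta> ^ n) * h \<theta>" for \<theta>
  proof -
    have "summable (\<lambda>n. b n * cis \<theta> ^ n)"
      by (rule summable_norm_cancel) (simp add: norm_mult norm_power b)
    then show ?thesis by (simp add: suminf_mult2 mult.assoc)
  qed
  ultimately show ?thesis by simp
qed

text \<open>
  Absolute summability allows both sums to be integrated term by term; the orthogonality of the powers does
  the rest. It is applied on circles of radius less than one only.
\<close>

lemma Parseval_abs_summable:
  fixes b :: "nat \<Rightarrow> complex"
  assumes b: "summable (\<lambda>n. norm (b n))"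
  shows "(\<lambda>n. (norm (b n))\<^sup>2) sums ((LINT \<theta>|arc. (norm (\<Sum>n. b n * cis \<theta> ^ n))\<^sup>2) / (2*pi))"
proof -
  define g where "g \<theta> = (\<Sum>n. b n * cis \<theta> ^ n)" for \<theta>
  have sm: "summable (\<lambda>n. norm (b n * cis \<theta> ^ n))" for \<theta> by (simp add: norm_mult norm_power b)
  have gb: "norm (g \<theta>) \<le> (\<Sum>n. norm (b n))" for \<theta>
    using summable_norm[OF sm, of \<theta>] by (simp add: g_def norm_mult norm_power)
  have gm: "g \<in> borel_measurable arc" unfolding g_def by measurable
  have gi: "integrable arc g" by (rule integrable_arc_bounded[OF gm]) (use gb in auto)
  have orth: "(LINT \<theta>|arc. cis \<theta> ^ n * cnj (cis \<theta> ^ m)) = (if n = m then 2*pi else 0)" for n m :: nat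
  proof -
    have *: "(LINT \<theta>|arc. cis \<theta> ^ k) = (if k = 0 then 2 * pi else 0)" for k
    proof -
      have "cmean (\<lambda>z. z ^ k) = 0 ^ k"
        by (rule cmean_holomorphic) (auto intro!: continuous_intros holomorphic_intros)
      then show ?thesis by (auto simp: cmean_def power_0_left split: if_splits)
    qed
    have c: "cis \<theta> ^ n * cnj (cis \<theta> ^ m) = (if m \<le> n then cis \<theta> ^ (n - m) else cnj (cis \<theta> ^ (m - n)))" for \<theta>
      by (auto simp: Complex.DeMoivre cis_cnj cis_mult of_nat_diff algebra_simps)
    have "(LINT \<theta>|arc. cnj (cis \<theta> ^ k)) = (if k = 0 then 2*pi else 0)" for k
      using *[of k] by (simp add: Bochner_Integration.integral_cnj[symmetric] del: complex_cnj_power)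
    then show ?thesis using * by (cases "m \<le> n") (simp_all add: c del: complex_cnj_power)
  qed
  have coef: "(LINT \<theta>|arc. g \<theta> * cnj (cis \<theta> ^ m)) = 2 * pi * b m" for m
  proof -
    have "(\<lambda>n. b n * (LINT \<theta>|arc. cis \<theta> ^ n * cnj (cis \<theta> ^ m))) sums (LINT \<theta>|arc. g \<theta> * cnj (cis \<theta> ^ m))"
      unfolding g_def
      by (rule power_series_integral[OF _ b])
         (rule integrable_arc_continuous[of "\<lambda>z. cnj (z ^ m)"], auto intro!: continuous_intros)
    moreover have "(\<lambda>n. b n * (LINT \<theta>|arc. cis \<theta> ^ n * cnj (cis \<theta> ^ m))) sums (2 * pi * b m)"
      unfolding orth using sums_single[of m "\<lambda>n. 2 * pi * b n"]
      by (simp add: if_distrib mult.commute cong: if_cong)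
    ultimately show ?thesis by (rule sums_unique2)
  qed
  have "(\<lambda>n. b n * (LINT \<theta>|arc. cis \<theta> ^ n * cnj (g \<theta>))) sums (LINT \<theta>|arc. g \<theta> * cnj (g \<theta>))"
    unfolding g_def[symmetric] unfolding g_def
    by (rule power_series_integral[OF _ b]) (use gi in \<open>simp add: g_def[symmetric]\<close>)
  moreover have "(LINT \<theta>|arc. cis \<theta> ^ n * cnj (g \<theta>)) = 2 * pi * cnj (b n)" for n
  proof -
    have "(LINT \<theta>|arc. cis \<theta> ^ n * cnj (g \<theta>)) = (LINT \<theta>|arc. cnj (g \<theta> * cnj (cis \<theta> ^ n)))"
      by (simp add: mult.commute)
    also have "\<dots> = cnj (LINT \<theta>|arc. g \<theta> * cnj (cis \<theta> ^ n))" by (rule Bochner_Integration.integral_cnj)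
    also have "\<dots> = cnj (2 * pi * b n)" by (simp only: coef)
    finally show ?thesis by simp
  qed
  moreover have "(LINT \<theta>|arc. g \<theta> * cnj (g \<theta>)) = complex_of_real (LINT \<theta>|arc. (norm (g \<theta>))\<^sup>2)"
    by (simp add: complex_norm_square[symmetric] del: of_real_power)
  moreover have "b n * (2 * pi * cnj (b n)) = complex_of_real (2 * pi * (norm (b n))\<^sup>2)" for n
    unfolding of_real_mult complex_norm_square by (simp add: mult_ac)
  ultimately have "(\<lambda>n. complex_of_real (2 * pi * (norm (b n))\<^sup>2)) sums complex_of_real (LINT \<theta>|arc. (norm (g \<theta>))\<^sup>2)"
    by (simp only: mult.assoc)
  then have "(\<lambda>n. 2 * pi * (norm (b n))\<^sup>2) sums (LINT \<theta>|arc. (norm (g \<theta>))\<^sup>2)"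
    by (simp only: sums_of_real_iff)
  from sums_divide[OF this, of "2*pi"] show ?thesis by (simp add: g_def)
qed

section \<open>Bounded holomorphic functions along a sequence of radii\<close>

lemma of_real_cis_ball: "0 \<le> r \<Longrightarrow> r < 1 \<Longrightarrow> of_real r * cis \<theta> \<in> ball 0 1"
  by (simp add: norm_mult)

text \<open>
  The Parseval identity on the circles of radius $r < 1$ bounds $\sum |a_n|^2 r^{2n}$ by $B^2$; let $r$ tend to one.
\<close>

lemma bounded_holomorphic_coeffs:
  assumes hol: "\<phi> holomorphic_on ball 0 1" and bd: "\<And>z. z \<in> ball 0 1 \<Longrightarrow> norm (\<phi> z) \<le> B"
  obtains a where "\<And>z. z \<in> ball 0 1 \<Longrightarrow> (\<lambda>n. a n * z ^ n) sums \<phi> z"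
    "\<And>r. 0 \<le> r \<Longrightarrow> r < 1 \<Longrightarrow> summable (\<lambda>n. norm (a n) * r ^ n)"
    "summable (\<lambda>n. (norm (a n))\<^sup>2)"
proof -
  define a where "a n = (deriv ^^ n) \<phi> 0 / fact n" for n
  have sums: "(\<lambda>n. a n * z ^ n) sums \<phi> z" if "z \<in> ball 0 1" for z
    using holomorphic_power_series[OF hol that] by (simp add: a_def)
  have abss: "summable (\<lambda>n. norm (a n) * r ^ n)" if r: "0 \<le> r" "r < 1" for r :: real
  proof -
    define R where "R = (1 + r) / 2"
    have R: "r < R" "R < 1" "0 < R" using r by (auto simp: R_def)
    have "summable (\<lambda>n. a n * of_real R ^ n)"
      using sums[of "of_real R"] R by (auto simp: sums_iff)
    from powser_insidea[OF this, of "of_real r"] r R show ?thesis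
      by (simp add: norm_mult norm_power)
  qed
  have part: "(\<Sum>n<N. (norm (a n))\<^sup>2 * (r ^ n)\<^sup>2) \<le> B\<^sup>2" if r: "0 \<le> r" "r < 1" for r N
  proof -
    define b where "b n = a n * of_real r ^ n" for n
    have nb: "norm (b n) = norm (a n) * r ^ n" for n using r by (simp add: b_def norm_mult norm_power)
    have "summable (\<lambda>n. norm (b n))" using abss[OF r] by (simp add: nb)
    from Parseval_abs_summable[OF this]
    have P: "(\<lambda>n. (norm (b n))\<^sup>2) sums ((LINT \<theta>|arc. (norm (\<Sum>n. b n * cis \<theta> ^ n))\<^sup>2) / (2*pi))" .
    have eq: "(\<Sum>n. b n * cis \<theta> ^ n) = \<phi> (of_real r * cis \<theta>)" for \<theta>
      using sums[OF of_real_cis_ball[OF r]] by (auto simp: sums_iff b_def power_mult_distrib mult_ac)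
    have "(\<Sum>n<N. (norm (b n))\<^sup>2) \<le> (LINT \<theta>|arc. (norm (\<Sum>n. b n * cis \<theta> ^ n))\<^sup>2) / (2*pi)"
      using P by (intro sum_le_suminf[where f="\<lambda>n. (norm (b n))\<^sup>2", THEN order_trans]) (auto simp: sums_iff)
    also have "\<dots> \<le> (LINT \<theta>|arc. B\<^sup>2) / (2*pi)"
    proof (intro divide_right_mono integral_mono)
      show "integrable arc (\<lambda>\<theta>. (norm (\<Sum>n. b n * cis \<theta> ^ n))\<^sup>2)"
        unfolding eq
        by (rule integrable_arc_bounded[where B="B\<^sup>2"])
           (auto simp: eq[symmetric] intro!: AE_I2 power_mono, simp add: eq bd[OF of_real_cis_ball[OF r]])
      show "(norm (\<Sum>n. b n * cis \<theta> ^ n))\<^sup>2 \<le> B\<^sup>2" for \<theta>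
        unfolding eq by (intro power_mono bd of_real_cis_ball r) auto
    qed (auto intro: integrable_arc_bounded)
    also have "\<dots> = B\<^sup>2" by (simp add: measure_arc[unfolded space_restrict_space] measure_restrict_space)
    finally show ?thesis by (simp add: nb power_mult_distrib)
  qed
  have "(\<Sum>n<N. (norm (a n))\<^sup>2) \<le> B\<^sup>2" for N
  proof (rule tendsto_upperbound)
    show "((\<lambda>r::real. \<Sum>n<N. (norm (a n))\<^sup>2 * (r ^ n)\<^sup>2) \<longlongrightarrow> (\<Sum>n<N. (norm (a n))\<^sup>2)) (at_left 1)"
      by (rule tendsto_eq_intros refl | simp)+
    show "\<forall>\<^sub>F r in at_left 1. (\<Sum>n<N. (norm (a n))\<^sup>2 * (r ^ n)\<^sup>2) \<le> B\<^sup>2"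
      using part by (auto simp: eventually_at_left_field intro!: exI[of _ 0])
  qed simp
  then have "summable (\<lambda>n. (norm (a n))\<^sup>2)"
    by (intro summableI_nonneg_bounded) auto
  with sums abss show ?thesis using that by blast
qed

text \<open>
  The squared distance of two dilates is $\sum |a_n|^2 (r^n - r'^n)^2$, whose tail is uniformly small because
  $\sum |a_n|^2$ converges.
\<close>

lemma bounded_holomorphic_L2_Cauchy:
  assumes hol: "\<phi> holomorphic_on ball 0 1" and bd: "\<And>z. z \<in> ball 0 1 \<Longrightarrow> norm (\<phi> z) \<le> B"
    and e: "e > 0"
  obtains \<rho> where "0 \<le> \<rho>" "\<rho> < 1"
    "\<And>r r'. \<rho> \<le> r \<Longrightarrow> r < 1 \<Longrightarrow> \<rho> \<le> r' \<Longrightarrow> r' < 1 \<Longrightarrow>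
       (LINT \<theta>|arc. (norm (\<phi> (of_real r * cis \<theta>) - \<phi> (of_real r' * cis \<theta>)))\<^sup>2) \<le> e"
proof -
  obtain a where sums: "\<And>z. z \<in> ball 0 1 \<Longrightarrow> (\<lambda>n. a n * z ^ n) sums \<phi> z"
    and abss: "\<And>r. 0 \<le> r \<Longrightarrow> r < 1 \<Longrightarrow> summable (\<lambda>n. norm (a n) * r ^ n)"
    and sq: "summable (\<lambda>n. (norm (a n))\<^sup>2)"
    using bounded_holomorphic_coeffs[OF hol bd] by blast
  let ?D = "\<lambda>\<rho>::real. \<Sum>n. (norm (a n))\<^sup>2 * (1 - \<rho> ^ n)\<^sup>2"
  have le: "(norm (a n))\<^sup>2 * (1 - \<rho> ^ n)\<^sup>2 \<le> (norm (a n))\<^sup>2" if "0 \<le> \<rho>" "\<rho> < 1" for \<rho> n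
    using that by (intro mult_left_le) (auto simp: power_le_one abs_square_le_1)
  have sD: "summable (\<lambda>n. (norm (a n))\<^sup>2 * (1 - \<rho> ^ n)\<^sup>2)" if "0 \<le> \<rho>" "\<rho> < 1" for \<rho>
    by (rule summable_comparison_test'[OF sq]) (use le[OF that] in auto)
  have "(?D \<longlongrightarrow> (\<Sum>n. 0)) (at_left 1)"
  proof (rule tannerys_theorem[THEN conjunct2, THEN conjunct2, of _ _ _ "\<lambda>n. (norm (a n))\<^sup>2"])
    show "((\<lambda>\<rho>. (norm (a n))\<^sup>2 * (1 - \<rho> ^ n)\<^sup>2) \<longlongrightarrow> 0) (at_left (1::real))" for n
      by (rule tendsto_eq_intros refl | simp)+
    have "\<forall>\<^sub>F \<rho> in at_left (1::real). 0 \<le> \<rho> \<and> \<rho> < 1"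
      by (auto simp: eventually_at_left_field intro!: exI[of _ 0])
    from eventually_prodI[OF eventually_True this, where 'a=nat and ?F=at_top]
    show "\<forall>\<^sub>F (n, \<rho>) in at_top \<times>\<^sub>F at_left 1. norm ((norm (a n))\<^sup>2 * (1 - \<rho> ^ n)\<^sup>2) \<le> (norm (a n))\<^sup>2"
      by (rule eventually_mono) (use le in auto)
  qed (use sq in auto)
  then have "\<forall>\<^sub>F \<rho> in at_left 1. ?D \<rho> < e / (2*pi)"
    using e by (intro order_tendstoD) auto
  moreover have "\<forall>\<^sub>F \<rho> in at_left (1::real). 0 \<le> \<rho> \<and> \<rho> < 1"
    by (auto simp: eventually_at_left_field intro!: exI[of _ 0])
  ultimately have "\<forall>\<^sub>F \<rho> in at_left 1. ?D \<rho> < e / (2*pi) \<and> 0 \<le> \<rho> \<and> \<rho> < 1"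
    by eventually_elim auto
  then obtain \<rho> where \<rho>: "?D \<rho> < e / (2*pi)" "0 \<le> \<rho>" "\<rho> < 1"
    using eventually_happens by fastforce
  show ?thesis
  proof (rule that[OF \<rho>(2,3)])
    fix r r' :: real assume r: "\<rho> \<le> r" "r < 1" "\<rho> \<le> r'" "r' < 1"
    define b where "b n = a n * of_real r ^ n - a n * of_real r' ^ n" for n
    have r0: "0 \<le> r" "0 \<le> r'" using r \<rho> by auto
    have nb: "norm (b n) = norm (a n) * \<bar>r ^ n - r' ^ n\<bar>" for n
      by (simp add: b_def norm_mult flip: of_real_power of_real_diff right_diff_distrib)
    have "summable (\<lambda>n. norm (b n))"
    proof (rule summable_comparison_test')
      show "summable (\<lambda>n. norm (a n) * r ^ n + norm (a n) * r' ^ n)"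
        using abss r r0 by (intro summable_add) auto
      show "norm (norm (b n)) \<le> norm (a n) * r ^ n + norm (a n) * r' ^ n" for n
        unfolding nb distrib_left[symmetric] using r0
        by (auto intro!: mult_left_mono simp: abs_le_iff add_increasing add_increasing2 intro: order_trans)
    qed
    from Parseval_abs_summable[OF this]
    have P: "(\<lambda>n. (norm (b n))\<^sup>2) sums ((LINT \<theta>|arc. (norm (\<Sum>n. b n * cis \<theta> ^ n))\<^sup>2) / (2*pi))" .
    have eq: "(\<Sum>n. b n * cis \<theta> ^ n) = \<phi> (of_real r * cis \<theta>) - \<phi> (of_real r' * cis \<theta>)" for \<theta>
      using sums_diff[OF sums[OF of_real_cis_ball[OF r0(1) r(2)]] sums[OF of_real_cis_ball[OF r0(2) r(4)]], of \<theta> \<theta>]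
      by (auto simp: sums_iff b_def power_mult_distrib algebra_simps)
    have "(norm (b n))\<^sup>2 \<le> (norm (a n))\<^sup>2 * (1 - \<rho> ^ n)\<^sup>2" for n
    proof -
      have "\<rho> ^ n \<le> r ^ n" "\<rho> ^ n \<le> r' ^ n" "r ^ n \<le> 1" "r' ^ n \<le> 1"
        using r r0 \<rho> by (auto intro!: power_mono power_le_one)
      then have "\<bar>r ^ n - r' ^ n\<bar>\<^sup>2 \<le> (1 - \<rho> ^ n)\<^sup>2" by (intro power_mono) auto
      then show ?thesis unfolding nb power_mult_distrib by (intro mult_left_mono) auto
    qed
    then have "(\<Sum>n. (norm (b n))\<^sup>2) \<le> ?D \<rho>"
      using P sD \<rho> by (intro suminf_le) (auto simp: sums_iff)
    then have "(LINT \<theta>|arc. (norm (\<phi> (of_real r * cis \<theta>) - \<phi> (of_real r' * cis \<theta>)))\<^sup>2) / (2*pi) \<le> e / (2*pi)"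
      using P \<rho>(1) unfolding eq by (simp only: sums_iff)
    then show "(LINT \<theta>|arc. (norm (\<phi> (of_real r * cis \<theta>) - \<phi> (of_real r' * cis \<theta>)))\<^sup>2) \<le> e"
      by (simp add: divide_le_cancel)
  qed
qed

lemma radial_measurable:
  assumes "continuous_on (ball 0 1) \<phi>" "0 \<le> r" "r < 1"
  shows "(\<lambda>\<theta>. \<phi> (of_real r * cis \<theta>) :: complex) \<in> borel_measurable arc"
proof (rule measurable_arc_continuous)
  show "continuous_on (sphere 0 1) (\<lambda>z. \<phi> (of_real r * z))"
    by (rule continuous_on_compose2[OF assms(1)]) (use assms in \<open>auto intro!: continuous_intros simp: norm_mult\<close>)
qed

lemma AE_summable_norm:
  fixes f :: "nat \<Rightarrow> 'a \<Rightarrow> complex"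
  assumes "\<And>k. integrable M (f k)" "summable (\<lambda>k. LINT x|M. norm (f k x))"
  shows "AE x in M. summable (\<lambda>k. norm (f k x))"
proof -
  have m: "(\<lambda>x. \<Sum>k. ennreal (norm (f k x))) \<in> borel_measurable M"
    using assms(1) by measurable
  have "(\<integral>\<^sup>+x. (\<Sum>k. ennreal (norm (f k x))) \<partial>M) = (\<Sum>k. \<integral>\<^sup>+x. ennreal (norm (f k x)) \<partial>M)"
    using assms(1) by (intro nn_integral_suminf) auto
  also have "\<dots> = (\<Sum>k. ennreal (LINT x|M. norm (f k x)))"
    using assms(1) by (subst nn_integral_eq_integral) auto
  also have "\<dots> = ennreal (\<Sum>k. LINT x|M. norm (f k x))"
    by (rule suminf_ennreal2) (use assms in auto)
  finally have "(\<integral>\<^sup>+x. (\<Sum>k. ennreal (norm (f k x))) \<partial>M) \<noteq> \<infinity>" by simp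
  from nn_integral_PInf_AE[OF m this] show ?thesis
  proof eventually_elim
    case (elim x)
    show ?case by (rule summable_suminf_not_top) (use elim in \<open>simp_all add: infinity_ennreal_def\<close>)
  qed
qed

text \<open>
  Choosing the radii so that the dilates form a rapidly converging Cauchy sequence in $L_2$ makes them converge
  almost everywhere. This yields a boundary function along one sequence of radii; the full radial limit needs
  the Poisson integral.
\<close>

lemma bounded_holomorphic_boundary_sequence:
  assumes hol: "\<phi> holomorphic_on ball 0 1" and bd: "\<And>z. z \<in> ball 0 1 \<Longrightarrow> norm (\<phi> z) \<le> B"
  obtains r \<psi> where "\<And>k. 0 \<le> r k" "\<And>k. r k < (1::real)" "r \<longlonglongrightarrow> 1"
    "\<psi> \<in> borel_measurable arc"
    "AE \<theta> in arc. (\<lambda>k. \<phi> (of_real (r k) * cis \<theta>)) \<longlonglongrightarrow> \<psi> \<theta>"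
    "AE \<theta> in arc. norm (\<psi> \<theta>) \<le> B"
proof -
  let ?I = "\<lambda>r r'. (LINT \<theta>|arc. (norm (\<phi> (of_real r * cis \<theta>) - \<phi> (of_real r' * cis \<theta>)))\<^sup>2)"
  have "\<exists>\<rho>. 0 \<le> \<rho> \<and> \<rho> < 1 \<and> (\<forall>r r'. \<rho> \<le> r \<longrightarrow> r < 1 \<longrightarrow> \<rho> \<le> r' \<longrightarrow> r' < 1 \<longrightarrow> ?I r r' \<le> (1/16) ^ k)" for k :: nat
  proof -
    have pos: "(1/16::real) ^ k > 0" by simp
    show ?thesis
    proof (rule bounded_holomorphic_L2_Cauchy[OF hol bd pos])
      fix \<rho> assume "0 \<le> \<rho>" "\<rho> < 1"
        "\<And>r r'. \<rho> \<le> r \<Longrightarrow> r < 1 \<Longrightarrow> \<rho> \<le> r' \<Longrightarrow> r' < 1 \<Longrightarrow> ?I r r' \<le> (1/16) ^ k"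
      then show ?thesis by (intro exI[of _ \<rho>] conjI allI impI)
    qed
  qed
  from choice[OF allI[OF this]] obtain \<rho> where \<rho>': "\<forall>k. 0 \<le> \<rho> k \<and> \<rho> k < 1 \<and>
      (\<forall>r r'. \<rho> k \<le> r \<longrightarrow> r < 1 \<longrightarrow> \<rho> k \<le> r' \<longrightarrow> r' < 1 \<longrightarrow> ?I r r' \<le> (1/16) ^ k)"
    by (rule exE)
  have \<rho>: "\<And>k. 0 \<le> \<rho> k" "\<And>k. \<rho> k < 1"
      "\<And>k r r'. \<rho> k \<le> r \<Longrightarrow> r < 1 \<Longrightarrow> \<rho> k \<le> r' \<Longrightarrow> r' < 1 \<Longrightarrow> ?I r r' \<le> (1/16) ^ k"
    using \<rho>' by (simp_all del: of_real_mult)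
  \<comment> \<open>The maximum over $j \le k$ puts both $r_k$ and $r_{k+1}$ above $\rho_k$; the second entry makes the radii tend to one.\<close>
  define r where "r k = Max ((\<lambda>j. max (\<rho> j) (1 - 1 / real (Suc j))) ` {..k})" for k
  have r1: "r k < 1" for k unfolding r_def using \<rho>(2) by (subst Max_less_iff) auto
  have rge: "max (\<rho> j) (1 - 1 / real (Suc j)) \<le> r k" if "j \<le> k" for j k
    unfolding r_def using that by (intro Max_ge) auto
  have r\<rho>: "\<rho> k \<le> r k" "\<rho> k \<le> r (Suc k)" "1 - 1 / real (Suc k) \<le> r k" for k
    using rge[of k k] rge[of k "Suc k"] by auto
  have r0: "0 \<le> r k" for k using r\<rho>(1)[of k] \<rho>(1)[of k] by linarith
  have rlim: "r \<longlonglongrightarrow> 1"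
  proof (rule tendsto_sandwich)
    show "(\<lambda>k. 1 - 1 / real (Suc k)) \<longlonglongrightarrow> 1"
      using tendsto_diff[OF tendsto_const LIMSEQ_inverse_real_of_nat, of 1] by (simp add: inverse_eq_divide)
    show "\<forall>\<^sub>F k in sequentially. 1 - 1 / real (Suc k) \<le> r k" using r\<rho> by auto
    show "\<forall>\<^sub>F k in sequentially. r k \<le> 1" by (intro always_eventually allI less_imp_le r1)
  qed simp
  define F where "F k \<theta> = \<phi> (of_real (r k) * cis \<theta>)" for k \<theta>
  have Fm [measurable]: "F k \<in> borel_measurable arc" for k
    unfolding F_def using holomorphic_on_imp_continuous_on[OF hol] r0 r1 by (rule radial_measurable)
  have Fb: "norm (F k \<theta>) \<le> B" for k \<theta> unfolding F_def by (intro bd of_real_cis_ball r0 r1)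
  have B0: "0 \<le> B" using Fb[of 0 0] norm_ge_zero order_trans by blast
  have db: "norm (F (Suc k) \<theta> - F k \<theta>) \<le> 2 * B" for k \<theta>
    using norm_triangle_ineq4[of "F (Suc k) \<theta>" "F k \<theta>"] Fb[of k \<theta>] Fb[of "Suc k" \<theta>] by linarith
  have di: "integrable arc (\<lambda>\<theta>. F (Suc k) \<theta> - F k \<theta>)" for k
    by (rule integrable_arc_bounded[where B="2*B"]) (use db in auto)
  have di2: "integrable arc (\<lambda>\<theta>. (norm (F (Suc k) \<theta> - F k \<theta>))\<^sup>2)" for k
  proof (rule integrable_arc_bounded)
    show "AE \<theta> in arc. norm ((norm (F (Suc k) \<theta> - F k \<theta>))\<^sup>2) \<le> (2*B)\<^sup>2"
    proof (rule AE_I2)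
      fix \<theta>
      have "(norm (F (Suc k) \<theta> - F k \<theta>))\<^sup>2 \<le> (2*B)\<^sup>2" by (intro power_mono db norm_ge_zero)
      then show "norm ((norm (F (Suc k) \<theta> - F k \<theta>))\<^sup>2) \<le> (2*B)\<^sup>2" by simp
    qed
  qed measurable
  have ci: "integrable arc (\<lambda>\<theta>. c :: real)" for c
    by (rule integrable_arc_bounded[where B="norm c"]) auto
  have ib: "(LINT \<theta>|arc. norm (F (Suc k) \<theta> - F k \<theta>)) \<le> (2*pi + 1) * (1/4) ^ k" for k
  proof -
    have "(LINT \<theta>|arc. norm (F (Suc k) \<theta> - F k \<theta>))
        \<le> (LINT \<theta>|arc. (1/4) ^ k + 4 ^ k * (norm (F (Suc k) \<theta> - F k \<theta>))\<^sup>2)"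
    proof (rule integral_mono)
      show "integrable arc (\<lambda>\<theta>. (1/4) ^ k + 4 ^ k * (norm (F (Suc k) \<theta> - F k \<theta>))\<^sup>2)"
        by (intro Bochner_Integration.integrable_add integrable_mult_right di2 ci)
      fix \<theta>
      define x c where "x = norm (F (Suc k) \<theta> - F k \<theta>)" and "c = (4::real) ^ k"
      have c: "c > 0" "(1/4) ^ k = 1 / c" and x: "x \<ge> 0" by (auto simp: c_def x_def power_divide)
      have "0 \<le> (1 - c * x)\<^sup>2 + c * x" using c x by simp
      then have "c * x \<le> c * (1 / c + c * x\<^sup>2)" using c by (simp add: power2_eq_square algebra_simps)
      then have "x \<le> 1 / c + c * x\<^sup>2" using c(1) by (rule mult_left_le_imp_le)
      then show "norm (F (Suc k) \<theta> - F k \<theta>) \<le> (1/4) ^ k + 4 ^ k * (norm (F (Suc k) \<theta> - F k \<theta>))\<^sup>2"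
        unfolding c(2) unfolding x_def c_def .
    qed (use di in auto)
    also have "\<dots> = 2*pi * (1/4) ^ k + 4 ^ k * ?I (r (Suc k)) (r k)"
      by (subst Bochner_Integration.integral_add[OF ci integrable_mult_right[OF di2]])
        (simp add: F_def measure_restrict_space)
    also have "\<dots> \<le> 2*pi * (1/4) ^ k + 4 ^ k * (1/16) ^ k"
      using \<rho>(3)[OF r\<rho>(2)[of k] r1 r\<rho>(1) r1] by (intro add_left_mono mult_left_mono) auto
    also have "\<dots> = (2*pi + 1) * (1/4) ^ k"
    proof -
      have "(4::real) ^ k * (1/16) ^ k = (4 * (1/16)) ^ k" by (rule power_mult_distrib[symmetric])
      then show ?thesis by (simp add: distrib_right)
    qed
    finally show ?thesis .
  qed
  have "summable (\<lambda>k. LINT \<theta>|arc. norm (F (Suc k) \<theta> - F k \<theta>))"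
  proof (rule summable_comparison_test')
    show "summable (\<lambda>k. (2*pi + 1) * (1/4::real) ^ k)" by (intro summable_mult summable_geometric) auto
    show "norm (LINT \<theta>|arc. norm (F (Suc k) \<theta> - F k \<theta>)) \<le> (2*pi + 1) * (1/4) ^ k" for k
      using ib by simp
  qed
  from AE_summable_norm[OF di this]
  have conv: "AE \<theta> in arc. convergent (\<lambda>k. F k \<theta>)"
  proof eventually_elim
    case (elim \<theta>)
    then have "summable (\<lambda>k. F (Suc k) \<theta> - F k \<theta>)" by (rule summable_norm_cancel)
    then have "convergent (\<lambda>n. F 0 \<theta> + (\<Sum>k<n. F (Suc k) \<theta> - F k \<theta>))"
      by (intro convergent_add convergent_const) (simp add: summable_iff_convergent)
    then show ?case by (simp add: sum_lessThan_telescope[of "\<lambda>k. F k \<theta>"])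
  qed
  define \<psi> where "\<psi> \<theta> = lim (\<lambda>k. F k \<theta>)" for \<theta>
  have lim: "AE \<theta> in arc. (\<lambda>k. F k \<theta>) \<longlonglongrightarrow> \<psi> \<theta>"
    using conv by eventually_elim (simp add: \<psi>_def convergent_LIMSEQ_iff)
  show ?thesis
  proof (rule that)
    show "0 \<le> r k" "r k < 1" "r \<longlonglongrightarrow> 1" for k by (fact r0 r1 rlim)+
    show "\<psi> \<in> borel_measurable arc" unfolding \<psi>_def by measurable
    show "AE \<theta> in arc. (\<lambda>k. \<phi> (of_real (r k) * cis \<theta>)) \<longlonglongrightarrow> \<psi> \<theta>"
      using lim unfolding F_def .
    show "AE \<theta> in arc. norm (\<psi> \<theta>) \<le> B"
      using lim
    proof eventually_elim
      case (elim \<theta>)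
      show ?case by (rule LIMSEQ_le_const2[OF tendsto_norm[OF elim]]) (use Fb in blast)
    qed
  qed
qed

section \<open>The Poisson integral\<close>

definition poisson :: "complex \<Rightarrow> complex \<Rightarrow> real" where
  "poisson z \<zeta> = (1 - (norm z)\<^sup>2) / (norm (\<zeta> - z))\<^sup>2"

lemma poisson_nonneg: "z \<in> ball 0 1 \<Longrightarrow> 0 \<le> poisson z \<zeta>"
  unfolding poisson_def
  apply (rule divide_nonneg_nonneg)
  apply (simp add: abs_square_le_1)
  apply simp
  done

lemma poisson_bound:
  assumes "z \<in> ball 0 1" "norm \<zeta> = 1" shows "poisson z \<zeta> \<le> 2 / (1 - norm z)"
proof -
  have z: "norm z < 1" using assms by simp
  have "1 - norm z \<le> norm (\<zeta> - z)" using norm_triangle_ineq2[of \<zeta> z] assms by simp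
  then have "(1 - norm z)\<^sup>2 \<le> (norm (\<zeta> - z))\<^sup>2" using z by (intro power_mono) auto
  then have "poisson z \<zeta> \<le> (1 - (norm z)\<^sup>2) / (1 - norm z)\<^sup>2"
    unfolding poisson_def using z by (intro divide_left_mono mult_pos_pos) (auto simp: abs_square_le_1)
  also have "\<dots> = (1 + norm z) / (1 - norm z)"
  proof -
    have "1 - (norm z)\<^sup>2 = (1 + norm z) * (1 - norm z)" by (simp add: power2_eq_square algebra_simps)
    then show ?thesis using z by (simp add: power2_eq_square)
  qed
  also have "\<dots> \<le> 2 / (1 - norm z)" using z by (intro divide_right_mono) auto
  finally show ?thesis .
qed

text \<open>
  On the circle the kernel is $(1 - |z|^2)\, \zeta / ((\zeta - z)(1 - \overline z \zeta))$. With
  $u(w) = f(w) / (1 - \overline z w)$, the mean value property of the difference quotient of $u$ at $z$ shows that the mean is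
  $(1 - |z|^2)\, u(z) = f(z)$.
\<close>

lemma poisson_formula_closed:
  assumes f: "f holomorphic_on ball 0 R" "R > 1" and z: "z \<in> ball 0 1"
  shows "cmean (\<lambda>\<zeta>. f \<zeta> * of_real (poisson z \<zeta>)) = f z"
proof -
  define u where "u w = f w / (1 - cnj z * w)" for w
  define g where "g w = (if w = z then deriv u z else (u w - u z) / (w - z))" for w
  define S where "S = (if z = 0 then R else min R (1 / norm z))"
  have z1: "norm z < 1" using z by simp
  have S1: "S > 1" using f z1 by (auto simp: S_def field_simps)
  have nzS: "1 - cnj z * w \<noteq> 0" if "norm w < S" for w
  proof
    assume "1 - cnj z * w = 0"
    then have "norm (cnj z * w) = 1" by (metis eq_iff_diff_eq_0 norm_one)
    moreover have "z \<noteq> 0 \<Longrightarrow> norm z * norm w < 1" using that by (simp add: S_def field_simps)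
    ultimately show False by (cases "z = 0") (auto simp: norm_mult)
  qed
  have nz: "1 - cnj z * w \<noteq> 0" if "norm w \<le> 1" for w using nzS that S1 by auto
  have "S \<le> R" by (simp add: S_def)
  then have uhol: "u holomorphic_on ball 0 S"
    unfolding u_def using f nzS by (intro holomorphic_intros) (auto intro: holomorphic_on_subset)
  have gholS: "g holomorphic_on ball 0 S"
    using pole_lemma_open[OF uhol, of z] by (simp add: g_def[abs_def])
  have ghol: "g holomorphic_on ball 0 1" by (rule holomorphic_on_subset[OF gholS]) (use S1 in auto)
  have gcont: "continuous_on (cball 0 1) g"
    by (rule continuous_on_subset[OF holomorphic_on_imp_continuous_on[OF gholS]]) (use S1 in auto)
  have pt: "f \<zeta> * of_real (poisson z \<zeta>) = of_real (1 - (norm z)\<^sup>2) * (u z * cnj (1 / (1 - cnj z * \<zeta>)) + \<zeta> * g \<zeta>)"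
    if "\<zeta> \<in> sphere 0 1" for \<zeta>
  proof -
    have \<zeta>: "\<zeta> * cnj \<zeta> = 1" using that by (simp add: complex_norm_square[symmetric])
    have nz': "\<zeta> \<noteq> z" "\<zeta> \<noteq> 0" using that z by auto
    have n1: "1 - cnj z * \<zeta> \<noteq> 0" using nz[of \<zeta>] that by simp
    have c: "cnj (1 - cnj z * \<zeta>) = (\<zeta> - z) / \<zeta>" using \<zeta> nz' by (simp add: field_simps)
    have "of_real ((norm (\<zeta> - z))\<^sup>2) = (\<zeta> - z) * (cnj \<zeta> - cnj z)"
      unfolding complex_norm_square by simp
    also have "cnj \<zeta> - cnj z = (1 - cnj z * \<zeta>) / \<zeta>" using \<zeta> nz' by (simp add: field_simps)
    finally have d: "of_real ((norm (\<zeta> - z))\<^sup>2) = (\<zeta> - z) * (1 - cnj z * \<zeta>) / \<zeta>" by simp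
    have "f \<zeta> * of_real (poisson z \<zeta>) = of_real (1 - (norm z)\<^sup>2) * (f \<zeta> * \<zeta> / ((\<zeta> - z) * (1 - cnj z * \<zeta>)))"
      unfolding poisson_def of_real_divide d by simp
    also have "f \<zeta> * \<zeta> / ((\<zeta> - z) * (1 - cnj z * \<zeta>)) = u \<zeta> * \<zeta> / (\<zeta> - z)"
      by (simp add: u_def)
    also have "\<dots> = u z * (\<zeta> / (\<zeta> - z)) + \<zeta> * g \<zeta>"
      using nz' by (simp add: g_def add_divide_distrib[symmetric]) (simp add: algebra_simps)
    also have "\<zeta> / (\<zeta> - z) = cnj (1 / (1 - cnj z * \<zeta>))"
      using c by (simp only: complex_cnj_divide) simp
    finally show ?thesis .
  qed
  have h1: "cmean (\<lambda>\<zeta>. 1 / (1 - cnj z * \<zeta>)) = 1"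
    using nz by (subst cmean_holomorphic) (auto intro!: continuous_intros holomorphic_intros)
  have h2: "cmean (\<lambda>\<zeta>. \<zeta> * g \<zeta>) = 0"
    using gcont ghol by (subst cmean_holomorphic) (auto intro!: continuous_intros holomorphic_intros)
  have i1: "integrable arc (\<lambda>\<theta>. cnj (1 / (1 - cnj z * cis \<theta>)))"
    using nz by (intro integrable_arc_continuous[of "\<lambda>\<zeta>. cnj (1 / (1 - cnj z * \<zeta>))"] continuous_intros) auto
  have i2: "integrable arc (\<lambda>\<theta>. cis \<theta> * g (cis \<theta>))"
    using gcont by (intro integrable_arc_continuous[of "\<lambda>\<zeta>. \<zeta> * g \<zeta>"]) (auto intro!: continuous_intros elim: continuous_on_subset)
  have "cmean (\<lambda>\<zeta>. f \<zeta> * of_real (poisson z \<zeta>))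
      = of_real (1 - (norm z)\<^sup>2) * (u z * cnj (cmean (\<lambda>\<zeta>. 1 / (1 - cnj z * \<zeta>))) + cmean (\<lambda>\<zeta>. \<zeta> * g \<zeta>))"
  proof -
    have "(LINT \<theta>|arc. f (cis \<theta>) * of_real (poisson z (cis \<theta>)))
        = (LINT \<theta>|arc. of_real (1 - (norm z)\<^sup>2) * (u z * cnj (1 / (1 - cnj z * cis \<theta>)) + cis \<theta> * g (cis \<theta>)))"
      using pt by (intro Bochner_Integration.integral_cong) auto
    also have "\<dots> = of_real (1 - (norm z)\<^sup>2) *
        (u z * (LINT \<theta>|arc. cnj (1 / (1 - cnj z * cis \<theta>))) + (LINT \<theta>|arc. cis \<theta> * g (cis \<theta>)))"
      using i1 i2 by (simp only: integral_mult_right_zero Bochner_Integration.integral_add integrable_mult_right)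
    finally have E: "(LINT \<theta>|arc. f (cis \<theta>) * of_real (poisson z (cis \<theta>))) = \<dots>" .
    show ?thesis
      unfolding cmean_def E Bochner_Integration.integral_cnj by (simp add: add_divide_distrib distrib_left)
  qed
  also have "\<dots> = of_real (1 - (norm z)\<^sup>2) * u z" by (simp add: h1 h2)
  also have "\<dots> = f z"
  proof -
    have "1 - cnj z * z = of_real (1 - (norm z)\<^sup>2)"
      unfolding of_real_diff complex_norm_square by (simp add: mult.commute)
    then show ?thesis using nz[of z] z1 by (simp add: u_def)
  qed
  finally show ?thesis .
qed

lemma poisson_integrable:
  assumes "z \<in> ball 0 1" shows "integrable arc (\<lambda>\<theta>. poisson z (cis \<theta>))"
proof -
  have m: "(\<lambda>\<theta>. poisson z (cis \<theta>)) \<in> borel_measurable arc"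
    unfolding poisson_def by measurable
  show ?thesis
    by (rule integrable_arc_bounded[OF m, of "2 / (1 - norm z)"])
       (use poisson_bound[OF assms] poisson_nonneg[OF assms] in auto)
qed

lemma poisson_total:
  assumes "z \<in> ball 0 1" shows "(LINT \<theta>|arc. poisson z (cis \<theta>)) = 2 * pi"
proof -
  have "cmean (\<lambda>\<zeta>. 1 * of_real (poisson z \<zeta>)) = 1"
    by (rule poisson_formula_closed[of "\<lambda>_. 1" 2]) (use assms in auto)
  then have "complex_of_real (LINT \<theta>|arc. poisson z (cis \<theta>)) = of_real (2 * pi)"
    by (simp add: cmean_def divide_eq_eq)
  then show ?thesis using of_real_eq_iff by blast
qed

text \<open>
  Apply the formula to the dilates of $\phi$ by the given radii and pass to the limit under the integral.
\<close>

lemma poisson_representation: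
  fixes \<phi> :: "complex \<Rightarrow> complex" and \<psi> :: "real \<Rightarrow> complex"
  assumes hol: "\<phi> holomorphic_on ball 0 1" and bd: "\<And>z. z \<in> ball 0 1 \<Longrightarrow> norm (\<phi> z) \<le> B"
    and r: "\<And>k. 0 \<le> r k" "\<And>k. r k < (1::real)" "r \<longlonglongrightarrow> 1"
    and \<psi>: "\<psi> \<in> borel_measurable arc" "AE \<theta> in arc. (\<lambda>k. \<phi> (of_real (r k) * cis \<theta>)) \<longlonglongrightarrow> \<psi> \<theta>"
    and z: "z \<in> ball 0 1"
  shows "(LINT \<theta>|arc. \<psi> \<theta> * of_real (poisson z (cis \<theta>))) = 2 * pi * \<phi> z"
proof -
  have pm [measurable]: "(\<lambda>\<theta>. poisson z (cis \<theta>)) \<in> borel_measurable arc"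
    using poisson_integrable[OF z] by auto
  have c: "continuous_on (ball 0 1) \<phi>" using hol by (rule holomorphic_on_imp_continuous_on)
  have "(\<lambda>k. LINT \<theta>|arc. \<phi> (of_real (r k) * cis \<theta>) * of_real (poisson z (cis \<theta>)))
        \<longlonglongrightarrow> (LINT \<theta>|arc. \<psi> \<theta> * of_real (poisson z (cis \<theta>)))"
  proof (rule integral_dominated_convergence[where w="\<lambda>\<theta>. B * poisson z (cis \<theta>)"])
    show "integrable arc (\<lambda>\<theta>. B * poisson z (cis \<theta>))"
      using poisson_integrable[OF z] by (rule integrable_mult_right)
    show "AE \<theta> in arc. (\<lambda>k. \<phi> (of_real (r k) * cis \<theta>) * of_real (poisson z (cis \<theta>)))
            \<longlonglongrightarrow> \<psi> \<theta> * of_real (poisson z (cis \<theta>))"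
      using \<psi>(2) by eventually_elim (intro tendsto_intros)
    show "AE \<theta> in arc. norm (\<phi> (of_real (r k) * cis \<theta>) * of_real (poisson z (cis \<theta>))) \<le> B * poisson z (cis \<theta>)" for k
      using bd[OF of_real_cis_ball[OF r(1,2)]] poisson_nonneg[OF z]
      by (intro AE_I2) (simp add: norm_mult mult_right_mono)
    show "(\<lambda>\<theta>. \<psi> \<theta> * of_real (poisson z (cis \<theta>))) \<in> borel_measurable arc"
      using \<psi>(1) by measurable
    show "(\<lambda>\<theta>. \<phi> (of_real (r k) * cis \<theta>) * of_real (poisson z (cis \<theta>))) \<in> borel_measurable arc" for k
      using radial_measurable[OF c r(1,2), of k] by measurable
  qed
  moreover have "(LINT \<theta>|arc. \<phi> (of_real (r k) * cis \<theta>) * of_real (poisson z (cis \<theta>))) = 2 * pi * \<phi> (of_real (r k) * z)" for k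
  proof -
    define R where "R = (if r k = 0 then 2 else 1 / r k)"
    have R: "R > 1" using r(1,2)[of k] by (auto simp: R_def)
    have "(\<lambda>w. \<phi> (of_real (r k) * w)) holomorphic_on ball 0 R"
    proof (rule holomorphic_on_compose_gen[of _ _ \<phi> "ball 0 1", unfolded o_def])
      show "(\<lambda>w::complex. of_real (r k) * w) ` ball 0 R \<subseteq> ball 0 1"
        using r(1,2)[of k] by (auto simp: R_def norm_mult field_simps dist_norm split: if_splits)
    qed (auto intro!: holomorphic_intros hol)
    from poisson_formula_closed[OF this R z] show ?thesis
      by (simp add: cmean_def divide_eq_eq)
  qed
  moreover have "(\<lambda>k. 2 * pi * \<phi> (of_real (r k) * z)) \<longlonglongrightarrow> 2 * pi * \<phi> z"
  proof (intro tendsto_intros)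
    have "isCont \<phi> z" using c z by (simp add: continuous_on_eq_continuous_at)
    moreover have "(\<lambda>k. of_real (r k) * z) \<longlonglongrightarrow> of_real 1 * z" by (intro tendsto_intros r)
    ultimately show "(\<lambda>k. \<phi> (of_real (r k) * z)) \<longlonglongrightarrow> \<phi> z"
      by (intro isCont_tendsto_compose[of z \<phi>]) simp_all
  qed
  ultimately show ?thesis by (simp add: LIMSEQ_unique)
qed

lemma cis_chord: "norm (cis a - cis b) = 2 * \<bar>sin ((a - b) / 2)\<bar>"
proof (rule power2_eq_imp_eq)
  have "(norm (cis a - cis b))\<^sup>2 = (cos a - cos b)\<^sup>2 + (sin a - sin b)\<^sup>2"
    by (simp add: cmod_power2)
  also have "\<dots> = 2 - 2 * cos (a - b)"
    using sin_cos_squared_add[of a] sin_cos_squared_add[of b]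
    by (simp add: cos_diff power2_eq_square algebra_simps)
  also have "cos (a - b) = 1 - 2 * (sin ((a - b) / 2))\<^sup>2"
    using cos_double_sin[of "(a-b)/2"] by (simp only: mult_2 field_sum_of_halves)
  finally show "(norm (cis a - cis b))\<^sup>2 = (2 * \<bar>sin ((a - b) / 2)\<bar>)\<^sup>2"
    by (simp add: power_mult_distrib)
qed auto

lemma sin_linear_lower_bound:
  assumes "0 < m" "m < pi"
  obtains c where "c > 0" "\<And>x. \<bar>x\<bar> \<le> m \<Longrightarrow> c * \<bar>x\<bar> \<le> \<bar>sin x\<bar>"
proof -
  define g where "g x = (if x = 0 then 1 else sin x / x)" for x :: real
  have "isCont g x" for x
  proof (cases "x = 0")
    case True
    have "((\<lambda>h. (sin (0 + h) - sin 0) / h) \<longlongrightarrow> cos (0::real)) (at 0)"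
      using DERIV_sin[of "0::real"] unfolding DERIV_def .
    then have "(g \<longlongrightarrow> cos 0) (at 0)"
      by (rule Lim_transform_eventually) (auto simp: g_def eventually_at_filter)
    then show ?thesis using True by (simp add: isCont_def) (simp add: g_def)
  next
    case False
    have "isCont (\<lambda>x. sin x / x) x" using False by (intro continuous_intros)
    moreover have "\<forall>\<^sub>F y in nhds x. g y = sin y / y"
      using False by (intro eventually_mono[OF t1_space_nhds[of x 0]]) (auto simp: g_def)
    ultimately show ?thesis by (subst isCont_cong) auto
  qed
  then have "continuous_on {0..m} g" by (intro continuous_at_imp_continuous_on) auto
  moreover have "{0..m} \<noteq> {}" using assms by auto
  ultimately obtain x0 where x0: "x0 \<in> {0..m}" "\<And>y. y \<in> {0..m} \<Longrightarrow> g x0 \<le> g y"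
    using continuous_attains_inf[of "{0..m}" g] by auto
  have pos: "g x0 > 0" using x0(1) assms by (auto simp: g_def intro!: divide_pos_pos sin_gt_zero)
  show ?thesis
  proof (rule that[OF pos])
    fix x :: real assume x: "\<bar>x\<bar> \<le> m"
    have s: "\<bar>sin x\<bar> = sin \<bar>x\<bar>"
      using x assms sin_ge_zero[of "\<bar>x\<bar>"] by (auto simp: abs_if)
    show "g x0 * \<bar>x\<bar> \<le> \<bar>sin x\<bar>"
      unfolding s using x0(2)[of "\<bar>x\<bar>"] x by (cases "x = 0") (auto simp: g_def field_simps)
  qed
qed

text \<open>
  Away from $t$ the Poisson kernel at $r e^{it}$ is at most a multiple of $(1 - r)/(\theta - t)^2$, so its
  tails are controlled by this integral.
\<close>

lemma inverse_square_arc_integral: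
  assumes "{a..b} \<subseteq> {0..2*pi}" "a \<le> b" "t \<notin> {a..b}"
  shows "integrable arc (\<lambda>\<theta>. indicator {a..b} \<theta> / (\<theta> - t)\<^sup>2)"
    and "(LINT \<theta>|arc. indicator {a..b} \<theta> / (\<theta> - t)\<^sup>2) = 1 / (a - t) - 1 / (b - t)"
proof -
  have c: "continuous_on {a..b} (\<lambda>\<theta>. 1 / (\<theta> - t)\<^sup>2)"
    using assms(3) by (auto intro!: continuous_intros)
  then have si: "set_integrable lebesgue {a..b} (\<lambda>\<theta>. 1 / (\<theta> - t)\<^sup>2)"
    by (rule absolutely_integrable_continuous_real)
  have eq: "indicator {0..2*pi} x *\<^sub>R (indicator {a..b} x / (x - t)\<^sup>2) = indicator {a..b} x *\<^sub>R (1 / (x - t)\<^sup>2)" for x :: real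
    using assms(1) by (auto simp: indicator_def)
  show "integrable arc (\<lambda>\<theta>. indicator {a..b} \<theta> / (\<theta> - t)\<^sup>2)"
    using si by (subst integrable_restrict_space) (simp_all only: eq set_integrable_def, auto)
  have "(LINT \<theta>|arc. indicator {a..b} \<theta> / (\<theta> - t)\<^sup>2) = (LINT \<theta>:{a..b}|lebesgue. 1 / (\<theta> - t)\<^sup>2)"
    by (subst integral_restrict_space) (simp_all only: eq set_lebesgue_integral_def, auto)
  also have "\<dots> = integral {a..b} (\<lambda>\<theta>. 1 / (\<theta> - t)\<^sup>2)"
    using si by (rule set_lebesgue_integral_eq_integral)
  also have "\<dots> = - 1 / (b - t) - - 1 / (a - t)"
  proof (intro integral_unique fundamental_theorem_of_calculus assms(2))
    fix x assume x: "x \<in> {a..b}"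
    then have "((\<lambda>\<theta>. - 1 / (\<theta> - t)) has_field_derivative 1 / (x - t)\<^sup>2) (at x)"
      using assms(3) by (auto intro!: derivative_eq_intros simp: power2_eq_square)
    then show "((\<lambda>\<theta>. - 1 / (\<theta> - t)) has_vector_derivative 1 / (x - t)\<^sup>2) (at x within {a..b})"
      by (simp add: has_real_derivative_iff_has_vector_derivative has_vector_derivative_at_within)
  qed
  finally show "(LINT \<theta>|arc. indicator {a..b} \<theta> / (\<theta> - t)\<^sup>2) = 1 / (a - t) - 1 / (b - t)" by simp
qed

text \<open>
  Split $N$ at distance $d = K (1 - r)$ from $t$. Near $t$ the kernel is at most $2/(1-r)$ and $N$ has density zero,
  beyond $d$ the kernel contributes $O((1-r)/d) = O(1/K)$.
\<close>

lemma poisson_tail: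
  assumes N: "N \<in> sets lebesgue" "N \<subseteq> {0..2*pi}" and t: "0 < t" "t < 2*pi"
    and dens: "((\<lambda>d. measure lebesgue (N \<inter> ball t d) / d) \<longlongrightarrow> 0) (at_right 0)"
  shows "((\<lambda>r. LINT \<theta>|arc. indicator N \<theta> * poisson (of_real r * cis t) (cis \<theta>)) \<longlongrightarrow> 0) (at_left 1)"
proof -
  \<comment> \<open>Half of the largest distance $|\theta - t|$ on the circle. It is less than $\pi$, so the sine of $|\theta - t|/2$ stays above a multiple of it.\<close>
  define m where "m = max t (2*pi - t) / 2"
  have m: "0 < m" "m < pi" using t by (auto simp: m_def)
  obtain c where c: "c > 0" "\<And>x. \<bar>x\<bar> \<le> m \<Longrightarrow> c * \<bar>x\<bar> \<le> \<bar>sin x\<bar>"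
    by (rule sin_linear_lower_bound[OF m]) blast
  have chord: "c * \<bar>\<theta> - t\<bar> \<le> norm (cis \<theta> - cis t)" if "\<theta> \<in> {0..2*pi}" for \<theta>
  proof -
    have "\<bar>(\<theta> - t) / 2\<bar> \<le> m" 
    proof -
      have "\<bar>\<theta> - t\<bar> \<le> max t (2*pi - t)" using that t by (auto simp: abs_if le_max_iff_disj)
      then show ?thesis by (simp add: m_def)
    qed
    from c(2)[OF this] show ?thesis by (simp add: cis_chord)
  qed
  let ?P = "\<lambda>r \<theta>. poisson (of_real r * cis t) (cis \<theta>)"
  have P1: "?P r \<theta> \<le> 2 / (1 - r)" if "0 \<le> r" "r < 1" for r \<theta>
    using poisson_bound[OF of_real_cis_ball[OF that], of "cis \<theta>" t] that by (simp add: norm_mult)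
  have P2: "?P r \<theta> \<le> 8 * (1 - r) / c\<^sup>2 * (1 / (\<theta> - t)\<^sup>2)"
    if "0 \<le> r" "r < 1" "\<theta> \<in> {0..2*pi}" "\<theta> \<noteq> t" for r \<theta>
  proof -
    let ?z = "of_real r * cis t"
    have nz: "norm ?z = r" using that by (simp add: norm_mult)
    have "norm (cis t - ?z) = norm (of_real (1 - r) * cis t)" by (simp add: algebra_simps)
    also have "\<dots> = 1 - r" using that by (simp only: norm_mult norm_of_real norm_cis) simp
    also have "1 - r \<le> norm (cis \<theta> - ?z)" using norm_triangle_ineq2[of "cis \<theta>" ?z] nz by simp
    finally have "norm (cis \<theta> - cis t) \<le> 2 * norm (cis \<theta> - ?z)"
      using norm_triangle_ineq4[of "cis \<theta> - ?z" "cis t - ?z"] by simp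
    then have "c * \<bar>\<theta> - t\<bar> / 2 \<le> norm (cis \<theta> - ?z)" using chord[OF that(3)] by simp
    then have "(c * \<bar>\<theta> - t\<bar> / 2)\<^sup>2 \<le> (norm (cis \<theta> - ?z))\<^sup>2" using c(1) by (intro power_mono) auto
    then have "?P r \<theta> \<le> (1 - r\<^sup>2) / (c * \<bar>\<theta> - t\<bar> / 2)\<^sup>2"
    proof -
      have "0 < c * \<bar>\<theta> - t\<bar> / 2" using c(1) that by simp
      then have "0 < (c * \<bar>\<theta> - t\<bar> / 2)\<^sup>2" by (rule zero_less_power)
      with \<open>(c * \<bar>\<theta> - t\<bar> / 2)\<^sup>2 \<le> _\<close> show ?thesis
        unfolding poisson_def nz using that by (intro divide_left_mono mult_pos_pos) (auto simp: abs_square_le_1 simp del: power_eq_0_iff zero_less_power2)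
    qed
    also have "\<dots> \<le> (2 * (1 - r)) / (c * \<bar>\<theta> - t\<bar> / 2)\<^sup>2"
    proof (rule divide_right_mono)
      have "0 \<le> (1 - r)\<^sup>2" by simp
      then show "1 - r\<^sup>2 \<le> 2 * (1 - r)" by (simp add: power2_eq_square algebra_simps)
    qed simp
    also have "\<dots> = 8 * (1 - r) / c\<^sup>2 * (1 / (\<theta> - t)\<^sup>2)"
      by (simp add: power_mult_distrib power_divide)
    finally show ?thesis .
  qed
  have est: "(LINT \<theta>|arc. indicator N \<theta> * ?P r \<theta>) \<le> 2 / (1 - r) * measure lebesgue (N \<inter> ball t d) + 16 * (1 - r) / (c\<^sup>2 * d)"
    if r: "0 \<le> r" "r < 1" and d: "0 < d" "d \<le> t" "d \<le> 2*pi - t" for r d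
  proof -
    let ?k = "8 * (1 - r) / c\<^sup>2"
    let ?f1 = "\<lambda>\<theta>. indicator {0..t-d} \<theta> / (\<theta> - t)\<^sup>2"
    let ?f2 = "\<lambda>\<theta>. indicator {t+d..2*pi} \<theta> / (\<theta> - t)\<^sup>2"
    have i1: "integrable arc ?f1" "(LINT \<theta>|arc. ?f1 \<theta>) \<le> 1 / d"
      using inverse_square_arc_integral[of 0 "t-d" t] d t by auto
    have i2: "integrable arc ?f2" "(LINT \<theta>|arc. ?f2 \<theta>) \<le> 1 / d"
      using inverse_square_arc_integral[of "t+d" "2*pi" t] d t by auto
    have NB: "N \<inter> ball t d \<in> sets lebesgue" "N \<inter> ball t d \<subseteq> {0..2*pi}" using N by auto
    then have NBa: "N \<inter> ball t d \<in> sets arc" by (simp add: sets_restrict_space_iff)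
    have i0: "integrable arc (indicator (N \<inter> ball t d) :: real \<Rightarrow> real)"
      by (rule integrable_arc_bounded[where B=1]) (use NBa in \<open>auto simp: indicator_def\<close>)
    have m0: "(LINT \<theta>|arc. indicator (N \<inter> ball t d) \<theta>) = measure lebesgue (N \<inter> ball t d)"
      using NB NBa by (simp add: measure_restrict_space Int_absorb2 space_restrict_space)
    have "(LINT \<theta>|arc. indicator N \<theta> * ?P r \<theta>)
        \<le> (LINT \<theta>|arc. 2 / (1 - r) * indicator (N \<inter> ball t d) \<theta> + ?k * (?f1 \<theta> + ?f2 \<theta>))"
    proof (rule integral_mono)
      have Na: "N \<in> sets arc" using N by (simp add: sets_restrict_space_iff)
      show "integrable arc (\<lambda>\<theta>. indicator N \<theta> * ?P r \<theta>)"
      proof (rule integrable_arc_bounded[where B="2 / (1 - r)"])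
        show "(\<lambda>\<theta>. indicator N \<theta> * ?P r \<theta>) \<in> borel_measurable arc"
          using Na poisson_integrable[OF of_real_cis_ball[OF r]] by measurable
        show "AE \<theta> in arc. norm (indicator N \<theta> * ?P r \<theta>) \<le> 2 / (1 - r)"
          using P1[OF r] poisson_nonneg[OF of_real_cis_ball[OF r]] r by (auto simp: indicator_def)
      qed
      show "integrable arc (\<lambda>\<theta>. 2 / (1 - r) * indicator (N \<inter> ball t d) \<theta> + ?k * (?f1 \<theta> + ?f2 \<theta>))"
        by (intro Bochner_Integration.integrable_add integrable_mult_right i0 i1 i2)
      fix \<theta> assume "\<theta> \<in> space arc"
      then have \<theta>: "\<theta> \<in> {0..2*pi}" by simp
      have k0: "?k \<ge> 0" using r c by simp
      have "0 \<le> ?f1 \<theta> + ?f2 \<theta>" by (intro add_nonneg_nonneg divide_nonneg_nonneg) auto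
      then have kf: "0 \<le> ?k * (?f1 \<theta> + ?f2 \<theta>)" using k0 by (rule mult_nonneg_nonneg[rotated])
      show "indicator N \<theta> * ?P r \<theta> \<le> 2 / (1 - r) * indicator (N \<inter> ball t d) \<theta> + ?k * (?f1 \<theta> + ?f2 \<theta>)"
      proof (cases "\<theta> \<in> N")
        case False
        then show ?thesis using k0 r by (auto intro!: add_nonneg_nonneg mult_nonneg_nonneg)
      next
        case True
        show ?thesis
        proof (cases "\<theta> \<in> ball t d")
          case True
          then have "indicator N \<theta> * ?P r \<theta> \<le> 2 / (1 - r) * indicator (N \<inter> ball t d) \<theta>"
            using \<open>\<theta> \<in> N\<close> P1[OF r, of \<theta>] by simp
          then show ?thesis using kf by linarith
        next
          case False
          then have "\<theta> \<noteq> t" "\<theta> \<in> {0..t-d} \<or> \<theta> \<in> {t+d..2*pi}" using d \<theta> by (auto simp: dist_real_def)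
          then have "1 / (\<theta> - t)\<^sup>2 \<le> ?f1 \<theta> + ?f2 \<theta>" by (auto simp: indicator_def)
          then have "?k * (1 / (\<theta> - t)\<^sup>2) \<le> ?k * (?f1 \<theta> + ?f2 \<theta>)" using k0 by (rule mult_left_mono)
          with P2[OF r \<theta> \<open>\<theta> \<noteq> t\<close>] show ?thesis using \<open>\<theta> \<in> N\<close> False by simp
        qed
      qed
    qed
    also have "\<dots> = 2 / (1 - r) * measure lebesgue (N \<inter> ball t d) + ?k * ((LINT \<theta>|arc. ?f1 \<theta>) + (LINT \<theta>|arc. ?f2 \<theta>))"
      using i0 i1 i2 m0 by (simp only: Bochner_Integration.integral_add integrable_mult_right
          Bochner_Integration.integrable_add integral_mult_right_zero)
    also have "\<dots> \<le> 2 / (1 - r) * measure lebesgue (N \<inter> ball t d) + ?k * (1 / d + 1 / d)"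
      using i1 i2 r c by (intro add_left_mono mult_left_mono add_mono) auto
    finally show ?thesis by simp
  qed
  have nonneg: "0 \<le> (LINT \<theta>|arc. indicator N \<theta> * ?P r \<theta>)" if "0 \<le> r" "r < 1" for r
    using poisson_nonneg[OF of_real_cis_ball[OF that]] by (intro Bochner_Integration.integral_nonneg) auto
  show ?thesis
  proof (rule tendstoI)
    fix e :: real assume e: "e > 0"
    \<comment> \<open>With this $K$ the contribution $16 (1-r)/(c^2 d)$ from outside the interval equals $e/2$.\<close>
    define K where "K = 32 / (c\<^sup>2 * e)"
    have K: "K > 0" using c e by (simp add: K_def)
    have "\<forall>\<^sub>F d in at_right 0. measure lebesgue (N \<inter> ball t d) / d < e / (4 * K)"
      using dens e K by (intro order_tendstoD) auto
    then obtain d0 where d0: "d0 > 0" "\<And>d. 0 < d \<Longrightarrow> d < d0 \<Longrightarrow> measure lebesgue (N \<inter> ball t d) / d < e / (4 * K)"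
      unfolding eventually_at_right_field by auto
    define d1 where "d1 = Min {d0, t, 2*pi - t}"
    have d1: "d1 > 0" "d1 \<le> d0" "d1 \<le> t" "d1 \<le> 2*pi - t" using d0 t by (auto simp: d1_def)
    have "dist (LINT \<theta>|arc. indicator N \<theta> * ?P r \<theta>) 0 < e" if r: "0 \<le> r" "r < 1" "1 - d1 / K < r" for r
    proof -
      define d where "d = K * (1 - r)"
      have d: "0 < d" "d < d1" using r K by (auto simp: d_def field_simps)
      have "2 / (1 - r) * measure lebesgue (N \<inter> ball t d) = 2 * K * (measure lebesgue (N \<inter> ball t d) / d)"
        using r K by (simp add: d_def)
      also have "\<dots> < 2 * K * (e / (4 * K))"
        using d0(2)[of d] d d1 K by (intro mult_strict_left_mono) auto
      also have "\<dots> = e / 2" using K by simp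
      finally have a: "2 / (1 - r) * measure lebesgue (N \<inter> ball t d) < e / 2" .
      have b: "16 * (1 - r) / (c\<^sup>2 * d) = e / 2"
      proof -
        have "16 * h / (c\<^sup>2 * (K * h)) = 16 / (c\<^sup>2 * K)" if "h \<noteq> 0" for h using that by simp
        from this[of "1 - r"] have "16 * (1 - r) / (c\<^sup>2 * d) = 16 / (c\<^sup>2 * K)" using r by (simp only: d_def)
        also have "\<dots> = e / 2" using c e by (simp add: K_def)
        finally show ?thesis .
      qed
      have "(LINT \<theta>|arc. indicator N \<theta> * ?P r \<theta>) < e"
      proof -
        have "(LINT \<theta>|arc. indicator N \<theta> * ?P r \<theta>) \<le> 2 / (1 - r) * measure lebesgue (N \<inter> ball t d) + 16 * (1 - r) / (c\<^sup>2 * d)"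
          by (rule est) (use r d d1 in auto)
        then show ?thesis using a b by linarith
      qed
      then show ?thesis using nonneg[OF r(1,2)] by simp
    qed
    then show "\<forall>\<^sub>F r in at_left 1. dist (LINT \<theta>|arc. indicator N \<theta> * ?P r \<theta>) 0 < e"
      unfolding eventually_at_left_field
      using d1 K by (intro exI[of _ "max 0 (1 - d1 / K)"]) auto
  qed
qed

section \<open>Radial limits of bounded holomorphic functions\<close>

text \<open>
  At a density point of the set where $\operatorname{Re} \psi > a$, the complement of that set contributes
  nothing to the Poisson integral in the limit, so the average of $\operatorname{Re} \psi$ is at least about $a$.
\<close>

lemma Fatou_one_sided:
  fixes \<phi> :: "complex \<Rightarrow> complex" and \<psi> :: "real \<Rightarrow> complex" and a :: real
  assumes hol: "\<phi> holomorphic_on ball 0 1" and bd: "\<And>z. z \<in> ball 0 1 \<Longrightarrow> norm (\<phi> z) \<le> B"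
    and r: "\<And>k. 0 \<le> r k" "\<And>k. r k < (1::real)" "r \<longlonglongrightarrow> 1"
    and \<psi>: "\<psi> \<in> borel_measurable arc" "AE \<theta> in arc. (\<lambda>k. \<phi> (of_real (r k) * cis \<theta>)) \<longlonglongrightarrow> \<psi> \<theta>"
    and \<psi>B: "AE \<theta> in arc. norm (\<psi> \<theta>) \<le> B"
  shows "AE t in arc. Re (\<psi> t) > a \<longrightarrow>
           (\<forall>e>0. \<forall>\<^sub>F r in at_left 1. Re (\<phi> (of_real r * cis t)) > a - e)"
proof -
  define N where "N = {\<theta> \<in> space arc. \<not> Re (\<psi> \<theta>) > a}"
  have Na: "N \<in> sets arc" unfolding N_def using \<psi>(1) by measurable
  then have N: "N \<in> sets lebesgue" "N \<subseteq> {0..2*pi}" by (auto simp: sets_restrict_space_iff)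
  define C where "C = B + \<bar>a\<bar>"
  have B0: "0 \<le> B" using order_trans[OF norm_ge_zero bd[of 0]] by simp
  have C0: "0 \<le> C" using B0 by (simp add: C_def)
  \<comment> \<open>Outside $N$ the boundary function exceeds $a$, on $N$ it is at least $-B \ge a - C$.\<close>
  have low: "Re (\<phi> z) \<ge> a - C / (2*pi) * (LINT \<theta>|arc. indicator N \<theta> * poisson z (cis \<theta>))"
    if z: "z \<in> ball 0 1" for z
  proof -
    have pm [measurable]: "(\<lambda>\<theta>. poisson z (cis \<theta>)) \<in> borel_measurable arc"
      using poisson_integrable[OF z] by auto
    note pi = poisson_integrable[OF z]
    have iN: "integrable arc (\<lambda>\<theta>. indicator N \<theta> * poisson z (cis \<theta>))"
      by (rule Bochner_Integration.integrable_bound[OF pi]) (use Na in \<open>auto simp: indicator_def\<close>)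
    have i\<psi>: "integrable arc (\<lambda>\<theta>. \<psi> \<theta> * of_real (poisson z (cis \<theta>)))"
    proof (rule Bochner_Integration.integrable_bound)
      show "integrable arc (\<lambda>\<theta>. B * poisson z (cis \<theta>))" using pi by (rule integrable_mult_right)
      show "AE \<theta> in arc. norm (\<psi> \<theta> * of_real (poisson z (cis \<theta>))) \<le> norm (B * poisson z (cis \<theta>))"
        using \<psi>B by eventually_elim (use B0 poisson_nonneg[OF z] in \<open>auto simp: norm_mult mult_right_mono\<close>)
    qed (use \<psi>(1) in measurable)
    have "(LINT \<theta>|arc. a * poisson z (cis \<theta>) - C * (indicator N \<theta> * poisson z (cis \<theta>)))
       \<le> (LINT \<theta>|arc. Re (\<psi> \<theta> * of_real (poisson z (cis \<theta>))))"
    proof (rule integral_mono_AE)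
      show "integrable arc (\<lambda>\<theta>. a * poisson z (cis \<theta>) - C * (indicator N \<theta> * poisson z (cis \<theta>)))"
        by (intro Bochner_Integration.integrable_diff integrable_mult_right pi iN)
      show "integrable arc (\<lambda>\<theta>. Re (\<psi> \<theta> * of_real (poisson z (cis \<theta>))))"
        using i\<psi> by (rule integrable_Re)
      show "AE \<theta> in arc. a * poisson z (cis \<theta>) - C * (indicator N \<theta> * poisson z (cis \<theta>))
              \<le> Re (\<psi> \<theta> * of_real (poisson z (cis \<theta>)))"
        using \<psi>B AE_space
      proof eventually_elim
        case (elim \<theta>)
        have "a - C * indicator N \<theta> \<le> Re (\<psi> \<theta>)"
        proof (cases "\<theta> \<in> N")
          case True
          then show ?thesis using elim(1) abs_Re_le_cmod[of "\<psi> \<theta>"] by (simp add: C_def)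
        next
          case False
          then show ?thesis using elim(2) by (simp add: N_def)
        qed
        then have "(a - C * indicator N \<theta>) * poisson z (cis \<theta>) \<le> Re (\<psi> \<theta>) * poisson z (cis \<theta>)"
          using poisson_nonneg[OF z] by (rule mult_right_mono)
        then show ?case by (simp add: algebra_simps)
      qed
    qed
    also have "(LINT \<theta>|arc. a * poisson z (cis \<theta>) - C * (indicator N \<theta> * poisson z (cis \<theta>)))
        = a * (2*pi) - C * (LINT \<theta>|arc. indicator N \<theta> * poisson z (cis \<theta>))"
      using pi iN by (simp only: Bochner_Integration.integral_diff integrable_mult_right
        integral_mult_right_zero poisson_total[OF z])
    also have "(LINT \<theta>|arc. Re (\<psi> \<theta> * of_real (poisson z (cis \<theta>)))) = Re (2 * pi * \<phi> z)"
      by (subst Bochner_Integration.integral_Re[OF i\<psi>]) (simp only: poisson_representation[OF hol bd r \<psi> z])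
    finally show ?thesis by (simp add: field_simps)
  qed
  have "AE t in lebesgue. \<not> (t \<notin> N \<and> \<not> ((\<lambda>d. measure lebesgue (N \<inter> ball t d) / d) \<longlongrightarrow> 0) (at_right 0))"
    by (rule AE_I'[OF Lebesgue_density[OF N(1), unfolded negligible_iff_null_sets]]) auto
  moreover have "AE t in lebesgue. t \<noteq> 0 \<and> t \<noteq> 2*pi"
    by (rule AE_I'[of "{0, 2*pi}"]) (auto simp flip: negligible_iff_null_sets)
  ultimately have "AE t in lebesgue. t \<in> {0..2*pi} \<longrightarrow> Re (\<psi> t) > a \<longrightarrow>
           (\<forall>e>0. \<forall>\<^sub>F r in at_left 1. Re (\<phi> (of_real r * cis t)) > a - e)"
  proof eventually_elim
    case (elim t)
    show ?case
    proof (intro impI allI)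
      fix e :: real assume t: "t \<in> {0..2*pi}" "Re (\<psi> t) > a" and e: "e > 0"
      then have "t \<notin> N" by (simp add: N_def)
      then have "((\<lambda>d. measure lebesgue (N \<inter> ball t d) / d) \<longlongrightarrow> 0) (at_right 0)" using elim by blast
      from poisson_tail[OF N _ _ this] elim t
      have "((\<lambda>r. LINT \<theta>|arc. indicator N \<theta> * poisson (of_real r * cis t) (cis \<theta>)) \<longlongrightarrow> 0) (at_left 1)" by auto
      then have "((\<lambda>r. a - C / (2*pi) * (LINT \<theta>|arc. indicator N \<theta> * poisson (of_real r * cis t) (cis \<theta>)))
           \<longlongrightarrow> a - C / (2*pi) * 0) (at_left 1)" by (intro tendsto_intros)
      then have "\<forall>\<^sub>F r in at_left 1. a - C / (2*pi) * (LINT \<theta>|arc. indicator N \<theta> * poisson (of_real r * cis t) (cis \<theta>)) > a - e"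
        using e by (intro order_tendstoD) auto
      moreover have "\<forall>\<^sub>F r in at_left (1::real). 0 \<le> r \<and> r < 1"
        by (auto simp: eventually_at_left_field intro!: exI[of _ 0])
      ultimately show "\<forall>\<^sub>F r in at_left 1. Re (\<phi> (of_real r * cis t)) > a - e"
      proof eventually_elim
        case (elim r)
        then show ?case using low[OF of_real_cis_ball[of r t]] by auto
      qed
    qed
  qed
  then show ?thesis by (subst AE_restrict_space_iff) auto
qed

text \<open>
  Use the one-sided bound for all rational $a$ and for the rotations of $\phi$ by $1, -1, i, -i$. The
  limit found this way is the boundary function along the sequence of radii.
\<close>

theorem Fatou:
  fixes \<phi> :: "complex \<Rightarrow> complex"
  assumes hol: "\<phi> holomorphic_on ball 0 1" and bd: "\<And>z. z \<in> ball 0 1 \<Longrightarrow> norm (\<phi> z) \<le> B"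
  shows "AE t in arc. \<exists>l. ((\<lambda>r::real. \<phi> (of_real r * cis t)) \<longlongrightarrow> l) (at_left 1)"
proof (rule bounded_holomorphic_boundary_sequence[OF hol bd])
  fix r \<psi>
  assume r: "\<And>k. 0 \<le> r k" "\<And>k. r k < (1::real)" "r \<longlonglongrightarrow> 1"
    and \<psi>: "\<psi> \<in> borel_measurable arc" "AE \<theta> in arc. (\<lambda>k. \<phi> (of_real (r k) * cis \<theta>)) \<longlonglongrightarrow> \<psi> \<theta>"
      "AE \<theta> in arc. norm (\<psi> \<theta>) \<le> B"
  have half: "AE t in arc. \<forall>e>0. \<forall>\<^sub>F r in at_left 1. Re (c * \<phi> (of_real r * cis t)) > Re (c * \<psi> t) - e"
    if c: "norm c = 1" for c :: complex
  proof -
    have "AE t in arc. Re (c * \<psi> t) > of_rat a \<longrightarrow>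
           (\<forall>e>0. \<forall>\<^sub>F r in at_left 1. Re (c * \<phi> (of_real r * cis t)) > of_rat a - e)" for a :: rat
    proof (rule Fatou_one_sided[where B=B])
      show "(\<lambda>z. c * \<phi> z) holomorphic_on ball 0 1" using hol by (intro holomorphic_intros)
      show "norm (c * \<phi> z) \<le> B" if "z \<in> ball 0 1" for z using bd[OF that] c by (simp add: norm_mult)
      show "0 \<le> r k" "r k < 1" "r \<longlonglongrightarrow> 1" for k by (fact r)+
      show "(\<lambda>t. c * \<psi> t) \<in> borel_measurable arc" using \<psi>(1) by measurable
      show "AE \<theta> in arc. (\<lambda>k. c * \<phi> (of_real (r k) * cis \<theta>)) \<longlonglongrightarrow> c * \<psi> \<theta>"
        using \<psi>(2) by eventually_elim (intro tendsto_intros)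
      show "AE \<theta> in arc. norm (c * \<psi> \<theta>) \<le> B" using \<psi>(3) c by (simp add: norm_mult)
    qed
    then have "AE t in arc. \<forall>a::rat. Re (c * \<psi> t) > of_rat a \<longrightarrow>
           (\<forall>e>0. \<forall>\<^sub>F r in at_left 1. Re (c * \<phi> (of_real r * cis t)) > of_rat a - e)"
      by (simp add: AE_all_countable)
    then show ?thesis
    proof eventually_elim
      case (elim t)
      show ?case
      proof (intro allI impI)
        fix e :: real assume e: "e > 0"
        obtain a :: rat where a: "Re (c * \<psi> t) - e / 2 < of_rat a" "of_rat a < Re (c * \<psi> t)"
          using of_rat_dense[of "Re (c * \<psi> t) - e / 2" "Re (c * \<psi> t)"] e by auto
        have "\<forall>\<^sub>F r in at_left 1. Re (c * \<phi> (of_real r * cis t)) > of_rat a - e / 2"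
          using elim a e by auto
        then show "\<forall>\<^sub>F r in at_left 1. Re (c * \<phi> (of_real r * cis t)) > Re (c * \<psi> t) - e"
          by eventually_elim (use a in auto)
      qed
    qed
  qed
  have "AE t in arc. ((\<lambda>r. \<phi> (of_real r * cis t)) \<longlongrightarrow> \<psi> t) (at_left 1)"
    using half[of 1, simplified] half[of "-1", simplified] half[of "\<i>", simplified] half[of "-\<i>", simplified]
  proof eventually_elim
    case (elim t)
    have "((\<lambda>r. Re (\<phi> (of_real r * cis t))) \<longlongrightarrow> Re (\<psi> t)) (at_left 1)"
    proof (rule order_tendstoI)
      fix x assume "x < Re (\<psi> t)"
      then show "\<forall>\<^sub>F r in at_left 1. x < Re (\<phi> (of_real r * cis t))"
        using elim(1)[rule_format, of "Re (\<psi> t) - x"] by simp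
    next
      fix x assume "Re (\<psi> t) < x"
      then have "\<forall>\<^sub>F r in at_left 1. - Re (\<psi> t) - (x - Re (\<psi> t)) < - Re (\<phi> (of_real r * cis t))"
        using elim(2)[rule_format, of "x - Re (\<psi> t)"] by simp
      then show "\<forall>\<^sub>F r in at_left 1. Re (\<phi> (of_real r * cis t)) < x"
        by eventually_elim simp
    qed
    moreover have "((\<lambda>r. Im (\<phi> (of_real r * cis t))) \<longlongrightarrow> Im (\<psi> t)) (at_left 1)"
    proof (rule order_tendstoI)
      fix x assume "x < Im (\<psi> t)"
      then show "\<forall>\<^sub>F r in at_left 1. x < Im (\<phi> (of_real r * cis t))"
        using elim(4)[rule_format, of "Im (\<psi> t) - x"] by simp
    next
      fix x assume "Im (\<psi> t) < x"
      then have "\<forall>\<^sub>F r in at_left 1. - Im (\<psi> t) - (x - Im (\<psi> t)) < - Im (\<phi> (of_real r * cis t))"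
        using elim(3)[rule_format, of "x - Im (\<psi> t)"] by simp
      then show "\<forall>\<^sub>F r in at_left 1. Im (\<phi> (of_real r * cis t)) < x"
        by eventually_elim simp
    qed
    ultimately show ?case by (subst tendsto_complex_iff) simp
  qed
  then show ?thesis by eventually_elim blast
qed

lemma complete_arc: "complete_measure arc"
proof
  fix A B assume *: "B \<subseteq> A" "A \<in> null_sets arc"
  have "A \<in> null_sets lebesgue" using *(2) by (simp add: null_sets_restrict_space)
  then have "B \<in> null_sets lebesgue"
    using *(1) by (simp add: null_sets_completion_subset[of B A])
  then have "B \<in> sets lebesgue" by (rule null_setsD2)
  moreover have "A \<subseteq> {0..2*pi}" using sets.sets_into_space[OF null_setsD2[OF *(2)]] by simp
  ultimately show "B \<in> sets arc" using *(1) by (subst sets_restrict_space_iff) auto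
qed

lemma measurable_arc_AE_cong:
  fixes f g :: "real \<Rightarrow> complex"
  assumes f: "f \<in> borel_measurable arc" and ae: "AE \<theta> in arc. f \<theta> = g \<theta>"
  shows "g \<in> borel_measurable arc"
proof (rule measurableI)
  fix A :: "complex set" assume A: "A \<in> sets borel"
  show "g -` A \<inter> space arc \<in> sets arc"
  proof (rule complete_measure.in_sets_AE[OF complete_arc])
    show "f -` A \<inter> space arc \<in> sets arc" using f A by (rule measurable_sets)
    show "AE x in arc. (x \<in> f -` A \<inter> space arc) = (x \<in> g -` A \<inter> space arc)"
      using ae by eventually_elim auto
  qed auto
qed simp

section \<open>Scalar functions on the circle\<close>

text \<open>
  The four scalar spaces below consist of functions, not of classes, and only constrain the values on the circle.
\<close>

definition l2 :: "(complex \<Rightarrow> complex) set" where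
  "l2 = {f. (\<lambda>\<theta>. f (cis \<theta>)) \<in> borel_measurable arc \<and> integrable arc (\<lambda>\<theta>. (cmod (f (cis \<theta>)))\<^sup>2)}"

definition h2 :: "(complex \<Rightarrow> complex) set" where
  "h2 = {f \<in> l2. \<forall>j>0. (LINT \<theta>|arc. f (cis \<theta>) * cis \<theta> ^ j) = 0}"

definition linf :: "(complex \<Rightarrow> complex) set" where
  "linf = {x. (\<lambda>\<theta>. x (cis \<theta>)) \<in> borel_measurable arc \<and> (\<exists>B. AE \<theta> in arc. cmod (x (cis \<theta>)) \<le> B)}"

text \<open>
  Bounded multipliers of the Hardy space. For functions on the circle this is $H_\infty$, in the form
  in which boundedness and analyticity of matrix entries are used.
\<close>

definition hinf :: "(complex \<Rightarrow> complex) set" where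
  "hinf = {x \<in> linf. \<forall>g\<in>h2. (\<lambda>\<zeta>. x \<zeta> * g \<zeta>) \<in> h2}"

lemma l2_measurable: "f \<in> l2 \<Longrightarrow> (\<lambda>\<theta>. f (cis \<theta>)) \<in> borel_measurable arc"
  by (simp add: l2_def)

lemma l2_mult_integrable:
  assumes "f \<in> l2" "g \<in> l2" shows "integrable arc (\<lambda>\<theta>. f (cis \<theta>) * g (cis \<theta>))"
proof (rule Bochner_Integration.integrable_bound)
  show "integrable arc (\<lambda>\<theta>. (cmod (f (cis \<theta>)))\<^sup>2 + (cmod (g (cis \<theta>)))\<^sup>2)"
    using assms by (auto simp: l2_def)
  show "(\<lambda>\<theta>. f (cis \<theta>) * g (cis \<theta>)) \<in> borel_measurable arc"
    using assms by (auto simp: l2_def)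
  show "AE \<theta> in arc. norm (f (cis \<theta>) * g (cis \<theta>)) \<le> norm ((cmod (f (cis \<theta>)))\<^sup>2 + (cmod (g (cis \<theta>)))\<^sup>2)"
  proof (rule AE_I2)
    fix \<theta>
    let ?a = "cmod (f (cis \<theta>))" and ?b = "cmod (g (cis \<theta>))"
    have "2 * (?a * ?b) \<le> ?a\<^sup>2 + ?b\<^sup>2" using sum_squares_bound[of ?a ?b] by simp
    moreover have "0 \<le> ?a * ?b" by simp
    ultimately have "?a * ?b \<le> ?a\<^sup>2 + ?b\<^sup>2" by linarith
    then show "norm (f (cis \<theta>) * g (cis \<theta>)) \<le> norm (?a\<^sup>2 + ?b\<^sup>2)"
      by (simp add: norm_mult)
  qed
qed

lemma borel_measurable_cnj:
  "f \<in> borel_measurable M \<Longrightarrow> (\<lambda>x. cnj (f x)) \<in> borel_measurable M"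
  by (rule measurable_compose[of f M borel cnj borel])
     (auto intro!: borel_measurable_continuous_onI continuous_intros)

lemma l2_cnj: "f \<in> l2 \<Longrightarrow> (\<lambda>\<zeta>. cnj (f \<zeta>)) \<in> l2"
  by (auto simp: l2_def borel_measurable_cnj)

lemma linf_cnj: "x \<in> linf \<Longrightarrow> (\<lambda>\<zeta>. cnj (x \<zeta>)) \<in> linf"
  by (auto simp: linf_def borel_measurable_cnj)

lemma l2_add:
  assumes "f \<in> l2" "g \<in> l2" shows "(\<lambda>\<zeta>. f \<zeta> + g \<zeta>) \<in> l2"
proof -
  have "integrable arc (\<lambda>\<theta>. (cmod (f (cis \<theta>) + g (cis \<theta>)))\<^sup>2)"
  proof (rule Bochner_Integration.integrable_bound)
    show "integrable arc (\<lambda>\<theta>. 2 * (cmod (f (cis \<theta>)))\<^sup>2 + 2 * (cmod (g (cis \<theta>)))\<^sup>2)"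
      using assms by (auto simp: l2_def)
    show "(\<lambda>\<theta>. (cmod (f (cis \<theta>) + g (cis \<theta>)))\<^sup>2) \<in> borel_measurable arc"
      using assms by (auto simp: l2_def)
    show "AE \<theta> in arc. norm ((cmod (f (cis \<theta>) + g (cis \<theta>)))\<^sup>2) \<le> norm (2 * (cmod (f (cis \<theta>)))\<^sup>2 + 2 * (cmod (g (cis \<theta>)))\<^sup>2)"
    proof (rule AE_I2)
      fix \<theta>
      let ?a = "cmod (f (cis \<theta>))" and ?b = "cmod (g (cis \<theta>))"
      have "(cmod (f (cis \<theta>) + g (cis \<theta>)))\<^sup>2 \<le> (?a + ?b)\<^sup>2"
        by (intro power_mono norm_triangle_ineq) auto
      also have "\<dots> \<le> 2 * ?a\<^sup>2 + 2 * ?b\<^sup>2"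
        using sum_squares_bound[of ?a ?b] by (simp add: power2_sum)
      finally show "norm ((cmod (f (cis \<theta>) + g (cis \<theta>)))\<^sup>2) \<le> norm (2 * ?a\<^sup>2 + 2 * ?b\<^sup>2)" by simp
    qed
  qed
  then show ?thesis using assms by (auto simp: l2_def)
qed

lemma l2_linf_mult:
  assumes "x \<in> linf" "f \<in> l2" shows "(\<lambda>\<zeta>. x \<zeta> * f \<zeta>) \<in> l2"
proof -
  obtain B where B: "AE \<theta> in arc. cmod (x (cis \<theta>)) \<le> B" using assms by (auto simp: linf_def)
  have "integrable arc (\<lambda>\<theta>. (cmod (x (cis \<theta>) * f (cis \<theta>)))\<^sup>2)"
  proof (rule Bochner_Integration.integrable_bound)
    show "integrable arc (\<lambda>\<theta>. B\<^sup>2 * (cmod (f (cis \<theta>)))\<^sup>2)"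
      using assms by (auto simp: l2_def)
    show "(\<lambda>\<theta>. (cmod (x (cis \<theta>) * f (cis \<theta>)))\<^sup>2) \<in> borel_measurable arc"
      using assms by (auto simp: l2_def linf_def)
    show "AE \<theta> in arc. norm ((cmod (x (cis \<theta>) * f (cis \<theta>)))\<^sup>2) \<le> norm (B\<^sup>2 * (cmod (f (cis \<theta>)))\<^sup>2)"
      using B
    proof eventually_elim
      case (elim \<theta>)
      then have "(cmod (x (cis \<theta>)))\<^sup>2 \<le> B\<^sup>2" by (intro power_mono) auto
      then show ?case by (simp add: norm_mult power_mult_distrib mult_right_mono)
    qed
  qed
  then show ?thesis using assms by (auto simp: l2_def linf_def)
qed

lemma l2_AE_cong:
  assumes "f \<in> l2" "AE \<theta> in arc. f (cis \<theta>) = g (cis \<theta>)" shows "g \<in> l2"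
proof -
  have m: "(\<lambda>\<theta>. g (cis \<theta>)) \<in> borel_measurable arc"
    using measurable_arc_AE_cong[OF l2_measurable[OF assms(1)] assms(2)] .
  have "integrable arc (\<lambda>\<theta>. (cmod (g (cis \<theta>)))\<^sup>2)"
  proof (rule Bochner_Integration.integrable_bound)
    show "integrable arc (\<lambda>\<theta>. (cmod (f (cis \<theta>)))\<^sup>2)" using assms by (simp add: l2_def)
    show "AE \<theta> in arc. norm ((cmod (g (cis \<theta>)))\<^sup>2) \<le> norm ((cmod (f (cis \<theta>)))\<^sup>2)"
      using assms(2) by eventually_elim simp
  qed (use m in measurable)
  then show ?thesis using m by (simp add: l2_def)
qed

lemma linf_AE_cong:
  assumes "f \<in> linf" "AE \<theta> in arc. f (cis \<theta>) = g (cis \<theta>)" shows "g \<in> linf"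
proof -
  obtain B where B: "AE \<theta> in arc. cmod (f (cis \<theta>)) \<le> B" using assms by (auto simp: linf_def)
  have "AE \<theta> in arc. cmod (g (cis \<theta>)) \<le> B" using B assms(2) by eventually_elim simp
  moreover have "(\<lambda>\<theta>. g (cis \<theta>)) \<in> borel_measurable arc"
    by (rule measurable_arc_AE_cong[OF _ assms(2)]) (use assms in \<open>simp add: linf_def\<close>)
  ultimately show ?thesis by (auto simp: linf_def)
qed

lemma linf_continuous: "continuous_on (sphere 0 1) x \<Longrightarrow> x \<in> linf"
proof -
  assume c: "continuous_on (sphere 0 1) x"
  have "bounded (x ` sphere 0 1)"
    by (intro compact_imp_bounded compact_continuous_image c) simp
  then obtain B where "\<forall>y\<in>x ` sphere 0 1. norm y \<le> B" unfolding bounded_iff by blast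
  then have "AE \<theta> in arc. cmod (x (cis \<theta>)) \<le> B" by (intro AE_I2) auto
  then show "x \<in> linf" using measurable_arc_continuous[OF c] by (auto simp: linf_def)
qed

lemma linf_const [simp]: "(\<lambda>\<zeta>. c) \<in> linf" by (rule linf_continuous) auto
lemma linf_id [simp]: "(\<lambda>\<zeta>. \<zeta>) \<in> linf" by (rule linf_continuous) auto

lemma linf_add:
  assumes "x \<in> linf" "y \<in> linf" shows "(\<lambda>\<zeta>. x \<zeta> + y \<zeta>) \<in> linf"
proof -
  obtain A B where A: "AE \<theta> in arc. cmod (x (cis \<theta>)) \<le> A" and B: "AE \<theta> in arc. cmod (y (cis \<theta>)) \<le> B"
    using assms by (auto simp: linf_def)
  have "AE \<theta> in arc. cmod (x (cis \<theta>) + y (cis \<theta>)) \<le> A + B"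
    using A B by eventually_elim (rule norm_triangle_mono)
  then show ?thesis using assms by (auto simp: linf_def)
qed

lemma linf_mult:
  assumes "x \<in> linf" "y \<in> linf" shows "(\<lambda>\<zeta>. x \<zeta> * y \<zeta>) \<in> linf"
proof -
  obtain A B where A: "AE \<theta> in arc. cmod (x (cis \<theta>)) \<le> A" and B: "AE \<theta> in arc. cmod (y (cis \<theta>)) \<le> B"
    using assms by (auto simp: linf_def)
  have "AE \<theta> in arc. cmod (x (cis \<theta>) * y (cis \<theta>)) \<le> A * B"
    using A B by eventually_elim (auto simp: norm_mult intro!: mult_mono order_trans[OF norm_ge_zero])
  then show ?thesis using assms by (auto simp: linf_def)
qed

lemma linf_uminus: "x \<in> linf \<Longrightarrow> (\<lambda>\<zeta>. - x \<zeta>) \<in> linf"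
  using linf_mult[OF linf_const[of "-1"], of x] by simp

lemma linf_sum: "(\<And>i. i \<in> I \<Longrightarrow> x i \<in> linf) \<Longrightarrow> (\<lambda>\<zeta>. \<Sum>i\<in>I. x i \<zeta>) \<in> linf"
  by (induction I rule: infinite_finite_induct) (auto intro!: linf_add)

lemma linf_imp_l2: "x \<in> linf \<Longrightarrow> x \<in> l2"
proof -
  assume "x \<in> linf"
  moreover have "(\<lambda>\<zeta>. 1) \<in> l2" by (auto simp: l2_def intro!: integrable_arc_bounded[where B=1])
  ultimately show "x \<in> l2" using l2_linf_mult[of x "\<lambda>_. 1"] by simp
qed

lemma l2_scale: "f \<in> l2 \<Longrightarrow> (\<lambda>\<zeta>. c * f \<zeta>) \<in> l2"
  by (rule l2_linf_mult) auto

lemma l2_zero [simp]: "(\<lambda>\<zeta>. 0) \<in> l2" by (rule linf_imp_l2) simp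

lemma l2_sum: "(\<And>i. i \<in> I \<Longrightarrow> f i \<in> l2) \<Longrightarrow> (\<lambda>\<zeta>. \<Sum>i\<in>I. f i \<zeta>) \<in> l2"
  by (induction I rule: infinite_finite_induct) (auto intro!: l2_add)

lemma l2_diff: "f \<in> l2 \<Longrightarrow> g \<in> l2 \<Longrightarrow> (\<lambda>\<zeta>. f \<zeta> - g \<zeta>) \<in> l2"
  using l2_add[of f "\<lambda>\<zeta>. -1 * g \<zeta>"] l2_scale[of g "-1"] by simp

lemma l2_power_integrable: "f \<in> l2 \<Longrightarrow> integrable arc (\<lambda>\<theta>. f (cis \<theta>) * cis \<theta> ^ j)"
  by (rule l2_mult_integrable[of f "\<lambda>z. z ^ j"]) (auto intro!: linf_imp_l2 linf_continuous continuous_intros)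

lemma h2_l2: "f \<in> h2 \<Longrightarrow> f \<in> l2" by (simp add: h2_def)

lemma h2_add: "f \<in> h2 \<Longrightarrow> g \<in> h2 \<Longrightarrow> (\<lambda>\<zeta>. f \<zeta> + g \<zeta>) \<in> h2"
  by (auto simp: h2_def l2_add distrib_right l2_power_integrable)

lemma h2_scale: "f \<in> h2 \<Longrightarrow> (\<lambda>\<zeta>. c * f \<zeta>) \<in> h2"
  by (auto simp: h2_def l2_scale mult.assoc)

lemma h2_zero [simp]: "(\<lambda>\<zeta>. 0) \<in> h2" by (auto simp: h2_def)

lemma h2_sum: "(\<And>i. i \<in> I \<Longrightarrow> f i \<in> h2) \<Longrightarrow> (\<lambda>\<zeta>. \<Sum>i\<in>I. f i \<zeta>) \<in> h2"
  by (induction I rule: infinite_finite_induct) (auto intro!: h2_add)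

lemma h2_AE_cong:
  assumes "f \<in> h2" "AE \<theta> in arc. f (cis \<theta>) = g (cis \<theta>)" shows "g \<in> h2"
proof -
  have "(LINT \<theta>|arc. g (cis \<theta>) * cis \<theta> ^ j) = (LINT \<theta>|arc. f (cis \<theta>) * cis \<theta> ^ j)" for j
  proof (rule integral_cong_AE)
    show "AE \<theta> in arc. g (cis \<theta>) * cis \<theta> ^ j = f (cis \<theta>) * cis \<theta> ^ j"
      using assms(2) by eventually_elim simp
    show "(\<lambda>\<theta>. g (cis \<theta>) * cis \<theta> ^ j) \<in> borel_measurable arc"
      "(\<lambda>\<theta>. f (cis \<theta>) * cis \<theta> ^ j) \<in> borel_measurable arc"
      using l2_power_integrable[OF l2_AE_cong[OF h2_l2[OF assms(1)] assms(2)]] l2_power_integrable[OF h2_l2[OF assms(1)]]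
      by (auto dest: borel_measurable_integrable)
  qed
  then show ?thesis using assms l2_AE_cong by (auto simp: h2_def)
qed

lemma hinf_linf: "x \<in> hinf \<Longrightarrow> x \<in> linf" by (simp add: hinf_def)
lemma hinf_h2: "x \<in> hinf \<Longrightarrow> g \<in> h2 \<Longrightarrow> (\<lambda>\<zeta>. x \<zeta> * g \<zeta>) \<in> h2" by (simp add: hinf_def)

lemma hinf_add: "x \<in> hinf \<Longrightarrow> y \<in> hinf \<Longrightarrow> (\<lambda>\<zeta>. x \<zeta> + y \<zeta>) \<in> hinf"
  by (auto simp: hinf_def linf_add distrib_right h2_add)

lemma hinf_mult: "x \<in> hinf \<Longrightarrow> y \<in> hinf \<Longrightarrow> (\<lambda>\<zeta>. x \<zeta> * y \<zeta>) \<in> hinf"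
  by (auto simp: hinf_def linf_mult mult.assoc)

lemma hinf_const [simp]: "(\<lambda>\<zeta>. c) \<in> hinf"
  by (auto simp: hinf_def h2_scale)

lemma hinf_sum: "(\<And>i. i \<in> I \<Longrightarrow> x i \<in> hinf) \<Longrightarrow> (\<lambda>\<zeta>. \<Sum>i\<in>I. x i \<zeta>) \<in> hinf"
  by (induction I rule: infinite_finite_induct) (auto intro!: hinf_add)

text \<open>
  Multiplying by a dilate of $\phi$ keeps the negative Fourier coefficients zero, since the dilate is a uniformly
  convergent power series on the circle; the limit is taken by dominated convergence.
\<close>

lemma hinf_boundary:
  assumes hol: "\<phi> holomorphic_on ball 0 1" and bd: "\<And>z. z \<in> ball 0 1 \<Longrightarrow> norm (\<phi> z) \<le> B"
    and lim: "AE \<theta> in arc. ((\<lambda>r::real. \<phi> (of_real r * cis \<theta>)) \<longlongrightarrow> x (cis \<theta>)) (at_left 1)"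
  shows "x \<in> hinf"
proof -
  define r where "r k = 1 - 1 / real (Suc (Suc k))" for k
  have r: "0 \<le> r k" "r k < 1" for k by (auto simp: r_def field_simps)
  have rl: "filterlim r (at_left 1) sequentially"
  proof (rule tendsto_imp_filterlim_at_left)
    show "r \<longlonglongrightarrow> 1"
      unfolding r_def using tendsto_diff[OF tendsto_const LIMSEQ_Suc[OF LIMSEQ_inverse_real_of_nat], of 1]
      by (simp add: inverse_eq_divide)
    show "\<forall>\<^sub>F k in sequentially. r k < 1" using r by simp
  qed
  define F where "F k \<theta> = \<phi> (of_real (r k) * cis \<theta>)" for k \<theta>
  have Fm [measurable]: "F k \<in> borel_measurable arc" for k
    unfolding F_def using holomorphic_on_imp_continuous_on[OF hol] r by (rule radial_measurable)
  have Fb: "norm (F k \<theta>) \<le> B" for k \<theta> unfolding F_def by (intro bd of_real_cis_ball r)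
  have Fl: "AE \<theta> in arc. (\<lambda>k. F k \<theta>) \<longlonglongrightarrow> x (cis \<theta>)"
    using lim by eventually_elim (auto simp: F_def intro: filterlim_compose[OF _ rl])
  have xm: "(\<lambda>\<theta>. x (cis \<theta>)) \<in> borel_measurable arc"
  proof (rule measurable_arc_AE_cong)
    show "(\<lambda>\<theta>. lim (\<lambda>k. F k \<theta>)) \<in> borel_measurable arc" by measurable
    show "AE \<theta> in arc. lim (\<lambda>k. F k \<theta>) = x (cis \<theta>)"
      using Fl by eventually_elim (rule limI)
  qed
  have xb: "AE \<theta> in arc. norm (x (cis \<theta>)) \<le> B"
    using Fl
  proof eventually_elim
    case (elim \<theta>)
    show ?case by (rule LIMSEQ_le_const2[OF tendsto_norm[OF elim]]) (use Fb in blast)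
  qed
  have xi: "x \<in> linf" using xm xb by (auto simp: linf_def)
  have "(\<lambda>\<zeta>. x \<zeta> * g \<zeta>) \<in> h2" if g: "g \<in> h2" for g
  proof -
    have gl: "g \<in> l2" using g by (rule h2_l2)
    have gm [measurable]: "(\<lambda>\<theta>. g (cis \<theta>)) \<in> borel_measurable arc" using gl by (rule l2_measurable)
    have "(LINT \<theta>|arc. x (cis \<theta>) * g (cis \<theta>) * cis \<theta> ^ j) = 0" if j: "j > 0" for j
    proof -
      have "(\<lambda>k. LINT \<theta>|arc. F k \<theta> * (g (cis \<theta>) * cis \<theta> ^ j)) \<longlonglongrightarrow> (LINT \<theta>|arc. x (cis \<theta>) * (g (cis \<theta>) * cis \<theta> ^ j))"
      proof (rule integral_dominated_convergence[where w="\<lambda>\<theta>. B * norm (g (cis \<theta>) * cis \<theta> ^ j)"])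
        show "integrable arc (\<lambda>\<theta>. B * norm (g (cis \<theta>) * cis \<theta> ^ j))"
          using l2_power_integrable[OF gl] by (intro integrable_mult_right integrable_norm)
        show "AE \<theta> in arc. (\<lambda>k. F k \<theta> * (g (cis \<theta>) * cis \<theta> ^ j)) \<longlonglongrightarrow> x (cis \<theta>) * (g (cis \<theta>) * cis \<theta> ^ j)"
          using Fl by eventually_elim (intro tendsto_intros)
        show "AE \<theta> in arc. norm (F k \<theta> * (g (cis \<theta>) * cis \<theta> ^ j)) \<le> B * norm (g (cis \<theta>) * cis \<theta> ^ j)" for k
          unfolding norm_mult[of "F k _"] using Fb by (intro AE_I2 mult_right_mono) auto
      qed (use xm in measurable)
      moreover have "(LINT \<theta>|arc. F k \<theta> * (g (cis \<theta>) * cis \<theta> ^ j)) = 0" for k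
      proof (rule bounded_holomorphic_coeffs[OF hol bd])
        fix a assume a: "\<And>z. z \<in> ball 0 1 \<Longrightarrow> (\<lambda>n. a n * z ^ n) sums \<phi> z"
          "\<And>r. 0 \<le> r \<Longrightarrow> r < 1 \<Longrightarrow> summable (\<lambda>n. norm (a n) * r ^ n)"
        have s: "summable (\<lambda>n. norm (a n * of_real (r k) ^ n))"
          using a(2)[OF r] r by (simp add: norm_mult norm_power)
        from power_series_integral[OF l2_power_integrable[OF gl] this, of j]
        have "(\<lambda>n. a n * of_real (r k) ^ n * (LINT \<theta>|arc. cis \<theta> ^ n * (g (cis \<theta>) * cis \<theta> ^ j)))
           sums (LINT \<theta>|arc. (\<Sum>n. a n * of_real (r k) ^ n * cis \<theta> ^ n) * (g (cis \<theta>) * cis \<theta> ^ j))" .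
        moreover have "(LINT \<theta>|arc. cis \<theta> ^ n * (g (cis \<theta>) * cis \<theta> ^ j)) = 0" for n
        proof -
          have "(LINT \<theta>|arc. g (cis \<theta>) * cis \<theta> ^ (n + j)) = 0" using g j by (simp add: h2_def)
          then show ?thesis by (simp add: power_add mult_ac)
        qed
        moreover have "(\<Sum>n. a n * of_real (r k) ^ n * cis \<theta> ^ n) = F k \<theta>" for \<theta>
          using a(1)[OF of_real_cis_ball[OF r]] by (auto simp: sums_iff F_def power_mult_distrib mult_ac)
        ultimately have "(\<lambda>n. 0) sums (LINT \<theta>|arc. F k \<theta> * (g (cis \<theta>) * cis \<theta> ^ j))" by simp
        from sums_unique2[OF this sums_zero] show ?thesis .
      qed
      ultimately show ?thesis by (simp add: LIMSEQ_const_iff mult.assoc)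
    qed
    then show ?thesis using l2_linf_mult[OF xi gl] by (simp add: h2_def)
  qed
  then show ?thesis using xi by (simp add: hinf_def)
qed

text \<open>
  The difference quotient at $\alpha$ is again bounded and holomorphic in the disc.
\<close>

lemma hinf_quotient:
  assumes hol: "\<phi> holomorphic_on ball 0 1" and bd: "\<And>z. z \<in> ball 0 1 \<Longrightarrow> norm (\<phi> z) \<le> B"
    and lim: "AE \<theta> in arc. ((\<lambda>r::real. \<phi> (of_real r * cis \<theta>)) \<longlongrightarrow> x (cis \<theta>)) (at_left 1)"
    and \<alpha>: "\<alpha> \<in> ball 0 1"
  shows "(\<lambda>\<zeta>. (x \<zeta> - \<phi> \<alpha>) / (\<zeta> - \<alpha>)) \<in> hinf"
proof -
  define \<psi> where "\<psi> w = (if w = \<alpha> then deriv \<phi> \<alpha> else (\<phi> w - \<phi> \<alpha>) / (w - \<alpha>))" for w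
  have \<psi>h: "\<psi> holomorphic_on ball 0 1"
    using pole_lemma_open[OF hol, of \<alpha>] by (simp add: \<psi>_def[abs_def])
  define \<rho> where "\<rho> = (1 + norm \<alpha>) / 2"
  have \<rho>: "norm \<alpha> < \<rho>" "\<rho> < 1" using \<alpha> by (auto simp: \<rho>_def)
  have "bounded (\<psi> ` cball 0 \<rho>)"
    using \<rho> by (intro compact_imp_bounded compact_continuous_image
        continuous_on_subset[OF holomorphic_on_imp_continuous_on[OF \<psi>h]]) auto
  then obtain B1 where B1: "\<And>z. z \<in> cball 0 \<rho> \<Longrightarrow> norm (\<psi> z) \<le> B1"
    unfolding bounded_iff by blast
  have B2: "norm (\<psi> z) \<le> 2 * B / (\<rho> - norm \<alpha>)" if z: "z \<in> ball 0 1" "z \<notin> cball 0 \<rho>" for z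
  proof -
    have zn: "z \<noteq> \<alpha>" "norm z > \<rho>" using z \<rho> by auto
    have "\<rho> - norm \<alpha> \<le> norm (z - \<alpha>)" using norm_triangle_ineq2[of z \<alpha>] zn by linarith
    moreover have "norm (\<phi> z - \<phi> \<alpha>) \<le> 2 * B"
      using norm_triangle_ineq4[of "\<phi> z" "\<phi> \<alpha>"] bd[OF z(1)] bd[OF \<alpha>] by linarith
    moreover have "0 \<le> B" using order_trans[OF norm_ge_zero bd[OF \<alpha>]] .
    ultimately show ?thesis using zn \<rho> by (auto simp: \<psi>_def norm_divide intro!: frac_le)
  qed
  show ?thesis
  proof (rule hinf_boundary[OF \<psi>h])
    show "norm (\<psi> z) \<le> max B1 (2 * B / (\<rho> - norm \<alpha>))" if "z \<in> ball 0 1" for z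
      using B1[of z] B2[OF that] by (cases "z \<in> cball 0 \<rho>") auto
    show "AE \<theta> in arc. ((\<lambda>r::real. \<psi> (of_real r * cis \<theta>)) \<longlongrightarrow> (x (cis \<theta>) - \<phi> \<alpha>) / (cis \<theta> - \<alpha>)) (at_left 1)"
      using lim
    proof eventually_elim
      case (elim \<theta>)
      have "cis \<theta> \<noteq> \<alpha>" using \<alpha> by auto
      have "((\<lambda>r::real. (\<phi> (of_real r * cis \<theta>) - \<phi> \<alpha>) / (of_real r * cis \<theta> - \<alpha>))
         \<longlongrightarrow> (x (cis \<theta>) - \<phi> \<alpha>) / (of_real 1 * cis \<theta> - \<alpha>)) (at_left 1)"
        by (intro tendsto_intros elim) (use \<open>cis \<theta> \<noteq> \<alpha>\<close> in simp)
      moreover have "\<forall>\<^sub>F r::real in at_left 1. \<psi> (of_real r * cis \<theta>) = (\<phi> (of_real r * cis \<theta>) - \<phi> \<alpha>) / (of_real r * cis \<theta> - \<alpha>)"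
        unfolding eventually_at_left_field
      proof (intro exI conjI allI impI)
        show "norm \<alpha> < 1" using \<alpha> by simp
        fix r :: real assume "norm \<alpha> < r" "r < 1"
        then have "norm (of_real r * cis \<theta>) \<noteq> norm \<alpha>" using norm_ge_zero[of \<alpha>] by (auto simp: norm_mult)
        then show "\<psi> (of_real r * cis \<theta>) = (\<phi> (of_real r * cis \<theta>) - \<phi> \<alpha>) / (of_real r * cis \<theta> - \<alpha>)"
          by (auto simp: \<psi>_def)
      qed
      ultimately show ?case by (simp add: tendsto_cong)
    qed
  qed
qed

lemma hinf_holomorphic:
  assumes c: "continuous_on (cball 0 1) \<phi>" and hol: "\<phi> holomorphic_on ball 0 1"
  shows "\<phi> \<in> hinf"
proof -
  have "bounded (\<phi> ` cball 0 1)"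
    by (intro compact_imp_bounded compact_continuous_image c) simp
  then obtain B where B: "\<And>z. z \<in> cball 0 1 \<Longrightarrow> norm (\<phi> z) \<le> B"
    unfolding bounded_iff by blast
  show ?thesis
  proof (rule hinf_boundary[OF hol])
    show "norm (\<phi> z) \<le> B" if "z \<in> ball 0 1" for z using B that by auto
    show "AE \<theta> in arc. ((\<lambda>r::real. \<phi> (of_real r * cis \<theta>)) \<longlongrightarrow> \<phi> (cis \<theta>)) (at_left 1)"
    proof (rule AE_I2)
      fix \<theta>
      have "((\<lambda>r::real. of_real r * cis \<theta>) \<longlongrightarrow> of_real 1 * cis \<theta>) (at_left 1)" by (intro tendsto_intros)
      moreover have "\<forall>\<^sub>F r::real in at_left 1. of_real r * cis \<theta> \<in> cball 0 1"
        by (auto simp: eventually_at_left_field norm_mult intro!: exI[of _ 0])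
      ultimately show "((\<lambda>r::real. \<phi> (of_real r * cis \<theta>)) \<longlongrightarrow> \<phi> (cis \<theta>)) (at_left 1)"
        using continuous_on_tendsto_compose[OF c, of "\<lambda>r. of_real r * cis \<theta>" "cis \<theta>"] by simp
    qed
  qed
qed

section \<open>Evaluation of Hardy space functions at a point of the disc\<close>

text \<open>
  The Cauchy integral: for $y$ in the Hardy space this is the value at $\alpha$ of its holomorphic
  extension to the disc.
\<close>

definition disc_value :: "complex \<Rightarrow> (complex \<Rightarrow> complex) \<Rightarrow> complex" where
  "disc_value \<alpha> y = cmean (\<lambda>\<zeta>. y \<zeta> * (\<zeta> / (\<zeta> - \<alpha>)))"

lemma inverse_minus_linf: "\<alpha> \<in> ball 0 1 \<Longrightarrow> (\<lambda>\<zeta>. 1 / (\<zeta> - \<alpha>)) \<in> linf"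
  by (rule linf_continuous) (auto intro!: continuous_intros)

lemma id_inverse_minus_linf: "\<alpha> \<in> ball 0 1 \<Longrightarrow> (\<lambda>\<zeta>. \<zeta> / (\<zeta> - \<alpha>)) \<in> linf"
  by (rule linf_continuous) (auto intro!: continuous_intros)

lemma one_minus_cnj_mult_nz:
  assumes "\<alpha> \<in> ball 0 1" "norm \<zeta> \<le> 1" shows "1 - cnj \<alpha> * \<zeta> \<noteq> 0"
proof
  assume "1 - cnj \<alpha> * \<zeta> = 0"
  then have "norm (cnj \<alpha> * \<zeta>) = 1" by (metis eq_iff_diff_eq_0 norm_one)
  moreover have "norm (cnj \<alpha> * \<zeta>) \<le> norm \<alpha>" using assms(2) by (simp add: norm_mult mult_left_le)
  ultimately show False using assms(1) by simp
qed

lemma sphere_mult_cnj: "\<zeta> \<in> sphere 0 1 \<Longrightarrow> \<zeta> * cnj \<zeta> = 1"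
  by (simp add: complex_norm_square[symmetric])

lemma cnj_sphere: "\<zeta> \<in> sphere 0 1 \<Longrightarrow> cnj \<zeta> = 1 / \<zeta>"
  using sphere_mult_cnj[of \<zeta>] by (cases "\<zeta> = 0") (simp_all add: field_simps)

lemma cnj_szego:
  assumes "\<alpha> \<in> ball 0 1" "\<zeta> \<in> sphere 0 1"
  shows "cnj (1 / (1 - cnj \<alpha> * \<zeta>)) = \<zeta> / (\<zeta> - \<alpha>)"
proof -
  have "\<zeta> \<noteq> 0" "\<zeta> \<noteq> \<alpha>" using assms by auto
  then have "cnj (1 - cnj \<alpha> * \<zeta>) = (\<zeta> - \<alpha>) / \<zeta>" using cnj_sphere[OF assms(2)] by (simp add: field_simps)
  then show ?thesis by (simp only: complex_cnj_divide) simp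
qed

lemma cmean_cong: "(\<And>\<zeta>. \<zeta> \<in> sphere 0 1 \<Longrightarrow> f \<zeta> = g \<zeta>) \<Longrightarrow> cmean f = cmean g"
  unfolding cmean_def by (metis cis_range)

lemma cmean_cnj: "cmean (\<lambda>\<zeta>. cnj (f \<zeta>)) = cnj (cmean f)"
  by (simp add: cmean_def)

lemma cmean_scale: "cmean (\<lambda>\<zeta>. c * f \<zeta>) = c * cmean f"
  by (simp add: cmean_def)

lemma disc_value_add:
  assumes "f \<in> l2" "g \<in> l2" "\<alpha> \<in> ball 0 1"
  shows "disc_value \<alpha> (\<lambda>\<zeta>. f \<zeta> + g \<zeta>) = disc_value \<alpha> f + disc_value \<alpha> g"
  using l2_mult_integrable[OF assms(1) linf_imp_l2[OF id_inverse_minus_linf[OF assms(3)]]]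
    l2_mult_integrable[OF assms(2) linf_imp_l2[OF id_inverse_minus_linf[OF assms(3)]]]
  by (simp add: disc_value_def cmean_def distrib_right add_divide_distrib del: times_divide_eq_right)

lemma disc_value_scale: "disc_value \<alpha> (\<lambda>\<zeta>. c * f \<zeta>) = c * disc_value \<alpha> f"
  by (simp add: disc_value_def mult.assoc cmean_scale del: times_divide_eq_right)

lemma disc_value_const:
  assumes \<alpha>: "\<alpha> \<in> ball 0 1" shows "disc_value \<alpha> (\<lambda>\<zeta>. c) = c"
proof -
  have "cmean (\<lambda>\<zeta>. 1 / (1 - cnj \<alpha> * \<zeta>)) = 1"
    using one_minus_cnj_mult_nz[OF \<alpha>] by (subst cmean_holomorphic) (auto intro!: continuous_intros holomorphic_intros)
  then have "cmean (\<lambda>\<zeta>. cnj (1 / (1 - cnj \<alpha> * \<zeta>))) = 1" unfolding cmean_cnj by simp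
  moreover have "cmean (\<lambda>\<zeta>. cnj (1 / (1 - cnj \<alpha> * \<zeta>))) = cmean (\<lambda>\<zeta>. \<zeta> / (\<zeta> - \<alpha>))"
    by (rule cmean_cong) (rule cnj_szego[OF \<alpha>])
  ultimately show ?thesis unfolding disc_value_def cmean_scale by simp
qed

lemma disc_value_diff_const:
  assumes "f \<in> l2" "\<alpha> \<in> ball 0 1"
  shows "disc_value \<alpha> (\<lambda>\<zeta>. f \<zeta> - c) = disc_value \<alpha> f - c"
  using disc_value_add[OF assms(1) linf_imp_l2[OF linf_const[of "-c"]] assms(2)] disc_value_const[OF assms(2), of "-c"] by simp

lemma disc_value_szego:
  assumes \<alpha>: "\<alpha> \<in> ball 0 1"
  shows "disc_value \<alpha> (\<lambda>\<zeta>. 1 / (1 - cnj \<alpha> * \<zeta>)) = 1 / of_real (1 - (norm \<alpha>)\<^sup>2)"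
proof -
  have n1: "1 - (norm \<alpha>)\<^sup>2 \<noteq> 0" 
  proof -
    have "(norm \<alpha>)\<^sup>2 < 1" using \<alpha> by (simp add: abs_square_less_1)
    then show ?thesis by linarith
  qed
  have "disc_value \<alpha> (\<lambda>\<zeta>. 1 / (1 - cnj \<alpha> * \<zeta>)) = cmean (\<lambda>\<zeta>. 1 / of_real (1 - (norm \<alpha>)\<^sup>2) * (1 * of_real (poisson \<alpha> \<zeta>)))"
    unfolding disc_value_def
  proof (rule cmean_cong)
    fix \<zeta> :: complex assume \<zeta>: "\<zeta> \<in> sphere 0 1"
    have nz: "\<zeta> \<noteq> 0" using \<zeta> by auto
    have c: "cnj (\<zeta> - \<alpha>) = (1 - cnj \<alpha> * \<zeta>) / \<zeta>" using cnj_sphere[OF \<zeta>] nz by (simp add: field_simps)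
    have "of_real ((norm (\<zeta> - \<alpha>))\<^sup>2) = (\<zeta> - \<alpha>) * ((1 - cnj \<alpha> * \<zeta>) / \<zeta>)"
      unfolding complex_norm_square c ..
    then have "1 / of_real (1 - (norm \<alpha>)\<^sup>2) * (1 * of_real (poisson \<alpha> \<zeta>)) = 1 / ((\<zeta> - \<alpha>) * ((1 - cnj \<alpha> * \<zeta>) / \<zeta>))"
      unfolding poisson_def of_real_divide using n1 by (simp flip: of_real_power of_real_diff)
    then show "1 / (1 - cnj \<alpha> * \<zeta>) * (\<zeta> / (\<zeta> - \<alpha>)) = 1 / of_real (1 - (norm \<alpha>)\<^sup>2) * (1 * of_real (poisson \<alpha> \<zeta>))"
      by (simp add: mult.commute)
  qed
  also have "\<dots> = 1 / of_real (1 - (norm \<alpha>)\<^sup>2)"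
    unfolding cmean_scale using poisson_formula_closed[of "\<lambda>_. 1" 2 \<alpha>] \<alpha> by simp
  finally show ?thesis .
qed

text \<open>
  The negative Fourier coefficients of $y/(\zeta - \alpha)$ form a geometric sequence with ratio $\alpha$, because those of
  $y$ vanish; its first term is the value of $y$ at $\alpha$.
\<close>

lemma h2_div_root:
  assumes y: "y \<in> h2" and \<alpha>: "\<alpha> \<in> ball 0 1" and ev: "disc_value \<alpha> y = 0"
  shows "(\<lambda>\<zeta>. y \<zeta> / (\<zeta> - \<alpha>)) \<in> h2"
proof -
  have ql: "(\<lambda>\<zeta>. y \<zeta> / (\<zeta> - \<alpha>)) \<in> l2"
    using l2_linf_mult[OF inverse_minus_linf[OF \<alpha>] h2_l2[OF y]] by simp
  have "(LINT \<theta>|arc. y (cis \<theta>) / (cis \<theta> - \<alpha>) * cis \<theta> ^ Suc j) = 0" for j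
  proof (induction j)
    case 0
    then show ?case using ev by (simp add: disc_value_def cmean_def)
  next
    case (Suc j)
    have eq: "y (cis \<theta>) / (cis \<theta> - \<alpha>) * cis \<theta> ^ Suc (Suc j)
        = y (cis \<theta>) * cis \<theta> ^ Suc j + \<alpha> * (y (cis \<theta>) / (cis \<theta> - \<alpha>) * cis \<theta> ^ Suc j)" for \<theta>
    proof -
      have "cis \<theta> - \<alpha> \<noteq> 0" using \<alpha> by auto
      then show ?thesis by (simp add: divide_simps) (simp add: algebra_simps)
    qed
    have "(LINT \<theta>|arc. y (cis \<theta>) / (cis \<theta> - \<alpha>) * cis \<theta> ^ Suc (Suc j))
       = (LINT \<theta>|arc. y (cis \<theta>) * cis \<theta> ^ Suc j) + \<alpha> * (LINT \<theta>|arc. y (cis \<theta>) / (cis \<theta> - \<alpha>) * cis \<theta> ^ Suc j)"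
      unfolding eq
      by (subst Bochner_Integration.integral_add[OF l2_power_integrable[OF h2_l2[OF y]] integrable_mult_right[OF l2_power_integrable[OF ql]]])
         (simp only: integral_mult_right_zero)
    also have "(LINT \<theta>|arc. y (cis \<theta>) * cis \<theta> ^ Suc j) = 0"
      using y unfolding h2_def by blast
    also note Suc
    finally show ?case by simp
  qed
  then show ?thesis using ql by (auto simp: h2_def gr0_conv_Suc)
qed

section \<open>Matrices and vectors\<close>

lemma mat_adjoint_carrier [simp]: "A \<in> carrier_mat n m \<Longrightarrow> mat_adjoint A \<in> carrier_mat m n"
  by (auto simp: mat_adjoint_def mat_of_rows_def)

lemma mat_adjoint_dims [simp]: "dim_row (mat_adjoint A) = dim_col A" "dim_col (mat_adjoint A) = dim_row A"
  by (auto simp: mat_adjoint_def mat_of_rows_def)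

lemma mat_adjoint_index [simp]:
  "i < dim_col A \<Longrightarrow> j < dim_row A \<Longrightarrow> mat_adjoint A $$ (i, j) = cnj (A $$ (j, i))" for A :: "complex mat"
  by (simp add: mat_adjoint_def mat_of_rows_index)

lemma mat_adjoint_adjoint [simp]: "mat_adjoint (mat_adjoint A) = A" for A :: "complex mat"
  by (rule eq_matI) auto

lemma mult_mat_vec_index:
  assumes "A \<in> carrier_mat n m" "x \<in> carrier_vec m" "i < n"
  shows "(A *\<^sub>v x) $ i = (\<Sum>j<m. A $$ (i, j) * x $ j)"
  using assms by (auto simp: scalar_prod_def atLeast0LessThan intro!: sum.cong)

lemma mult_mat_index:
  assumes "A \<in> carrier_mat n m" "B \<in> carrier_mat m l" "i < n" "j < l"
  shows "(A * B) $$ (i, j) = (\<Sum>k<m. A $$ (i, k) * B $$ (k, j))"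
  using assms by (auto simp: scalar_prod_def atLeast0LessThan intro!: sum.cong)

lemma cscalar_prod_sum:
  fixes x :: "complex vec"
  assumes "y \<in> carrier_vec n" shows "x \<bullet>c y = (\<Sum>i<n. x $ i * cnj (y $ i))"
  using assms by (auto simp: scalar_prod_def atLeast0LessThan intro!: sum.cong)

lemma mat_adjoint_mult:
  assumes "A \<in> carrier_mat n m" "B \<in> carrier_mat m l"
  shows "mat_adjoint (A * B) = mat_adjoint B * mat_adjoint (A :: complex mat)"
proof (rule eq_matI)
  fix i j assume "i < dim_row (mat_adjoint B * mat_adjoint A)" "j < dim_col (mat_adjoint B * mat_adjoint A)"
  then have ij: "i < l" "j < n" using assms by auto
  have "mat_adjoint (A * B) $$ (i, j) = cnj (\<Sum>k<m. A $$ (j, k) * B $$ (k, i))"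
  proof -
    have "mat_adjoint (A * B) $$ (i, j) = cnj ((A * B) $$ (j, i))"
      using ij assms by (intro mat_adjoint_index) auto
    then show ?thesis using mult_mat_index[OF assms ij(2,1)] by simp
  qed
  also have "\<dots> = (\<Sum>k<m. mat_adjoint B $$ (i, k) * mat_adjoint A $$ (k, j))"
    using ij assms by (simp add: mult.commute)
  also have "\<dots> = (mat_adjoint B * mat_adjoint A) $$ (i, j)"
    using ij assms by (subst mult_mat_index[of _ l m _ n]) auto
  finally show "mat_adjoint (A * B) $$ (i, j) = (mat_adjoint B * mat_adjoint A) $$ (i, j)" .
qed (use assms in auto)

lemma cscalar_prod_adjoint:
  fixes A :: "complex mat"
  assumes "A \<in> carrier_mat n m" "x \<in> carrier_vec m" "y \<in> carrier_vec n"
  shows "(A *\<^sub>v x) \<bullet>c y = x \<bullet>c (mat_adjoint A *\<^sub>v y)"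
proof -
  have "(A *\<^sub>v x) \<bullet>c y = (\<Sum>i<n. \<Sum>j<m. A $$ (i, j) * x $ j * cnj (y $ i))"
    using assms by (simp add: cscalar_prod_sum mult_mat_vec_index sum_distrib_right del: index_mult_mat_vec)
  also have "\<dots> = (\<Sum>j<m. \<Sum>i<n. A $$ (i, j) * x $ j * cnj (y $ i))" by (rule sum.swap)
  also have "\<dots> = (\<Sum>j<m. x $ j * cnj ((mat_adjoint A *\<^sub>v y) $ j))"
    using assms by (intro sum.cong refl)
      (simp add: mult_mat_vec_index[of "mat_adjoint A" m n] sum_distrib_left mult_ac del: index_mult_mat_vec)
  also have "\<dots> = x \<bullet>c (mat_adjoint A *\<^sub>v y)"
    by (rule cscalar_prod_sum[symmetric]) (use assms in \<open>auto intro!: mult_mat_vec_carrier[of _ m n]\<close>)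
  finally show ?thesis .
qed

lemma cscalar_prod_cnj:
  fixes x y :: "complex vec"
  assumes "x \<in> carrier_vec n" "y \<in> carrier_vec n" shows "y \<bullet>c x = cnj (x \<bullet>c y)"
  using assms by (simp add: cscalar_prod_sum[of _ n] mult.commute)

section \<open>Vector valued functions on the circle\<close>

lemma L2_iff: "f \<in> L2 k \<longleftrightarrow> (\<forall>\<zeta>\<in>sphere 0 1. f \<zeta> \<in> carrier_vec k) \<and> (\<forall>i<k. (\<lambda>\<zeta>. f \<zeta> $ i) \<in> l2)"
  by (simp add: L2_def l2_def)

lemma H2_iff: "f \<in> H2 k \<longleftrightarrow> (\<forall>\<zeta>\<in>sphere 0 1. f \<zeta> \<in> carrier_vec k) \<and> (\<forall>i<k. (\<lambda>\<zeta>. f \<zeta> $ i) \<in> h2)"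
  by (auto simp: H2_def L2_iff h2_def)

lemma L2_carrier: "f \<in> L2 k \<Longrightarrow> \<zeta> \<in> sphere 0 1 \<Longrightarrow> f \<zeta> \<in> carrier_vec k"
  by (auto simp: L2_iff)
lemma L2_comp: "f \<in> L2 k \<Longrightarrow> i < k \<Longrightarrow> (\<lambda>\<zeta>. f \<zeta> $ i) \<in> l2"
  by (auto simp: L2_iff)
lemma H2_comp: "f \<in> H2 k \<Longrightarrow> i < k \<Longrightarrow> (\<lambda>\<zeta>. f \<zeta> $ i) \<in> h2"
  by (auto simp: H2_iff)
lemma H2_L2: "f \<in> H2 k \<Longrightarrow> f \<in> L2 k" by (simp add: H2_def)
lemma H2_perp_L2: "f \<in> H2_perp k \<Longrightarrow> f \<in> L2 k" by (simp add: H2_perp_def ominus_def)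

lemma l2_cong: "f \<in> l2 \<Longrightarrow> (\<And>\<zeta>. \<zeta> \<in> sphere 0 1 \<Longrightarrow> f \<zeta> = g \<zeta>) \<Longrightarrow> g \<in> l2"
  by (erule l2_AE_cong) (auto intro: AE_I2)
lemma h2_cong: "f \<in> h2 \<Longrightarrow> (\<And>\<zeta>. \<zeta> \<in> sphere 0 1 \<Longrightarrow> f \<zeta> = g \<zeta>) \<Longrightarrow> g \<in> h2"
  by (erule h2_AE_cong) (auto intro: AE_I2)
lemma linf_cong: "f \<in> linf \<Longrightarrow> (\<And>\<zeta>. \<zeta> \<in> sphere 0 1 \<Longrightarrow> f \<zeta> = g \<zeta>) \<Longrightarrow> g \<in> linf"
  by (erule linf_AE_cong) (auto intro: AE_I2)

lemma hinf_AE_cong: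
  assumes "x \<in> hinf" "AE \<theta> in arc. x (cis \<theta>) = y (cis \<theta>)" shows "y \<in> hinf"
proof -
  have "(\<lambda>\<zeta>. y \<zeta> * g \<zeta>) \<in> h2" if "g \<in> h2" for g
    by (rule h2_AE_cong[OF hinf_h2[OF assms(1) that]]) (use assms(2) in \<open>eventually_elim, simp\<close>)
  then show ?thesis using linf_AE_cong[OF hinf_linf[OF assms(1)] assms(2)] by (simp add: hinf_def)
qed

lemma hinf_cong: "f \<in> hinf \<Longrightarrow> (\<And>\<zeta>. \<zeta> \<in> sphere 0 1 \<Longrightarrow> f \<zeta> = g \<zeta>) \<Longrightarrow> g \<in> hinf"
  by (erule hinf_AE_cong) (auto intro: AE_I2)

lemma L2_AE_cong:
  assumes "f \<in> L2 k" "L2_eq f g" "\<And>\<zeta>. \<zeta> \<in> sphere 0 1 \<Longrightarrow> g \<zeta> \<in> carrier_vec k"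
  shows "g \<in> L2 k"
  unfolding L2_iff
proof (intro conjI ballI allI impI)
  fix i assume "i < k"
  show "(\<lambda>\<zeta>. g \<zeta> $ i) \<in> l2"
    by (rule l2_AE_cong[OF L2_comp[OF assms(1) \<open>i < k\<close>]])
       (use assms(2)[unfolded L2_eq_def] in \<open>eventually_elim, simp\<close>)
qed (rule assms(3))

lemma H2_AE_cong:
  assumes "f \<in> H2 k" "L2_eq f g" "\<And>\<zeta>. \<zeta> \<in> sphere 0 1 \<Longrightarrow> g \<zeta> \<in> carrier_vec k"
  shows "g \<in> H2 k"
  unfolding H2_iff
proof (intro conjI ballI allI impI)
  fix i assume "i < k"
  show "(\<lambda>\<zeta>. g \<zeta> $ i) \<in> h2"
    by (rule h2_AE_cong[OF H2_comp[OF assms(1) \<open>i < k\<close>]])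
       (use assms(2)[unfolded L2_eq_def] in \<open>eventually_elim, simp\<close>)
qed (rule assms(3))

lemma L2_eq_sphere: "(\<And>\<zeta>. \<zeta> \<in> sphere 0 1 \<Longrightarrow> f \<zeta> = g \<zeta>) \<Longrightarrow> L2_eq f g"
  unfolding L2_eq_def by (intro AE_I2) auto
lemma H2_cong:
  assumes "f \<in> H2 k" "\<And>\<zeta>. \<zeta> \<in> sphere 0 1 \<Longrightarrow> f \<zeta> = g \<zeta>" shows "g \<in> H2 k"
proof (rule H2_AE_cong[OF assms(1) L2_eq_sphere])
  show "g \<zeta> \<in> carrier_vec k" if "\<zeta> \<in> sphere 0 1" for \<zeta>
    using L2_carrier[OF H2_L2[OF assms(1)] that] assms(2)[OF that] by simp
qed (rule assms(2))

lemma L2_add: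
  assumes "f \<in> L2 k" "g \<in> L2 k" shows "vv_add f g \<in> L2 k"
  unfolding L2_iff
proof (intro conjI ballI allI impI)
  fix i assume i: "i < k"
  show "(\<lambda>\<zeta>. vv_add f g \<zeta> $ i) \<in> l2"
    by (rule l2_cong[OF l2_add[OF L2_comp[OF assms(1) i] L2_comp[OF assms(2) i]]])
       (use i carrier_vecD[OF L2_carrier[OF assms(2)]] in \<open>auto simp: vv_add_def\<close>)
qed (use assms in \<open>auto simp: vv_add_def L2_iff\<close>)

lemma L2_diff:
  assumes "f \<in> L2 k" "g \<in> L2 k" shows "vv_diff f g \<in> L2 k"
  unfolding L2_iff
proof (intro conjI ballI allI impI)
  fix i assume i: "i < k"
  show "(\<lambda>\<zeta>. vv_diff f g \<zeta> $ i) \<in> l2"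
    by (rule l2_cong[OF l2_diff[OF L2_comp[OF assms(1) i] L2_comp[OF assms(2) i]]])
       (use i carrier_vecD[OF L2_carrier[OF assms(2)]] in \<open>auto simp: vv_diff_def\<close>)
qed (use assms in \<open>auto simp: vv_diff_def L2_iff\<close>)

lemma H2_add:
  assumes "f \<in> H2 k" "g \<in> H2 k" shows "vv_add f g \<in> H2 k"
  unfolding H2_iff
proof (intro conjI ballI allI impI)
  fix i assume i: "i < k"
  show "(\<lambda>\<zeta>. vv_add f g \<zeta> $ i) \<in> h2"
    by (rule h2_cong[OF h2_add[OF H2_comp[OF assms(1) i] H2_comp[OF assms(2) i]]])
       (use i carrier_vecD[OF L2_carrier[OF H2_L2[OF assms(2)]]] in \<open>auto simp: vv_add_def\<close>)
qed (use assms in \<open>auto simp: vv_add_def H2_iff\<close>)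

definition vv_scale :: "(complex \<Rightarrow> complex) \<Rightarrow> vvf \<Rightarrow> vvf" where
  "vv_scale x f = (\<lambda>\<zeta>. x \<zeta> \<cdot>\<^sub>v f \<zeta>)"

lemma L2_scale:
  assumes "x \<in> linf" "f \<in> L2 k" shows "vv_scale x f \<in> L2 k"
  unfolding L2_iff
proof (intro conjI ballI allI impI)
  fix i assume i: "i < k"
  show "(\<lambda>\<zeta>. vv_scale x f \<zeta> $ i) \<in> l2"
    by (rule l2_cong[OF l2_linf_mult[OF assms(1) L2_comp[OF assms(2) i]]])
       (use i carrier_vecD[OF L2_carrier[OF assms(2)]] in \<open>auto simp: vv_scale_def\<close>)
qed (use assms in \<open>auto simp: vv_scale_def L2_iff\<close>)

lemma H2_scale:
  assumes "x \<in> hinf" "f \<in> H2 k" shows "vv_scale x f \<in> H2 k"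
  unfolding H2_iff
proof (intro conjI ballI allI impI)
  fix i assume i: "i < k"
  show "(\<lambda>\<zeta>. vv_scale x f \<zeta> $ i) \<in> h2"
    by (rule h2_cong[OF hinf_h2[OF assms(1) H2_comp[OF assms(2) i]]])
       (use i carrier_vecD[OF L2_carrier[OF H2_L2[OF assms(2)]]] in \<open>auto simp: vv_scale_def\<close>)
qed (use assms in \<open>auto simp: vv_scale_def H2_iff\<close>)

lemma vv_diff_eq_add:
  assumes "f \<in> L2 k" "g \<in> L2 k" "\<zeta> \<in> sphere 0 1"
  shows "vv_diff f g \<zeta> = vv_add f (vv_scale (\<lambda>_. -1) g) \<zeta>"
  using L2_carrier[OF assms(1,3)] L2_carrier[OF assms(2,3)]
  by (intro eq_vecI) (auto simp: vv_diff_def vv_add_def vv_scale_def)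

lemma H2_diff:
  assumes "f \<in> H2 k" "g \<in> H2 k" shows "vv_diff f g \<in> H2 k"
  by (rule H2_cong[OF H2_add[OF assms(1) H2_scale[OF hinf_const[of "-1"] assms(2)]]])
     (simp add: vv_diff_eq_add[OF H2_L2[OF assms(1)] H2_L2[OF assms(2)]])

lemma h2_const [simp]: "(\<lambda>\<zeta>. c) \<in> h2"
proof -
  have "(LINT \<theta>|arc. cis \<theta> ^ j) = 0" if "j > 0" for j :: nat
  proof -
    have "cmean (\<lambda>z. z ^ j) = 0 ^ j"
      by (rule cmean_holomorphic) (auto intro!: continuous_intros holomorphic_intros)
    then show ?thesis using that by (auto simp: cmean_def power_0_left)
  qed
  then show ?thesis by (auto simp: h2_def intro: linf_imp_l2)
qed

lemma H2_const: "c \<in> carrier_vec k \<Longrightarrow> (\<lambda>_. c) \<in> H2 k"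
  by (auto simp: H2_iff)

subsection \<open>The inner product\<close>

definition ip :: "(complex \<Rightarrow> complex) \<Rightarrow> (complex \<Rightarrow> complex) \<Rightarrow> complex" where
  "ip f g = cmean (\<lambda>\<zeta>. f \<zeta> * cnj (g \<zeta>))"

lemma L2_inner_ip:
  assumes "f \<in> L2 k" "g \<in> L2 k"
  shows "L2_inner f g = (\<Sum>i<k. ip (\<lambda>\<zeta>. f \<zeta> $ i) (\<lambda>\<zeta>. g \<zeta> $ i))"
proof -
  have "(LINT \<theta>|arc. f (cis \<theta>) \<bullet>c g (cis \<theta>)) = (LINT \<theta>|arc. (\<Sum>i<k. f (cis \<theta>) $ i * cnj (g (cis \<theta>) $ i)))"
    using L2_carrier[OF assms(2)] by (intro Bochner_Integration.integral_cong refl cscalar_prod_sum) auto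
  also have "\<dots> = (\<Sum>i<k. LINT \<theta>|arc. f (cis \<theta>) $ i * cnj (g (cis \<theta>) $ i))"
    by (rule Bochner_Integration.integral_sum)
       (use L2_comp[OF assms(1)] l2_cnj[OF L2_comp[OF assms(2)]] l2_mult_integrable in blast)
  finally show ?thesis by (simp add: L2_inner_def ip_def cmean_def sum_divide_distrib)
qed

lemma ip_integrable: "f \<in> l2 \<Longrightarrow> g \<in> l2 \<Longrightarrow> integrable arc (\<lambda>\<theta>. f (cis \<theta>) * cnj (g (cis \<theta>)))"
  using l2_mult_integrable[OF _ l2_cnj] by blast

lemma L2_inner_integrable:
  assumes "f \<in> L2 k" "g \<in> L2 k"
  shows "integrable arc (\<lambda>\<theta>. f (cis \<theta>) \<bullet>c g (cis \<theta>))"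
proof -
  have "integrable arc (\<lambda>\<theta>. (\<Sum>i<k. f (cis \<theta>) $ i * cnj (g (cis \<theta>) $ i)))"
    by (intro Bochner_Integration.integrable_sum ip_integrable[of "\<lambda>\<zeta>. f \<zeta> $ _" "\<lambda>\<zeta>. g \<zeta> $ _"])
       (use L2_comp[OF assms(1)] L2_comp[OF assms(2)] in auto)
  also have "(\<lambda>\<theta>. (\<Sum>i<k. f (cis \<theta>) $ i * cnj (g (cis \<theta>) $ i))) = (\<lambda>\<theta>. f (cis \<theta>) \<bullet>c g (cis \<theta>))"
    using L2_carrier[OF assms(2)] cscalar_prod_sum by (metis cis_range)
  finally show ?thesis .
qed

lemma L2_inner_eq_cong:
  assumes "f \<in> L2 k" "g \<in> L2 k" "f' \<in> L2 k" "g' \<in> L2 k" "L2_eq f f'" "L2_eq g g'"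
  shows "L2_inner f g = L2_inner f' g'"
proof -
  have "(LINT \<theta>|arc. f (cis \<theta>) \<bullet>c g (cis \<theta>)) = (LINT \<theta>|arc. f' (cis \<theta>) \<bullet>c g' (cis \<theta>))"
  proof (rule integral_cong_AE)
    show "AE \<theta> in arc. f (cis \<theta>) \<bullet>c g (cis \<theta>) = f' (cis \<theta>) \<bullet>c g' (cis \<theta>)"
      using assms(5,6)[unfolded L2_eq_def] by eventually_elim simp
  qed (use L2_inner_integrable assms in \<open>auto dest: borel_measurable_integrable\<close>)
  then show ?thesis by (simp add: L2_inner_def)
qed

lemma L2_inner_sphere_cong:
  assumes "\<And>\<zeta>. \<zeta> \<in> sphere 0 1 \<Longrightarrow> f \<zeta> = f' \<zeta>" "\<And>\<zeta>. \<zeta> \<in> sphere 0 1 \<Longrightarrow> g \<zeta> = g' \<zeta>"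
  shows "L2_inner f g = L2_inner f' g'"
  unfolding L2_inner_def using assms[OF cis_range] by simp

lemma L2_inner_add_left:
  assumes "f \<in> L2 k" "g \<in> L2 k" "h \<in> L2 k"
  shows "L2_inner (vv_add f g) h = L2_inner f h + L2_inner g h"
proof -
  have "(LINT \<theta>|arc. vv_add f g (cis \<theta>) \<bullet>c h (cis \<theta>)) = (LINT \<theta>|arc. f (cis \<theta>) \<bullet>c h (cis \<theta>) + g (cis \<theta>) \<bullet>c h (cis \<theta>))"
    using assms[THEN L2_carrier[OF _ cis_range]]
    by (intro Bochner_Integration.integral_cong refl) (auto simp: vv_add_def intro!: add_scalar_prod_distrib[of _ k])
  then show ?thesis
    using L2_inner_integrable[OF assms(1,3)] L2_inner_integrable[OF assms(2,3)]
    by (simp add: L2_inner_def add_divide_distrib)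
qed

lemma L2_inner_scale_left:
  assumes "f \<in> L2 k" "h \<in> L2 k"
  shows "L2_inner (vv_scale (\<lambda>_. c) f) h = c * L2_inner f h"
proof -
  have "(LINT \<theta>|arc. vv_scale (\<lambda>_. c) f (cis \<theta>) \<bullet>c h (cis \<theta>)) = (LINT \<theta>|arc. c * (f (cis \<theta>) \<bullet>c h (cis \<theta>)))"
    using assms[THEN L2_carrier[OF _ cis_range]]
    by (intro Bochner_Integration.integral_cong refl) (auto simp: vv_scale_def intro!: smult_scalar_prod_distrib[of _ k])
  then show ?thesis by (simp add: L2_inner_def)
qed

lemma L2_inner_diff_left:
  assumes "f \<in> L2 k" "g \<in> L2 k" "h \<in> L2 k"
  shows "L2_inner (vv_diff f g) h = L2_inner f h - L2_inner g h"
proof -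
  have "L2_inner (vv_diff f g) h = L2_inner (vv_add f (vv_scale (\<lambda>_. -1) g)) h"
    by (rule L2_inner_sphere_cong) (use vv_diff_eq_add[OF assms(1,2)] in auto)
  then show ?thesis
    using L2_inner_add_left[OF assms(1) L2_scale[OF linf_const[of "-1"] assms(2)] assms(3)]
      L2_inner_scale_left[OF assms(2,3), of "-1"] by simp
qed

lemma L2_inner_cnj:
  assumes "f \<in> L2 k" "g \<in> L2 k" shows "L2_inner g f = cnj (L2_inner f g)"
proof -
  have "(LINT \<theta>|arc. g (cis \<theta>) \<bullet>c f (cis \<theta>)) = (LINT \<theta>|arc. cnj (f (cis \<theta>) \<bullet>c g (cis \<theta>)))"
    using assms[THEN L2_carrier[OF _ cis_range]]
    by (intro Bochner_Integration.integral_cong refl cscalar_prod_cnj) auto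
  then show ?thesis by (simp add: L2_inner_def)
qed

lemma L2_inner_add_right:
  assumes "f \<in> L2 k" "g \<in> L2 k" "h \<in> L2 k"
  shows "L2_inner h (vv_add f g) = L2_inner h f + L2_inner h g"
  using L2_inner_add_left[OF assms] L2_inner_cnj[OF L2_add[OF assms(1,2)] assms(3)]
    L2_inner_cnj[OF assms(1,3)] L2_inner_cnj[OF assms(2,3)] by simp

lemma L2_inner_diff_right:
  assumes "f \<in> L2 k" "g \<in> L2 k" "h \<in> L2 k"
  shows "L2_inner h (vv_diff f g) = L2_inner h f - L2_inner h g"
  using L2_inner_diff_left[OF assms] L2_inner_cnj[OF L2_diff[OF assms(1,2)] assms(3)]
    L2_inner_cnj[OF assms(1,3)] L2_inner_cnj[OF assms(2,3)] by simp

lemma L2_inner_zero_imp: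
  assumes "f \<in> L2 k" "L2_inner f f = 0"
  shows "AE \<theta> in arc. f (cis \<theta>) = 0\<^sub>v k"
proof -
  have nn: "f (cis \<theta>) \<bullet>c f (cis \<theta>) = of_real (\<Sum>i<k. (cmod (f (cis \<theta>) $ i))\<^sup>2)" for \<theta>
    unfolding cscalar_prod_sum[OF L2_carrier[OF assms(1) cis_range]] of_real_sum complex_norm_square ..
  have i: "integrable arc (\<lambda>\<theta>. \<Sum>i<k. (cmod (f (cis \<theta>) $ i))\<^sup>2)"
    using assms(1) by (intro Bochner_Integration.integrable_sum) (auto simp: L2_def)
  have "(LINT \<theta>|arc. complex_of_real (\<Sum>i<k. (cmod (f (cis \<theta>) $ i))\<^sup>2)) = 0"
    using assms(2) unfolding L2_inner_def nn by (simp del: of_real_sum)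
  then have "complex_of_real (LINT \<theta>|arc. (\<Sum>i<k. (cmod (f (cis \<theta>) $ i))\<^sup>2)) = 0"
    by (simp only: integral_complex_of_real)
  then have "(LINT \<theta>|arc. (\<Sum>i<k. (cmod (f (cis \<theta>) $ i))\<^sup>2)) = 0" by (simp only: of_real_eq_0_iff)
  then have "AE \<theta> in arc. (\<Sum>i<k. (cmod (f (cis \<theta>) $ i))\<^sup>2) = 0"
    by (subst (asm) integral_nonneg_eq_0_iff_AE[OF i]) (intro AE_I2 sum_nonneg zero_le_power2, simp)
  then show ?thesis
  proof eventually_elim
    case (elim \<theta>)
    then have "\<forall>i<k. f (cis \<theta>) $ i = 0" by (subst (asm) sum_nonneg_eq_0_iff) auto
    then show ?case using L2_carrier[OF assms(1) cis_range, of \<theta>] by (intro eq_vecI) auto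
  qed
qed

subsection \<open>Multiplication by matrix valued functions\<close>

text \<open>
  \<open>LM\<close> and \<open>AM\<close> single out the bounded measurable and the bounded analytic mvf's on the circle, i.e. the
  multiplication operators on $L_2$ and those that also preserve $H_2$.
\<close>

definition LM :: "nat \<Rightarrow> nat \<Rightarrow> mvf \<Rightarrow> bool" where
  "LM p k X \<longleftrightarrow> (\<forall>\<zeta>\<in>sphere 0 1. X \<zeta> \<in> carrier_mat p k) \<and> (\<forall>i<p. \<forall>j<k. (\<lambda>\<zeta>. X \<zeta> $$ (i, j)) \<in> linf)"

definition AM :: "nat \<Rightarrow> nat \<Rightarrow> mvf \<Rightarrow> bool" where
  "AM p k X \<longleftrightarrow> (\<forall>\<zeta>\<in>sphere 0 1. X \<zeta> \<in> carrier_mat p k) \<and> (\<forall>i<p. \<forall>j<k. (\<lambda>\<zeta>. X \<zeta> $$ (i, j)) \<in> hinf)"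

lemma AM_LM: "AM p k X \<Longrightarrow> LM p k X" by (auto simp: AM_def LM_def hinf_linf)
lemma LM_carrier: "LM p k X \<Longrightarrow> \<zeta> \<in> sphere 0 1 \<Longrightarrow> X \<zeta> \<in> carrier_mat p k" by (auto simp: LM_def)
lemma AM_carrier: "AM p k X \<Longrightarrow> \<zeta> \<in> sphere 0 1 \<Longrightarrow> X \<zeta> \<in> carrier_mat p k" by (auto simp: AM_def)

lemma mv_mult_carrier:
  assumes "LM p k X" "f \<in> L2 k" "\<zeta> \<in> sphere 0 1" shows "mv_mult X f \<zeta> \<in> carrier_vec p"
  unfolding mv_mult_def by (rule mult_mat_vec_carrier[OF LM_carrier[OF assms(1,3)] L2_carrier[OF assms(2,3)]])

lemma mv_mult_index:
  assumes "LM p k X" "f \<in> L2 k" "\<zeta> \<in> sphere 0 1" "i < p"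
  shows "mv_mult X f \<zeta> $ i = (\<Sum>j<k. X \<zeta> $$ (i, j) * f \<zeta> $ j)"
  unfolding mv_mult_def by (rule mult_mat_vec_index[OF LM_carrier[OF assms(1,3)] L2_carrier[OF assms(2,3)] assms(4)])

lemma L2_mv:
  assumes "LM p k X" "f \<in> L2 k" shows "mv_mult X f \<in> L2 p"
  unfolding L2_iff
proof (intro conjI ballI allI impI)
  fix i assume i: "i < p"
  have "(\<lambda>\<zeta>. \<Sum>j<k. X \<zeta> $$ (i, j) * f \<zeta> $ j) \<in> l2"
    using assms i by (intro l2_sum l2_linf_mult) (auto simp: LM_def L2_iff)
  then show "(\<lambda>\<zeta>. mv_mult X f \<zeta> $ i) \<in> l2"
    by (rule l2_cong) (simp add: mv_mult_index[OF assms _ i])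
qed (rule mv_mult_carrier[OF assms])

lemma H2_mv:
  assumes "AM p k X" "f \<in> H2 k" shows "mv_mult X f \<in> H2 p"
  unfolding H2_iff
proof (intro conjI ballI allI impI)
  fix i assume i: "i < p"
  have "(\<lambda>\<zeta>. \<Sum>j<k. X \<zeta> $$ (i, j) * f \<zeta> $ j) \<in> h2"
    using assms i by (intro h2_sum hinf_h2) (auto simp: AM_def H2_iff)
  then show "(\<lambda>\<zeta>. mv_mult X f \<zeta> $ i) \<in> h2"
    by (rule h2_cong) (simp add: mv_mult_index[OF AM_LM[OF assms(1)] H2_L2[OF assms(2)] _ i])
qed (rule mv_mult_carrier[OF AM_LM[OF assms(1)] H2_L2[OF assms(2)]])

lemma LM_adj: "LM p k X \<Longrightarrow> LM k p (mvf_adj X)"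
  unfolding LM_def mvf_adj_def
proof (elim conjE, intro conjI ballI allI impI)
  fix i j assume c: "\<forall>\<zeta>\<in>sphere 0 1. X \<zeta> \<in> carrier_mat p k"
    and l: "\<forall>i<p. \<forall>j<k. (\<lambda>\<zeta>. X \<zeta> $$ (i, j)) \<in> linf" and ij: "i < k" "j < p"
  have "(\<lambda>\<zeta>. cnj (X \<zeta> $$ (j, i))) \<in> linf" using l ij by (intro linf_cnj) auto
  then show "(\<lambda>\<zeta>. mat_adjoint (X \<zeta>) $$ (i, j)) \<in> linf"
  proof (rule linf_cong)
    fix \<zeta> :: complex assume "\<zeta> \<in> sphere 0 1"
    then have "X \<zeta> \<in> carrier_mat p k" using c by blast
    then show "cnj (X \<zeta> $$ (j, i)) = mat_adjoint (X \<zeta>) $$ (i, j)" using ij by simp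
  qed
qed auto

lemma L2_inner_adj:
  assumes "LM p k X" "f \<in> L2 k" "g \<in> L2 p"
  shows "L2_inner (mv_mult X f) g = L2_inner f (mv_mult (mvf_adj X) g)"
proof -
  have "mv_mult X f (cis \<theta>) \<bullet>c g (cis \<theta>) = f (cis \<theta>) \<bullet>c mv_mult (mvf_adj X) g (cis \<theta>)" for \<theta>
    unfolding mv_mult_def mvf_adj_def
    by (rule cscalar_prod_adjoint[OF LM_carrier[OF assms(1)] L2_carrier[OF assms(2)] L2_carrier[OF assms(3)]]) auto
  then show ?thesis by (simp add: L2_inner_def)
qed

lemma L2_inner_adj':
  assumes "LM p k X" "f \<in> L2 k" "g \<in> L2 p"
  shows "L2_inner (mv_mult (mvf_adj X) g) f = L2_inner g (mv_mult X f)"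
  using L2_inner_adj[OF assms] L2_inner_cnj[OF L2_mv[OF assms(1,2)] assms(3)]
    L2_inner_cnj[OF assms(2) L2_mv[OF LM_adj[OF assms(1)] assms(3)]] by simp

subsection \<open>The orthogonal complement of the Hardy space\<close>

lemma H2_perp_iff: "f \<in> H2_perp k \<longleftrightarrow> f \<in> L2 k \<and> (\<forall>g\<in>H2 k. L2_inner f g = 0)"
  by (simp add: H2_perp_def ominus_def)

lemma H2_perp_inner: "f \<in> H2_perp k \<Longrightarrow> g \<in> H2 k \<Longrightarrow> L2_inner f g = 0"
  by (simp add: H2_perp_iff)

lemma H2_perp_inner': "f \<in> H2_perp k \<Longrightarrow> g \<in> H2 k \<Longrightarrow> L2_inner g f = 0"
  using L2_inner_cnj[of f k g] by (simp add: H2_perp_iff H2_L2)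

lemma H2_perp_add: "f \<in> H2_perp k \<Longrightarrow> g \<in> H2_perp k \<Longrightarrow> vv_add f g \<in> H2_perp k"
  by (auto simp: H2_perp_iff L2_add L2_inner_add_left[of _ k] H2_L2)

lemma H2_perp_diff: "f \<in> H2_perp k \<Longrightarrow> g \<in> H2_perp k \<Longrightarrow> vv_diff f g \<in> H2_perp k"
  by (auto simp: H2_perp_iff L2_diff L2_inner_diff_left[of _ k] H2_L2)

lemma H2_perp_AE_cong:
  assumes "f \<in> H2_perp k" "L2_eq f g" "\<And>\<zeta>. \<zeta> \<in> sphere 0 1 \<Longrightarrow> g \<zeta> \<in> carrier_vec k"
  shows "g \<in> H2_perp k"
proof -
  have gL: "g \<in> L2 k" using L2_AE_cong[OF H2_perp_L2[OF assms(1)] assms(2,3)] .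
  have "L2_inner g h = 0" if "h \<in> H2 k" for h
    using L2_inner_eq_cong[OF H2_perp_L2[OF assms(1)] H2_L2[OF that] gL H2_L2[OF that] assms(2) L2_eq_sphere]
      H2_perp_inner[OF assms(1) that] by simp
  then show ?thesis using gL by (simp add: H2_perp_iff)
qed

lemma H2_perp_cong:
  assumes "f \<in> H2_perp k" "\<And>\<zeta>. \<zeta> \<in> sphere 0 1 \<Longrightarrow> f \<zeta> = g \<zeta>" shows "g \<in> H2_perp k"
proof (rule H2_perp_AE_cong[OF assms(1) L2_eq_sphere])
  show "g \<zeta> \<in> carrier_vec k" if "\<zeta> \<in> sphere 0 1" for \<zeta>
    using L2_carrier[OF H2_perp_L2[OF assms(1)] that] assms(2)[OF that] by simp
qed (rule assms(2))

text \<open>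
  The adjoint of an operator that preserves $H_2$ preserves the orthogonal complement.
\<close>

lemma H2_perp_adj:
  assumes "AM p k X" "g \<in> H2_perp p" shows "mv_mult (mvf_adj X) g \<in> H2_perp k"
  unfolding H2_perp_iff
proof (intro conjI ballI)
  show "mv_mult (mvf_adj X) g \<in> L2 k" using L2_mv[OF LM_adj[OF AM_LM[OF assms(1)]] H2_perp_L2[OF assms(2)]] .
  fix h assume h: "h \<in> H2 k"
  show "L2_inner (mv_mult (mvf_adj X) g) h = 0"
    unfolding L2_inner_adj'[OF AM_LM[OF assms(1)] H2_L2[OF h] H2_perp_L2[OF assms(2)]]
    by (rule H2_perp_inner[OF assms(2) H2_mv[OF assms(1) h]])
qed

lemma vv_scale_mv:
  assumes "f \<in> L2 k" "\<zeta> \<in> sphere 0 1"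
  shows "vv_scale x f \<zeta> = mv_mult (\<lambda>\<zeta>. x \<zeta> \<cdot>\<^sub>m 1\<^sub>m k) f \<zeta>"
proof (rule eq_vecI)
  note c = L2_carrier[OF assms]
  fix i assume "i < dim_vec (mv_mult (\<lambda>\<zeta>. x \<zeta> \<cdot>\<^sub>m 1\<^sub>m k) f \<zeta>)"
  then have i: "i < k" by (simp add: mv_mult_def)
  have "mv_mult (\<lambda>\<zeta>. x \<zeta> \<cdot>\<^sub>m 1\<^sub>m k) f \<zeta> $ i = (\<Sum>j<k. (x \<zeta> \<cdot>\<^sub>m 1\<^sub>m k) $$ (i, j) * f \<zeta> $ j)"
    unfolding mv_mult_def by (rule mult_mat_vec_index[OF _ c i]) simp
  also have "\<dots> = (\<Sum>j<k. if j = i then x \<zeta> * f \<zeta> $ j else 0)"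
    by (rule sum.cong) (use i in auto)
  also have "\<dots> = x \<zeta> * f \<zeta> $ i" using i by simp
  finally show "vv_scale x f \<zeta> $ i = mv_mult (\<lambda>\<zeta>. x \<zeta> \<cdot>\<^sub>m 1\<^sub>m k) f \<zeta> $ i"
    using i c by (simp add: vv_scale_def)
qed (use L2_carrier[OF assms] in \<open>simp add: vv_scale_def mv_mult_def\<close>)

lemma AM_scalar: "x \<in> hinf \<Longrightarrow> AM k k (\<lambda>\<zeta>. x \<zeta> \<cdot>\<^sub>m 1\<^sub>m k)"
proof -
  assume x: "x \<in> hinf"
  have "(\<lambda>\<zeta>. (x \<zeta> \<cdot>\<^sub>m 1\<^sub>m k) $$ (i, j)) \<in> hinf" if "i < k" "j < k" for i j
    by (rule hinf_cong[of "\<lambda>\<zeta>. x \<zeta> * (if i = j then 1 else 0)"]) (use x that in \<open>auto intro: hinf_mult\<close>)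
  then show ?thesis by (auto simp: AM_def)
qed

lemma H2_perp_scale_cnj:
  assumes "x \<in> hinf" "f \<in> H2_perp k" shows "vv_scale (\<lambda>\<zeta>. cnj (x \<zeta>)) f \<in> H2_perp k"
proof (rule H2_perp_cong[OF H2_perp_adj[OF AM_scalar[OF assms(1)] assms(2)]])
  fix \<zeta> :: complex assume \<zeta>: "\<zeta> \<in> sphere 0 1"
  have "mat_adjoint (x \<zeta> \<cdot>\<^sub>m 1\<^sub>m k) = cnj (x \<zeta>) \<cdot>\<^sub>m (1\<^sub>m k :: complex mat)" by (rule eq_matI) auto
  then show "mv_mult (mvf_adj (\<lambda>\<zeta>. x \<zeta> \<cdot>\<^sub>m 1\<^sub>m k)) f \<zeta> = vv_scale (\<lambda>\<zeta>. cnj (x \<zeta>)) f \<zeta>"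
    using vv_scale_mv[OF H2_perp_L2[OF assms(2)] \<zeta>, of "\<lambda>\<zeta>. cnj (x \<zeta>)"] by (simp add: mv_mult_def mvf_adj_def)
qed

section \<open>Corona type identities\<close>

lemma h2_coeff: "f \<in> h2 \<Longrightarrow> j > 0 \<Longrightarrow> (LINT \<theta>|arc. f (cis \<theta>) * cis \<theta> ^ j) = 0"
  by (simp add: h2_def)

text \<open>
  Subtracting the value $c = y(\alpha)$ leaves a function with a zero at $\alpha$.
\<close>

lemma H2_split_at:
  assumes y: "y \<in> H2 k" and \<alpha>: "\<alpha> \<in> ball 0 1"
  obtains c y' where "c \<in> carrier_vec k" "y' \<in> H2 k"
    "\<And>\<zeta>. \<zeta> \<in> sphere 0 1 \<Longrightarrow> y \<zeta> = c + (\<zeta> - \<alpha>) \<cdot>\<^sub>v y' \<zeta>"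
proof -
  define c where "c = vec k (\<lambda>i. disc_value \<alpha> (\<lambda>\<zeta>. y \<zeta> $ i))"
  define y' where "y' = (\<lambda>\<zeta>. vec k (\<lambda>i. (y \<zeta> $ i - c $ i) / (\<zeta> - \<alpha>)))"
  have "(\<lambda>\<zeta>. (y \<zeta> $ i - c $ i) / (\<zeta> - \<alpha>)) \<in> h2" if i: "i < k" for i
  proof (rule h2_div_root[OF _ \<alpha>])
    show "(\<lambda>\<zeta>. y \<zeta> $ i - c $ i) \<in> h2"
      using h2_add[OF H2_comp[OF y i] h2_const[of "- c $ i"]] by simp
    show "disc_value \<alpha> (\<lambda>\<zeta>. y \<zeta> $ i - c $ i) = 0"
      using i by (simp add: disc_value_diff_const[OF h2_l2[OF H2_comp[OF y i]] \<alpha>] c_def)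
  qed
  then have "y' \<in> H2 k" by (auto simp: H2_iff y'_def)
  moreover have "y \<zeta> = c + (\<zeta> - \<alpha>) \<cdot>\<^sub>v y' \<zeta>" if "\<zeta> \<in> sphere 0 1" for \<zeta>
    using L2_carrier[OF H2_L2[OF y] that] that \<alpha> by (intro eq_vecI) (auto simp: y'_def c_def)
  ultimately show ?thesis by (intro that[of c y']) (auto simp: c_def)
qed

lemma szego_hinf: "\<alpha> \<in> ball 0 1 \<Longrightarrow> (\<lambda>\<zeta>. 1 / (1 - cnj \<alpha> * \<zeta>)) \<in> hinf"
  using one_minus_cnj_mult_nz by (intro hinf_holomorphic) (auto intro!: continuous_intros holomorphic_intros)

lemma ip_kernel_h2:
  assumes "\<alpha> \<in> ball 0 1" "g \<in> h2" shows "ip (\<lambda>\<zeta>. 1 / (\<zeta> - \<alpha>)) g = 0"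
proof -
  have "(\<lambda>\<zeta>. 1 / (1 - cnj \<alpha> * \<zeta>) * g \<zeta>) \<in> h2" using hinf_h2[OF szego_hinf[OF assms(1)] assms(2)] .
  from h2_coeff[OF this, of 1]
  have "(LINT \<theta>|arc. 1 / (1 - cnj \<alpha> * cis \<theta>) * g (cis \<theta>) * cis \<theta> ^ 1) = 0" by simp
  then have "cmean (\<lambda>\<zeta>. 1 / (1 - cnj \<alpha> * \<zeta>) * g \<zeta> * \<zeta>) = 0" by (simp add: cmean_def)
  then have "cmean (\<lambda>\<zeta>. cnj (1 / (1 - cnj \<alpha> * \<zeta>) * g \<zeta> * \<zeta>)) = 0" by (subst cmean_cnj) simp
  also have "cmean (\<lambda>\<zeta>. cnj (1 / (1 - cnj \<alpha> * \<zeta>) * g \<zeta> * \<zeta>)) = ip (\<lambda>\<zeta>. 1 / (\<zeta> - \<alpha>)) g"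
    unfolding ip_def
  proof (rule cmean_cong)
    fix \<zeta> :: complex assume \<zeta>: "\<zeta> \<in> sphere 0 1"
    have "cnj (1 / (1 - cnj \<alpha> * \<zeta>) * g \<zeta> * \<zeta>) = \<zeta> / (\<zeta> - \<alpha>) * cnj (g \<zeta>) * cnj \<zeta>"
      using cnj_szego[OF assms(1) \<zeta>] by (simp only: complex_cnj_mult)
    also have "\<dots> = (\<zeta> * cnj \<zeta>) / (\<zeta> - \<alpha>) * cnj (g \<zeta>)" by (simp add: mult_ac)
    finally show "cnj (1 / (1 - cnj \<alpha> * \<zeta>) * g \<zeta> * \<zeta>) = 1 / (\<zeta> - \<alpha>) * cnj (g \<zeta>)"
      using sphere_mult_cnj[OF \<zeta>] by simp
  qed
  finally show ?thesis .
qed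

lemma ip_scale_left: "ip (\<lambda>\<zeta>. c * f \<zeta>) g = c * ip f g"
  by (simp add: ip_def mult.assoc cmean_scale)

lemma ip_scale_right: "ip f (\<lambda>\<zeta>. c * g \<zeta>) = cnj c * ip f g"
proof -
  have "ip f (\<lambda>\<zeta>. c * g \<zeta>) = cmean (\<lambda>\<zeta>. cnj c * (f \<zeta> * cnj (g \<zeta>)))"
    unfolding ip_def by (rule cmean_cong) (simp add: mult_ac)
  then show ?thesis by (simp add: cmean_scale ip_def)
qed

lemma ip_add_right:
  assumes "f \<in> l2" "g \<in> l2" "h \<in> l2" shows "ip f (\<lambda>\<zeta>. g \<zeta> + h \<zeta>) = ip f g + ip f h"
  using ip_integrable[OF assms(1,2)] ip_integrable[OF assms(1,3)]
  by (simp add: ip_def cmean_def distrib_left add_divide_distrib)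

lemma ip_diff_left:
  assumes "f \<in> l2" "g \<in> l2" "h \<in> l2" shows "ip (\<lambda>\<zeta>. f \<zeta> - g \<zeta>) h = ip f h - ip g h"
  using ip_integrable[OF assms(1,3)] ip_integrable[OF assms(2,3)]
  by (simp add: ip_def cmean_def left_diff_distrib diff_divide_distrib)

lemma ip_cnj_id_kernel: "\<alpha> \<in> ball 0 1 \<Longrightarrow> ip cnj (\<lambda>\<zeta>. 1 / (\<zeta> - \<alpha>)) = 1"
proof -
  assume \<alpha>: "\<alpha> \<in> ball 0 1"
  have "ip cnj (\<lambda>\<zeta>. 1 / (\<zeta> - \<alpha>)) = cmean (\<lambda>\<zeta>. cnj (1 * (\<zeta> / (\<zeta> - \<alpha>))))"
    unfolding ip_def by (rule cmean_cong) (simp add: mult_ac)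
  then show ?thesis using disc_value_const[OF \<alpha>, of 1] unfolding disc_value_def cmean_cnj by simp
qed

text \<open>
  The counterpart for the complement of $H_2$, with the conjugate zero $\overline{\zeta - \alpha}$. Orthogonality of
  the remainder to $H_2$ is checked by splitting the test function at $\alpha$.
\<close>

lemma H2_perp_split_at:
  assumes x: "x \<in> H2_perp k" and \<alpha>: "\<alpha> \<in> ball 0 1"
  obtains c x' where "c \<in> carrier_vec k" "x' \<in> H2_perp k"
    "\<And>\<zeta>. \<zeta> \<in> sphere 0 1 \<Longrightarrow> x \<zeta> = cnj \<zeta> \<cdot>\<^sub>v c + cnj (\<zeta> - \<alpha>) \<cdot>\<^sub>v x' \<zeta>"
proof -
  note xL = H2_perp_L2[OF x]
  have kl: "(\<lambda>\<zeta>. 1 / (\<zeta> - \<alpha>)) \<in> l2" using inverse_minus_linf[OF \<alpha>] by (rule linf_imp_l2)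
  have cl: "cnj \<in> linf" using linf_cnj[OF linf_id] .
  define c where "c = vec k (\<lambda>i. ip (\<lambda>\<zeta>. x \<zeta> $ i) (\<lambda>\<zeta>. 1 / (\<zeta> - \<alpha>)))"
  define w where "w = (\<lambda>\<zeta>. vec k (\<lambda>i. x \<zeta> $ i - cnj \<zeta> * c $ i))"
  define x' where "x' = vv_scale (\<lambda>\<zeta>. cnj (1 / (\<zeta> - \<alpha>))) w"
  have ccl: "(\<lambda>\<zeta>. cnj \<zeta> * c $ i) \<in> l2" for i
    by (intro linf_imp_l2 linf_mult cl linf_const)
  have wL: "w \<in> L2 k"
    using l2_diff[OF L2_comp[OF xL] ccl] by (auto simp: L2_iff w_def)
  have x'L: "x' \<in> L2 k" unfolding x'_def by (rule L2_scale[OF linf_cnj[OF inverse_minus_linf[OF \<alpha>]] wL])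
  have w0: "ip (\<lambda>\<zeta>. w \<zeta> $ i) (\<lambda>\<zeta>. 1 / (\<zeta> - \<alpha>)) = 0" if i: "i < k" for i
  proof -
    have "ip (\<lambda>\<zeta>. w \<zeta> $ i) (\<lambda>\<zeta>. 1 / (\<zeta> - \<alpha>)) = ip (\<lambda>\<zeta>. x \<zeta> $ i - cnj \<zeta> * c $ i) (\<lambda>\<zeta>. 1 / (\<zeta> - \<alpha>))"
      using i by (simp add: w_def)
    also have "\<dots> = c $ i - ip (\<lambda>\<zeta>. c $ i * cnj \<zeta>) (\<lambda>\<zeta>. 1 / (\<zeta> - \<alpha>))"
      using ip_diff_left[OF L2_comp[OF xL i] ccl[of i] kl] i by (simp add: c_def mult.commute)
    also have "\<dots> = 0" using ip_scale_left[of "c $ i" cnj] ip_cnj_id_kernel[OF \<alpha>] by simp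
    finally show ?thesis .
  qed
  have x'P: "x' \<in> H2_perp k"
    unfolding H2_perp_iff
  proof (intro conjI ballI x'L)
    fix g assume g: "g \<in> H2 k"
    obtain v g' where v: "v \<in> carrier_vec k" and g': "g' \<in> H2 k"
      and gs: "\<And>\<zeta>. \<zeta> \<in> sphere 0 1 \<Longrightarrow> g \<zeta> = v + (\<zeta> - \<alpha>) \<cdot>\<^sub>v g' \<zeta>"
      by (rule H2_split_at[OF g \<alpha>]) blast
    have g'c: "\<zeta> \<in> sphere 0 1 \<Longrightarrow> g' \<zeta> \<in> carrier_vec k" for \<zeta> by (rule L2_carrier[OF H2_L2[OF g']])
    have gl: "(\<lambda>\<zeta>. g' \<zeta> $ i) \<in> l2" if "i < k" for i using h2_l2[OF H2_comp[OF g' that]] .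
    have "L2_inner x' g = (\<Sum>i<k. ip (\<lambda>\<zeta>. x' \<zeta> $ i) (\<lambda>\<zeta>. g \<zeta> $ i))"
      by (rule L2_inner_ip[OF x'L H2_L2[OF g]])
    also have "\<dots> = (\<Sum>i<k. ip (\<lambda>\<zeta>. w \<zeta> $ i) (\<lambda>\<zeta>. v $ i * (1 / (\<zeta> - \<alpha>)) + g' \<zeta> $ i))"
    proof (rule sum.cong[OF refl], unfold ip_def, rule cmean_cong)
      fix i and \<zeta> :: complex assume i: "i \<in> {..<k}" and \<zeta>: "\<zeta> \<in> sphere 0 1"
      have nz: "\<zeta> - \<alpha> \<noteq> 0" using \<zeta> \<alpha> by auto
      have "x' \<zeta> $ i * cnj (g \<zeta> $ i) = w \<zeta> $ i * cnj (g \<zeta> $ i / (\<zeta> - \<alpha>))"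
        using i by (simp add: x'_def vv_scale_def w_def)
      also have "g \<zeta> $ i / (\<zeta> - \<alpha>) = v $ i * (1 / (\<zeta> - \<alpha>)) + g' \<zeta> $ i"
        using gs[OF \<zeta>] i v carrier_vecD[OF g'c[OF \<zeta>]] nz by (simp add: add_divide_distrib)
      finally show "x' \<zeta> $ i * cnj (g \<zeta> $ i) = w \<zeta> $ i * cnj (v $ i * (1 / (\<zeta> - \<alpha>)) + g' \<zeta> $ i)" .
    qed
    also have "\<dots> = (\<Sum>i<k. ip (\<lambda>\<zeta>. w \<zeta> $ i) (\<lambda>\<zeta>. g' \<zeta> $ i))"
    proof (rule sum.cong[OF refl])
      fix i assume "i \<in> {..<k}"
      then have i: "i < k" by simp
      show "ip (\<lambda>\<zeta>. w \<zeta> $ i) (\<lambda>\<zeta>. v $ i * (1 / (\<zeta> - \<alpha>)) + g' \<zeta> $ i) = ip (\<lambda>\<zeta>. w \<zeta> $ i) (\<lambda>\<zeta>. g' \<zeta> $ i)"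
        unfolding ip_add_right[OF L2_comp[OF wL i] l2_scale[OF kl] gl[OF i]] ip_scale_right w0[OF i] by simp
    qed
    also have "\<dots> = L2_inner w g'" by (rule L2_inner_ip[OF wL H2_L2[OF g'], symmetric])
    also have "\<dots> = L2_inner (vv_diff x (vv_scale cnj (\<lambda>_. c))) g'"
    proof (rule L2_inner_sphere_cong)
      fix \<zeta> :: complex assume "\<zeta> \<in> sphere 0 1"
      show "w \<zeta> = vv_diff x (vv_scale cnj (\<lambda>_. c)) \<zeta>"
        using L2_carrier[OF xL \<open>\<zeta> \<in> sphere 0 1\<close>] by (intro eq_vecI) (auto simp: w_def vv_diff_def vv_scale_def c_def)
    qed simp
    also have "\<dots> = L2_inner x g' - L2_inner (vv_scale cnj (\<lambda>_. c)) g'"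
      by (rule L2_inner_diff_left[OF xL L2_scale[OF cl H2_L2[OF H2_const]] H2_L2[OF g']]) (simp add: c_def)
    also have "L2_inner x g' = 0" by (rule H2_perp_inner[OF x g'])
    also have "L2_inner (vv_scale cnj (\<lambda>_. c)) g' = (\<Sum>i<k. ip (\<lambda>\<zeta>. vv_scale cnj (\<lambda>_. c) \<zeta> $ i) (\<lambda>\<zeta>. g' \<zeta> $ i))"
      by (rule L2_inner_ip[OF L2_scale[OF cl H2_L2[OF H2_const]] H2_L2[OF g']]) (simp add: c_def)
    also have "\<dots> = (\<Sum>i<k. c $ i * ip (\<lambda>\<zeta>. 1 / (\<zeta> - 0)) (\<lambda>\<zeta>. g' \<zeta> $ i))"
    proof (rule sum.cong[OF refl], subst ip_scale_left[symmetric], unfold ip_def, rule cmean_cong)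
      fix i and \<zeta> :: complex assume i: "i \<in> {..<k}" and \<zeta>: "\<zeta> \<in> sphere 0 1"
      show "vv_scale cnj (\<lambda>_. c) \<zeta> $ i * cnj (g' \<zeta> $ i) = c $ i * (1 / (\<zeta> - 0)) * cnj (g' \<zeta> $ i)"
        using i cnj_sphere[OF \<zeta>] by (simp add: vv_scale_def c_def)
    qed
    also have "\<dots> = 0" using H2_comp[OF g'] by (intro sum.neutral ballI) (simp only: ip_kernel_h2[of 0] centre_in_ball zero_less_one lessThan_iff mult_zero_right)
    finally show "L2_inner x' g = 0" by simp
  qed
  have "x \<zeta> = cnj \<zeta> \<cdot>\<^sub>v c + cnj (\<zeta> - \<alpha>) \<cdot>\<^sub>v x' \<zeta>" if \<zeta>: "\<zeta> \<in> sphere 0 1" for \<zeta>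
  proof -
    have "\<zeta> - \<alpha> \<noteq> 0" using \<zeta> \<alpha> by auto
    then have "cnj (\<zeta> - \<alpha>) * cnj (1 / (\<zeta> - \<alpha>)) = 1" by (simp flip: complex_cnj_mult complex_cnj_diff complex_cnj_divide)
    then have E: "cnj (\<zeta> - \<alpha>) * (cnj (1 / (\<zeta> - \<alpha>)) * d) = d" for d by (simp only: mult.assoc[symmetric]) simp
    show ?thesis
      using L2_carrier[OF xL \<zeta>] by (intro eq_vecI) (auto simp: E x'_def w_def vv_scale_def c_def simp del: complex_cnj_diff complex_cnj_divide)
  qed
  then show ?thesis using x'P by (intro that[of c x']) (auto simp: c_def)
qed

text \<open>
  \<open>X\<close> is the boundary function of the bounded analytic \<open>X0\<close>. The relation between the two is encoded by the
  difference quotients $(X(\zeta) - X_0(\alpha))/(\zeta - \alpha)$, which must again be bounded analytic.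
\<close>

definition AMv :: "nat \<Rightarrow> nat \<Rightarrow> mvf \<Rightarrow> (complex \<Rightarrow> complex mat) \<Rightarrow> bool" where
  "AMv p k X X0 \<longleftrightarrow> AM p k X \<and> (\<forall>\<alpha>\<in>ball 0 1. X0 \<alpha> \<in> carrier_mat p k \<and>
     AM p k (\<lambda>\<zeta>. (1 / (\<zeta> - \<alpha>)) \<cdot>\<^sub>m (X \<zeta> - X0 \<alpha>)))"

lemma AMv_split:
  assumes "AMv p k X X0" "\<alpha> \<in> ball 0 1" "\<zeta> \<in> sphere 0 1" "c \<in> carrier_vec k"
  shows "X \<zeta> *\<^sub>v c = X0 \<alpha> *\<^sub>v c + (\<zeta> - \<alpha>) \<cdot>\<^sub>v (((1 / (\<zeta> - \<alpha>)) \<cdot>\<^sub>m (X \<zeta> - X0 \<alpha>)) *\<^sub>v c)"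
proof -
  have X: "X \<zeta> \<in> carrier_mat p k" "X0 \<alpha> \<in> carrier_mat p k" using assms by (auto simp: AMv_def AM_def)
  then have Q: "(1 / (\<zeta> - \<alpha>)) \<cdot>\<^sub>m (X \<zeta> - X0 \<alpha>) \<in> carrier_mat p k" by auto
  show ?thesis
  proof (rule eq_vecI)
    have nz: "\<zeta> - \<alpha> \<noteq> 0" using assms by auto
    fix i assume "i < dim_vec (X0 \<alpha> *\<^sub>v c + (\<zeta> - \<alpha>) \<cdot>\<^sub>v (((1 / (\<zeta> - \<alpha>)) \<cdot>\<^sub>m (X \<zeta> - X0 \<alpha>)) *\<^sub>v c))"
    then have i: "i < p" using X by simp
    have "(X0 \<alpha> *\<^sub>v c + (\<zeta> - \<alpha>) \<cdot>\<^sub>v (((1 / (\<zeta> - \<alpha>)) \<cdot>\<^sub>m (X \<zeta> - X0 \<alpha>)) *\<^sub>v c)) $ i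
        = (X0 \<alpha> *\<^sub>v c) $ i + (\<zeta> - \<alpha>) * (((1 / (\<zeta> - \<alpha>)) \<cdot>\<^sub>m (X \<zeta> - X0 \<alpha>)) *\<^sub>v c) $ i"
      using X i by simp
    also have "\<dots> = (\<Sum>j<k. X0 \<alpha> $$ (i, j) * c $ j) + (\<Sum>j<k. (X \<zeta> $$ (i, j) - X0 \<alpha> $$ (i, j)) * c $ j)"
      unfolding mult_mat_vec_index[OF X(2) assms(4) i] mult_mat_vec_index[OF Q assms(4) i] sum_distrib_left
      by (intro arg_cong2[where f="(+)"] sum.cong refl) (use X i nz in auto)
    also have "\<dots> = (\<Sum>j<k. X \<zeta> $$ (i, j) * c $ j)"
      by (simp add: sum.distrib[symmetric] distrib_right[symmetric])
    also have "\<dots> = (X \<zeta> *\<^sub>v c) $ i" by (rule mult_mat_vec_index[OF X(1) assms(4) i, symmetric])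
    finally show "(X \<zeta> *\<^sub>v c) $ i = (X0 \<alpha> *\<^sub>v c + (\<zeta> - \<alpha>) \<cdot>\<^sub>v (((1 / (\<zeta> - \<alpha>)) \<cdot>\<^sub>m (X \<zeta> - X0 \<alpha>)) *\<^sub>v c)) $ i" ..
  qed (use X in simp)
qed

text \<open>
  A single step writes $y = X a + Y b + m_\alpha y'$. Repeating it for all $\alpha$ in the list leaves a
  remainder with the factor $\prod m_\alpha$, which the last hypothesis places in the range of $X$. The two uses are
  $V = H_2$ with $m_\alpha = \zeta - \alpha$ and $V = (H_2)^\perp$ with the conjugate factor.
\<close>

lemma corona_iteration:
  fixes V :: "nat \<Rightarrow> vvf set" and m :: "complex \<Rightarrow> complex \<Rightarrow> complex"
  assumes car: "\<And>k f \<zeta>. f \<in> V k \<Longrightarrow> \<zeta> \<in> sphere 0 1 \<Longrightarrow> f \<zeta> \<in> carrier_vec k"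
    and add: "\<And>k f g. f \<in> V k \<Longrightarrow> g \<in> V k \<Longrightarrow> vv_add f g \<in> V k"
    and scale: "\<And>k f \<alpha>. f \<in> V k \<Longrightarrow> \<alpha> \<in> ball 0 1 \<Longrightarrow> vv_scale (m \<alpha>) f \<in> V k"
    and zero: "\<And>k. (\<lambda>_. 0\<^sub>v k) \<in> V k"
    and X: "\<And>\<zeta>. \<zeta> \<in> sphere 0 1 \<Longrightarrow> X \<zeta> \<in> carrier_mat p k"
    and Y: "\<And>\<zeta>. \<zeta> \<in> sphere 0 1 \<Longrightarrow> Y \<zeta> \<in> carrier_mat p l"
    and step: "\<And>y \<alpha>. y \<in> V p \<Longrightarrow> \<alpha> \<in> ball 0 1 \<Longrightarrow> \<exists>a\<in>V k. \<exists>b\<in>V l. \<exists>y'\<in>V p.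
         \<forall>\<zeta>\<in>sphere 0 1. y \<zeta> = X \<zeta> *\<^sub>v a \<zeta> + Y \<zeta> *\<^sub>v b \<zeta> + m \<alpha> \<zeta> \<cdot>\<^sub>v y' \<zeta>"
    and as: "set as \<subseteq> ball 0 1"
    and fin: "\<And>y. y \<in> V p \<Longrightarrow> \<exists>a\<in>V k. \<forall>\<zeta>\<in>sphere 0 1. prod_list (map (\<lambda>\<alpha>. m \<alpha> \<zeta>) as) \<cdot>\<^sub>v y \<zeta> = X \<zeta> *\<^sub>v a \<zeta>"
    and y: "y \<in> V p"
  shows "\<exists>a\<in>V k. \<exists>b\<in>V l. \<forall>\<zeta>\<in>sphere 0 1. y \<zeta> = X \<zeta> *\<^sub>v a \<zeta> + Y \<zeta> *\<^sub>v b \<zeta>"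
proof -
  define M where "M as \<zeta> = prod_list (map (\<lambda>\<alpha>. m \<alpha> \<zeta>) as)" for as \<zeta>
  have Mscale: "vv_scale (M bs) f \<in> V j" if "f \<in> V j" "set bs \<subseteq> ball 0 1" for bs f j
    using that(2)
  proof (induction bs)
    case Nil
    have "vv_scale (M []) f = f" by (auto simp: vv_scale_def M_def)
    then show ?case using that(1) by simp
  next
    case (Cons \<beta> bs)
    have "vv_scale (M (\<beta> # bs)) f = vv_scale (m \<beta>) (vv_scale (M bs) f)"
      by (auto simp: vv_scale_def M_def smult_smult_assoc)
    then show ?case using Cons scale by simp
  qed
  have it: "\<exists>a\<in>V k. \<exists>b\<in>V l. \<exists>y'\<in>V p. \<forall>\<zeta>\<in>sphere 0 1. y \<zeta> = X \<zeta> *\<^sub>v a \<zeta> + Y \<zeta> *\<^sub>v b \<zeta> + M bs \<zeta> \<cdot>\<^sub>v y' \<zeta>"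
    if "set bs \<subseteq> ball 0 1" for bs
    using that
  proof (induction bs)
    case Nil
    have "y \<zeta> = X \<zeta> *\<^sub>v 0\<^sub>v k + Y \<zeta> *\<^sub>v 0\<^sub>v l + M [] \<zeta> \<cdot>\<^sub>v y \<zeta>" if "\<zeta> \<in> sphere 0 1" for \<zeta>
    proof -
      have "X \<zeta> *\<^sub>v 0\<^sub>v k = 0\<^sub>v p" "Y \<zeta> *\<^sub>v 0\<^sub>v l = 0\<^sub>v p" using X[OF that] Y[OF that] by auto
      then show ?thesis using car[OF y that] by (simp add: M_def)
    qed
    then show ?case
      by (intro bexI[of _ "\<lambda>_. 0\<^sub>v k"] bexI[of _ "\<lambda>_. 0\<^sub>v l"] bexI[of _ y] ballI zero y)
  next
    case (Cons \<beta> bs)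
    then have \<beta>: "\<beta> \<in> ball 0 1" and bs: "set bs \<subseteq> ball 0 1" by auto
    from Cons.IH[OF bs] obtain a b y1 where 1: "a \<in> V k" "b \<in> V l" "y1 \<in> V p"
      "\<forall>\<zeta>\<in>sphere 0 1. y \<zeta> = X \<zeta> *\<^sub>v a \<zeta> + Y \<zeta> *\<^sub>v b \<zeta> + M bs \<zeta> \<cdot>\<^sub>v y1 \<zeta>" by blast
    from step[OF 1(3) \<beta>] obtain a' b' y2 where 2: "a' \<in> V k" "b' \<in> V l" "y2 \<in> V p"
      "\<forall>\<zeta>\<in>sphere 0 1. y1 \<zeta> = X \<zeta> *\<^sub>v a' \<zeta> + Y \<zeta> *\<^sub>v b' \<zeta> + m \<beta> \<zeta> \<cdot>\<^sub>v y2 \<zeta>" by blast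
    let ?a = "vv_add a (vv_scale (M bs) a')" and ?b = "vv_add b (vv_scale (M bs) b')"
    have "y \<zeta> = X \<zeta> *\<^sub>v ?a \<zeta> + Y \<zeta> *\<^sub>v ?b \<zeta> + M (\<beta> # bs) \<zeta> \<cdot>\<^sub>v y2 \<zeta>" if \<zeta>: "\<zeta> \<in> sphere 0 1" for \<zeta>
    proof -
      note c = X[OF \<zeta>] Y[OF \<zeta>] car[OF 1(1) \<zeta>] car[OF 1(2) \<zeta>] car[OF 2(1) \<zeta>] car[OF 2(2) \<zeta>] car[OF 2(3) \<zeta>]
      have Xa: "X \<zeta> *\<^sub>v ?a \<zeta> = X \<zeta> *\<^sub>v a \<zeta> + M bs \<zeta> \<cdot>\<^sub>v (X \<zeta> *\<^sub>v a' \<zeta>)"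
        unfolding vv_add_def vv_scale_def using c
        by (subst mult_add_distrib_mat_vec[of _ p k]) (auto simp: mult_mat_vec[of _ p k])
      have Yb: "Y \<zeta> *\<^sub>v ?b \<zeta> = Y \<zeta> *\<^sub>v b \<zeta> + M bs \<zeta> \<cdot>\<^sub>v (Y \<zeta> *\<^sub>v b' \<zeta>)"
        unfolding vv_add_def vv_scale_def using c
        by (subst mult_add_distrib_mat_vec[of _ p l]) (auto simp: mult_mat_vec[of _ p l])
      define v1 v2 v3 v4 v5 where v: "v1 = X \<zeta> *\<^sub>v a \<zeta>" "v2 = X \<zeta> *\<^sub>v a' \<zeta>" "v3 = Y \<zeta> *\<^sub>v b \<zeta>" "v4 = Y \<zeta> *\<^sub>v b' \<zeta>" "v5 = y2 \<zeta>"
      have vc: "dim_vec v1 = p" "dim_vec v2 = p" "dim_vec v3 = p" "dim_vec v4 = p" "dim_vec v5 = p"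
        using c by (auto simp: v)
      show ?thesis
        unfolding Xa Yb 1(4)[rule_format, OF \<zeta>] 2(4)[rule_format, OF \<zeta>] v[symmetric]
        by (intro eq_vecI) (auto simp: vc M_def algebra_simps)
    qed
    moreover have "?a \<in> V k" "?b \<in> V l" using 1 2 bs by (auto intro!: add Mscale)
    ultimately show ?case using 2(3) by blast
  qed
  from it[OF as] obtain a b y1 where 1: "a \<in> V k" "b \<in> V l" "y1 \<in> V p"
      "\<forall>\<zeta>\<in>sphere 0 1. y \<zeta> = X \<zeta> *\<^sub>v a \<zeta> + Y \<zeta> *\<^sub>v b \<zeta> + M as \<zeta> \<cdot>\<^sub>v y1 \<zeta>" by blast
  from fin[OF 1(3)] obtain a' where 2: "a' \<in> V k" "\<forall>\<zeta>\<in>sphere 0 1. M as \<zeta> \<cdot>\<^sub>v y1 \<zeta> = X \<zeta> *\<^sub>v a' \<zeta>"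
    unfolding M_def by blast
  have "y \<zeta> = X \<zeta> *\<^sub>v vv_add a a' \<zeta> + Y \<zeta> *\<^sub>v b \<zeta>" if \<zeta>: "\<zeta> \<in> sphere 0 1" for \<zeta>
  proof -
    note c = X[OF \<zeta>] Y[OF \<zeta>] car[OF 1(1) \<zeta>] car[OF 1(2) \<zeta>] car[OF 2(1) \<zeta>]
    have Xa: "X \<zeta> *\<^sub>v vv_add a a' \<zeta> = X \<zeta> *\<^sub>v a \<zeta> + X \<zeta> *\<^sub>v a' \<zeta>"
      unfolding vv_add_def using c by (intro mult_add_distrib_mat_vec[of _ p k]) auto
    show ?thesis
      unfolding Xa 1(4)[rule_format, OF \<zeta>] 2(2)[rule_format, OF \<zeta>]
      using c by (intro eq_vecI) auto
  qed
  moreover have "vv_add a a' \<in> V k" using 1 2 by (auto intro: add)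
  ultimately show ?thesis using 1(2) by blast
qed

lemma minus_const_hinf: "(\<lambda>\<zeta>. \<zeta> - \<alpha>) \<in> hinf"
  by (rule hinf_holomorphic) (auto intro!: continuous_intros holomorphic_intros)

lemma mv_mult_const_H2:
  assumes "AM p k X" "c \<in> carrier_vec k" shows "(\<lambda>\<zeta>. X \<zeta> *\<^sub>v c) \<in> H2 p"
  using H2_mv[OF assms(1) H2_const[OF assms(2)]] by (simp add: mv_mult_def)

text \<open>
  For the step, split $y = c + (\zeta - \alpha) y_1$ and write the constant as
  $c = X_0(\alpha) c_1 + Y_0(\alpha) c_2$. Since $X - X_0(\alpha)$ and $Y - Y_0(\alpha)$ are divisible by $\zeta - \alpha$, replacing
  the values at $\alpha$ by $X$ and $Y$ only changes the remainder.
\<close>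

lemma corona_H2:
  assumes X: "AMv p k X X0" and Y: "AMv p l Y Y0"
    and onto: "\<And>\<alpha> c. \<alpha> \<in> ball 0 1 \<Longrightarrow> c \<in> carrier_vec p \<Longrightarrow>
        \<exists>c1\<in>carrier_vec k. \<exists>c2\<in>carrier_vec l. c = X0 \<alpha> *\<^sub>v c1 + Y0 \<alpha> *\<^sub>v c2"
    and as: "set as \<subseteq> ball 0 1"
    and fin: "\<And>y. y \<in> H2 p \<Longrightarrow> \<exists>a\<in>H2 k. \<forall>\<zeta>\<in>sphere 0 1. prod_list (map (\<lambda>\<alpha>. \<zeta> - \<alpha>) as) \<cdot>\<^sub>v y \<zeta> = X \<zeta> *\<^sub>v a \<zeta>"
    and y: "y \<in> H2 p"
  shows "\<exists>a\<in>H2 k. \<exists>b\<in>H2 l. \<forall>\<zeta>\<in>sphere 0 1. y \<zeta> = X \<zeta> *\<^sub>v a \<zeta> + Y \<zeta> *\<^sub>v b \<zeta>"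
proof (rule corona_iteration[where V=H2 and m="\<lambda>\<alpha> \<zeta>. \<zeta> - \<alpha>", OF _ _ _ _ _ _ _ as fin y])
  have XA: "AM p k X" and YA: "AM p l Y" using X Y by (auto simp: AMv_def)
  show "f \<zeta> \<in> carrier_vec j" if "f \<in> H2 j" "\<zeta> \<in> sphere 0 1" for j f \<zeta>
    using L2_carrier[OF H2_L2[OF that(1)] that(2)] .
  show "vv_scale (\<lambda>\<zeta>. \<zeta> - \<alpha>) f \<in> H2 j" if "f \<in> H2 j" for j f \<alpha> using H2_scale[OF minus_const_hinf that] .
  show "X \<zeta> \<in> carrier_mat p k" "Y \<zeta> \<in> carrier_mat p l" if "\<zeta> \<in> sphere 0 1" for \<zeta>
    using AM_carrier[OF XA that] AM_carrier[OF YA that] .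
  show "\<exists>a\<in>H2 k. \<exists>b\<in>H2 l. \<exists>y'\<in>H2 p. \<forall>\<zeta>\<in>sphere 0 1. y \<zeta> = X \<zeta> *\<^sub>v a \<zeta> + Y \<zeta> *\<^sub>v b \<zeta> + (\<zeta> - \<alpha>) \<cdot>\<^sub>v y' \<zeta>"
    if y: "y \<in> H2 p" and \<alpha>: "\<alpha> \<in> ball 0 1" for y \<alpha>
  proof -
    obtain c y1 where c: "c \<in> carrier_vec p" and y1: "y1 \<in> H2 p"
      and ys: "\<And>\<zeta>. \<zeta> \<in> sphere 0 1 \<Longrightarrow> y \<zeta> = c + (\<zeta> - \<alpha>) \<cdot>\<^sub>v y1 \<zeta>"
      by (rule H2_split_at[OF y \<alpha>]) blast
    from onto[OF \<alpha> c] obtain c1 c2 where c12: "c1 \<in> carrier_vec k" "c2 \<in> carrier_vec l"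
      and cs: "c = X0 \<alpha> *\<^sub>v c1 + Y0 \<alpha> *\<^sub>v c2" by blast
    define Qx where "Qx = (\<lambda>\<zeta>. (1 / (\<zeta> - \<alpha>)) \<cdot>\<^sub>m (X \<zeta> - X0 \<alpha>))"
    define Qy where "Qy = (\<lambda>\<zeta>. (1 / (\<zeta> - \<alpha>)) \<cdot>\<^sub>m (Y \<zeta> - Y0 \<alpha>))"
    have Q: "AM p k Qx" "AM p l Qy" "X0 \<alpha> \<in> carrier_mat p k" "Y0 \<alpha> \<in> carrier_mat p l"
      using X Y \<alpha> by (auto simp: AMv_def Qx_def Qy_def)
    let ?y' = "vv_diff (vv_diff y1 (\<lambda>\<zeta>. Qx \<zeta> *\<^sub>v c1)) (\<lambda>\<zeta>. Qy \<zeta> *\<^sub>v c2)"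
    have "?y' \<in> H2 p" by (intro H2_diff y1 mv_mult_const_H2[OF Q(1) c12(1)] mv_mult_const_H2[OF Q(2) c12(2)])
    moreover have "y \<zeta> = X \<zeta> *\<^sub>v c1 + Y \<zeta> *\<^sub>v c2 + (\<zeta> - \<alpha>) \<cdot>\<^sub>v ?y' \<zeta>" if \<zeta>: "\<zeta> \<in> sphere 0 1" for \<zeta>
    proof -
      define u1 u2 u3 u4 u5 where u: "u1 = X0 \<alpha> *\<^sub>v c1" "u2 = Y0 \<alpha> *\<^sub>v c2" "u3 = Qx \<zeta> *\<^sub>v c1" "u4 = Qy \<zeta> *\<^sub>v c2" "u5 = y1 \<zeta>"
      have uc: "dim_vec u1 = p" "dim_vec u2 = p" "dim_vec u3 = p" "dim_vec u4 = p" "dim_vec u5 = p"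
        using Q(3,4) AM_carrier[OF Q(1) \<zeta>] AM_carrier[OF Q(2) \<zeta>] L2_carrier[OF H2_L2[OF y1] \<zeta>] by (auto simp: u)
      show ?thesis
        unfolding ys[OF \<zeta>] cs AMv_split[OF X \<alpha> \<zeta> c12(1), folded Qx_def] AMv_split[OF Y \<alpha> \<zeta> c12(2), folded Qy_def]
          vv_diff_def
        unfolding Qx_def[symmetric] Qy_def[symmetric]
        unfolding fun_cong[OF Qx_def, of \<zeta>, symmetric] fun_cong[OF Qy_def, of \<zeta>, symmetric] u[symmetric]
        by (intro eq_vecI) (auto simp: uc algebra_simps)
    qed
    ultimately show ?thesis
      using H2_const[OF c12(1)] H2_const[OF c12(2)] by (intro bexI[of _ "\<lambda>_. c1"] bexI[of _ "\<lambda>_. c2"] bexI[of _ ?y']) auto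
  qed
qed (auto intro: H2_add H2_const)

lemma H2_perp_cnj_const:
  assumes "c \<in> carrier_vec k" shows "vv_scale cnj (\<lambda>_. c) \<in> H2_perp k"
  unfolding H2_perp_iff
proof (intro conjI ballI)
  have cl: "cnj \<in> linf" using linf_cnj[OF linf_id] .
  have L: "vv_scale cnj (\<lambda>_. c) \<in> L2 k" by (rule L2_scale[OF cl H2_L2[OF H2_const[OF assms]]])
  then show "vv_scale cnj (\<lambda>_. c) \<in> L2 k" .
  fix g assume g: "g \<in> H2 k"
  have "L2_inner (vv_scale cnj (\<lambda>_. c)) g = (\<Sum>i<k. ip (\<lambda>\<zeta>. vv_scale cnj (\<lambda>_. c) \<zeta> $ i) (\<lambda>\<zeta>. g \<zeta> $ i))"
    by (rule L2_inner_ip[OF L H2_L2[OF g]])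
  also have "\<dots> = (\<Sum>i<k. c $ i * ip (\<lambda>\<zeta>. 1 / (\<zeta> - 0)) (\<lambda>\<zeta>. g \<zeta> $ i))"
  proof (rule sum.cong[OF refl], subst ip_scale_left[symmetric], unfold ip_def, rule cmean_cong)
    fix i and \<zeta> :: complex assume i: "i \<in> {..<k}" and \<zeta>: "\<zeta> \<in> sphere 0 1"
    show "vv_scale cnj (\<lambda>_. c) \<zeta> $ i * cnj (g \<zeta> $ i) = c $ i * (1 / (\<zeta> - 0)) * cnj (g \<zeta> $ i)"
      using i cnj_sphere[OF \<zeta>] assms by (simp add: vv_scale_def)
  qed
  also have "\<dots> = 0" using H2_comp[OF g] by (intro sum.neutral ballI)
    (simp only: ip_kernel_h2[of 0] centre_in_ball zero_less_one lessThan_iff mult_zero_right)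
  finally show "L2_inner (vv_scale cnj (\<lambda>_. c)) g = 0" .
qed

lemma AMv_split_adj:
  assumes "AMv k p X X0" "\<alpha> \<in> ball 0 1" "\<zeta> \<in> sphere 0 1" "c \<in> carrier_vec k"
  shows "mat_adjoint (X \<zeta>) *\<^sub>v c = mat_adjoint (X0 \<alpha>) *\<^sub>v c
    + cnj (\<zeta> - \<alpha>) \<cdot>\<^sub>v (mat_adjoint ((1 / (\<zeta> - \<alpha>)) \<cdot>\<^sub>m (X \<zeta> - X0 \<alpha>)) *\<^sub>v c)"
proof -
  have X: "X \<zeta> \<in> carrier_mat k p" "X0 \<alpha> \<in> carrier_mat k p" using assms by (auto simp: AMv_def AM_def)
  define Q where "Q = (1 / (\<zeta> - \<alpha>)) \<cdot>\<^sub>m (X \<zeta> - X0 \<alpha>)"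
  have Q: "Q \<in> carrier_mat k p" using X by (auto simp: Q_def)
  have nz: "\<zeta> - \<alpha> \<noteq> 0" using assms by auto
  have entry: "X \<zeta> $$ (j, i) = X0 \<alpha> $$ (j, i) + (\<zeta> - \<alpha>) * Q $$ (j, i)" if "i < p" "j < k" for i j
    using X that nz by (simp add: Q_def)
  show ?thesis
    unfolding Q_def[symmetric]
  proof (rule eq_vecI)
    fix i assume "i < dim_vec (mat_adjoint (X0 \<alpha>) *\<^sub>v c + cnj (\<zeta> - \<alpha>) \<cdot>\<^sub>v (mat_adjoint Q *\<^sub>v c))"
    then have i: "i < p" using X Q by simp
    have "(mat_adjoint (X \<zeta>) *\<^sub>v c) $ i = (\<Sum>j<k. cnj (X \<zeta> $$ (j, i)) * c $ j)"
      unfolding mult_mat_vec_index[OF mat_adjoint_carrier[OF X(1)] assms(4) i] using X i by (intro sum.cong) auto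
    also have "\<dots> = (\<Sum>j<k. cnj (X0 \<alpha> $$ (j, i)) * c $ j) + cnj (\<zeta> - \<alpha>) * (\<Sum>j<k. cnj (Q $$ (j, i)) * c $ j)"
      unfolding sum_distrib_left sum.distrib[symmetric]
      by (rule sum.cong[OF refl]) (simp only: lessThan_iff entry[OF i] complex_cnj_add complex_cnj_mult distrib_right mult.assoc)
    also have "\<dots> = (mat_adjoint (X0 \<alpha>) *\<^sub>v c) $ i + cnj (\<zeta> - \<alpha>) * (mat_adjoint Q *\<^sub>v c) $ i"
      unfolding mult_mat_vec_index[OF mat_adjoint_carrier[OF X(2)] assms(4) i] mult_mat_vec_index[OF mat_adjoint_carrier[OF Q] assms(4) i]
      using X Q i by (intro arg_cong2[where f="(+)"] arg_cong2[where f="(*)"] sum.cong refl) auto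
    finally show "(mat_adjoint (X \<zeta>) *\<^sub>v c) $ i = (mat_adjoint (X0 \<alpha>) *\<^sub>v c + cnj (\<zeta> - \<alpha>) \<cdot>\<^sub>v (mat_adjoint Q *\<^sub>v c)) $ i"
      using X Q i by simp
  qed (use X Q in simp)
qed

text \<open>
  The same argument for the adjoints, with the constants multiplied by $\overline\zeta$ so that they lie in $(H_2)^\perp$.
\<close>

lemma corona_H2_perp:
  assumes X: "AMv k p X X0" and Y: "AMv l p Y Y0"
    and onto: "\<And>\<alpha> c. \<alpha> \<in> ball 0 1 \<Longrightarrow> c \<in> carrier_vec p \<Longrightarrow>
        \<exists>c1\<in>carrier_vec k. \<exists>c2\<in>carrier_vec l. c = mat_adjoint (X0 \<alpha>) *\<^sub>v c1 + mat_adjoint (Y0 \<alpha>) *\<^sub>v c2"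
    and as: "set as \<subseteq> ball 0 1"
    and fin: "\<And>y. y \<in> H2_perp p \<Longrightarrow> \<exists>a\<in>H2_perp k. \<forall>\<zeta>\<in>sphere 0 1.
        prod_list (map (\<lambda>\<alpha>. cnj (\<zeta> - \<alpha>)) as) \<cdot>\<^sub>v y \<zeta> = mat_adjoint (X \<zeta>) *\<^sub>v a \<zeta>"
    and y: "y \<in> H2_perp p"
  shows "\<exists>a\<in>H2_perp k. \<exists>b\<in>H2_perp l. \<forall>\<zeta>\<in>sphere 0 1. y \<zeta> = mat_adjoint (X \<zeta>) *\<^sub>v a \<zeta> + mat_adjoint (Y \<zeta>) *\<^sub>v b \<zeta>"
proof (rule corona_iteration[where V=H2_perp and m="\<lambda>\<alpha> \<zeta>. cnj (\<zeta> - \<alpha>)", OF _ _ _ _ _ _ _ as fin y])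
  have XA: "AM k p X" and YA: "AM l p Y" using X Y by (auto simp: AMv_def)
  show "f \<zeta> \<in> carrier_vec j" if "f \<in> H2_perp j" "\<zeta> \<in> sphere 0 1" for j f \<zeta>
    using L2_carrier[OF H2_perp_L2[OF that(1)] that(2)] .
  show "vv_scale (\<lambda>\<zeta>. cnj (\<zeta> - \<alpha>)) f \<in> H2_perp j" if "f \<in> H2_perp j" for j f \<alpha>
    using H2_perp_scale_cnj[OF minus_const_hinf that] .
  show "mat_adjoint (X \<zeta>) \<in> carrier_mat p k" "mat_adjoint (Y \<zeta>) \<in> carrier_mat p l" if "\<zeta> \<in> sphere 0 1" for \<zeta>
    using AM_carrier[OF XA that] AM_carrier[OF YA that] by auto
  show "(\<lambda>_. 0\<^sub>v j) \<in> H2_perp j" for j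
    by (rule H2_perp_cong[OF H2_perp_cnj_const[of "0\<^sub>v j"]]) (auto simp: vv_scale_def)
  show "\<exists>a\<in>H2_perp k. \<exists>b\<in>H2_perp l. \<exists>y'\<in>H2_perp p. \<forall>\<zeta>\<in>sphere 0 1.
      y \<zeta> = mat_adjoint (X \<zeta>) *\<^sub>v a \<zeta> + mat_adjoint (Y \<zeta>) *\<^sub>v b \<zeta> + cnj (\<zeta> - \<alpha>) \<cdot>\<^sub>v y' \<zeta>"
    if y: "y \<in> H2_perp p" and \<alpha>: "\<alpha> \<in> ball 0 1" for y \<alpha>
  proof -
    obtain c y1 where c: "c \<in> carrier_vec p" and y1: "y1 \<in> H2_perp p"
      and ys: "\<And>\<zeta>. \<zeta> \<in> sphere 0 1 \<Longrightarrow> y \<zeta> = cnj \<zeta> \<cdot>\<^sub>v c + cnj (\<zeta> - \<alpha>) \<cdot>\<^sub>v y1 \<zeta>"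
      by (rule H2_perp_split_at[OF y \<alpha>]) blast
    from onto[OF \<alpha> c] obtain c1 c2 where c12: "c1 \<in> carrier_vec k" "c2 \<in> carrier_vec l"
      and cs: "c = mat_adjoint (X0 \<alpha>) *\<^sub>v c1 + mat_adjoint (Y0 \<alpha>) *\<^sub>v c2" by blast
    define Qx where "Qx = (\<lambda>\<zeta>. (1 / (\<zeta> - \<alpha>)) \<cdot>\<^sub>m (X \<zeta> - X0 \<alpha>))"
    define Qy where "Qy = (\<lambda>\<zeta>. (1 / (\<zeta> - \<alpha>)) \<cdot>\<^sub>m (Y \<zeta> - Y0 \<alpha>))"
    have Q: "AM k p Qx" "AM l p Qy" "X0 \<alpha> \<in> carrier_mat k p" "Y0 \<alpha> \<in> carrier_mat l p"
      using X Y \<alpha> by (auto simp: AMv_def Qx_def Qy_def)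
    let ?c1 = "vv_scale cnj (\<lambda>_. c1)" and ?c2 = "vv_scale cnj (\<lambda>_. c2)"
    let ?y' = "vv_diff (vv_diff y1 (mv_mult (mvf_adj Qx) ?c1)) (mv_mult (mvf_adj Qy) ?c2)"
    note cP = H2_perp_cnj_const[OF c12(1)] H2_perp_cnj_const[OF c12(2)]
    have "?y' \<in> H2_perp p" by (intro H2_perp_diff y1 H2_perp_adj[OF Q(1) cP(1)] H2_perp_adj[OF Q(2) cP(2)])
    moreover have "y \<zeta> = mat_adjoint (X \<zeta>) *\<^sub>v ?c1 \<zeta> + mat_adjoint (Y \<zeta>) *\<^sub>v ?c2 \<zeta> + cnj (\<zeta> - \<alpha>) \<cdot>\<^sub>v ?y' \<zeta>"
      if \<zeta>: "\<zeta> \<in> sphere 0 1" for \<zeta>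
    proof -
      note cc = L2_carrier[OF H2_perp_L2[OF cP(1)] \<zeta>] L2_carrier[OF H2_perp_L2[OF cP(2)] \<zeta>]
      have A0: "mat_adjoint (X0 \<alpha>) \<in> carrier_mat p k" "mat_adjoint (Y0 \<alpha>) \<in> carrier_mat p l" using Q by auto
      have k1: "mat_adjoint (X0 \<alpha>) *\<^sub>v ?c1 \<zeta> = cnj \<zeta> \<cdot>\<^sub>v (mat_adjoint (X0 \<alpha>) *\<^sub>v c1)"
        unfolding vv_scale_def by (rule mult_mat_vec[OF A0(1) c12(1)])
      have k2: "mat_adjoint (Y0 \<alpha>) *\<^sub>v ?c2 \<zeta> = cnj \<zeta> \<cdot>\<^sub>v (mat_adjoint (Y0 \<alpha>) *\<^sub>v c2)"
        unfolding vv_scale_def by (rule mult_mat_vec[OF A0(2) c12(2)])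
      define u1 u2 u3 u4 u5 where u: "u1 = mat_adjoint (X0 \<alpha>) *\<^sub>v c1" "u2 = mat_adjoint (Y0 \<alpha>) *\<^sub>v c2"
        "u3 = mat_adjoint (Qx \<zeta>) *\<^sub>v ?c1 \<zeta>" "u4 = mat_adjoint (Qy \<zeta>) *\<^sub>v ?c2 \<zeta>" "u5 = y1 \<zeta>"
      have uc: "dim_vec u1 = p" "dim_vec u2 = p" "dim_vec u3 = p" "dim_vec u4 = p" "dim_vec u5 = p"
        using Q(3,4) AM_carrier[OF Q(1) \<zeta>] AM_carrier[OF Q(2) \<zeta>] L2_carrier[OF H2_perp_L2[OF y1] \<zeta>] by (auto simp: u)
      have yv: "?y' \<zeta> = (u5 - u3) - u4" by (simp add: vv_diff_def mv_mult_def mvf_adj_def u)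
      show ?thesis
        unfolding ys[OF \<zeta>] cs AMv_split_adj[OF X \<alpha> \<zeta> cc(1)] AMv_split_adj[OF Y \<alpha> \<zeta> cc(2)] yv k1 k2
        unfolding fun_cong[OF Qx_def, of \<zeta>, symmetric] fun_cong[OF Qy_def, of \<zeta>, symmetric] u[symmetric]
        by (intro eq_vecI) (auto simp: uc algebra_simps)
    qed
    ultimately show ?thesis
      using cP by (intro bexI[of _ ?c1] bexI[of _ ?c2] bexI[of _ ?y']) auto
  qed
qed (auto intro: H2_perp_add)

section \<open>Blaschke--Potapov products\<close>

text \<open>
  The properties of Blaschke--Potapov products that are used: they are inner; every element of $L_2$ has an
  orthogonal projection to $H_2 \ominus b H_2$, whose complement in $H_2$ is $b H_2$; and $b^*$ becomes analytic after
  multiplication with a polynomial. Stating them as one predicate makes it easy to see that products inherit them.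
\<close>

definition finite_inner :: "nat \<Rightarrow> mvf \<Rightarrow> bool" where
  "finite_inner k b \<longleftrightarrow> AM k k b \<and>
     (\<forall>\<zeta>\<in>sphere 0 1. mat_adjoint (b \<zeta>) * b \<zeta> = 1\<^sub>m k \<and> b \<zeta> * mat_adjoint (b \<zeta>) = 1\<^sub>m k) \<and>
     (\<forall>f\<in>L2 k. \<exists>g\<in>H_b k b. (\<forall>h\<in>H_b k b. L2_inner (vv_diff f g) h = 0) \<and>
        (f \<in> H2 k \<longrightarrow> mv_mult (mvf_adj b) (vv_diff f g) \<in> H2 k)) \<and>
     (\<exists>as. set as \<subseteq> ball 0 1 \<and>
        AM k k (\<lambda>\<zeta>. prod_list (map (\<lambda>\<alpha>. \<zeta> - \<alpha>) as) \<cdot>\<^sub>m mat_adjoint (b \<zeta>)))"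

lemma H_b_iff: "f \<in> H_b k b \<longleftrightarrow> f \<in> H2 k \<and> (\<forall>y\<in>H2 k. L2_inner f (mv_mult b y) = 0)"
  by (auto simp: H_b_def ominus_def)

lemma H_b_L2: "f \<in> H_b k b \<Longrightarrow> f \<in> L2 k" by (simp add: H_b_iff H2_L2)

lemma H_b_add:
  assumes "AM k k b" "f \<in> H_b k b" "g \<in> H_b k b" shows "vv_add f g \<in> H_b k b"
  using assms L2_inner_add_left[OF H_b_L2[OF assms(2)] H_b_L2[OF assms(3)] L2_mv[OF AM_LM[OF assms(1)]]]
  by (auto simp: H_b_iff H2_add H2_L2)

lemma H_b_diff:
  assumes "AM k k b" "f \<in> H_b k b" "g \<in> H_b k b" shows "vv_diff f g \<in> H_b k b"
  using assms L2_inner_diff_left[OF H_b_L2[OF assms(2)] H_b_L2[OF assms(3)] L2_mv[OF AM_LM[OF assms(1)]]]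
  by (auto simp: H_b_iff H2_diff H2_L2)

lemma unitary_cancel:
  assumes "X \<in> carrier_mat k k" "f \<in> carrier_vec k" "Y \<in> carrier_mat k k" "X * Y = 1\<^sub>m k"
  shows "X *\<^sub>v (Y *\<^sub>v f) = (f :: complex vec)"
  using assms by (simp add: assoc_mult_mat_vec[symmetric])

text \<open>
  An element of $H_2 \ominus b H_2$ that lies in $b H_2$ is orthogonal to itself.
\<close>

lemma inner_zero_of_H_b_range:
  assumes b: "AM k k b" and r: "r \<in> H_b k b" "y \<in> H2 k" "\<And>\<zeta>. \<zeta> \<in> sphere 0 1 \<Longrightarrow> r \<zeta> = mv_mult b y \<zeta>"
    and x: "x \<in> L2 k"
  shows "L2_inner x r = 0"
proof -
  note rL = H_b_L2[OF r(1)]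
  have "L2_inner r r = L2_inner r (mv_mult b y)" by (rule L2_inner_sphere_cong) (use r in auto)
  then have "L2_inner r r = 0" using r by (simp add: H_b_iff)
  then have ae: "AE \<theta> in arc. r (cis \<theta>) = 0\<^sub>v k" by (rule L2_inner_zero_imp[OF rL])
  have z: "(\<lambda>_. 0\<^sub>v k) \<in> L2 k" by (rule H2_L2[OF H2_const]) simp
  have "L2_inner x r = L2_inner x (\<lambda>_. 0\<^sub>v k)"
    by (rule L2_inner_eq_cong[OF x rL x z L2_eq_sphere]) (use ae in \<open>auto simp: L2_eq_def\<close>)
  also have "\<dots> = 0"
  proof -
    have "x (cis \<theta>) \<bullet>c 0\<^sub>v k = 0" for \<theta>
      using cscalar_prod_sum[of "0\<^sub>v k" k] by simp
    then show ?thesis unfolding L2_inner_def by simp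
  qed
  finally show ?thesis .
qed

lemma AM_mult:
  assumes "AM n m X" "AM m l Y" shows "AM n l (\<lambda>\<zeta>. X \<zeta> * Y \<zeta>)"
  unfolding AM_def
proof (intro conjI ballI allI impI)
  fix i j assume ij: "i < n" "j < l"
  have "(\<lambda>\<zeta>. \<Sum>k<m. X \<zeta> $$ (i, k) * Y \<zeta> $$ (k, j)) \<in> hinf"
    using assms ij by (intro hinf_sum hinf_mult) (auto simp: AM_def)
  then show "(\<lambda>\<zeta>. (X \<zeta> * Y \<zeta>) $$ (i, j)) \<in> hinf"
    by (rule hinf_cong) (rule mult_mat_index[OF AM_carrier[OF assms(1)] AM_carrier[OF assms(2)] ij, symmetric])
qed (rule mult_carrier_mat[OF AM_carrier[OF assms(1)] AM_carrier[OF assms(2)]])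

lemma AM_cong:
  assumes "AM n m X" "\<And>\<zeta>. \<zeta> \<in> sphere 0 1 \<Longrightarrow> X \<zeta> = Y \<zeta>" shows "AM n m Y"
  unfolding AM_def
proof (intro conjI ballI allI impI)
  show "Y \<zeta> \<in> carrier_mat n m" if "\<zeta> \<in> sphere 0 1" for \<zeta>
    using AM_carrier[OF assms(1) that] assms(2)[OF that] by simp
  fix i j assume "i < n" "j < m"
  then have "(\<lambda>\<zeta>. X \<zeta> $$ (i, j)) \<in> hinf" using assms(1) by (auto simp: AM_def)
  then show "(\<lambda>\<zeta>. Y \<zeta> $$ (i, j)) \<in> hinf" by (rule hinf_cong) (simp only: assms(2))
qed

lemma mvf_adj_mult_cancel:
  assumes "\<And>\<zeta>. \<zeta> \<in> sphere 0 1 \<Longrightarrow> mat_adjoint (b \<zeta>) * b \<zeta> = 1\<^sub>m k" "LM k k b" "f \<in> L2 k" "\<zeta> \<in> sphere 0 1"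
  shows "mv_mult (mvf_adj b) (mv_mult b f) \<zeta> = f \<zeta>"
  unfolding mv_mult_def mvf_adj_def
  by (rule unitary_cancel[OF mat_adjoint_carrier[OF LM_carrier[OF assms(2,4)]] L2_carrier[OF assms(3,4)] LM_carrier[OF assms(2,4)] assms(1)[OF assms(4)]])

lemma mult_mvf_adj_cancel:
  assumes "\<And>\<zeta>. \<zeta> \<in> sphere 0 1 \<Longrightarrow> b \<zeta> * mat_adjoint (b \<zeta>) = 1\<^sub>m k" "LM k k b" "f \<in> L2 k" "\<zeta> \<in> sphere 0 1"
  shows "mv_mult b (mv_mult (mvf_adj b) f) \<zeta> = f \<zeta>"
  unfolding mv_mult_def mvf_adj_def
  by (rule unitary_cancel[OF LM_carrier[OF assms(2,4)] L2_carrier[OF assms(3,4)] mat_adjoint_carrier[OF LM_carrier[OF assms(2,4)]] assms(1)[OF assms(4)]])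

lemma L2_inner_isometry:
  assumes "\<And>\<zeta>. \<zeta> \<in> sphere 0 1 \<Longrightarrow> mat_adjoint (b \<zeta>) * b \<zeta> = 1\<^sub>m k" "LM k k b" "f \<in> L2 k" "g \<in> L2 k"
  shows "L2_inner (mv_mult b f) (mv_mult b g) = L2_inner f g"
proof -
  have "L2_inner (mv_mult b f) (mv_mult b g) = L2_inner f (mv_mult (mvf_adj b) (mv_mult b g))"
    by (rule L2_inner_adj[OF assms(2,3) L2_mv[OF assms(2,4)]])
  also have "\<dots> = L2_inner f g"
    by (rule L2_inner_sphere_cong) (auto intro!: mvf_adj_mult_cancel[OF assms(1,2,4)])
  finally show ?thesis .
qed

text \<open>
  The space decomposes as $\mathcal H(b_1 b_2) = \mathcal H(b_1) \oplus b_1 \mathcal H(b_2)$, so $f$ is projected to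
  the first summand and the remainder, after division by $b_1$, to the second.
\<close>

lemma finite_inner_mult:
  assumes "finite_inner k b1" "finite_inner k b2"
  shows "finite_inner k (\<lambda>\<zeta>. b1 \<zeta> * b2 \<zeta>)"
proof -
  define b where "b = (\<lambda>\<zeta>. b1 \<zeta> * b2 \<zeta>)"
  have A1: "AM k k b1" and A2: "AM k k b2" using assms by (auto simp: finite_inner_def)
  have A: "AM k k b" unfolding b_def by (rule AM_mult[OF A1 A2])
  note L1 = AM_LM[OF A1] and L2' = AM_LM[OF A2] and L = AM_LM[OF A]
  have u1: "\<And>\<zeta>. \<zeta> \<in> sphere 0 1 \<Longrightarrow> mat_adjoint (b1 \<zeta>) * b1 \<zeta> = 1\<^sub>m k" "\<And>\<zeta>. \<zeta> \<in> sphere 0 1 \<Longrightarrow> b1 \<zeta> * mat_adjoint (b1 \<zeta>) = 1\<^sub>m k"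
    and u2: "\<And>\<zeta>. \<zeta> \<in> sphere 0 1 \<Longrightarrow> mat_adjoint (b2 \<zeta>) * b2 \<zeta> = 1\<^sub>m k" "\<And>\<zeta>. \<zeta> \<in> sphere 0 1 \<Longrightarrow> b2 \<zeta> * mat_adjoint (b2 \<zeta>) = 1\<^sub>m k"
    using assms by (auto simp: finite_inner_def)
  have d1: "\<exists>g\<in>H_b k b1. (\<forall>h\<in>H_b k b1. L2_inner (vv_diff f g) h = 0) \<and>
        (f \<in> H2 k \<longrightarrow> mv_mult (mvf_adj b1) (vv_diff f g) \<in> H2 k)" if "f \<in> L2 k" for f
    using assms(1) that unfolding finite_inner_def by blast
  have d2: "\<exists>g\<in>H_b k b2. (\<forall>h\<in>H_b k b2. L2_inner (vv_diff f g) h = 0) \<and>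
        (f \<in> H2 k \<longrightarrow> mv_mult (mvf_adj b2) (vv_diff f g) \<in> H2 k)" if "f \<in> L2 k" for f
    using assms(2) that unfolding finite_inner_def by blast
  have un: "mat_adjoint (b \<zeta>) * b \<zeta> = 1\<^sub>m k \<and> b \<zeta> * mat_adjoint (b \<zeta>) = 1\<^sub>m k" if \<zeta>: "\<zeta> \<in> sphere 0 1" for \<zeta>
  proof
    note c = LM_carrier[OF L1 \<zeta>] LM_carrier[OF L2' \<zeta>]
    have "b \<zeta> * mat_adjoint (b \<zeta>) = b1 \<zeta> * (b2 \<zeta> * (mat_adjoint (b2 \<zeta>) * mat_adjoint (b1 \<zeta>)))"
      unfolding b_def mat_adjoint_mult[OF c] using c by (intro assoc_mult_mat[of _ k k _ k _ k]) auto
    also have "b2 \<zeta> * (mat_adjoint (b2 \<zeta>) * mat_adjoint (b1 \<zeta>)) = mat_adjoint (b1 \<zeta>)"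
      using c u2(2)[OF \<zeta>] by (simp add: assoc_mult_mat[of _ k k _ k _ k, symmetric])
    finally show "b \<zeta> * mat_adjoint (b \<zeta>) = 1\<^sub>m k" using u1(2)[OF \<zeta>] by simp
    have "mat_adjoint (b \<zeta>) * b \<zeta> = mat_adjoint (b2 \<zeta>) * (mat_adjoint (b1 \<zeta>) * (b1 \<zeta> * b2 \<zeta>))"
      unfolding b_def mat_adjoint_mult[OF c] using c by (intro assoc_mult_mat[of _ k k _ k _ k]) auto
    also have "mat_adjoint (b1 \<zeta>) * (b1 \<zeta> * b2 \<zeta>) = b2 \<zeta>"
      using c u1(1)[OF \<zeta>] by (simp add: assoc_mult_mat[of _ k k _ k _ k, symmetric])
    finally show "mat_adjoint (b \<zeta>) * b \<zeta> = 1\<^sub>m k" using u2(1)[OF \<zeta>] by simp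
  qed
  have bms: "mv_mult b y \<zeta> = mv_mult b1 (mv_mult b2 y) \<zeta>" if "y \<in> L2 k" "\<zeta> \<in> sphere 0 1" for y \<zeta>
    unfolding mv_mult_def b_def
    by (rule assoc_mult_mat_vec[OF LM_carrier[OF L1 that(2)] LM_carrier[OF L2' that(2)] L2_carrier[OF that]])
  have in1: "g \<in> H_b k b" if g: "g \<in> H_b k b1" for g
    unfolding H_b_iff
  proof (intro conjI ballI)
    show "g \<in> H2 k" using g by (simp add: H_b_iff)
    fix y assume y: "y \<in> H2 k"
    have "L2_inner g (mv_mult b y) = L2_inner g (mv_mult b1 (mv_mult b2 y))"
      by (rule L2_inner_sphere_cong) (use bms[OF H2_L2[OF y]] in auto)
    also have "\<dots> = 0" using g H2_mv[OF A2 y] by (simp add: H_b_iff)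
    finally show "L2_inner g (mv_mult b y) = 0" .
  qed
  have in2: "mv_mult b1 g \<in> H_b k b" if g: "g \<in> H_b k b2" for g
    unfolding H_b_iff
  proof (intro conjI ballI)
    have gH: "g \<in> H2 k" using g by (simp add: H_b_iff)
    show "mv_mult b1 g \<in> H2 k" by (rule H2_mv[OF A1 gH])
    fix y assume y: "y \<in> H2 k"
    have "L2_inner (mv_mult b1 g) (mv_mult b y) = L2_inner (mv_mult b1 g) (mv_mult b1 (mv_mult b2 y))"
      by (rule L2_inner_sphere_cong) (use bms[OF H2_L2[OF y]] in auto)
    also have "\<dots> = L2_inner g (mv_mult b2 y)"
      by (rule L2_inner_isometry[OF u1(1) L1 H2_L2[OF gH] L2_mv[OF L2' H2_L2[OF y]]])
    also have "\<dots> = 0" using g y by (simp add: H_b_iff)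
    finally show "L2_inner (mv_mult b1 g) (mv_mult b y) = 0" .
  qed
  have main: "\<exists>g1\<in>H_b k b1. \<exists>g2\<in>H_b k b2.
     (\<forall>h\<in>H_b k b1. L2_inner (vv_diff f g1) h = 0) \<and>
     (\<forall>h\<in>H_b k b2. L2_inner (vv_diff (mv_mult (mvf_adj b1) (vv_diff f g1)) g2) h = 0) \<and>
     (f \<in> H2 k \<longrightarrow> mv_mult (mvf_adj b) (vv_diff f (vv_add g1 (mv_mult b1 g2))) \<in> H2 k)" if f: "f \<in> L2 k" for f
  proof -
    from d1[OF f] obtain g1 where g1: "g1 \<in> H_b k b1" "\<forall>h\<in>H_b k b1. L2_inner (vv_diff f g1) h = 0"
      "f \<in> H2 k \<longrightarrow> mv_mult (mvf_adj b1) (vv_diff f g1) \<in> H2 k" by blast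
    define f1 where "f1 = mv_mult (mvf_adj b1) (vv_diff f g1)"
    have fg: "vv_diff f g1 \<in> L2 k" by (rule L2_diff[OF f H_b_L2[OF g1(1)]])
    have f1: "f1 \<in> L2 k" unfolding f1_def by (rule L2_mv[OF LM_adj[OF L1] fg])
    from d2[OF f1] obtain g2 where g2: "g2 \<in> H_b k b2" "\<forall>h\<in>H_b k b2. L2_inner (vv_diff f1 g2) h = 0"
      "f1 \<in> H2 k \<longrightarrow> mv_mult (mvf_adj b2) (vv_diff f1 g2) \<in> H2 k" by blast
    have "mv_mult (mvf_adj b) (vv_diff f (vv_add g1 (mv_mult b1 g2))) \<in> H2 k" if "f \<in> H2 k"
    proof (rule H2_cong)
      show "mv_mult (mvf_adj b2) (vv_diff f1 g2) \<in> H2 k" using g1(3) g2(3) that by (simp add: f1_def)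
      fix \<zeta> :: complex assume \<zeta>: "\<zeta> \<in> sphere 0 1"
      note c = LM_carrier[OF L1 \<zeta>] LM_carrier[OF L2' \<zeta>] L2_carrier[OF f \<zeta>] L2_carrier[OF H_b_L2[OF g1(1)] \<zeta>] L2_carrier[OF H_b_L2[OF g2(1)] \<zeta>]
      have g2e: "g2 \<zeta> = mat_adjoint (b1 \<zeta>) *\<^sub>v (b1 \<zeta> *\<^sub>v g2 \<zeta>)"
        by (rule unitary_cancel[symmetric, OF mat_adjoint_carrier[OF c(1)] c(5) c(1) u1(1)[OF \<zeta>]])
      have ff: "f \<zeta> - (g1 \<zeta> + b1 \<zeta> *\<^sub>v g2 \<zeta>) = (f \<zeta> - g1 \<zeta>) - b1 \<zeta> *\<^sub>v g2 \<zeta>"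
        using c by (intro eq_vecI) (auto simp: algebra_simps)
      have "mv_mult (mvf_adj b2) (vv_diff f1 g2) \<zeta>
        = mat_adjoint (b2 \<zeta>) *\<^sub>v (mat_adjoint (b1 \<zeta>) *\<^sub>v (f \<zeta> - g1 \<zeta>) - mat_adjoint (b1 \<zeta>) *\<^sub>v (b1 \<zeta> *\<^sub>v g2 \<zeta>))"
        unfolding mv_mult_def vv_diff_def mvf_adj_def f1_def using g2e by simp
      also have "mat_adjoint (b1 \<zeta>) *\<^sub>v (f \<zeta> - g1 \<zeta>) - mat_adjoint (b1 \<zeta>) *\<^sub>v (b1 \<zeta> *\<^sub>v g2 \<zeta>)
          = mat_adjoint (b1 \<zeta>) *\<^sub>v ((f \<zeta> - g1 \<zeta>) - b1 \<zeta> *\<^sub>v g2 \<zeta>)"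
        using c by (intro mult_minus_distrib_mat_vec[of _ k k, symmetric]) (auto intro!: minus_carrier_vec mult_mat_vec_carrier[of _ k k])
      also have "mat_adjoint (b2 \<zeta>) *\<^sub>v \<dots> = (mat_adjoint (b2 \<zeta>) * mat_adjoint (b1 \<zeta>)) *\<^sub>v ((f \<zeta> - g1 \<zeta>) - b1 \<zeta> *\<^sub>v g2 \<zeta>)"
        using c by (intro assoc_mult_mat_vec[of _ k k _ k, symmetric]) (auto intro!: minus_carrier_vec mult_mat_vec_carrier[of _ k k])
      also have "mat_adjoint (b2 \<zeta>) * mat_adjoint (b1 \<zeta>) = mat_adjoint (b \<zeta>)"
        unfolding b_def by (rule mat_adjoint_mult[OF c(1,2), symmetric])
      finally show "mv_mult (mvf_adj b2) (vv_diff f1 g2) \<zeta> = mv_mult (mvf_adj b) (vv_diff f (vv_add g1 (mv_mult b1 g2))) \<zeta>"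
        unfolding ff[symmetric] by (simp add: mv_mult_def mvf_adj_def vv_diff_def vv_add_def)
    qed
    with g1 g2 show ?thesis by (auto simp: f1_def)
  qed
  have proj: "\<exists>g\<in>H_b k b. (\<forall>h\<in>H_b k b. L2_inner (vv_diff f g) h = 0) \<and>
        (f \<in> H2 k \<longrightarrow> mv_mult (mvf_adj b) (vv_diff f g) \<in> H2 k)" if f: "f \<in> L2 k" for f
  proof -
    from main[OF f] obtain g1 g2 where g: "g1 \<in> H_b k b1" "g2 \<in> H_b k b2"
     "\<forall>h\<in>H_b k b1. L2_inner (vv_diff f g1) h = 0"
     "\<forall>h\<in>H_b k b2. L2_inner (vv_diff (mv_mult (mvf_adj b1) (vv_diff f g1)) g2) h = 0"
     "f \<in> H2 k \<longrightarrow> mv_mult (mvf_adj b) (vv_diff f (vv_add g1 (mv_mult b1 g2))) \<in> H2 k" by blast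
    let ?g = "vv_add g1 (mv_mult b1 g2)"
    have gH: "?g \<in> H_b k b" by (rule H_b_add[OF A in1[OF g(1)] in2[OF g(2)]])
    note g1L = H_b_L2[OF g(1)] and g2L = H_b_L2[OF g(2)] and gL = H_b_L2[OF gH]
    have fgL: "vv_diff f ?g \<in> L2 k" by (rule L2_diff[OF f gL])
    have b1g2L: "mv_mult b1 g2 \<in> L2 k" by (rule L2_mv[OF L1 g2L])
    have split: "L2_inner (vv_diff f ?g) h = L2_inner (vv_diff f g1) h - L2_inner (mv_mult b1 g2) h" if "h \<in> L2 k" for h
      using L2_inner_diff_left[OF f gL that] L2_inner_diff_left[OF f g1L that] L2_inner_add_left[OF g1L b1g2L that] by simp
    have "L2_inner (vv_diff f ?g) h = 0" if h: "h \<in> H_b k b" for h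
    proof -
      have hH: "h \<in> H2 k" using h by (simp add: H_b_iff)
      from main[OF H2_L2[OF hH]] obtain k1 k2 where kk: "k1 \<in> H_b k b1" "k2 \<in> H_b k b2"
        "mv_mult (mvf_adj b) (vv_diff h (vv_add k1 (mv_mult b1 k2))) \<in> H2 k" using hH by blast
      let ?k = "vv_add k1 (mv_mult b1 k2)"
      have kH: "?k \<in> H_b k b" by (rule H_b_add[OF A in1[OF kk(1)] in2[OF kk(2)]])
      have rH: "vv_diff h ?k \<in> H_b k b" by (rule H_b_diff[OF A h kH])
      have ub: "\<And>\<zeta>. \<zeta> \<in> sphere 0 1 \<Longrightarrow> b \<zeta> * mat_adjoint (b \<zeta>) = 1\<^sub>m k" using un by blast
      have "L2_inner (vv_diff f ?g) (vv_diff h ?k) = 0"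
        by (rule inner_zero_of_H_b_range[OF A rH kk(3) _ fgL]) (rule mult_mvf_adj_cancel[OF ub L H_b_L2[OF rH], symmetric])
      then have "L2_inner (vv_diff f ?g) h = L2_inner (vv_diff f ?g) ?k"
        using L2_inner_diff_right[OF H2_L2[OF hH] H_b_L2[OF kH] fgL] by simp
      also have "\<dots> = L2_inner (vv_diff f ?g) k1 + L2_inner (vv_diff f ?g) (mv_mult b1 k2)"
        by (rule L2_inner_add_right[OF H_b_L2[OF kk(1)] L2_mv[OF L1 H_b_L2[OF kk(2)]] fgL])
      also have "L2_inner (vv_diff f ?g) k1 = 0"
      proof -
        have "L2_inner k1 (mv_mult b1 g2) = 0" using kk(1) g(2) by (simp add: H_b_iff)
        then have "L2_inner (mv_mult b1 g2) k1 = 0" using L2_inner_cnj[OF H_b_L2[OF kk(1)] b1g2L] by simp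
        then show ?thesis using split[OF H_b_L2[OF kk(1)]] g(3) kk(1) by simp
      qed
      also have "L2_inner (vv_diff f ?g) (mv_mult b1 k2) = 0"
      proof -
        note k2L = H_b_L2[OF kk(2)]
        have fg1L: "vv_diff f g1 \<in> L2 k" by (rule L2_diff[OF f g1L])
        have "L2_inner (vv_diff f g1) (mv_mult b1 k2) = L2_inner (mv_mult (mvf_adj b1) (vv_diff f g1)) k2"
          by (rule L2_inner_adj'[OF L1 k2L fg1L, symmetric])
        moreover have "L2_inner (mv_mult b1 g2) (mv_mult b1 k2) = L2_inner g2 k2"
          by (rule L2_inner_isometry[OF u1(1) L1 g2L k2L])
        moreover have "L2_inner (mv_mult (mvf_adj b1) (vv_diff f g1)) k2 - L2_inner g2 k2 = 0"
          using L2_inner_diff_left[OF L2_mv[OF LM_adj[OF L1] fg1L] g2L k2L] g(4) kk(2) by simp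
        ultimately show ?thesis using split[OF L2_mv[OF L1 k2L]] by simp
      qed
      finally show ?thesis by simp
    qed
    then show ?thesis using gH g(5) by blast
  qed
  obtain as1 as2 where as: "set as1 \<subseteq> ball 0 1" "set as2 \<subseteq> ball 0 1"
    "AM k k (\<lambda>\<zeta>. prod_list (map (\<lambda>\<alpha>. \<zeta> - \<alpha>) as1) \<cdot>\<^sub>m mat_adjoint (b1 \<zeta>))"
    "AM k k (\<lambda>\<zeta>. prod_list (map (\<lambda>\<alpha>. \<zeta> - \<alpha>) as2) \<cdot>\<^sub>m mat_adjoint (b2 \<zeta>))"
    using assms unfolding finite_inner_def by blast
  have pol: "AM k k (\<lambda>\<zeta>. prod_list (map (\<lambda>\<alpha>. \<zeta> - \<alpha>) (as2 @ as1)) \<cdot>\<^sub>m mat_adjoint (b \<zeta>))"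
  proof (rule AM_cong[OF AM_mult[OF as(4,3)]])
    fix \<zeta> :: complex assume \<zeta>: "\<zeta> \<in> sphere 0 1"
    note c = LM_carrier[OF L1 \<zeta>] LM_carrier[OF L2' \<zeta>]
    show "prod_list (map (\<lambda>\<alpha>. \<zeta> - \<alpha>) as2) \<cdot>\<^sub>m mat_adjoint (b2 \<zeta>) * (prod_list (map (\<lambda>\<alpha>. \<zeta> - \<alpha>) as1) \<cdot>\<^sub>m mat_adjoint (b1 \<zeta>))
       = prod_list (map (\<lambda>\<alpha>. \<zeta> - \<alpha>) (as2 @ as1)) \<cdot>\<^sub>m mat_adjoint (b \<zeta>)"
      unfolding b_def mat_adjoint_mult[OF c] using c
      by (simp add: mult_smult_assoc_mat[of _ k k _ k] mult_smult_distrib[of _ k k _ k])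
        (auto intro!: eq_matI)
  qed
  have "finite_inner k b"
    unfolding finite_inner_def using A un proj pol as(1,2)
    by (intro conjI ballI exI[of _ "as2 @ as1"]) auto
  then show ?thesis by (simp add: b_def)
qed

lemma finite_inner_unitary:
  assumes U: "U \<in> carrier_mat k k" "mat_adjoint U * U = 1\<^sub>m k"
  shows "finite_inner k (\<lambda>_. U)"
proof -
  have U': "U * mat_adjoint U = 1\<^sub>m k"
    using mat_mult_left_right_inverse[OF mat_adjoint_carrier[OF U(1)] U(1) U(2)] .
  have A: "AM k k (\<lambda>_. U)" using U by (auto simp: AM_def)
  have A': "AM k k (\<lambda>_. mat_adjoint U)" using U by (auto simp: AM_def)
  have z: "(\<lambda>_. 0\<^sub>v k) \<in> H_b k (\<lambda>_. U)"
    unfolding H_b_iff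
  proof (intro conjI ballI H2_const)
    fix y assume "y \<in> H2 k"
    then have yL: "mv_mult (\<lambda>_. U) y \<in> L2 k" by (intro L2_mv[OF AM_LM[OF A]] H2_L2)
    have "(0\<^sub>v k :: complex vec) \<bullet>c mv_mult (\<lambda>_. U) y (cis \<theta>) = 0" for \<theta>
      using cscalar_prod_sum[OF L2_carrier[OF yL cis_range]] by simp
    then show "L2_inner (\<lambda>_. 0\<^sub>v k) (mv_mult (\<lambda>_. U) y) = 0" unfolding L2_inner_def by simp
  qed simp
  have d0: "vv_diff f (\<lambda>_. 0\<^sub>v k) \<zeta> = f \<zeta>" if "f \<in> L2 k" "\<zeta> \<in> sphere 0 1" for f \<zeta>
    using L2_carrier[OF that] by (auto simp: vv_diff_def)
  have "\<exists>g\<in>H_b k (\<lambda>_. U). (\<forall>h\<in>H_b k (\<lambda>_. U). L2_inner (vv_diff f g) h = 0) \<and>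
        (f \<in> H2 k \<longrightarrow> mv_mult (mvf_adj (\<lambda>_. U)) (vv_diff f g) \<in> H2 k)" if f: "f \<in> L2 k" for f
  proof (intro bexI[OF _ z] conjI ballI impI)
    have fL: "vv_diff f (\<lambda>_. 0\<^sub>v k) \<in> L2 k" by (rule L2_diff[OF f H_b_L2[OF z]])
    fix h assume h: "h \<in> H_b k (\<lambda>_. U)"
    then have hH: "h \<in> H2 k" by (simp add: H_b_iff)
    have aH: "mv_mult (\<lambda>_. mat_adjoint U) h \<in> H2 k" by (rule H2_mv[OF A' hH])
    show "L2_inner (vv_diff f (\<lambda>_. 0\<^sub>v k)) h = 0"
    proof (rule inner_zero_of_H_b_range[OF A h aH _ fL])
      fix \<zeta> :: complex assume "\<zeta> \<in> sphere 0 1"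
      then show "h \<zeta> = mv_mult (\<lambda>_. U) (mv_mult (\<lambda>_. mat_adjoint U) h) \<zeta>"
        using mult_mvf_adj_cancel[OF U' AM_LM[OF A] H2_L2[OF hH]] by (simp add: mvf_adj_def)
    qed
  next
    assume fH: "f \<in> H2 k"
    have "mv_mult (\<lambda>_. mat_adjoint U) (vv_diff f (\<lambda>_. 0\<^sub>v k)) \<in> H2 k"
      by (rule H2_mv[OF A' H2_diff[OF fH]]) (use z in \<open>simp add: H_b_iff\<close>)
    then show "mv_mult (mvf_adj (\<lambda>_. U)) (vv_diff f (\<lambda>_. 0\<^sub>v k)) \<in> H2 k" by (simp add: mvf_adj_def)
  qed
  moreover have "AM k k (\<lambda>\<zeta>. prod_list (map (\<lambda>\<alpha>. \<zeta> - \<alpha>) []) \<cdot>\<^sub>m mat_adjoint U)"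
    by (rule AM_cong[OF A']) (auto intro!: eq_matI)
  ultimately show ?thesis unfolding finite_inner_def using A U U'
    by (intro conjI ballI exI[of _ "[]"]) auto
qed

text \<open>
  The operator that is multiplication by $s$ on the range of the projection $Q$ and the identity on its kernel;
  a Blaschke--Potapov factor is this matrix at $s = (z-\alpha)/(1 - \overline\alpha z)$.
\<close>

definition pmat :: "nat \<Rightarrow> complex mat \<Rightarrow> complex \<Rightarrow> complex mat" where
  "pmat k Q s = 1\<^sub>m k - Q + s \<cdot>\<^sub>m Q"

lemma bp_factor_pmat: "bp_factor k (\<alpha>, Q) z = pmat k Q ((z - \<alpha>) / (1 - cnj \<alpha> * z))"
  by (simp add: bp_factor_def pmat_def)

lemma pmat_carrier [simp]: "Q \<in> carrier_mat k k \<Longrightarrow> pmat k Q s \<in> carrier_mat k k"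
  by (auto simp: pmat_def)

lemma pmat_index:
  "Q \<in> carrier_mat k k \<Longrightarrow> i < k \<Longrightarrow> j < k \<Longrightarrow> pmat k Q s $$ (i, j) = (if i = j then 1 else 0) + (s - 1) * Q $$ (i, j)"
  by (simp add: pmat_def algebra_simps)

lemma pmat_mult:
  assumes Q: "Q \<in> carrier_mat k k" "Q * Q = Q"
  shows "pmat k Q s * pmat k Q t = pmat k Q (s * t)"
proof (rule eq_matI)
  fix i j assume "i < dim_row (pmat k Q (s * t))" "j < dim_col (pmat k Q (s * t))"
  then have ij: "i < k" "j < k" using carrier_matD[OF pmat_carrier[OF Q(1), of "s*t"]] by auto
  have QQ: "(\<Sum>l<k. Q $$ (i, l) * Q $$ (l, j)) = Q $$ (i, j)"
    using mult_mat_index[OF Q(1) Q(1) ij] Q(2) by simp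
  have "(pmat k Q s * pmat k Q t) $$ (i, j) = (\<Sum>l<k. pmat k Q s $$ (i, l) * pmat k Q t $$ (l, j))"
    by (rule mult_mat_index[OF pmat_carrier[OF Q(1)] pmat_carrier[OF Q(1)] ij])
  also have "\<dots> = (\<Sum>l<k. (if l = i then pmat k Q t $$ (l, j) else 0) +
     ((if l = j then (s - 1) * Q $$ (i, l) else 0) + (s - 1) * (t - 1) * (Q $$ (i, l) * Q $$ (l, j))))"
    using ij by (intro sum.cong refl) (auto simp: pmat_index[OF Q(1)] algebra_simps)
  also have "\<dots> = pmat k Q t $$ (i, j) + ((s - 1) * Q $$ (i, j) + (s - 1) * (t - 1) * Q $$ (i, j))"
    unfolding sum.distrib sum_distrib_left[symmetric] QQ using ij by simp
  also have "\<dots> = pmat k Q (s * t) $$ (i, j)"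
    using ij by (simp add: pmat_index[OF Q(1)] algebra_simps)
  finally show "(pmat k Q s * pmat k Q t) $$ (i, j) = pmat k Q (s * t) $$ (i, j)" .
qed (use Q carrier_matD[OF pmat_carrier[OF Q(1)]] in auto)

lemma pmat_one: "Q \<in> carrier_mat k k \<Longrightarrow> pmat k Q 1 = 1\<^sub>m k"
  by (rule eq_matI) (auto simp: pmat_def)

lemma pmat_adjoint:
  assumes "Q \<in> carrier_mat k k" "mat_adjoint Q = Q" shows "mat_adjoint (pmat k Q s) = pmat k Q (cnj s)"
proof (rule eq_matI)
  fix i j assume "i < dim_row (pmat k Q (cnj s))" "j < dim_col (pmat k Q (cnj s))"
  then have ij: "i < k" "j < k" using carrier_matD[OF pmat_carrier[OF assms(1), of "cnj s"]] by auto
  have "cnj (Q $$ (j, i)) = Q $$ (i, j)" using mat_adjoint_index[of i Q j] assms ij by simp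
  then show "mat_adjoint (pmat k Q s) $$ (i, j) = pmat k Q (cnj s) $$ (i, j)"
    using ij carrier_matD[OF pmat_carrier[OF assms(1), of s]] by (simp add: pmat_index[OF assms(1)])
qed (use carrier_matD[OF pmat_carrier[OF assms(1)]] in auto)

lemma disc_value_l2: "disc_value \<alpha> f = ip f (\<lambda>\<zeta>. 1 / (1 - cnj \<alpha> * \<zeta>))" if "\<alpha> \<in> ball 0 1"
  unfolding disc_value_def ip_def by (rule cmean_cong) (simp only: cnj_szego[OF that])

lemma disc_value_sum:
  assumes "\<And>j. j \<in> J \<Longrightarrow> f j \<in> l2" "\<alpha> \<in> ball 0 1" "finite J"
  shows "disc_value \<alpha> (\<lambda>\<zeta>. \<Sum>j\<in>J. c j * f j \<zeta>) = (\<Sum>j\<in>J. c j * disc_value \<alpha> (f j))"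
  using assms(3,1)
proof (induction J rule: finite_induct)
  case empty
  then show ?case using disc_value_const[OF assms(2), of 0] by simp
next
  case (insert j J)
  then have "disc_value \<alpha> (\<lambda>\<zeta>. c j * f j \<zeta> + (\<Sum>j\<in>J. c j * f j \<zeta>)) = c j * disc_value \<alpha> (f j) + (\<Sum>j\<in>J. c j * disc_value \<alpha> (f j))"
    using assms(2) by (subst disc_value_add) (auto intro!: l2_scale l2_sum simp: disc_value_scale)
  then show ?case using insert by simp
qed

text \<open>
  Here $\mathcal H(b)$ consists of the multiples $Q v / (1 - \overline\alpha \zeta)$ of the Szego kernel, and the
  projection of $f$ is given by $v = (1 - |\alpha|^2)\, Q f(\alpha)$.
\<close>

lemma finite_inner_bp_factor:
  assumes \<alpha>: "\<alpha> \<in> ball 0 1" and Q: "Q \<in> carrier_mat k k" "Q * Q = Q" "mat_adjoint Q = Q"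
  shows "finite_inner k (bp_factor k (\<alpha>, Q))"
proof -
  define e where "e \<zeta> = 1 / (1 - cnj \<alpha> * \<zeta>)" for \<zeta>
  define \<phi> where "\<phi> \<zeta> = (\<zeta> - \<alpha>) / (1 - cnj \<alpha> * \<zeta>)" for \<zeta>
  define b where "b \<zeta> = pmat k Q (\<phi> \<zeta>)" for \<zeta>
  have beq: "bp_factor k (\<alpha>, Q) = b" by (simp add: fun_eq_iff bp_factor_pmat b_def \<phi>_def)
  have nz: "norm \<zeta> \<le> 1 \<Longrightarrow> 1 - cnj \<alpha> * \<zeta> \<noteq> 0" for \<zeta> by (rule one_minus_cnj_mult_nz[OF \<alpha>])
  have eh: "e \<in> hinf" unfolding e_def by (rule szego_hinf[OF \<alpha>])
  have el: "e \<in> l2" by (rule linf_imp_l2[OF hinf_linf[OF eh]])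
  have \<phi>h: "\<phi> \<in> hinf" unfolding \<phi>_def using nz by (intro hinf_holomorphic) (auto intro!: continuous_intros holomorphic_intros)
  have A: "AM k k b"
    unfolding AM_def
  proof (intro conjI ballI allI impI)
    fix i j assume ij: "i < k" "j < k"
    have "(\<lambda>\<zeta>. (if i = j then 1 else 0) + (\<phi> \<zeta> + (-1)) * Q $$ (i, j)) \<in> hinf"
      by (intro hinf_add hinf_mult \<phi>h hinf_const)
    then show "(\<lambda>\<zeta>. b \<zeta> $$ (i, j)) \<in> hinf" unfolding b_def pmat_index[OF Q(1) ij] by simp
  qed (simp add: b_def Q)
  note L = AM_LM[OF A]
  have \<phi>c': "cnj (\<phi> \<zeta>) = (1 - cnj \<alpha> * \<zeta>) / (\<zeta> - \<alpha>)" if "\<zeta> \<in> sphere 0 1" for \<zeta>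
  proof -
    have z: "\<zeta> \<noteq> 0" "\<zeta> \<noteq> \<alpha>" using that \<alpha> by auto
    have "cnj (\<phi> \<zeta>) = cnj (\<zeta> - \<alpha>) * cnj (1 / (1 - cnj \<alpha> * \<zeta>))" by (simp add: \<phi>_def)
    also have "cnj (\<zeta> - \<alpha>) = (1 - cnj \<alpha> * \<zeta>) / \<zeta>" using cnj_sphere[OF that] z by (simp add: field_simps)
    also have "cnj (1 / (1 - cnj \<alpha> * \<zeta>)) = \<zeta> / (\<zeta> - \<alpha>)" by (rule cnj_szego[OF \<alpha> that])
    finally show ?thesis using z by simp
  qed
  have \<phi>c: "\<phi> \<zeta> * cnj (\<phi> \<zeta>) = 1" if "\<zeta> \<in> sphere 0 1" for \<zeta>
  proof -
    have "\<zeta> \<noteq> \<alpha>" using that \<alpha> by auto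
    then show ?thesis unfolding \<phi>c'[OF that] using nz[of \<zeta>] that by (simp add: \<phi>_def)
  qed
  have adj: "mat_adjoint (b \<zeta>) = pmat k Q (cnj (\<phi> \<zeta>))" for \<zeta> unfolding b_def by (rule pmat_adjoint[OF Q(1,3)])
  have un: "mat_adjoint (b \<zeta>) * b \<zeta> = 1\<^sub>m k \<and> b \<zeta> * mat_adjoint (b \<zeta>) = 1\<^sub>m k" if "\<zeta> \<in> sphere 0 1" for \<zeta>
    unfolding adj unfolding b_def pmat_mult[OF Q(1,2)] using \<phi>c[OF that] pmat_one[OF Q(1)] by (simp add: mult.commute)
  define N where "N = complex_of_real (1 - (norm \<alpha>)\<^sup>2)"
  have N0: "N \<noteq> 0"
  proof -
    have "(norm \<alpha>)\<^sup>2 < 1" using \<alpha> by (simp add: abs_square_less_1)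
    then show ?thesis unfolding N_def of_real_eq_0_iff by linarith
  qed
  define ev where "ev f = vec k (\<lambda>i. disc_value \<alpha> (\<lambda>\<zeta>. f \<zeta> $ i))" for f :: vvf
  have evc: "ev f \<in> carrier_vec k" for f by (simp add: ev_def)
  define G where "G f = (\<lambda>\<zeta>. (N * e \<zeta>) \<cdot>\<^sub>v (Q *\<^sub>v ev f))" for f
  have Qc: "Q *\<^sub>v v \<in> carrier_vec k" if "v \<in> carrier_vec k" for v using mult_mat_vec_carrier[OF Q(1) that] .
  have QQv: "Q *\<^sub>v (Q *\<^sub>v v) = Q *\<^sub>v v" if "v \<in> carrier_vec k" for v
    using assoc_mult_mat_vec[OF Q(1) Q(1) that] Q(2) by simp
  have GH: "G f \<in> H2 k" for f
    unfolding H2_iff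
  proof (intro conjI ballI allI impI)
    fix i assume "i < k"
    then have "(\<lambda>\<zeta>. G f \<zeta> $ i) = (\<lambda>\<zeta>. (N * e \<zeta>) * (Q *\<^sub>v ev f) $ i)"
      using carrier_vecD[OF Qc[OF evc]] by (simp add: G_def fun_eq_iff)
    moreover have "(\<lambda>\<zeta>. (N * e \<zeta>) * (Q *\<^sub>v ev f) $ i) \<in> h2" by (intro hinf_h2 hinf_mult hinf_const eh h2_const)
    ultimately show "(\<lambda>\<zeta>. G f \<zeta> $ i) \<in> h2" by simp
  qed (use Qc[OF evc] in \<open>simp add: G_def\<close>)
  note GL = H2_L2[OF GH]
  have Gb: "G f \<in> H_b k b" for f
    unfolding H_b_iff
  proof (intro conjI ballI GH)
    fix y assume y: "y \<in> H2 k"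
    define v where "v = Q *\<^sub>v ev f"
    have vc: "v \<in> carrier_vec k" unfolding v_def by (rule Qc[OF evc])
    have Qv: "Q *\<^sub>v v = v" unfolding v_def by (rule QQv[OF evc])
    have bG: "mv_mult (mvf_adj b) (G f) \<zeta> $ i = N * v $ i * (1 / (\<zeta> - \<alpha>))" if \<zeta>: "\<zeta> \<in> sphere 0 1" and i: "i < k" for \<zeta> i
    proof -
      have "mv_mult (mvf_adj b) (G f) \<zeta> $ i = (N * e \<zeta>) * (pmat k Q (cnj (\<phi> \<zeta>)) *\<^sub>v v) $ i"
        using mult_mat_vec[OF pmat_carrier[OF Q(1)] vc] i carrier_matD[OF pmat_carrier[OF Q(1)]]
        by (simp add: mv_mult_def mvf_adj_def adj G_def v_def[symmetric])
      also have "(pmat k Q (cnj (\<phi> \<zeta>)) *\<^sub>v v) $ i = (\<Sum>j<k. (if j = i then v $ j else 0) + (cnj (\<phi> \<zeta>) - 1) * (Q $$ (i, j) * v $ j))"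
        unfolding mult_mat_vec_index[OF pmat_carrier[OF Q(1)] vc i]
        by (rule sum.cong[OF refl]) (use i in \<open>auto simp: pmat_index[OF Q(1)] algebra_simps\<close>)
      also have "\<dots> = v $ i + (cnj (\<phi> \<zeta>) - 1) * (Q *\<^sub>v v) $ i"
        unfolding sum.distrib sum_distrib_left[symmetric] mult_mat_vec_index[OF Q(1) vc i] using i by simp
      also have "\<dots> = cnj (\<phi> \<zeta>) * v $ i" unfolding Qv by (simp add: algebra_simps)
      also have "N * e \<zeta> * (cnj (\<phi> \<zeta>) * v $ i) = N * v $ i * (1 / (\<zeta> - \<alpha>))"
        unfolding \<phi>c'[OF \<zeta>] e_def using nz[of \<zeta>] \<zeta> by simp
      finally show ?thesis .
    qed
    have "L2_inner (G f) (mv_mult b y) = L2_inner (mv_mult (mvf_adj b) (G f)) y"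
      by (rule L2_inner_adj'[OF L H2_L2[OF y] GL, symmetric])
    also have "\<dots> = (\<Sum>i<k. ip (\<lambda>\<zeta>. mv_mult (mvf_adj b) (G f) \<zeta> $ i) (\<lambda>\<zeta>. y \<zeta> $ i))"
      by (rule L2_inner_ip[OF L2_mv[OF LM_adj[OF L] GL] H2_L2[OF y]])
    also have "\<dots> = (\<Sum>i<k. N * v $ i * ip (\<lambda>\<zeta>. 1 / (\<zeta> - \<alpha>)) (\<lambda>\<zeta>. y \<zeta> $ i))"
      by (rule sum.cong[OF refl], subst ip_scale_left[symmetric], unfold ip_def, rule cmean_cong) (simp add: bG)
    also have "\<dots> = 0"
      by (intro sum.neutral ballI) (simp only: ip_kernel_h2[OF \<alpha> H2_comp[OF y]] lessThan_iff mult_zero_right)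
    finally show "L2_inner (G f) (mv_mult b y) = 0" .
  qed
  have evG: "ev (G f) = Q *\<^sub>v ev f" for f
  proof (rule eq_vecI)
    fix i assume "i < dim_vec (Q *\<^sub>v ev f)"
    then have i: "i < k" using carrier_vecD[OF Qc[OF evc]] by simp
    have "disc_value \<alpha> (\<lambda>\<zeta>. G f \<zeta> $ i) = disc_value \<alpha> (\<lambda>\<zeta>. (N * (Q *\<^sub>v ev f) $ i) * e \<zeta>)"
      using i carrier_vecD[OF Qc[OF evc]] by (simp add: G_def mult_ac)
    also have "\<dots> = (Q *\<^sub>v ev f) $ i"
      unfolding disc_value_scale using disc_value_szego[OF \<alpha>] N0 by (simp add: e_def[abs_def] N_def)
    finally show "ev (G f) $ i = (Q *\<^sub>v ev f) $ i" using i by (simp add: ev_def)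
  qed (use carrier_vecD[OF Qc[OF evc]] in \<open>simp add: ev_def\<close>)
  have evdiff: "ev (vv_diff f (G f)) = ev f - Q *\<^sub>v ev f" if f: "f \<in> L2 k" for f
  proof (rule eq_vecI)
    fix i assume "i < dim_vec (ev f - Q *\<^sub>v ev f)"
    then have i: "i < k" using carrier_vecD[OF Qc[OF evc]] by simp
    have "disc_value \<alpha> (\<lambda>\<zeta>. vv_diff f (G f) \<zeta> $ i) = disc_value \<alpha> (\<lambda>\<zeta>. f \<zeta> $ i + (-1) * G f \<zeta> $ i)"
      using i carrier_vecD[OF Qc[OF evc]] by (simp add: vv_diff_def G_def)
    also have "\<dots> = disc_value \<alpha> (\<lambda>\<zeta>. f \<zeta> $ i) + (-1) * disc_value \<alpha> (\<lambda>\<zeta>. G f \<zeta> $ i)"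
      using disc_value_add[OF L2_comp[OF f i] l2_scale[OF L2_comp[OF GL i], of "-1"] \<alpha>, of f] disc_value_scale[of \<alpha> "-1"] by simp
    also have "disc_value \<alpha> (\<lambda>\<zeta>. G f \<zeta> $ i) = (Q *\<^sub>v ev f) $ i" using evG[of f] i by (metis ev_def index_vec)
    finally show "ev (vv_diff f (G f)) $ i = (ev f - Q *\<^sub>v ev f) $ i"
      using i carrier_vecD[OF Qc[OF evc]] by (simp add: ev_def)
  qed (use carrier_vecD[OF Qc[OF evc]] in \<open>simp add: ev_def\<close>)
  have H2part: "mv_mult (mvf_adj b) (vv_diff f (G f)) \<in> H2 k" if f: "f \<in> H2 k" for f
  proof -
    define w where "w = vv_diff f (G f)"
    have wH: "w \<in> H2 k" unfolding w_def by (rule H2_diff[OF f GH])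
    note wL = H2_L2[OF wH]
    have evw: "ev w = ev f - Q *\<^sub>v ev f" unfolding w_def by (rule evdiff[OF H2_L2[OF f]])
    define q where "q \<zeta> = Q *\<^sub>v w \<zeta>" for \<zeta>
    have qi: "q \<zeta> $ i = (\<Sum>j<k. Q $$ (i, j) * w \<zeta> $ j)" if "\<zeta> \<in> sphere 0 1" "i < k" for \<zeta> i
      unfolding q_def by (rule mult_mat_vec_index[OF Q(1) L2_carrier[OF wL that(1)] that(2)])
    have qdiv: "(\<lambda>\<zeta>. (\<Sum>j<k. Q $$ (i, j) * w \<zeta> $ j) / (\<zeta> - \<alpha>)) \<in> h2" if i: "i < k" for i
    proof (rule h2_div_root[OF _ \<alpha>])
      show "(\<lambda>\<zeta>. \<Sum>j<k. Q $$ (i, j) * w \<zeta> $ j) \<in> h2"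
        by (intro h2_sum h2_scale H2_comp[OF wH]) simp
      have "disc_value \<alpha> (\<lambda>\<zeta>. \<Sum>j<k. Q $$ (i, j) * w \<zeta> $ j) = (\<Sum>j<k. Q $$ (i, j) * disc_value \<alpha> (\<lambda>\<zeta>. w \<zeta> $ j))"
        by (rule disc_value_sum[OF _ \<alpha>]) (auto intro: L2_comp[OF wL])
      also have "\<dots> = (Q *\<^sub>v ev w) $ i"
        unfolding mult_mat_vec_index[OF Q(1) evc i] by (simp add: ev_def)
      also have "Q *\<^sub>v ev w = 0\<^sub>v k"
        unfolding evw mult_minus_distrib_mat_vec[OF Q(1) evc Qc[OF evc]] QQv[OF evc]
        using Qc[OF evc] by simp
      finally show "disc_value \<alpha> (\<lambda>\<zeta>. \<Sum>j<k. Q $$ (i, j) * w \<zeta> $ j) = 0" using i by simp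
    qed
    have "mv_mult (mvf_adj b) w \<in> H2 k"
      unfolding H2_iff
    proof (intro conjI ballI allI impI)
      show "mv_mult (mvf_adj b) w \<zeta> \<in> carrier_vec k" if "\<zeta> \<in> sphere 0 1" for \<zeta>
        by (rule mv_mult_carrier[OF LM_adj[OF L] wL that])
      fix i assume i: "i < k"
      have "(\<lambda>\<zeta>. (w \<zeta> $ i + (-1) * (\<Sum>j<k. Q $$ (i, j) * w \<zeta> $ j)) +
         (1 + (- cnj \<alpha>) * \<zeta>) * ((\<Sum>j<k. Q $$ (i, j) * w \<zeta> $ j) / (\<zeta> - \<alpha>))) \<in> h2"
      proof (rule h2_add)
        show "(\<lambda>\<zeta>. w \<zeta> $ i + (-1) * (\<Sum>j<k. Q $$ (i, j) * w \<zeta> $ j)) \<in> h2"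
          by (intro h2_add h2_scale h2_sum H2_comp[OF wH] i) simp
        have "(\<lambda>\<zeta>. 1 + (- cnj \<alpha>) * \<zeta>) \<in> hinf"
          by (intro hinf_holomorphic) (auto intro!: continuous_intros holomorphic_intros)
        then show "(\<lambda>\<zeta>. (1 + (- cnj \<alpha>) * \<zeta>) * ((\<Sum>j<k. Q $$ (i, j) * w \<zeta> $ j) / (\<zeta> - \<alpha>))) \<in> h2"
          by (rule hinf_h2[OF _ qdiv[OF i]])
      qed
      then show "(\<lambda>\<zeta>. mv_mult (mvf_adj b) w \<zeta> $ i) \<in> h2"
      proof (rule h2_cong)
        fix \<zeta> :: complex assume \<zeta>: "\<zeta> \<in> sphere 0 1"
        have "mv_mult (mvf_adj b) w \<zeta> $ i = (\<Sum>j<k. pmat k Q (cnj (\<phi> \<zeta>)) $$ (i, j) * w \<zeta> $ j)"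
          unfolding mv_mult_def mvf_adj_def adj
          by (rule mult_mat_vec_index[OF pmat_carrier[OF Q(1)] L2_carrier[OF wL \<zeta>] i])
        also have "\<dots> = (\<Sum>j<k. (if j = i then w \<zeta> $ j else 0) + (cnj (\<phi> \<zeta>) - 1) * (Q $$ (i, j) * w \<zeta> $ j))"
          by (rule sum.cong[OF refl]) (use i in \<open>auto simp: pmat_index[OF Q(1)] algebra_simps\<close>)
        also have "\<dots> = w \<zeta> $ i + (cnj (\<phi> \<zeta>) - 1) * (\<Sum>j<k. Q $$ (i, j) * w \<zeta> $ j)"
          unfolding sum.distrib sum_distrib_left[symmetric] using i by simp
        finally show "w \<zeta> $ i + (-1) * (\<Sum>j<k. Q $$ (i, j) * w \<zeta> $ j) +
           (1 + (- cnj \<alpha>) * \<zeta>) * ((\<Sum>j<k. Q $$ (i, j) * w \<zeta> $ j) / (\<zeta> - \<alpha>)) = mv_mult (mvf_adj b) w \<zeta> $ i"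
          unfolding \<phi>c'[OF \<zeta>] by (simp add: algebra_simps)
      qed
    qed
    then show ?thesis by (simp add: w_def)
  qed
  have innerG: "L2_inner f (G h) = cnj N * (ev f \<bullet>c (Q *\<^sub>v ev h))" if f: "f \<in> L2 k" for f h
  proof -
    have "L2_inner f (G h) = (\<Sum>i<k. ip (\<lambda>\<zeta>. f \<zeta> $ i) (\<lambda>\<zeta>. G h \<zeta> $ i))" by (rule L2_inner_ip[OF f GL])
    also have "\<dots> = (\<Sum>i<k. ip (\<lambda>\<zeta>. f \<zeta> $ i) (\<lambda>\<zeta>. (N * (Q *\<^sub>v ev h) $ i) * e \<zeta>))"
      using carrier_vecD[OF Qc[OF evc]] by (intro sum.cong refl) (simp add: G_def mult_ac)
    also have "\<dots> = (\<Sum>i<k. cnj (N * (Q *\<^sub>v ev h) $ i) * disc_value \<alpha> (\<lambda>\<zeta>. f \<zeta> $ i))"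
      unfolding ip_scale_right disc_value_l2[OF \<alpha>] e_def ..
    also have "\<dots> = cnj N * (ev f \<bullet>c (Q *\<^sub>v ev h))"
      unfolding cscalar_prod_sum[OF Qc[OF evc]] sum_distrib_left by (intro sum.cong refl) (simp add: ev_def mult_ac)
    finally show ?thesis .
  qed
  have proj: "L2_inner (vv_diff f (G f)) h = 0" if f: "f \<in> L2 k" and h: "h \<in> H_b k b" for f h
  proof -
    have hH: "h \<in> H2 k" using h by (simp add: H_b_iff)
    have dL: "vv_diff f (G f) \<in> L2 k" by (rule L2_diff[OF f GL])
    have rH: "vv_diff h (G h) \<in> H_b k b" by (rule H_b_diff[OF A h Gb])
    have "L2_inner (vv_diff f (G f)) (vv_diff h (G h)) = 0"
      by (rule inner_zero_of_H_b_range[OF A rH H2part[OF hH] _ dL])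
         (rule mult_mvf_adj_cancel[OF _ L H_b_L2[OF rH], symmetric], use un in blast)
    then have "L2_inner (vv_diff f (G f)) h = L2_inner (vv_diff f (G f)) (G h)"
      using L2_inner_diff_right[OF H2_L2[OF hH] GL dL] by simp
    also have "\<dots> = cnj N * ((ev f - Q *\<^sub>v ev f) \<bullet>c (Q *\<^sub>v ev h))"
      unfolding innerG[OF dL] evdiff[OF f] ..
    also have "(ev f - Q *\<^sub>v ev f) \<bullet>c (Q *\<^sub>v ev h) = (Q *\<^sub>v (ev f - Q *\<^sub>v ev f)) \<bullet>c ev h"
      using cscalar_prod_adjoint[OF Q(1) _ evc, of "ev f - Q *\<^sub>v ev f" h] Q(3) Qc[OF evc] evc by simp
    also have "Q *\<^sub>v (ev f - Q *\<^sub>v ev f) = 0\<^sub>v k"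
      unfolding mult_minus_distrib_mat_vec[OF Q(1) evc Qc[OF evc]] QQv[OF evc] using Qc[OF evc] by simp
    also have "0\<^sub>v k \<bullet>c ev h = 0" using cscalar_prod_sum[OF evc[of h]] by simp
    finally show ?thesis by simp
  qed
  have pol: "AM k k (\<lambda>\<zeta>. prod_list (map (\<lambda>\<alpha>. \<zeta> - \<alpha>) [\<alpha>]) \<cdot>\<^sub>m mat_adjoint (b \<zeta>))"
    unfolding AM_def
  proof (intro conjI ballI allI impI)
    fix i j assume ij: "i < k" "j < k"
    have "(\<lambda>\<zeta>. (\<zeta> - \<alpha>) * ((if i = j then 1 else 0) + (- Q $$ (i, j))) + (1 + (- cnj \<alpha>) * \<zeta>) * Q $$ (i, j)) \<in> hinf"
      by (intro hinf_holomorphic) (auto intro!: continuous_intros holomorphic_intros)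
    then show "(\<lambda>\<zeta>. (prod_list (map (\<lambda>\<alpha>. \<zeta> - \<alpha>) [\<alpha>]) \<cdot>\<^sub>m mat_adjoint (b \<zeta>)) $$ (i, j)) \<in> hinf"
    proof (rule hinf_cong)
      fix \<zeta> :: complex assume \<zeta>: "\<zeta> \<in> sphere 0 1"
      have z: "\<zeta> - \<alpha> \<noteq> 0" using \<zeta> \<alpha> by auto
      have "(\<zeta> - \<alpha>) * (cnj (\<phi> \<zeta>) * Q $$ (i, j)) = (1 - cnj \<alpha> * \<zeta>) * Q $$ (i, j)"
        unfolding \<phi>c'[OF \<zeta>] using z by simp
      then show "(\<zeta> - \<alpha>) * ((if i = j then 1 else 0) + (- Q $$ (i, j))) + (1 + (- cnj \<alpha>) * \<zeta>) * Q $$ (i, j)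
          = (prod_list (map (\<lambda>\<alpha>. \<zeta> - \<alpha>) [\<alpha>]) \<cdot>\<^sub>m mat_adjoint (b \<zeta>)) $$ (i, j)"
        unfolding adj using ij carrier_matD[OF pmat_carrier[OF Q(1)]]
        by (simp add: pmat_index[OF Q(1)] algebra_simps)
    qed
  qed (use Q in \<open>auto simp: adj\<close>)
  show ?thesis
    unfolding beq finite_inner_def using A un proj H2part Gb pol \<alpha>
    by (intro conjI ballI exI[of _ "[\<alpha>]"] bexI[OF _ Gb]) auto
qed

lemma finite_inner_cong:
  assumes "finite_inner k b" "\<And>\<zeta>. \<zeta> \<in> sphere 0 1 \<Longrightarrow> b \<zeta> = b' \<zeta>"
  shows "finite_inner k b'"
proof -
  have A: "AM k k b" and un: "\<And>\<zeta>. \<zeta> \<in> sphere 0 1 \<Longrightarrow> mat_adjoint (b \<zeta>) * b \<zeta> = 1\<^sub>m k \<and> b \<zeta> * mat_adjoint (b \<zeta>) = 1\<^sub>m k"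
    and pr: "\<And>f. f \<in> L2 k \<Longrightarrow> \<exists>g\<in>H_b k b. (\<forall>h\<in>H_b k b. L2_inner (vv_diff f g) h = 0) \<and>
        (f \<in> H2 k \<longrightarrow> mv_mult (mvf_adj b) (vv_diff f g) \<in> H2 k)"
    and pol: "\<exists>as. set as \<subseteq> ball 0 1 \<and> AM k k (\<lambda>\<zeta>. prod_list (map (\<lambda>\<alpha>. \<zeta> - \<alpha>) as) \<cdot>\<^sub>m mat_adjoint (b \<zeta>))"
    using assms(1) unfolding finite_inner_def by blast+
  have mvc: "L2_inner f (mv_mult b y) = L2_inner f (mv_mult b' y)" for f y
    by (rule L2_inner_sphere_cong) (simp_all add: mv_mult_def assms(2))
  have Hb: "H_b k b = H_b k b'" unfolding set_eq_iff H_b_iff mvc by simp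
  have H2c: "mv_mult (mvf_adj b') f \<in> H2 k" if "mv_mult (mvf_adj b) f \<in> H2 k" for f
    by (rule H2_cong[OF that]) (simp add: mv_mult_def mvf_adj_def assms(2))
  have "AM k k b'" by (rule AM_cong[OF A assms(2)])
  moreover have "mat_adjoint (b' \<zeta>) * b' \<zeta> = 1\<^sub>m k \<and> b' \<zeta> * mat_adjoint (b' \<zeta>) = 1\<^sub>m k" if "\<zeta> \<in> sphere 0 1" for \<zeta>
    using un[OF that] assms(2)[OF that] by simp
  moreover have "\<exists>g\<in>H_b k b'. (\<forall>h\<in>H_b k b'. L2_inner (vv_diff f g) h = 0) \<and>
        (f \<in> H2 k \<longrightarrow> mv_mult (mvf_adj b') (vv_diff f g) \<in> H2 k)" if "f \<in> L2 k" for f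
    using pr[OF that] H2c unfolding Hb by blast
  moreover have "\<exists>as. set as \<subseteq> ball 0 1 \<and> AM k k (\<lambda>\<zeta>. prod_list (map (\<lambda>\<alpha>. \<zeta> - \<alpha>) as) \<cdot>\<^sub>m mat_adjoint (b' \<zeta>))"
  proof -
    from pol obtain as where as: "set as \<subseteq> ball 0 1"
      "AM k k (\<lambda>\<zeta>. prod_list (map (\<lambda>\<alpha>. \<zeta> - \<alpha>) as) \<cdot>\<^sub>m mat_adjoint (b \<zeta>))" by blast
    show ?thesis by (intro exI[of _ as] conjI as(1) AM_cong[OF as(2)]) (simp add: assms(2))
  qed
  ultimately show ?thesis unfolding finite_inner_def by blast
qed

text \<open>
  Unlike general bounded analytic functions, Blaschke--Potapov products are continuous on the closed disc, so
  their boundary values need no limit.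
\<close>

definition cont_hol :: "nat \<Rightarrow> mvf \<Rightarrow> bool" where
  "cont_hol k X \<longleftrightarrow> (\<forall>z\<in>cball 0 1. X z \<in> carrier_mat k k) \<and>
     (\<forall>i<k. \<forall>j<k. continuous_on (cball 0 1) (\<lambda>z. X z $$ (i, j)) \<and> (\<lambda>z. X z $$ (i, j)) holomorphic_on ball 0 1)"

text \<open>
  A continuous inverse of \<open>X\<close> on an annulus that reaches up to the circle. It bounds $b_\ell^{-1} s_\ell$ and
  $s_r b_r^{-1}$ there, away from their poles.
\<close>

definition annulus_inverse :: "nat \<Rightarrow> mvf \<Rightarrow> real \<Rightarrow> mvf \<Rightarrow> bool" where
  "annulus_inverse k X \<rho> Z \<longleftrightarrow>
     (\<forall>z. \<rho> < norm z \<and> norm z \<le> 1 \<longrightarrow> Z z \<in> carrier_mat k k \<and> Z z * X z = 1\<^sub>m k) \<and>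
     (\<forall>i<k. \<forall>j<k. continuous_on {z. \<rho> < norm z \<and> norm z \<le> 1} (\<lambda>z. Z z $$ (i, j)))"

lemma cont_hol_const: "U \<in> carrier_mat k k \<Longrightarrow> cont_hol k (\<lambda>_. U)"
  by (auto simp: cont_hol_def)

lemma continuous_on_mat_mult:
  assumes "\<And>z. z \<in> S \<Longrightarrow> X z \<in> carrier_mat k k" "\<And>z. z \<in> S \<Longrightarrow> Y z \<in> carrier_mat k k"
    "\<And>i j. i < k \<Longrightarrow> j < k \<Longrightarrow> continuous_on S (\<lambda>z. X z $$ (i, j) :: complex)"
    "\<And>i j. i < k \<Longrightarrow> j < k \<Longrightarrow> continuous_on S (\<lambda>z. Y z $$ (i, j))" "i < k" "j < k"
  shows "continuous_on S (\<lambda>z. (X z * Y z) $$ (i, j))"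
proof -
  have "continuous_on S (\<lambda>z. \<Sum>l<k. X z $$ (i, l) * Y z $$ (l, j))"
    using assms by (intro continuous_intros) auto
  then show ?thesis
    by (subst continuous_on_cong[OF refl mult_mat_index[OF assms(1,2,5,6)]])
qed

lemma cont_hol_mult:
  assumes "cont_hol k X" "cont_hol k Y" shows "cont_hol k (\<lambda>z. X z * Y z)"
proof -
  have c: "X z \<in> carrier_mat k k" "Y z \<in> carrier_mat k k" if "z \<in> cball 0 1" for z
    using assms that unfolding cont_hol_def by blast+
  have cc: "continuous_on (cball 0 1) (\<lambda>z. (X z * Y z) $$ (i, j))" if "i < k" "j < k" for i j
    by (rule continuous_on_mat_mult[OF c _ _ that]) (use assms in \<open>auto simp: cont_hol_def\<close>)
  have "(\<lambda>z. (X z * Y z) $$ (i, j)) holomorphic_on ball 0 1" if "i < k" "j < k" for i j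
  proof (rule holomorphic_transform)
    show "(\<lambda>z. \<Sum>l<k. X z $$ (i, l) * Y z $$ (l, j)) holomorphic_on ball 0 1"
      using assms that by (intro holomorphic_intros) (auto simp: cont_hol_def)
    fix z :: complex assume "z \<in> ball 0 1"
    then show "(\<Sum>l<k. X z $$ (i, l) * Y z $$ (l, j)) = (X z * Y z) $$ (i, j)"
      by (intro mult_mat_index[OF c that, symmetric]) auto
  qed
  then show ?thesis using cc c by (auto simp: cont_hol_def intro!: mult_carrier_mat)
qed

lemma annulus_inverse_mult:
  assumes X: "annulus_inverse k X \<rho>1 Z" "cont_hol k X" and Y: "annulus_inverse k Y \<rho>2 W" "cont_hol k Y"
  shows "annulus_inverse k (\<lambda>z. X z * Y z) (max \<rho>1 \<rho>2) (\<lambda>z. W z * Z z)"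
proof -
  let ?S = "{z. max \<rho>1 \<rho>2 < norm z \<and> norm z \<le> 1} :: complex set"
  have Z: "Z z \<in> carrier_mat k k" "Z z * X z = 1\<^sub>m k" and W: "W z \<in> carrier_mat k k" "W z * Y z = 1\<^sub>m k"
    if "z \<in> ?S" for z using X(1) Y(1) that unfolding annulus_inverse_def by auto
  have c: "X z \<in> carrier_mat k k" "Y z \<in> carrier_mat k k" if "z \<in> ?S" for z
    using X(2) Y(2) that unfolding cont_hol_def by auto
  have inv: "W z * Z z * (X z * Y z) = 1\<^sub>m k" if z: "z \<in> ?S" for z
  proof -
    have "W z * Z z * (X z * Y z) = W z * (Z z * (X z * Y z))"
      using Z[OF z] W[OF z] c[OF z] by (intro assoc_mult_mat[of _ k k _ k _ k]) auto
    also have "Z z * (X z * Y z) = Z z * X z * Y z"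
      using Z[OF z] W[OF z] c[OF z] by (intro assoc_mult_mat[of _ k k _ k _ k, symmetric]) auto
    finally show ?thesis using Z[OF z] W[OF z] c[OF z] by simp
  qed
  have "continuous_on ?S (\<lambda>z. (W z * Z z) $$ (i, j))" if "i < k" "j < k" for i j
  proof (rule continuous_on_mat_mult[OF W(1) Z(1) _ _ that])
    fix i j assume "i < k" "j < k"
    then have "continuous_on {z. \<rho>2 < norm z \<and> norm z \<le> 1} (\<lambda>z. W z $$ (i, j))"
      "continuous_on {z. \<rho>1 < norm z \<and> norm z \<le> 1} (\<lambda>z. Z z $$ (i, j))"
      using X(1) Y(1) unfolding annulus_inverse_def by auto
    then show "continuous_on ?S (\<lambda>z. W z $$ (i, j))" "continuous_on ?S (\<lambda>z. Z z $$ (i, j))"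
      by (auto elim!: continuous_on_subset)
  qed
  then show ?thesis unfolding annulus_inverse_def using inv Z W by (auto intro!: mult_carrier_mat)
qed

lemma annulus_inverse_const:
  assumes "U \<in> carrier_mat k k" "mat_adjoint U * U = 1\<^sub>m k"
  shows "annulus_inverse k (\<lambda>_. U) 0 (\<lambda>_. mat_adjoint U)"
  using assms by (auto simp: annulus_inverse_def)

lemma bp_factor_cont_hol:
  assumes \<alpha>: "\<alpha> \<in> ball 0 1" and Q: "Q \<in> carrier_mat k k"
  shows "cont_hol k (bp_factor k (\<alpha>, Q))"
  unfolding cont_hol_def bp_factor_pmat
proof (intro conjI ballI allI impI)
  fix i j assume ij: "i < k" "j < k"
  have nz: "norm z \<le> 1 \<Longrightarrow> 1 - cnj \<alpha> * z \<noteq> 0" for z by (rule one_minus_cnj_mult_nz[OF \<alpha>])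
  show "continuous_on (cball 0 1) (\<lambda>z. pmat k Q ((z - \<alpha>) / (1 - cnj \<alpha> * z)) $$ (i, j))"
    "(\<lambda>z. pmat k Q ((z - \<alpha>) / (1 - cnj \<alpha> * z)) $$ (i, j)) holomorphic_on ball 0 1"
    unfolding pmat_index[OF Q ij] using nz by (auto intro!: continuous_intros holomorphic_intros)
qed (use Q in simp)

lemma bp_factor_annulus_inverse:
  assumes \<alpha>: "\<alpha> \<in> ball 0 1" and Q: "Q \<in> carrier_mat k k" "Q * Q = Q"
  shows "annulus_inverse k (bp_factor k (\<alpha>, Q)) (norm \<alpha>) (\<lambda>z. pmat k Q ((1 - cnj \<alpha> * z) / (z - \<alpha>)))"
  unfolding annulus_inverse_def bp_factor_pmat
proof (intro conjI allI impI)
  have nz: "norm z \<le> 1 \<Longrightarrow> 1 - cnj \<alpha> * z \<noteq> 0" for z by (rule one_minus_cnj_mult_nz[OF \<alpha>])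
  fix z :: complex assume z: "norm \<alpha> < norm z \<and> norm z \<le> 1"
  have "(1 - cnj \<alpha> * z) / (z - \<alpha>) * ((z - \<alpha>) / (1 - cnj \<alpha> * z)) = 1"
    using z nz[of z] by auto
  then show "pmat k Q ((1 - cnj \<alpha> * z) / (z - \<alpha>)) * pmat k Q ((z - \<alpha>) / (1 - cnj \<alpha> * z)) = 1\<^sub>m k"
    unfolding pmat_mult[OF Q] using pmat_one[OF Q(1)] by simp
next
  fix i j assume ij: "i < k" "j < k"
  show "continuous_on {z. norm \<alpha> < norm z \<and> norm z \<le> 1} (\<lambda>z. pmat k Q ((1 - cnj \<alpha> * z) / (z - \<alpha>)) $$ (i, j))"
    unfolding pmat_index[OF Q(1) ij] by (intro continuous_intros) auto
qed (use Q in simp)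

lemma annulus_inverse_cong:
  assumes "annulus_inverse k X \<rho> Z" "\<And>z. z \<in> cball 0 1 \<Longrightarrow> X z = Y z" shows "annulus_inverse k Y \<rho> Z"
  using assms unfolding annulus_inverse_def by auto

lemma cont_hol_cong:
  assumes X: "cont_hol k X" and eq: "\<And>z. z \<in> cball 0 1 \<Longrightarrow> X z = Y z" shows "cont_hol k Y"
  unfolding cont_hol_def
proof (intro conjI ballI allI impI)
  show "Y z \<in> carrier_mat k k" if "z \<in> cball 0 1" for z
    using X eq[OF that] that unfolding cont_hol_def by metis
  fix i j assume ij: "i < k" "j < k"
  have "continuous_on (cball 0 1) (\<lambda>z. X z $$ (i, j))" "(\<lambda>z. X z $$ (i, j)) holomorphic_on ball 0 1"
    using X ij unfolding cont_hol_def by auto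
  then show "continuous_on (cball 0 1) (\<lambda>z. Y z $$ (i, j))" "(\<lambda>z. Y z $$ (i, j)) holomorphic_on ball 0 1"
    using eq by (auto elim!: continuous_on_eq holomorphic_transform)
qed

lemma blaschke_potapov_props:
  assumes "blaschke_potapov k \<kappa> b"
  shows "finite_inner k b" "cont_hol k b" "\<exists>\<rho> Z. 0 \<le> \<rho> \<and> \<rho> < 1 \<and> annulus_inverse k b \<rho> Z"
proof -
  obtain U fs where U: "U \<in> carrier_mat k k" "mat_adjoint U * U = 1\<^sub>m k"
    and fs: "\<forall>(\<alpha>, Q) \<in> set fs. \<alpha> \<in> ball 0 1 \<and> rank_one_projection k Q"
    and b: "\<forall>z \<in> cball 0 1. b z = U * foldr (\<lambda>f X. bp_factor k f z * X) fs (1\<^sub>m k)"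
    using assms unfolding blaschke_potapov_def by blast
  define P where "P gs z = foldr (\<lambda>f X. bp_factor k f z * X) gs (1\<^sub>m k)" for gs z
  have "finite_inner k (P gs) \<and> cont_hol k (P gs) \<and> (\<exists>\<rho> Z. 0 \<le> \<rho> \<and> \<rho> < 1 \<and> annulus_inverse k (P gs) \<rho> Z)"
    if "set gs \<subseteq> set fs" for gs
    using that
  proof (induction gs)
    case Nil
    have o: "(1\<^sub>m k :: complex mat) \<in> carrier_mat k k" "mat_adjoint (1\<^sub>m k) * 1\<^sub>m k = (1\<^sub>m k :: complex mat)"
      by (auto intro!: eq_matI)
    have "P [] = (\<lambda>_. 1\<^sub>m k)" by (simp add: P_def fun_eq_iff)
    then show ?case
      using finite_inner_unitary[OF o] cont_hol_const[OF o(1)] annulus_inverse_const[OF o]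
      by (auto intro!: exI[of _ 0])
  next
    case (Cons f gs)
    obtain \<alpha> Q where f: "f = (\<alpha>, Q)" by (cases f)
    have \<alpha>: "\<alpha> \<in> ball 0 1" and Q: "Q \<in> carrier_mat k k" "Q * Q = Q" "mat_adjoint Q = Q"
      using fs Cons.prems unfolding f by (auto simp: rank_one_projection_def)
    have PC: "P (f # gs) = (\<lambda>z. bp_factor k (\<alpha>, Q) z * P gs z)" by (simp add: P_def f fun_eq_iff)
    from Cons obtain \<rho> Z where IH: "finite_inner k (P gs)" "cont_hol k (P gs)" "0 \<le> \<rho>" "\<rho> < 1" "annulus_inverse k (P gs) \<rho> Z"
      by auto
    have "annulus_inverse k (P (f # gs)) (max (norm \<alpha>) \<rho>) (\<lambda>z. Z z * pmat k Q ((1 - cnj \<alpha> * z) / (z - \<alpha>)))"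
      unfolding PC
      by (rule annulus_inverse_mult[OF bp_factor_annulus_inverse[OF \<alpha> Q(1,2)] bp_factor_cont_hol[OF \<alpha> Q(1)] IH(5,2)])
    moreover have "0 \<le> max (norm \<alpha>) \<rho>" "max (norm \<alpha>) \<rho> < 1" using \<alpha> IH by auto
    moreover have "finite_inner k (P (f # gs))"
      unfolding PC by (rule finite_inner_mult[OF finite_inner_bp_factor[OF \<alpha> Q] IH(1)])
    moreover have "cont_hol k (P (f # gs))"
      unfolding PC by (rule cont_hol_mult[OF bp_factor_cont_hol[OF \<alpha> Q(1)] IH(2)])
    ultimately show ?case by blast
  qed
  from this[OF order_refl] obtain \<rho> Z where
    P: "finite_inner k (P fs)" "cont_hol k (P fs)" "0 \<le> \<rho>" "\<rho> < 1" "annulus_inverse k (P fs) \<rho> Z" by auto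
  have bP: "b z = U * P fs z" if "z \<in> cball 0 1" for z using b that by (simp add: P_def)
  show "finite_inner k b"
    by (rule finite_inner_cong[OF finite_inner_mult[OF finite_inner_unitary[OF U] P(1)]]) (auto simp: bP)
  show "cont_hol k b"
    by (rule cont_hol_cong[OF cont_hol_mult[OF cont_hol_const[OF U(1)] P(2)]]) (simp add: bP)
  have "annulus_inverse k b (max 0 \<rho>) (\<lambda>z. Z z * mat_adjoint U)"
    by (rule annulus_inverse_cong[OF annulus_inverse_mult[OF annulus_inverse_const[OF U] cont_hol_const[OF U(1)] P(5,2)]]) (simp add: bP)
  then show "\<exists>\<rho> Z. 0 \<le> \<rho> \<and> \<rho> < 1 \<and> annulus_inverse k b \<rho> Z"
    using P(3,4) by (intro exI[of _ "max 0 \<rho>"] exI[of _ "\<lambda>z. Z z * mat_adjoint U"]) auto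
qed

lemma AMv_boundary:
  assumes car: "\<And>\<zeta>. \<zeta> \<in> sphere 0 1 \<Longrightarrow> X \<zeta> \<in> carrier_mat p k" "\<And>z. z \<in> ball 0 1 \<Longrightarrow> F z \<in> carrier_mat p k"
    and hol: "\<And>i j. i < p \<Longrightarrow> j < k \<Longrightarrow> (\<lambda>z. F z $$ (i, j)) holomorphic_on ball 0 1"
    and bd: "\<And>i j. i < p \<Longrightarrow> j < k \<Longrightarrow> \<exists>B. \<forall>z\<in>ball 0 1. norm (F z $$ (i, j)) \<le> B"
    and lim: "\<And>i j. i < p \<Longrightarrow> j < k \<Longrightarrow> AE \<theta> in arc. ((\<lambda>r::real. F (of_real r * cis \<theta>) $$ (i, j)) \<longlongrightarrow> X (cis \<theta>) $$ (i, j)) (at_left 1)"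
  shows "AMv p k X F"
  unfolding AMv_def
proof (intro conjI ballI)
  show "AM p k X"
    unfolding AM_def
  proof (intro conjI ballI allI impI car(1))
    fix i j assume ij: "i < p" "j < k"
    obtain B where B: "\<forall>z\<in>ball 0 1. norm (F z $$ (i, j)) \<le> B" using bd[OF ij] by blast
    show "(\<lambda>\<zeta>. X \<zeta> $$ (i, j)) \<in> hinf"
      by (rule hinf_boundary[OF hol[OF ij] _ lim[OF ij]]) (use B in blast)
  qed
  fix \<alpha> :: complex assume \<alpha>: "\<alpha> \<in> ball 0 1"
  show "F \<alpha> \<in> carrier_mat p k" by (rule car(2)[OF \<alpha>])
  show "AM p k (\<lambda>\<zeta>. 1 / (\<zeta> - \<alpha>) \<cdot>\<^sub>m (X \<zeta> - F \<alpha>))"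
    unfolding AM_def
  proof (intro conjI ballI allI impI)
    show "1 / (\<zeta> - \<alpha>) \<cdot>\<^sub>m (X \<zeta> - F \<alpha>) \<in> carrier_mat p k" if "\<zeta> \<in> sphere 0 1" for \<zeta>
      by (rule smult_carrier_mat[OF minus_carrier_mat[OF car(2)[OF \<alpha>]]])
    fix i j assume ij: "i < p" "j < k"
    obtain B where B: "\<forall>z\<in>ball 0 1. norm (F z $$ (i, j)) \<le> B" using bd[OF ij] by blast
    have "(\<lambda>\<zeta>. (X \<zeta> $$ (i, j) - F \<alpha> $$ (i, j)) / (\<zeta> - \<alpha>)) \<in> hinf"
      by (rule hinf_quotient[OF hol[OF ij] _ lim[OF ij] \<alpha>]) (use B in blast)
    then show "(\<lambda>\<zeta>. (1 / (\<zeta> - \<alpha>) \<cdot>\<^sub>m (X \<zeta> - F \<alpha>)) $$ (i, j)) \<in> hinf"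
      by (rule hinf_cong) (use car(2)[OF \<alpha>] ij in simp)
  qed
qed

lemma radial_limit_continuous:
  assumes "continuous_on (cball 0 1) \<phi>"
  shows "((\<lambda>r::real. \<phi> (of_real r * cis \<theta>) :: complex) \<longlongrightarrow> \<phi> (cis \<theta>)) (at_left 1)"
proof -
  have "((\<lambda>r::real. of_real r * cis \<theta>) \<longlongrightarrow> of_real 1 * cis \<theta>) (at_left 1)" by (intro tendsto_intros)
  moreover have "\<forall>\<^sub>F r::real in at_left 1. of_real r * cis \<theta> \<in> cball 0 1"
    by (auto simp: eventually_at_left_field norm_mult intro!: exI[of _ 0])
  ultimately show ?thesis
    using continuous_on_tendsto_compose[OF assms, of "\<lambda>r. of_real r * cis \<theta>" "cis \<theta>"] by simp
qed

lemma cont_hol_AMv: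
  assumes "cont_hol k b" shows "AMv k k b b"
proof (rule AMv_boundary)
  have c: "b z \<in> carrier_mat k k" if "z \<in> cball 0 1" for z using assms that unfolding cont_hol_def by blast
  show "b z \<in> carrier_mat k k" if "z \<in> ball 0 1" for z using that by (intro c) auto
  show "b z \<in> carrier_mat k k" if "z \<in> sphere 0 1" for z using that by (intro c) auto
  fix i j assume ij: "i < k" "j < k"
  have cont: "continuous_on (cball 0 1) (\<lambda>z. b z $$ (i, j))" and h: "(\<lambda>z. b z $$ (i, j)) holomorphic_on ball 0 1"
    using assms ij unfolding cont_hol_def by blast+
  show "(\<lambda>z. b z $$ (i, j)) holomorphic_on ball 0 1" by (rule h)
  have "bounded ((\<lambda>z. b z $$ (i, j)) ` cball 0 1)"
    by (intro compact_imp_bounded compact_continuous_image cont) simp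
  then obtain B where "\<forall>y\<in>(\<lambda>z. b z $$ (i, j)) ` cball 0 1. norm y \<le> B" unfolding bounded_iff by blast
  then show "\<exists>B. \<forall>z\<in>ball 0 1. norm (b z $$ (i, j)) \<le> B" by (intro exI[of _ B]) auto
  show "AE \<theta> in arc. ((\<lambda>r::real. b (of_real r * cis \<theta>) $$ (i, j)) \<longlongrightarrow> b (cis \<theta>) $$ (i, j)) (at_left 1)"
    by (intro AE_I2 radial_limit_continuous[OF cont])
qed

section \<open>Boundary values of generalized Schur functions\<close>

lemma full_rank_onto:
  fixes A :: "complex mat"
  assumes A: "A \<in> carrier_mat p m" and r: "vec_space.rank p A = p" and c: "c \<in> carrier_vec p"
  shows "\<exists>x\<in>carrier_vec m. A *\<^sub>v x = c"
proof -
  interpret vec_space "TYPE(complex)" p .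
  have cc: "set (cols A) \<subseteq> carrier_vec p" using A cols_dim by blast
  obtain U where U: "finite U" "maximal U (\<lambda>T. T \<subseteq> set (cols A) \<and> lin_indpt T)"
  proof -
    have "lin_indpt {}" unfolding lin_dep_def by auto
    then show ?thesis
      using maximal_exists_superset[of "set (cols A)" "\<lambda>T. T \<subseteq> set (cols A) \<and> lin_indpt T" "{}"] that by auto
  qed
  have Us: "U \<subseteq> set (cols A)" "lin_indpt U" using U(2) by (auto simp: maximal_def)
  have "card U = p" using rank_card_indpt[OF A U(2)] r by simp
  then have "basis U"
    using dim_li_is_basis[OF fin_dim U(1) _ Us(2)] Us(1) cc dim_is_n by auto
  then have "span U = carrier_vec p" by (simp add: basis_def)
  moreover have "span U \<subseteq> span (set (cols A))" by (rule span_is_monotone[OF Us(1)])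
  ultimately have "c \<in> col_space A" using c by (auto simp: col_space_def)
  then show ?thesis using col_space_eq[OF A] A by auto
qed

lemma hcat_carrier: "A \<in> carrier_mat p k \<Longrightarrow> B \<in> carrier_mat p l \<Longrightarrow> hcat A B \<in> carrier_mat p (k + l)"
  by (auto simp: hcat_def)

lemma hcat_index:
  assumes "A \<in> carrier_mat p k" "B \<in> carrier_mat p l" "i < p" "j < k + l"
  shows "hcat A B $$ (i, j) = (if j < k then A $$ (i, j) else B $$ (i, j - k))"
  using assms by (auto simp: hcat_def)

lemma hcat_mult_vec:
  fixes A B :: "complex mat"
  assumes A: "A \<in> carrier_mat p k" and B: "B \<in> carrier_mat p l" and x: "x \<in> carrier_vec (k + l)"
  shows "hcat A B *\<^sub>v x = A *\<^sub>v vec_first x k + B *\<^sub>v vec_last x l"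
proof (rule eq_vecI)
  fix i assume "i < dim_vec (A *\<^sub>v vec_first x k + B *\<^sub>v vec_last x l)"
  then have i: "i < p" using B by simp
  have "(hcat A B *\<^sub>v x) $ i = (\<Sum>j<k + l. hcat A B $$ (i, j) * x $ j)"
    by (rule mult_mat_vec_index[OF hcat_carrier[OF A B] x i])
  also have "\<dots> = (\<Sum>j<k + l. (if j < k then A $$ (i, j) else B $$ (i, j - k)) * x $ j)"
    by (rule sum.cong[OF refl]) (simp add: hcat_index[OF A B i])
  also have "\<dots> = (\<Sum>j<k. (if j < k then A $$ (i, j) else B $$ (i, j - k)) * x $ j)
     + (\<Sum>j=k..<k+l. (if j < k then A $$ (i, j) else B $$ (i, j - k)) * x $ j)"
    unfolding lessThan_atLeast0 by (rule sum.atLeastLessThan_concat[symmetric]) auto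
  also have "(\<Sum>j<k. (if j < k then A $$ (i, j) else B $$ (i, j - k)) * x $ j) = (\<Sum>j<k. A $$ (i, j) * vec_first x k $ j)"
    using x by (intro sum.cong refl) (auto simp: vec_first_def)
  also have "(\<Sum>j=k..<k+l. (if j < k then A $$ (i, j) else B $$ (i, j - k)) * x $ j)
     = (\<Sum>j<l. B $$ (i, j) * vec_last x l $ j)"
    using x by (intro sum.reindex_bij_witness[of _ "\<lambda>j. j + k" "\<lambda>j. j - k"]) (auto simp: vec_last_def add.commute)
  also have "(\<Sum>j<k. A $$ (i, j) * vec_first x k $ j) = (A *\<^sub>v vec_first x k) $ i"
    by (rule mult_mat_vec_index[OF A _ i, symmetric]) simp
  also have "(\<Sum>j<l. B $$ (i, j) * vec_last x l $ j) = (B *\<^sub>v vec_last x l) $ i"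
    by (rule mult_mat_vec_index[OF B _ i, symmetric]) simp
  finally show "(hcat A B *\<^sub>v x) $ i = (A *\<^sub>v vec_first x k + B *\<^sub>v vec_last x l) $ i"
    using i B by simp
qed (use A B in \<open>simp add: hcat_def\<close>)

lemma hcat_full_rank_onto:
  fixes A B :: "complex mat"
  assumes A: "A \<in> carrier_mat p k" and B: "B \<in> carrier_mat p l" and r: "vec_space.rank p (hcat A B) = p"
    and c: "c \<in> carrier_vec p"
  shows "\<exists>c1\<in>carrier_vec k. \<exists>c2\<in>carrier_vec l. c = A *\<^sub>v c1 + B *\<^sub>v c2"
proof -
  obtain x where x: "x \<in> carrier_vec (k + l)" "hcat A B *\<^sub>v x = c"
    using full_rank_onto[OF hcat_carrier[OF A B] r c] by blast
  show ?thesis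
    using hcat_mult_vec[OF A B x(1)] x by (intro bexI[of _ "vec_first x k"] bexI[of _ "vec_last x l"]) auto
qed

text \<open>
  Near an isolated singularity a meromorphic function is holomorphic; if it is also bounded there, it has
  no pole, and the canonical representative has no removable singularities either.
\<close>

lemma hol_domain_extend:
  assumes s: "\<forall>i<p. \<forall>j<q. (\<lambda>z. s z $$ (i, j)) nicely_meromorphic_on ball 0 1"
    and z: "z \<in> ball 0 1"
    and bd: "\<forall>\<^sub>F w in at z. w \<in> hol_domain p q s \<longrightarrow> (\<forall>i<p. \<forall>j<q. norm (s w $$ (i, j)) \<le> B)"
  shows "z \<in> hol_domain p q s"
proof -
  have an: "\<forall>\<^sub>F w in at z. (\<lambda>w. s w $$ (i, j)) analytic_on {w}" if ij: "i < p" "j < q" for i j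
  proof -
    have "(\<lambda>z. s z $$ (i, j)) meromorphic_on ball 0 1" using s ij by (auto simp: nicely_meromorphic_on_def)
    then have "(\<lambda>z. s z $$ (i, j)) meromorphic_on {z}" by (rule meromorphic_on_subset) (use z in auto)
    from meromorphic_on_isolated_singularity[OF this] obtain r where r: "r > 0" "(\<lambda>z. s z $$ (i, j)) analytic_on ball z r - {z}"
      unfolding isolated_singularity_at_def by blast
    have "\<forall>\<^sub>F w in at z. w \<in> ball z r - {z}"
      using r(1) by (intro eventually_at_in_open) auto
    then show ?thesis by eventually_elim (rule analytic_on_subset[OF r(2)], auto)
  qed
  have "\<forall>\<^sub>F w in at z. \<forall>i\<in>{..<p}. \<forall>j\<in>{..<q}. (\<lambda>w. s w $$ (i, j)) analytic_on {w}"
    using an by (intro eventually_ball_finite ballI) auto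
  moreover have "\<forall>\<^sub>F w in at z. w \<in> ball 0 1"
    using z by (intro eventually_at_in_open') auto
  ultimately have "\<forall>\<^sub>F w in at z. w \<in> hol_domain p q s"
    by eventually_elim (auto simp: hol_domain_def)
  with bd have bd': "\<forall>\<^sub>F w in at z. \<forall>i<p. \<forall>j<q. norm (s w $$ (i, j)) \<le> B"
    by eventually_elim blast
  have "(\<lambda>w. s w $$ (i, j)) analytic_on {z}" if ij: "i < p" "j < q" for i j
  proof (rule nicely_meromorphic_on_imp_analytic_at)
    show "(\<lambda>w. s w $$ (i, j)) nicely_meromorphic_on ball 0 1" using s ij by blast
    show "\<not> is_pole (\<lambda>w. s w $$ (i, j)) z"
    proof
      assume "is_pole (\<lambda>w. s w $$ (i, j)) z"
      then have "\<forall>\<^sub>F w in at z. norm (s w $$ (i, j)) \<ge> B + 1"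
        unfolding is_pole_def filterlim_at_infinity_conv_norm_at_top filterlim_at_top by blast
      with bd' have "\<forall>\<^sub>F w in at z. False"
      proof eventually_elim
        case (elim w)
        then have "norm (s w $$ (i, j)) \<le> B" using ij by blast
        with elim(2) show False by linarith
      qed
      then show False by simp
    qed
  qed (use z in auto)
  then show ?thesis using z by (auto simp: hol_domain_def)
qed

text \<open>
  The Gram matrix of a single point and a single unit vector is a number that must not be negative. It equals
  $(1 - \sum_l |s_{il}(z)|^2)/(1 - |z|^2)$.
\<close>

lemma schur_kernel_entry_bound:
  assumes s: "s \<in> schur p q" and z: "z \<in> hol_domain p q s" and ij: "i < p" "j < q"
  shows "norm (s z $$ (i, j)) \<le> 1"
proof -
  have zb: "z \<in> ball 0 1" using z by (simp add: hol_domain_def)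
  have sc: "s z \<in> carrier_mat p q" using s zb by (auto simp: gen_schur_def)
  define G where "G = gram_mat (schur_kernel p s) 1 (\<lambda>_. z) (\<lambda>_. unit_vec p i)"
  define a where "a = (schur_kernel p s z z *\<^sub>v unit_vec p i) \<bullet>c unit_vec p i"
  define t where "t = (1 - (\<Sum>l<q. (cmod (s z $$ (i, l)))\<^sup>2)) / (1 - (norm z)\<^sup>2)"
  have n1: "1 - (norm z)\<^sup>2 > 0" using zb by (simp add: abs_square_less_1)
  have Kc: "schur_kernel p s z z \<in> carrier_mat p p" using sc by (auto simp: schur_kernel_def)
  have "a = (\<Sum>l<p. (schur_kernel p s z z *\<^sub>v unit_vec p i) $ l * cnj (unit_vec p i $ l))"
    unfolding a_def by (rule cscalar_prod_sum) simp
  also have "\<dots> = (\<Sum>l<p. if l = i then (schur_kernel p s z z *\<^sub>v unit_vec p i) $ l else 0)"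
    by (rule sum.cong) (use ij in auto)
  also have "\<dots> = (schur_kernel p s z z *\<^sub>v unit_vec p i) $ i" using ij by simp
  also have "\<dots> = (\<Sum>l<p. schur_kernel p s z z $$ (i, l) * unit_vec p i $ l)"
    by (rule mult_mat_vec_index[OF Kc _ ij(1)]) simp
  also have "\<dots> = (\<Sum>l<p. if l = i then schur_kernel p s z z $$ (i, l) else 0)"
    by (rule sum.cong) (use ij in auto)
  also have "\<dots> = schur_kernel p s z z $$ (i, i)" using ij by simp
  also have "\<dots> = 1 / (1 - z * cnj z) * (1 - (s z * mat_adjoint (s z)) $$ (i, i))"
    using sc ij by (simp add: schur_kernel_def)
  also have "(s z * mat_adjoint (s z)) $$ (i, i) = (\<Sum>l<q. s z $$ (i, l) * mat_adjoint (s z) $$ (l, i))"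
    by (rule mult_mat_index[OF sc mat_adjoint_carrier[OF sc] ij(1,1)])
  also have "\<dots> = of_real (\<Sum>l<q. (cmod (s z $$ (i, l)))\<^sup>2)"
    unfolding of_real_sum complex_norm_square using sc ij by (intro sum.cong refl) auto
  also have "1 - z * cnj z = of_real (1 - (norm z)\<^sup>2)" unfolding of_real_diff complex_norm_square by simp
  finally have a: "a = of_real t" by (simp add: t_def)
  have Gc: "G \<in> carrier_mat 1 1" by (simp add: G_def gram_mat_def)
  have "upper_triangular G" using Gc by (auto simp: upper_triangular_def)
  then have "char_poly G = (\<Prod>a\<leftarrow>diag_mat G. [:- a, 1:])" by (rule char_poly_upper_triangular[OF Gc])
  also have "diag_mat G = [a]" by (simp add: diag_mat_def G_def gram_mat_def a_def)
  finally have cp: "char_poly G = [:- a, 1:]" by simp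
  have "neg_eigenvalues G \<le> 0"
  proof -
    have "has_neg_squares p (schur_kernel p s) (hol_domain p q s) 0" using s by (simp add: gen_schur_def)
    then show ?thesis unfolding has_neg_squares_def G_def using z by auto
  qed
  then have "{# z \<in># proots (char_poly G). z < 0 #} = {#}" by (simp add: neg_eigenvalues_def)
  moreover have "a \<in># proots (char_poly G)" unfolding cp by simp
  ultimately have "\<not> a < 0" by (metis (mono_tags) count_empty count_filter_mset count_eq_zero_iff)
  then have "t \<ge> 0" unfolding a by (auto simp: less_complex_def)
  then have le1: "(\<Sum>l<q. (cmod (s z $$ (i, l)))\<^sup>2) \<le> 1" using n1 by (simp add: t_def zero_le_divide_iff)
  have "(cmod (s z $$ (i, j)))\<^sup>2 \<le> (\<Sum>l<q. (cmod (s z $$ (i, l)))\<^sup>2)"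
    using ij by (intro member_le_sum) auto
  then have "(cmod (s z $$ (i, j)))\<^sup>2 \<le> 1" using le1 by linarith
  then show ?thesis by (simp add: abs_square_le_1)
qed

text \<open>
  Boundedness excludes poles, so the domain of holomorphy is the whole disc.
\<close>

lemma schur_holomorphic:
  assumes s: "s \<in> schur p q" and ij: "i < p" "j < q"
  shows "hol_domain p q s = ball 0 1" "(\<lambda>z. s z $$ (i, j)) holomorphic_on ball 0 1"
    "\<forall>z\<in>ball 0 1. norm (s z $$ (i, j)) \<le> 1"
proof -
  have "z \<in> hol_domain p q s" if z: "z \<in> ball 0 1" for z
    by (rule hol_domain_extend[OF _ z, of p q s 1])
       (use s schur_kernel_entry_bound[OF s] in \<open>auto simp: gen_schur_def intro!: always_eventually\<close>)
  then show H: "hol_domain p q s = ball 0 1" by (auto simp: hol_domain_def)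
  have "(\<lambda>z. s z $$ (i, j)) analytic_on ball 0 1"
    unfolding analytic_on_analytic_at[of _ "ball 0 1"] using H ij by (auto simp: hol_domain_def)
  then show "(\<lambda>z. s z $$ (i, j)) holomorphic_on ball 0 1" by (rule analytic_imp_holomorphic)
  show "\<forall>z\<in>ball 0 1. norm (s z $$ (i, j)) \<le> 1"
    using schur_kernel_entry_bound[OF s _ ij] H by simp
qed

text \<open>
  The boundary function \<open>bdry\<close> is defined by a limit operator that returns an arbitrary value when the limit
  does not exist; this predicate records that the values are limits at the given point.
\<close>

definition radial_limits :: "nat \<Rightarrow> nat \<Rightarrow> mvf \<Rightarrow> complex \<Rightarrow> bool" where
  "radial_limits p q s \<zeta> \<longleftrightarrow> (\<forall>i<p. \<forall>j<q.
     ((\<lambda>r::real. s (of_real r * \<zeta>) $$ (i, j)) \<longlongrightarrow> bdry p q s \<zeta> $$ (i, j)) (at_left 1))"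

lemma radial_limitsI:
  assumes "\<And>i j. i < p \<Longrightarrow> j < q \<Longrightarrow> \<exists>l. ((\<lambda>r::real. s (of_real r * \<zeta>) $$ (i, j)) \<longlongrightarrow> l) (at_left 1)"
  shows "radial_limits p q s \<zeta>"
  unfolding radial_limits_def
proof (intro allI impI)
  fix i j assume ij: "i < p" "j < q"
  obtain l where l: "((\<lambda>r::real. s (of_real r * \<zeta>) $$ (i, j)) \<longlongrightarrow> l) (at_left 1)" using assms[OF ij] by blast
  then have "Lim (at_left 1) (\<lambda>r::real. s (of_real r * \<zeta>) $$ (i, j)) = l" by (intro tendsto_Lim) auto
  then show "((\<lambda>r::real. s (of_real r * \<zeta>) $$ (i, j)) \<longlongrightarrow> bdry p q s \<zeta> $$ (i, j)) (at_left 1)"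
    using l ij by (simp add: bdry_def)
qed

lemma bdry_carrier [simp]: "bdry p q s \<zeta> \<in> carrier_mat p q" by (simp add: bdry_def)

lemma AE_all_less:
  assumes "\<And>i. i < (n::nat) \<Longrightarrow> AE x in M. P i x" shows "AE x in M. \<forall>i<n. P i x"
proof -
  have "AE x in M. \<forall>i\<in>{..<n}. P i x" by (subst AE_finite_all) (use assms in auto)
  then show ?thesis by (rule eventually_mono) auto
qed

lemma schur_radial_limits:
  assumes s: "s \<in> schur p q" shows "AE \<theta> in arc. radial_limits p q s (cis \<theta>)"
proof -
  have "AE \<theta> in arc. \<forall>i<p. \<forall>j<q. \<exists>l. ((\<lambda>r::real. s (of_real r * cis \<theta>) $$ (i, j)) \<longlongrightarrow> l) (at_left 1)"
  proof (intro AE_all_less)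
    fix i j assume ij: "i < p" "j < q"
    show "AE \<theta> in arc. \<exists>l. ((\<lambda>r::real. s (of_real r * cis \<theta>) $$ (i, j)) \<longlongrightarrow> l) (at_left 1)"
      by (rule Fatou[OF schur_holomorphic(2)[OF s ij], of 1]) (use schur_holomorphic(3)[OF s ij] in blast)
  qed
  then show ?thesis by eventually_elim (auto intro: radial_limitsI)
qed

lemma schur_AMv:
  assumes s: "s \<in> schur p q" shows "AMv p q (bdry p q s) s"
proof (rule AMv_boundary)
  show "s z \<in> carrier_mat p q" if "z \<in> ball 0 1" for z using s that by (auto simp: gen_schur_def)
  fix i j assume ij: "i < p" "j < q"
  show "(\<lambda>z. s z $$ (i, j)) holomorphic_on ball 0 1" by (rule schur_holomorphic(2)[OF s ij])
  show "\<exists>B. \<forall>z\<in>ball 0 1. norm (s z $$ (i, j)) \<le> B" using schur_holomorphic(3)[OF s ij] by blast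
  show "AE \<theta> in arc. ((\<lambda>r::real. s (of_real r * cis \<theta>) $$ (i, j)) \<longlongrightarrow> bdry p q s (cis \<theta>) $$ (i, j)) (at_left 1)"
    using schur_radial_limits[OF s] by eventually_elim (use ij in \<open>simp add: radial_limits_def\<close>)
qed simp

text \<open>
  On an annulus next to the circle $b_\ell$ is invertible with bounded inverse, so $s = b_\ell^{-1} s_\ell$
  is bounded there and has no poles. Its radial limits are those of $s_\ell$ multiplied by the continuous $b_\ell^{-1}$.
\<close>

lemma left_KL_boundary:
  assumes s: "s \<in> gen_schur p q \<kappa>" and L: "left_KL p q \<kappa> s bl sl"
  shows "AE \<theta> in arc. radial_limits p q s (cis \<theta>)"
    and "AE \<theta> in arc. bl (cis \<theta>) * bdry p q s (cis \<theta>) = bdry p q sl (cis \<theta>)"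
    and "LM p q (bdry p q s)"
    and "\<exists>\<rho><1. \<forall>z. \<rho> < norm z \<and> norm z < 1 \<longrightarrow> z \<in> hol_domain p q s"
proof -
  have bp: "blaschke_potapov p \<kappa> bl" and sl: "sl \<in> schur p q"
    and fac: "\<And>z. z \<in> hol_domain p q s \<Longrightarrow> bl z * s z = sl z"
    using L by (auto simp: left_KL_def)
  obtain \<rho> Z where \<rho>: "0 \<le> \<rho>" "\<rho> < 1" and Z: "annulus_inverse p bl \<rho> Z"
    using blaschke_potapov_props(3)[OF bp] by blast
  have blc: "bl z \<in> carrier_mat p p" if "z \<in> cball 0 1" for z
    using blaschke_potapov_props(2)[OF bp] that unfolding cont_hol_def by blast
  have Zc: "Z z \<in> carrier_mat p p" "Z z * bl z = 1\<^sub>m p" if "\<rho> < norm z" "norm z \<le> 1" for z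
    using Z that unfolding annulus_inverse_def by blast+
  have Zcont: "continuous_on {z. \<rho> < norm z \<and> norm z \<le> 1} (\<lambda>z. Z z $$ (i, j))" if "i < p" "j < p" for i j
    using Z that unfolding annulus_inverse_def by blast
  have slc: "sl z \<in> carrier_mat p q" if "z \<in> ball 0 1" for z using sl that by (auto simp: gen_schur_def)
  have sc: "s z \<in> carrier_mat p q" if "z \<in> ball 0 1" for z using s that by (auto simp: gen_schur_def)
  have sZ: "s z $$ (i, j) = (\<Sum>l<p. Z z $$ (i, l) * sl z $$ (l, j))"
    if z: "z \<in> hol_domain p q s" "\<rho> < norm z" and ij: "i < p" "j < q" for z i j
  proof -
    have zb: "z \<in> ball 0 1" using z by (simp add: hol_domain_def)
    note c = Zc[OF z(2)] sc[OF zb] blc[of z]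
    have "s z = Z z * bl z * s z" using c zb by simp
    also have "\<dots> = Z z * (bl z * s z)" using c zb by (intro assoc_mult_mat[of _ p p _ p _ q]) auto
    also have "\<dots> = Z z * sl z" by (simp only: fac[OF z(1)])
    finally have "s z = Z z * sl z" .
    then show ?thesis using mult_mat_index[OF _ slc[OF zb] ij, of "Z z"] c zb by simp
  qed
  have annulus: "z \<in> hol_domain p q s" if z: "\<rho> < norm z" "norm z < 1" for z
  proof (rule hol_domain_extend)
    show "\<forall>i<p. \<forall>j<q. (\<lambda>z. s z $$ (i, j)) nicely_meromorphic_on ball 0 1"
      using s by (simp add: gen_schur_def)
    show "z \<in> ball 0 1" using z by simp
    define B where "B = (\<Sum>i<p. \<Sum>l<p. norm (Z z $$ (i, l)) + 1)"
    define A where "A = {z::complex. \<rho> < norm z \<and> norm z < 1}"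
    have oA: "open A" unfolding A_def by (auto intro!: open_Collect_conj open_Collect_less continuous_intros)
    have zA: "z \<in> A" using z by (simp add: A_def)
    have "\<forall>\<^sub>F w in at z. norm (Z w $$ (i, l)) < norm (Z z $$ (i, l)) + 1" if il: "i < p" "l < p" for i l
    proof -
      have "continuous_on A (\<lambda>z. Z z $$ (i, l))"
        by (rule continuous_on_subset[OF Zcont[OF il]]) (auto simp: A_def)
      then have "isCont (\<lambda>z. Z z $$ (i, l)) z" using oA zA by (simp add: continuous_on_eq_continuous_at)
      then have "((\<lambda>w. norm (Z w $$ (i, l))) \<longlongrightarrow> norm (Z z $$ (i, l))) (at z)"
        by (intro tendsto_norm) (simp add: isCont_def)
      then show ?thesis by (rule order_tendstoD) simp
    qed
    then have "\<forall>\<^sub>F w in at z. \<forall>i\<in>{..<p}. \<forall>l\<in>{..<p}. norm (Z w $$ (i, l)) < norm (Z z $$ (i, l)) + 1"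
      by (intro eventually_ball_finite ballI) auto
    moreover have "\<forall>\<^sub>F w in at z. w \<in> A" using oA zA by (intro eventually_at_in_open') auto
    ultimately show "\<forall>\<^sub>F w in at z. w \<in> hol_domain p q s \<longrightarrow> (\<forall>i<p. \<forall>j<q. norm (s w $$ (i, j)) \<le> B)"
    proof eventually_elim
      case (elim w)
      show ?case
      proof (intro impI allI)
        fix i j assume w: "w \<in> hol_domain p q s" and ij: "i < p" "j < q"
        have wA: "\<rho> < norm w" "w \<in> ball 0 1" using elim(2) by (auto simp: A_def)
        have "norm (s w $$ (i, j)) \<le> (\<Sum>l<p. norm (Z w $$ (i, l) * sl w $$ (l, j)))"
          unfolding sZ[OF w wA(1) ij] by (rule norm_sum)
        also have "\<dots> \<le> (\<Sum>l<p. norm (Z z $$ (i, l)) + 1)"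
        proof (rule sum_mono)
          fix l assume l: "l \<in> {..<p}"
          have "norm (sl w $$ (l, j)) \<le> 1" using schur_holomorphic(3)[OF sl _ ij(2), of l] l wA(2) by blast
          then have "norm (Z w $$ (i, l) * sl w $$ (l, j)) \<le> norm (Z w $$ (i, l))"
            unfolding norm_mult by (rule mult_left_le) simp
          also have "\<dots> \<le> norm (Z z $$ (i, l)) + 1" using elim(1) ij l by (meson lessThan_iff less_imp_le)
          finally show "norm (Z w $$ (i, l) * sl w $$ (l, j)) \<le> norm (Z z $$ (i, l)) + 1" .
        qed
        also have "\<dots> \<le> B" unfolding B_def
          using ij by (intro member_le_sum[of i "{..<p}" "\<lambda>i. \<Sum>l<p. norm (Z z $$ (i, l)) + 1"]
            sum_nonneg add_nonneg_nonneg norm_ge_zero) auto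
        finally show "norm (s w $$ (i, j)) \<le> B" .
      qed
    qed
  qed
  show "\<exists>\<rho><1. \<forall>z. \<rho> < norm z \<and> norm z < 1 \<longrightarrow> z \<in> hol_domain p q s"
    using \<rho>(2) annulus by blast
  have lim: "((\<lambda>r::real. s (of_real r * cis \<theta>) $$ (i, j)) \<longlongrightarrow> (\<Sum>l<p. Z (cis \<theta>) $$ (i, l) * bdry p q sl (cis \<theta>) $$ (l, j))) (at_left 1)"
    if rl: "radial_limits p q sl (cis \<theta>)" and ij: "i < p" "j < q" for \<theta> i j
  proof (rule Lim_transform_eventually)
    show "((\<lambda>r::real. \<Sum>l<p. Z (of_real r * cis \<theta>) $$ (i, l) * sl (of_real r * cis \<theta>) $$ (l, j))
       \<longlongrightarrow> (\<Sum>l<p. Z (cis \<theta>) $$ (i, l) * bdry p q sl (cis \<theta>) $$ (l, j))) (at_left 1)"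
    proof (intro tendsto_sum tendsto_mult)
      fix l assume l: "l \<in> {..<p}"
      show "((\<lambda>r::real. sl (of_real r * cis \<theta>) $$ (l, j)) \<longlongrightarrow> bdry p q sl (cis \<theta>) $$ (l, j)) (at_left 1)"
        using rl ij l by (simp add: radial_limits_def)
      have "((\<lambda>r::real. of_real r * cis \<theta>) \<longlongrightarrow> of_real 1 * cis \<theta>) (at_left 1)" by (intro tendsto_intros)
      moreover have "\<forall>\<^sub>F r::real in at_left 1. of_real r * cis \<theta> \<in> {z. \<rho> < norm z \<and> norm z \<le> 1}"
        unfolding eventually_at_left_field using \<rho> by (intro exI[of _ \<rho>]) (auto simp: norm_mult)
      ultimately show "((\<lambda>r::real. Z (of_real r * cis \<theta>) $$ (i, l)) \<longlongrightarrow> Z (cis \<theta>) $$ (i, l)) (at_left 1)"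
        using continuous_on_tendsto_compose[OF Zcont[OF ij(1)], of l "\<lambda>r. of_real r * cis \<theta>" "cis \<theta>"] l \<rho> by simp
    qed
    show "\<forall>\<^sub>F r::real in at_left 1. (\<Sum>l<p. Z (of_real r * cis \<theta>) $$ (i, l) * sl (of_real r * cis \<theta>) $$ (l, j)) = s (of_real r * cis \<theta>) $$ (i, j)"
      unfolding eventually_at_left_field
    proof (intro exI conjI allI impI)
      show "\<rho> < 1" by (rule \<rho>)
      fix r :: real assume "\<rho> < r" "r < 1"
      then have n: "\<rho> < norm (of_real r * cis \<theta>)" "norm (of_real r * cis \<theta>) < 1" using \<rho> by (auto simp: norm_mult)
      show "(\<Sum>l<p. Z (of_real r * cis \<theta>) $$ (i, l) * sl (of_real r * cis \<theta>) $$ (l, j)) = s (of_real r * cis \<theta>) $$ (i, j)"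
        by (rule sZ[OF annulus[OF n] n(1) ij, symmetric])
    qed
  qed
  show rls: "AE \<theta> in arc. radial_limits p q s (cis \<theta>)"
    using schur_radial_limits[OF sl] by eventually_elim (use lim in \<open>blast intro: radial_limitsI\<close>)
  show ae: "AE \<theta> in arc. bl (cis \<theta>) * bdry p q s (cis \<theta>) = bdry p q sl (cis \<theta>)"
    using schur_radial_limits[OF sl] rls
  proof eventually_elim
    case (elim \<theta>)
    note c = Zc[of "cis \<theta>"] blc[of "cis \<theta>"]
    have c': "Z (cis \<theta>) \<in> carrier_mat p p" "Z (cis \<theta>) * bl (cis \<theta>) = 1\<^sub>m p" "bl (cis \<theta>) \<in> carrier_mat p p"
      using c \<rho> by auto
    have bZ: "bl (cis \<theta>) * Z (cis \<theta>) = 1\<^sub>m p" by (rule mat_mult_left_right_inverse[OF c'(1,3,2)])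
    have "bdry p q s (cis \<theta>) = Z (cis \<theta>) * bdry p q sl (cis \<theta>)"
    proof (rule eq_matI)
      fix i j assume "i < dim_row (Z (cis \<theta>) * bdry p q sl (cis \<theta>))" "j < dim_col (Z (cis \<theta>) * bdry p q sl (cis \<theta>))"
      then have ij: "i < p" "j < q" using c' by (auto simp: bdry_def)
      have "bdry p q s (cis \<theta>) $$ (i, j) = (\<Sum>l<p. Z (cis \<theta>) $$ (i, l) * bdry p q sl (cis \<theta>) $$ (l, j))"
        using elim(2) ij unfolding radial_limits_def
        by (intro tendsto_unique[OF _ _ lim[OF elim(1) ij]]) auto
      also have "\<dots> = (Z (cis \<theta>) * bdry p q sl (cis \<theta>)) $$ (i, j)"
        by (rule mult_mat_index[OF c'(1) bdry_carrier ij, symmetric])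
      finally show "bdry p q s (cis \<theta>) $$ (i, j) = (Z (cis \<theta>) * bdry p q sl (cis \<theta>)) $$ (i, j)" .
    qed (use c' in \<open>auto simp: bdry_def\<close>)
    then have "bl (cis \<theta>) * bdry p q s (cis \<theta>) = bl (cis \<theta>) * Z (cis \<theta>) * bdry p q sl (cis \<theta>)"
      using c' by (simp add: assoc_mult_mat[of _ p p _ p _ q])
    then show ?case unfolding bZ left_mult_one_mat[OF bdry_carrier] .
  qed
  have AB: "AM p p bl" and un: "\<And>\<zeta>. \<zeta> \<in> sphere 0 1 \<Longrightarrow> mat_adjoint (bl \<zeta>) * bl \<zeta> = 1\<^sub>m p"
    using blaschke_potapov_props(1)[OF bp] by (auto simp: finite_inner_def)
  have AS: "AM p q (bdry p q sl)" using schur_AMv[OF sl] by (simp add: AMv_def)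
  show "LM p q (bdry p q s)"
    unfolding LM_def
  proof (intro conjI ballI allI impI bdry_carrier)
    fix i j assume ij: "i < p" "j < q"
    have "(\<lambda>\<zeta>. \<Sum>l<p. cnj (bl \<zeta> $$ (l, i)) * bdry p q sl \<zeta> $$ (l, j)) \<in> linf"
      using AM_LM[OF AB] AM_LM[OF AS] ij by (intro linf_sum linf_mult linf_cnj) (auto simp: LM_def)
    then show "(\<lambda>\<zeta>. bdry p q s \<zeta> $$ (i, j)) \<in> linf"
    proof (rule linf_AE_cong)
      show "AE \<theta> in arc. (\<Sum>l<p. cnj (bl (cis \<theta>) $$ (l, i)) * bdry p q sl (cis \<theta>) $$ (l, j)) = bdry p q s (cis \<theta>) $$ (i, j)"
        using ae
      proof eventually_elim
        case (elim \<theta>)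
        note c = AM_carrier[OF AB cis_range, of \<theta>]
        have "bdry p q s (cis \<theta>) = mat_adjoint (bl (cis \<theta>)) * bl (cis \<theta>) * bdry p q s (cis \<theta>)"
          unfolding un[OF cis_range] left_mult_one_mat[OF bdry_carrier] ..
        also have "\<dots> = mat_adjoint (bl (cis \<theta>)) * (bl (cis \<theta>) * bdry p q s (cis \<theta>))"
          using c by (intro assoc_mult_mat[of _ p p _ p _ q]) auto
        finally have "bdry p q s (cis \<theta>) = mat_adjoint (bl (cis \<theta>)) * bdry p q sl (cis \<theta>)" unfolding elim .
        then have "bdry p q s (cis \<theta>) $$ (i, j) = (\<Sum>l<p. mat_adjoint (bl (cis \<theta>)) $$ (i, l) * bdry p q sl (cis \<theta>) $$ (l, j))"
          using mult_mat_index[OF mat_adjoint_carrier[OF c] bdry_carrier ij] by simp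
        then show ?case using c ij by simp
      qed
    qed
  qed
qed

text \<open>
  Radial limits and holomorphy near the circle are already known from the left factorization; it remains to
  pass to the limit in $s b_r = s_r$.
\<close>

lemma right_KL_boundary:
  assumes s: "s \<in> gen_schur p q \<kappa>" and rls: "AE \<theta> in arc. radial_limits p q s (cis \<theta>)"
    and annulus: "\<exists>\<rho><1. \<forall>z. \<rho> < norm z \<and> norm z < 1 \<longrightarrow> z \<in> hol_domain p q s"
    and R: "right_KL p q \<kappa> s br sr"
  shows "AE \<theta> in arc. bdry p q s (cis \<theta>) * br (cis \<theta>) = bdry p q sr (cis \<theta>)"
proof -
  have bp: "blaschke_potapov q \<kappa> br" and sr: "sr \<in> schur p q"
    and fac: "\<And>z. z \<in> hol_domain p q s \<Longrightarrow> s z * br z = sr z"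
    using R by (auto simp: right_KL_def)
  obtain \<rho> where \<rho>: "\<rho> < 1" "\<And>z. \<rho> < norm z \<Longrightarrow> norm z < 1 \<Longrightarrow> z \<in> hol_domain p q s" using annulus by blast
  have brc: "br z \<in> carrier_mat q q" if "z \<in> cball 0 1" for z
    using blaschke_potapov_props(2)[OF bp] that unfolding cont_hol_def by blast
  have brcont: "continuous_on (cball 0 1) (\<lambda>z. br z $$ (i, j))" if "i < q" "j < q" for i j
    using blaschke_potapov_props(2)[OF bp] that unfolding cont_hol_def by blast
  have sc: "s z \<in> carrier_mat p q" if "z \<in> ball 0 1" for z using s that by (auto simp: gen_schur_def)
  show ?thesis
    using rls schur_radial_limits[OF sr]
  proof eventually_elim
    case (elim \<theta>)
    note bc = brc[of "cis \<theta>"]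
    show ?case
    proof (rule eq_matI)
      fix i j assume "i < dim_row (bdry p q sr (cis \<theta>))" "j < dim_col (bdry p q sr (cis \<theta>))"
      then have ij: "i < p" "j < q" by (auto simp: bdry_def)
      have "((\<lambda>r::real. \<Sum>l<q. s (of_real r * cis \<theta>) $$ (i, l) * br (of_real r * cis \<theta>) $$ (l, j))
         \<longlongrightarrow> (\<Sum>l<q. bdry p q s (cis \<theta>) $$ (i, l) * br (cis \<theta>) $$ (l, j))) (at_left 1)"
        using elim(1) ij by (intro tendsto_sum tendsto_mult radial_limit_continuous brcont) (auto simp: radial_limits_def)
      moreover have "\<forall>\<^sub>F r::real in at_left 1. (\<Sum>l<q. s (of_real r * cis \<theta>) $$ (i, l) * br (of_real r * cis \<theta>) $$ (l, j))
          = sr (of_real r * cis \<theta>) $$ (i, j)"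
        unfolding eventually_at_left_field
      proof (intro exI conjI allI impI)
        show "max 0 \<rho> < 1" using \<rho> by simp
        fix r :: real assume "max 0 \<rho> < r" "r < 1"
        then have n: "\<rho> < norm (of_real r * cis \<theta>)" "norm (of_real r * cis \<theta>) < 1" by (auto simp: norm_mult)
        then have zb: "of_real r * cis \<theta> \<in> ball 0 1" "of_real r * cis \<theta> \<in> cball 0 1" by auto
        show "(\<Sum>l<q. s (of_real r * cis \<theta>) $$ (i, l) * br (of_real r * cis \<theta>) $$ (l, j)) = sr (of_real r * cis \<theta>) $$ (i, j)"
          unfolding fac[OF \<rho>(2)[OF n], symmetric] by (rule mult_mat_index[OF sc[OF zb(1)] brc[OF zb(2)] ij, symmetric])
      qed
      ultimately have "((\<lambda>r::real. sr (of_real r * cis \<theta>) $$ (i, j))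
         \<longlongrightarrow> (\<Sum>l<q. bdry p q s (cis \<theta>) $$ (i, l) * br (cis \<theta>) $$ (l, j))) (at_left 1)"
        by (rule Lim_transform_eventually)
      then have "(\<Sum>l<q. bdry p q s (cis \<theta>) $$ (i, l) * br (cis \<theta>) $$ (l, j)) = bdry p q sr (cis \<theta>) $$ (i, j)"
        using elim(2) ij unfolding radial_limits_def by (intro tendsto_unique) auto
      then show "(bdry p q s (cis \<theta>) * br (cis \<theta>)) $$ (i, j) = bdry p q sr (cis \<theta>) $$ (i, j)"
        using mult_mat_index[OF bdry_carrier _ ij, of "br (cis \<theta>)" q s "cis \<theta>"] bc by simp
    qed (use bc in \<open>auto simp: bdry_def\<close>)
  qed
qed

section \<open>The operator $\Gamma_\ell$\<close>

lemma orth_proj_props: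
  assumes "\<exists>g\<in>V. \<forall>h\<in>V. L2_inner (vv_diff f g) h = 0"
  shows "orth_proj V f \<in> V" "\<And>h. h \<in> V \<Longrightarrow> L2_inner (vv_diff f (orth_proj V f)) h = 0"
proof -
  have "\<exists>g. g \<in> V \<and> (\<forall>h\<in>V. L2_inner (vv_diff f g) h = 0)" using assms by blast
  from someI_ex[OF this]
  show "orth_proj V f \<in> V" "\<And>h. h \<in> V \<Longrightarrow> L2_inner (vv_diff f (orth_proj V f)) h = 0"
    unfolding orth_proj_def by blast+
qed

lemma L2_eq_of_inner_zero:
  assumes f: "f \<in> L2 k" and g: "g \<in> L2 k" and z: "L2_inner (vv_diff f g) (vv_diff f g) = 0"
  shows "L2_eq f g"
proof -
  have "AE \<theta> in arc. vv_diff f g (cis \<theta>) = 0\<^sub>v k" by (rule L2_inner_zero_imp[OF L2_diff[OF f g] z])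
  then show ?thesis unfolding L2_eq_def
  proof eventually_elim
    case (elim \<theta>)
    note c = L2_carrier[OF f cis_range, of \<theta>] L2_carrier[OF g cis_range, of \<theta>]
    show ?case
    proof (rule eq_vecI)
      fix i assume "i < dim_vec (g (cis \<theta>))"
      then have i: "i < k" using c by simp
      then have "(f (cis \<theta>) - g (cis \<theta>)) $ i = 0" using elim by (simp add: vv_diff_def)
      then show "f (cis \<theta>) $ i = g (cis \<theta>) $ i" using c i by simp
    qed (use c in simp)
  qed
qed

lemma orth_proj_unique:
  assumes f: "f \<in> L2 k" and V: "V \<subseteq> L2 k" "\<And>g h. g \<in> V \<Longrightarrow> h \<in> V \<Longrightarrow> vv_diff g h \<in> V"
    and g: "g \<in> V" "\<And>h. h \<in> V \<Longrightarrow> L2_inner (vv_diff f g) h = 0"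
    and g': "g' \<in> V" "\<And>h. h \<in> V \<Longrightarrow> L2_inner (vv_diff f g') h = 0"
  shows "L2_eq g g'"
proof (rule L2_eq_of_inner_zero)
  show gL: "g \<in> L2 k" and gL': "g' \<in> L2 k" using V g g' by auto
  let ?d = "vv_diff g g'"
  have d: "?d \<in> V" by (rule V(2)[OF g(1) g'(1)])
  have dL: "?d \<in> L2 k" using d V by auto
  show "L2_inner ?d ?d = 0"
    using g(2)[OF d] g'(2)[OF d] L2_inner_diff_left[OF f gL dL] L2_inner_diff_left[OF f gL' dL] L2_inner_diff_left[OF gL gL' dL]
    by simp
qed

text \<open>
  If $w$ is orthogonal to $b H_2$, projecting it to $H_2 \ominus b H_2$ removes all of its $H_2$ part.
\<close>

lemma finite_inner_perp:
  assumes b: "finite_inner k b" and w: "w \<in> L2 k" "\<And>y. y \<in> H2 k \<Longrightarrow> L2_inner w (mv_mult b y) = 0"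
    and g: "g \<in> H_b k b" "\<And>h. h \<in> H_b k b \<Longrightarrow> L2_inner (vv_diff w g) h = 0"
  shows "vv_diff w g \<in> H2_perp k"
  unfolding H2_perp_iff
proof (intro conjI ballI)
  have A: "AM k k b" and un: "\<And>\<zeta>. \<zeta> \<in> sphere 0 1 \<Longrightarrow> b \<zeta> * mat_adjoint (b \<zeta>) = 1\<^sub>m k"
    using b unfolding finite_inner_def by blast+
  note gL = H_b_L2[OF g(1)]
  show dL: "vv_diff w g \<in> L2 k" by (rule L2_diff[OF w(1) gL])
  fix h assume h: "h \<in> H2 k"
  have "\<exists>h1\<in>H_b k b. mv_mult (mvf_adj b) (vv_diff h h1) \<in> H2 k"
    using b h H2_L2[OF h] unfolding finite_inner_def by blast
  then obtain h1 where h1: "h1 \<in> H_b k b" "mv_mult (mvf_adj b) (vv_diff h h1) \<in> H2 k" by blast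
  define y where "y = mv_mult (mvf_adj b) (vv_diff h h1)"
  have y: "y \<in> H2 k" using h1 by (simp add: y_def)
  note h1L = H_b_L2[OF h1(1)] and yL = H2_L2[OF y]
  have byL: "mv_mult b y \<in> L2 k" by (rule L2_mv[OF AM_LM[OF A] yL])
  have "L2_inner (vv_diff w g) h = L2_inner (vv_diff w g) (vv_add h1 (mv_mult b y))"
  proof (rule L2_inner_sphere_cong)
    fix \<zeta> :: complex assume \<zeta>: "\<zeta> \<in> sphere 0 1"
    have "mv_mult b y \<zeta> = vv_diff h h1 \<zeta>"
      unfolding y_def by (rule mult_mvf_adj_cancel[OF un AM_LM[OF A] L2_diff[OF H2_L2[OF h] h1L] \<zeta>])
    then show "h \<zeta> = vv_add h1 (mv_mult b y) \<zeta>"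
      using L2_carrier[OF H2_L2[OF h] \<zeta>] L2_carrier[OF h1L \<zeta>] by (auto simp: vv_add_def vv_diff_def)
  qed simp
  also have "\<dots> = L2_inner (vv_diff w g) h1 + L2_inner (vv_diff w g) (mv_mult b y)"
    by (rule L2_inner_add_right[OF h1L byL dL])
  also have "L2_inner (vv_diff w g) h1 = 0" by (rule g(2)[OF h1(1)])
  also have "L2_inner (vv_diff w g) (mv_mult b y) = 0"
    using L2_inner_diff_left[OF w(1) gL byL] w(2)[OF y] g(1) y by (simp add: H_b_iff)
  finally show "L2_inner (vv_diff w g) h = 0" by simp
qed

lemma L2_eq_diff: "L2_eq f g \<Longrightarrow> L2_eq f' g' \<Longrightarrow> L2_eq (vv_diff f f') (vv_diff g g')"
  unfolding L2_eq_def vv_diff_def by (erule (1) eventually_elim2) simp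

lemma L2_eq_refl: "L2_eq f f" by (simp add: L2_eq_def)

text \<open>
  The consequences of a pair of Krein--Langer factorizations on the circle: \<open>SL\<close> and \<open>SR\<close> are the boundary
  values of $s_\ell$ and $s_r$. The last two assumptions are the coprimeness conditions in the form of identities between Hardy
  spaces.
\<close>

locale kl_pair =
  fixes p q :: nat and s bl br SL SR :: mvf and S :: mvf
  defines S_def: "S \<equiv> bdry p q s"
  assumes S: "LM p q S"
    and fl: "finite_inner p bl" and fr: "finite_inner q br"
    and SL: "AM p q SL" and SR: "AM p q SR"
    and left: "AE \<theta> in arc. bl (cis \<theta>) * S (cis \<theta>) = SL (cis \<theta>)"
    and right: "AE \<theta> in arc. S (cis \<theta>) * br (cis \<theta>) = SR (cis \<theta>)"
    and left_corona: "\<And>y. y \<in> H2 p \<Longrightarrow> \<exists>a\<in>H2 p. \<exists>b\<in>H2 q. \<forall>\<zeta>\<in>sphere 0 1. y \<zeta> = bl \<zeta> *\<^sub>v a \<zeta> + SL \<zeta> *\<^sub>v b \<zeta>"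
    and right_corona: "\<And>x. x \<in> H2_perp q \<Longrightarrow> \<exists>a\<in>H2_perp q. \<exists>b\<in>H2_perp p. \<forall>\<zeta>\<in>sphere 0 1.
       x \<zeta> = mat_adjoint (br \<zeta>) *\<^sub>v a \<zeta> + mat_adjoint (SR \<zeta>) *\<^sub>v b \<zeta>"
begin

abbreviation "Sa \<equiv> mvf_adj S"

lemmas Sa = LM_adj[OF S]

lemma bl: "AM p p bl" "\<And>\<zeta>. \<zeta> \<in> sphere 0 1 \<Longrightarrow> mat_adjoint (bl \<zeta>) * bl \<zeta> = 1\<^sub>m p"
    "\<And>\<zeta>. \<zeta> \<in> sphere 0 1 \<Longrightarrow> bl \<zeta> * mat_adjoint (bl \<zeta>) = 1\<^sub>m p"
  using fl unfolding finite_inner_def by blast+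
lemma br: "AM q q br" "\<And>\<zeta>. \<zeta> \<in> sphere 0 1 \<Longrightarrow> mat_adjoint (br \<zeta>) * br \<zeta> = 1\<^sub>m q"
    "\<And>\<zeta>. \<zeta> \<in> sphere 0 1 \<Longrightarrow> br \<zeta> * mat_adjoint (br \<zeta>) = 1\<^sub>m q"
  using fr unfolding finite_inner_def by blast+

lemma S_carrier: "S (cis \<theta>) \<in> carrier_mat p q" by (simp add: S_def)

text \<open>
  $g \in H_2^p + S H_2^q$, with the component $b$ made explicit because it determines $\langle \Gamma_\ell h, g\rangle$.
\<close>

definition spG :: "vvf \<Rightarrow> vvf \<Rightarrow> bool" where
  "spG g b \<longleftrightarrow> g \<in> L2 p \<and> b \<in> H2 q \<and> (\<exists>a\<in>H2 p. L2_eq g (vv_add a (mv_mult S b)))"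

text \<open>
  $h \in (H_2^q)^\perp + S^* (H_2^p)^\perp$. Like \<open>spG\<close>, this depends on $S$ only and not on the factors.
\<close>

definition spH :: "vvf \<Rightarrow> bool" where
  "spH h \<longleftrightarrow> h \<in> L2 q \<and> (\<exists>a\<in>H2_perp q. \<exists>b\<in>H2_perp p. L2_eq h (vv_add a (mv_mult Sa b)))"

text \<open>
  Multiply the identity for $H_2^p$ by $b_\ell^*$: since $b_\ell S = s_\ell$, it says
  $b_\ell^* H_2^p = H_2^p + S H_2^q$.
\<close>

lemma spG_intro:
  assumes g: "g \<in> L2 p" and blg: "mv_mult bl g \<in> H2 p"
  shows "\<exists>b. spG g b"
proof -
  from left_corona[OF blg] obtain a b where ab: "a \<in> H2 p" "b \<in> H2 q"
    "\<forall>\<zeta>\<in>sphere 0 1. mv_mult bl g \<zeta> = bl \<zeta> *\<^sub>v a \<zeta> + SL \<zeta> *\<^sub>v b \<zeta>" by blast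
  have "L2_eq g (vv_add a (mv_mult S b))"
    unfolding L2_eq_def using left
  proof eventually_elim
    case (elim \<theta>)
    note c = AM_carrier[OF bl(1) cis_range, of \<theta>] L2_carrier[OF H2_L2[OF ab(1)] cis_range, of \<theta>]
      L2_carrier[OF H2_L2[OF ab(2)] cis_range, of \<theta>] S_carrier[of \<theta>] L2_carrier[OF g cis_range, of \<theta>]
    have Sb: "S (cis \<theta>) *\<^sub>v b (cis \<theta>) \<in> carrier_vec p" by (rule mult_mat_vec_carrier[OF c(4,3)])
    have "SL (cis \<theta>) *\<^sub>v b (cis \<theta>) = bl (cis \<theta>) *\<^sub>v (S (cis \<theta>) *\<^sub>v b (cis \<theta>))"
      unfolding elim[symmetric] by (rule assoc_mult_mat_vec[OF c(1,4,3)])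
    then have "bl (cis \<theta>) *\<^sub>v g (cis \<theta>) = bl (cis \<theta>) *\<^sub>v (a (cis \<theta>) + S (cis \<theta>) *\<^sub>v b (cis \<theta>))"
      using ab(3)[rule_format, OF cis_range, of \<theta>] mult_add_distrib_mat_vec[OF c(1,2) Sb] by (simp add: mv_mult_def)
    then have "mat_adjoint (bl (cis \<theta>)) *\<^sub>v (bl (cis \<theta>) *\<^sub>v g (cis \<theta>))
       = mat_adjoint (bl (cis \<theta>)) *\<^sub>v (bl (cis \<theta>) *\<^sub>v (a (cis \<theta>) + S (cis \<theta>) *\<^sub>v b (cis \<theta>)))" by simp
    then have "g (cis \<theta>) = a (cis \<theta>) + S (cis \<theta>) *\<^sub>v b (cis \<theta>)"
      unfolding unitary_cancel[OF mat_adjoint_carrier[OF c(1)] c(5) c(1) bl(2)[OF cis_range]]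
        unitary_cancel[OF mat_adjoint_carrier[OF c(1)] add_carrier_vec[OF c(2) Sb] c(1) bl(2)[OF cis_range]] .
    then show ?case by (simp add: vv_add_def mv_mult_def)
  qed
  then show ?thesis using g ab by (auto simp: spG_def)
qed

text \<open>
  Multiply the identity for $(H_2^q)^\perp$ by $b_r$: since $S b_r = s_r$, it says
  $b_r (H_2^q)^\perp = (H_2^q)^\perp + S^* (H_2^p)^\perp$.
\<close>

lemma spH_intro:
  assumes h: "h \<in> L2 q" and brh: "mv_mult (mvf_adj br) h \<in> H2_perp q"
  shows "spH h"
proof -
  from right_corona[OF brh] obtain a b where ab: "a \<in> H2_perp q" "b \<in> H2_perp p"
    "\<forall>\<zeta>\<in>sphere 0 1. mv_mult (mvf_adj br) h \<zeta> = mat_adjoint (br \<zeta>) *\<^sub>v a \<zeta> + mat_adjoint (SR \<zeta>) *\<^sub>v b \<zeta>" by blast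
  have "L2_eq h (vv_add a (mv_mult Sa b))"
    unfolding L2_eq_def using right
  proof eventually_elim
    case (elim \<theta>)
    note c = AM_carrier[OF br(1) cis_range, of \<theta>] L2_carrier[OF H2_perp_L2[OF ab(1)] cis_range, of \<theta>]
      L2_carrier[OF H2_perp_L2[OF ab(2)] cis_range, of \<theta>] S_carrier[of \<theta>] L2_carrier[OF h cis_range, of \<theta>]
    note ca = mat_adjoint_carrier[OF c(1)] mat_adjoint_carrier[OF c(4)]
    have Sb: "mat_adjoint (S (cis \<theta>)) *\<^sub>v b (cis \<theta>) \<in> carrier_vec q" by (rule mult_mat_vec_carrier[OF ca(2) c(3)])
    have "mat_adjoint (SR (cis \<theta>)) *\<^sub>v b (cis \<theta>) = mat_adjoint (br (cis \<theta>)) *\<^sub>v (mat_adjoint (S (cis \<theta>)) *\<^sub>v b (cis \<theta>))"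
      unfolding elim[symmetric] mat_adjoint_mult[OF c(4,1)] by (rule assoc_mult_mat_vec[OF ca c(3)])
    then have "mat_adjoint (br (cis \<theta>)) *\<^sub>v h (cis \<theta>) = mat_adjoint (br (cis \<theta>)) *\<^sub>v (a (cis \<theta>) + mat_adjoint (S (cis \<theta>)) *\<^sub>v b (cis \<theta>))"
      using ab(3)[rule_format, OF cis_range, of \<theta>] mult_add_distrib_mat_vec[OF ca(1) c(2) Sb] by (simp add: mv_mult_def mvf_adj_def)
    then have "br (cis \<theta>) *\<^sub>v (mat_adjoint (br (cis \<theta>)) *\<^sub>v h (cis \<theta>))
       = br (cis \<theta>) *\<^sub>v (mat_adjoint (br (cis \<theta>)) *\<^sub>v (a (cis \<theta>) + mat_adjoint (S (cis \<theta>)) *\<^sub>v b (cis \<theta>)))" by simp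
    then have "h (cis \<theta>) = a (cis \<theta>) + mat_adjoint (S (cis \<theta>)) *\<^sub>v b (cis \<theta>)"
      unfolding unitary_cancel[OF c(1) c(5) ca(1) br(3)[OF cis_range]]
        unitary_cancel[OF c(1) add_carrier_vec[OF c(2) Sb] ca(1) br(3)[OF cis_range]] .
    then show ?case by (simp add: vv_add_def mv_mult_def mvf_adj_def)
  qed
  then show ?thesis using h ab by (auto simp: spH_def)
qed

lemma Sa_perp_range:
  assumes x: "x \<in> H2_perp p" and y: "y \<in> H2 q"
  shows "L2_inner (mv_mult Sa x) (mv_mult br y) = 0"
proof -
  note xL = H2_perp_L2[OF x] and yL = H2_L2[OF y]
  have byL: "mv_mult br y \<in> L2 q" by (rule L2_mv[OF AM_LM[OF br(1)] yL])
  have "L2_inner (mv_mult Sa x) (mv_mult br y) = L2_inner x (mv_mult S (mv_mult br y))"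
    by (rule L2_inner_adj'[OF S byL xL])
  also have "\<dots> = L2_inner x (mv_mult SR y)"
  proof (rule L2_inner_eq_cong[OF xL L2_mv[OF S byL] xL L2_mv[OF AM_LM[OF SR] yL] L2_eq_refl])
    show "L2_eq (mv_mult S (mv_mult br y)) (mv_mult SR y)"
      unfolding L2_eq_def using right
    proof eventually_elim
      case (elim \<theta>)
      show ?case unfolding mv_mult_def elim[symmetric]
        by (rule assoc_mult_mat_vec[symmetric, OF S_carrier AM_carrier[OF br(1) cis_range] L2_carrier[OF yL cis_range]])
    qed
  qed
  also have "\<dots> = 0" by (rule H2_perp_inner[OF x H2_mv[OF SR y]])
  finally show ?thesis .
qed

lemma spH_perp_range:
  assumes h: "spH h" and y: "y \<in> H2 q"
  shows "L2_inner h (mv_mult br y) = 0"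
proof -
  from h obtain a b where ab: "h \<in> L2 q" "a \<in> H2_perp q" "b \<in> H2_perp p" "L2_eq h (vv_add a (mv_mult Sa b))"
    by (auto simp: spH_def)
  have byH: "mv_mult br y \<in> H2 q" by (rule H2_mv[OF br(1) y])
  have SbL: "mv_mult Sa b \<in> L2 q" by (rule L2_mv[OF Sa H2_perp_L2[OF ab(3)]])
  have "L2_inner h (mv_mult br y) = L2_inner (vv_add a (mv_mult Sa b)) (mv_mult br y)"
    by (rule L2_inner_eq_cong[OF ab(1) H2_L2[OF byH] L2_add[OF H2_perp_L2[OF ab(2)] SbL] H2_L2[OF byH] ab(4) L2_eq_refl])
  also have "\<dots> = L2_inner a (mv_mult br y) + L2_inner (mv_mult Sa b) (mv_mult br y)"
    by (rule L2_inner_add_left[OF H2_perp_L2[OF ab(2)] SbL H2_L2[OF byH]])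
  also have "\<dots> = 0" using H2_perp_inner[OF ab(2) byH] Sa_perp_range[OF ab(3) y] by simp
  finally show ?thesis .
qed

abbreviation Pr where "Pr k \<equiv> orth_proj (H_b q br) k"

lemma Pr:
  assumes "k \<in> L2 q"
  shows "Pr k \<in> H_b q br" "\<And>h. h \<in> H_b q br \<Longrightarrow> L2_inner (vv_diff k (Pr k)) h = 0"
proof -
  have "\<exists>g\<in>H_b q br. \<forall>h\<in>H_b q br. L2_inner (vv_diff k g) h = 0"
    using fr assms unfolding finite_inner_def by blast
  from orth_proj_props[OF this]
  show "Pr k \<in> H_b q br" "\<And>h. h \<in> H_b q br \<Longrightarrow> L2_inner (vv_diff k (Pr k)) h = 0" by blast+
qed

lemma H2_projection_exists:
  assumes x: "x \<in> H2_perp p"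
  shows "\<exists>g\<in>H2 q. \<forall>h\<in>H2 q. L2_inner (vv_diff (mv_mult Sa x) g) h = 0"
proof -
  have SxL: "mv_mult Sa x \<in> L2 q" by (rule L2_mv[OF Sa H2_perp_L2[OF x]])
  have "vv_diff (mv_mult Sa x) (Pr (mv_mult Sa x)) \<in> H2_perp q"
    by (rule finite_inner_perp[OF fr SxL Sa_perp_range[OF x] Pr[OF SxL]])
  then show ?thesis using Pr(1)[OF SxL] by (intro bexI[of _ "Pr (mv_mult Sa x)"]) (auto simp: H2_perp_iff H_b_iff)
qed

lemma H_star_b_perp: "x \<in> H_star_b p bl \<Longrightarrow> x \<in> H2_perp p"
  by (simp add: H_star_b_def ominus_def)

text \<open>
  This is the surjectivity of $Y_\ell$. For $y \in \mathcal H(b_r)$ the function $b_r^* y$ is orthogonal to $H_2^q$, so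
  $y = a + S^* x_0$ with $a, x_0$ orthogonal to the Hardy spaces. Removing from $x_0$ its part in $b_\ell^* (H_2^p)^\perp$ leaves an element
  of $\mathcal H_*(b_\ell)$, and changes $S^* x_0$ only by an element of $s_\ell^* (H_2^p)^\perp \subseteq (H_2^q)^\perp$.
\<close>

lemma Gamma_exists:
  assumes k: "k \<in> L2 q"
  shows "\<exists>x. x \<in> H_star_b p bl \<and> L2_eq (Y_left p q s x) (Pr k)"
proof -
  define y where "y = Pr k"
  have yb: "y \<in> H_b q br" unfolding y_def by (rule Pr(1)[OF k])
  then have yH: "y \<in> H2 q" by (simp add: H_b_iff)
  note yL = H2_L2[OF yH]
  have "mv_mult (mvf_adj br) y \<in> H2_perp q"
    unfolding H2_perp_iff
  proof (intro conjI ballI)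
    show "mv_mult (mvf_adj br) y \<in> L2 q" by (rule L2_mv[OF LM_adj[OF AM_LM[OF br(1)]] yL])
    fix z assume z: "z \<in> H2 q"
    show "L2_inner (mv_mult (mvf_adj br) y) z = 0"
      unfolding L2_inner_adj'[OF AM_LM[OF br(1)] H2_L2[OF z] yL] using yb z by (simp add: H_b_iff)
  qed
  from spH_intro[OF yL this] obtain a x0 where ax: "a \<in> H2_perp q" "x0 \<in> H2_perp p" "L2_eq y (vv_add a (mv_mult Sa x0))"
    by (auto simp: spH_def)
  note x0L = H2_perp_L2[OF ax(2)]
  have bxL: "mv_mult bl x0 \<in> L2 p" by (rule L2_mv[OF AM_LM[OF bl(1)] x0L])
  have bx_perp: "L2_inner (mv_mult bl x0) (mv_mult bl z) = 0" if z: "z \<in> H2 p" for z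
    using L2_inner_isometry[OF bl(2) AM_LM[OF bl(1)] x0L H2_L2[OF z]] H2_perp_inner[OF ax(2) z] by simp
  obtain g where g: "g \<in> H_b p bl" "\<And>h. h \<in> H_b p bl \<Longrightarrow> L2_inner (vv_diff (mv_mult bl x0) g) h = 0"
    using fl bxL unfolding finite_inner_def by blast
  define r where "r = vv_diff (mv_mult bl x0) g"
  have r: "r \<in> H2_perp p" unfolding r_def by (rule finite_inner_perp[OF fl bxL bx_perp g])
  define x where "x = mv_mult (mvf_adj bl) g"
  have gH: "g \<in> H2 p" using g by (simp add: H_b_iff)
  note gL = H2_L2[OF gH] and bla = LM_adj[OF AM_LM[OF bl(1)]]
  have xL: "x \<in> L2 p" unfolding x_def by (rule L2_mv[OF bla gL])
  have xP: "x \<in> H2_perp p"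
    unfolding H2_perp_iff
  proof (intro conjI ballI xL)
    fix z assume z: "z \<in> H2 p"
    show "L2_inner x z = 0"
      unfolding x_def L2_inner_adj'[OF AM_LM[OF bl(1)] H2_L2[OF z] gL] using g(1) z by (simp add: H_b_iff)
  qed
  have xs: "x \<in> H_star_b p bl"
    unfolding H_star_b_def ominus_def
  proof (intro CollectI conjI xP ballI)
    fix w assume "w \<in> mv_mult (mvf_adj bl) ` H2_perp p"
    then obtain h where h: "h \<in> H2_perp p" "w = mv_mult (mvf_adj bl) h" by blast
    note hL = H2_perp_L2[OF h(1)]
    have "L2_inner x w = L2_inner g (mv_mult bl (mv_mult (mvf_adj bl) h))"
      unfolding x_def h(2) by (rule L2_inner_adj'[OF AM_LM[OF bl(1)] L2_mv[OF bla hL] gL])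
    also have "\<dots> = L2_inner g h"
      by (rule L2_inner_sphere_cong) (use mult_mvf_adj_cancel[OF bl(3) AM_LM[OF bl(1)] hL] in auto)
    also have "\<dots> = 0" by (rule H2_perp_inner'[OF h(1) gH])
    finally show "L2_inner x w = 0" .
  qed
  have SLr: "mv_mult (mvf_adj SL) r \<in> H2_perp q" by (rule H2_perp_adj[OF SL r])
  have SxL: "mv_mult Sa x \<in> L2 q" by (rule L2_mv[OF Sa xL])
  have eq: "L2_eq (vv_add a (mv_mult (mvf_adj SL) r)) (vv_diff y (mv_mult Sa x))"
    using ax(3) left unfolding L2_eq_def
  proof eventually_elim
    case (elim \<theta>)
    note c = AM_carrier[OF bl(1) cis_range, of \<theta>] S_carrier[of \<theta>] L2_carrier[OF x0L cis_range, of \<theta>]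
      L2_carrier[OF gL cis_range, of \<theta>] L2_carrier[OF H2_perp_L2[OF ax(1)] cis_range, of \<theta>] L2_carrier[OF H2_perp_L2[OF r] cis_range, of \<theta>]
      L2_carrier[OF xL cis_range, of \<theta>]
    note ca = mat_adjoint_carrier[OF c(1)] mat_adjoint_carrier[OF c(2)]
    have "mat_adjoint (bl (cis \<theta>)) *\<^sub>v r (cis \<theta>) = mat_adjoint (bl (cis \<theta>)) *\<^sub>v (bl (cis \<theta>) *\<^sub>v x0 (cis \<theta>)) - x (cis \<theta>)"
      unfolding r_def x_def vv_diff_def mv_mult_def mvf_adj_def
      by (rule mult_minus_distrib_mat_vec[OF ca(1) mult_mat_vec_carrier[OF c(1,3)] c(4)])
    also have "mat_adjoint (bl (cis \<theta>)) *\<^sub>v (bl (cis \<theta>) *\<^sub>v x0 (cis \<theta>)) = x0 (cis \<theta>)"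
      by (rule unitary_cancel[OF ca(1) c(3) c(1) bl(2)[OF cis_range]])
    finally have br': "mat_adjoint (bl (cis \<theta>)) *\<^sub>v r (cis \<theta>) = x0 (cis \<theta>) - x (cis \<theta>)" .
    have "mat_adjoint (SL (cis \<theta>)) *\<^sub>v r (cis \<theta>) = mat_adjoint (S (cis \<theta>)) *\<^sub>v (mat_adjoint (bl (cis \<theta>)) *\<^sub>v r (cis \<theta>))"
      unfolding elim(2)[symmetric] mat_adjoint_mult[OF c(1,2)] by (rule assoc_mult_mat_vec[OF ca(2,1) c(6)])
    also have "\<dots> = mat_adjoint (S (cis \<theta>)) *\<^sub>v x0 (cis \<theta>) - mat_adjoint (S (cis \<theta>)) *\<^sub>v x (cis \<theta>)"
      unfolding br' by (rule mult_minus_distrib_mat_vec[OF ca(2) c(3,7)])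
    finally show ?case
      unfolding vv_add_def vv_diff_def mv_mult_def mvf_adj_def elim(1)[unfolded vv_add_def mv_mult_def mvf_adj_def]
      using c ca by (intro eq_vecI) (auto simp: algebra_simps simp del: index_mult_mat_vec)
  qed
  have dP: "vv_diff y (mv_mult Sa x) \<in> H2_perp q"
    by (rule H2_perp_AE_cong[OF H2_perp_add[OF ax(1) SLr] eq L2_carrier[OF L2_diff[OF yL SxL]]])
  have yproj: "L2_inner (vv_diff (mv_mult Sa x) y) h = 0" if h: "h \<in> H2 q" for h
    using H2_perp_inner[OF dP h] L2_inner_diff_left[OF yL SxL H2_L2[OF h]] L2_inner_diff_left[OF SxL yL H2_L2[OF h]] by simp
  have "L2_eq (orth_proj (H2 q) (mv_mult Sa x)) y"
    by (rule orth_proj_unique[OF SxL _ H2_diff orth_proj_props[OF H2_projection_exists[OF xP]] yH yproj]) (auto dest: H2_L2)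
  then show ?thesis using xs by (auto simp: Y_left_def S_def y_def)
qed

abbreviation \<Gamma> where "\<Gamma> k \<equiv> Gamma_left p q s bl br k"

text \<open>
  The definition of $\Gamma_\ell$ selects some preimage, up to null sets; these two properties hold for any selection.
\<close>

lemma Gamma:
  assumes k: "k \<in> L2 q"
  shows "\<Gamma> k \<in> H2_perp p" "vv_diff (mv_mult Sa (\<Gamma> k)) (Pr k) \<in> H2_perp q"
proof -
  have G: "\<Gamma> k \<in> H_star_b p bl" "L2_eq (Y_left p q s (\<Gamma> k)) (Pr k)"
    using someI_ex[OF Gamma_exists[OF k]] unfolding Gamma_left_def by blast+
  show P: "\<Gamma> k \<in> H2_perp p" by (rule H_star_b_perp[OF G(1)])
  have SxL: "mv_mult Sa (\<Gamma> k) \<in> L2 q" by (rule L2_mv[OF Sa H2_perp_L2[OF P]])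
  let ?y = "orth_proj (H2 q) (mv_mult Sa (\<Gamma> k))"
  note pr = orth_proj_props[OF H2_projection_exists[OF P]]
  have 1: "vv_diff (mv_mult Sa (\<Gamma> k)) ?y \<in> H2_perp q"
    using pr L2_diff[OF SxL H2_L2[OF pr(1)]] by (simp add: H2_perp_iff)
  have eq: "L2_eq (vv_diff (mv_mult Sa (\<Gamma> k)) ?y) (vv_diff (mv_mult Sa (\<Gamma> k)) (Pr k))"
    using G(2) by (intro L2_eq_diff L2_eq_refl) (simp add: Y_left_def S_def)
  show "vv_diff (mv_mult Sa (\<Gamma> k)) (Pr k) \<in> H2_perp q"
    by (rule H2_perp_AE_cong[OF 1 eq L2_carrier[OF L2_diff[OF SxL H_b_L2[OF Pr(1)[OF k]]]]])
qed

text \<open>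
  Such an $h$ is orthogonal to $b_r H_2^q$, so its projection to $\mathcal H(b_r)$ is its full $H_2^q$ part.
\<close>

lemma Gamma_spH:
  assumes h: "spH h" shows "vv_diff h (mv_mult Sa (\<Gamma> h)) \<in> H2_perp q"
proof -
  have hL: "h \<in> L2 q" using h by (simp add: spH_def)
  note G = Gamma[OF hL] and PL = H_b_L2[OF Pr(1)[OF hL]]
  have SxL: "mv_mult Sa (\<Gamma> h) \<in> L2 q" by (rule L2_mv[OF Sa H2_perp_L2[OF G(1)]])
  have "vv_diff h (Pr h) \<in> H2_perp q"
    by (rule finite_inner_perp[OF fr hL spH_perp_range[OF h] Pr[OF hL]])
  from H2_perp_diff[OF this G(2)] show ?thesis
  proof (rule H2_perp_cong)
    fix \<zeta> :: complex assume \<zeta>: "\<zeta> \<in> sphere 0 1"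
    note c = L2_carrier[OF hL \<zeta>] L2_carrier[OF PL \<zeta>] L2_carrier[OF SxL \<zeta>]
    show "vv_diff (vv_diff h (Pr h)) (vv_diff (mv_mult Sa (\<Gamma> h)) (Pr h)) \<zeta> = vv_diff h (mv_mult Sa (\<Gamma> h)) \<zeta>"
      unfolding vv_diff_def using c by (intro eq_vecI) auto
  qed
qed

text \<open>
  The inner product depends on $h$ and $b$ only. So $\Gamma_\ell h$ may be exchanged for any other $x$ with the same
  property, and $\langle \Gamma_\ell h, g \rangle$ is linear in $h$.
\<close>

lemma inner_spG:
  assumes x: "x \<in> H2_perp p" and h: "h \<in> L2 q" "vv_diff h (mv_mult Sa x) \<in> H2_perp q" and g: "spG g b"
  shows "L2_inner x g = L2_inner h b"
proof -
  from g obtain a where a: "g \<in> L2 p" "b \<in> H2 q" "a \<in> H2 p" "L2_eq g (vv_add a (mv_mult S b))" by (auto simp: spG_def)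
  note xL = H2_perp_L2[OF x]
  have SbL: "mv_mult S b \<in> L2 p" by (rule L2_mv[OF S H2_L2[OF a(2)]])
  have SxL: "mv_mult Sa x \<in> L2 q" by (rule L2_mv[OF Sa xL])
  have "L2_inner x g = L2_inner x (vv_add a (mv_mult S b))"
    by (rule L2_inner_eq_cong[OF xL a(1) xL L2_add[OF H2_L2[OF a(3)] SbL] L2_eq_refl a(4)])
  also have "\<dots> = L2_inner x a + L2_inner x (mv_mult S b)" by (rule L2_inner_add_right[OF H2_L2[OF a(3)] SbL xL])
  also have "L2_inner x a = 0" by (rule H2_perp_inner[OF x a(3)])
  also have "L2_inner x (mv_mult S b) = L2_inner (mv_mult Sa x) b" by (rule L2_inner_adj'[OF S H2_L2[OF a(2)] xL, symmetric])
  also have "\<dots> = L2_inner h b"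
    using H2_perp_inner[OF h(2) a(2)] L2_inner_diff_left[OF h(1) SxL H2_L2[OF a(2)]] by simp
  finally show ?thesis by simp
qed

text \<open>
  The adjoint takes $g = a + S b$ to the projection of $b$ to $\mathcal H(b_r)$.
\<close>

lemma Gamma_adjoint:
  assumes g: "spG g b"
  shows "Gamma_left_adj p q s bl br g \<in> L2 q"
    "\<And>k. k \<in> L2 q \<Longrightarrow> L2_inner (\<Gamma> k) g = L2_inner k (Gamma_left_adj p q s bl br g)"
proof -
  have bL: "b \<in> L2 q" using g by (auto simp: spG_def H2_L2)
  note Pb = Pr[OF bL] and PbL = H_b_L2[OF Pr(1)[OF bL]]
  have "L2_inner (\<Gamma> k) g = L2_inner k (Pr b)" if k: "k \<in> L2 q" for k
  proof -
    note G = Gamma[OF k] and Pk = Pr[OF k] and PkL = H_b_L2[OF Pr(1)[OF k]]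
    have SxL: "mv_mult Sa (\<Gamma> k) \<in> L2 q" by (rule L2_mv[OF Sa H2_perp_L2[OF G(1)]])
    have "vv_diff (Pr k) (mv_mult Sa (\<Gamma> k)) \<in> H2_perp q"
      using G(2) L2_diff[OF PkL SxL] L2_inner_diff_left[OF PkL SxL H2_L2] L2_inner_diff_left[OF SxL PkL H2_L2]
      by (auto simp: H2_perp_iff)
    from inner_spG[OF G(1) PkL this g] have "L2_inner (\<Gamma> k) g = L2_inner (Pr k) b" .
    also have "\<dots> = L2_inner (Pr k) (Pr b)"
      using Pb(2)[OF Pk(1)] L2_inner_diff_left[OF bL PbL PkL] L2_inner_cnj[OF bL PkL] L2_inner_cnj[OF PbL PkL] by simp
    also have "\<dots> = L2_inner k (Pr b)"
      using Pk(2)[OF Pb(1)] L2_inner_diff_left[OF k PkL PbL] by simp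
    finally show ?thesis .
  qed
  then have "\<exists>h. h \<in> L2 q \<and> (\<forall>f\<in>L2 q. L2_inner (\<Gamma> f) g = L2_inner f h)" using PbL by blast
  from someI_ex[OF this]
  show "Gamma_left_adj p q s bl br g \<in> L2 q"
    "\<And>k. k \<in> L2 q \<Longrightarrow> L2_inner (\<Gamma> k) g = L2_inner k (Gamma_left_adj p q s bl br g)"
    unfolding Gamma_left_adj_def by blast+
qed

end

section \<open>The Hermitian form of $P_s$ and its displacement identity\<close>

abbreviation upper :: "nat \<Rightarrow> vvf \<Rightarrow> vvf" where "upper p f \<equiv> (\<lambda>z. vec_first (f z) p)"
abbreviation lower :: "nat \<Rightarrow> vvf \<Rightarrow> vvf" where "lower q f \<equiv> (\<lambda>z. vec_last (f z) q)"

lemma L2_upper: "f \<in> L2 (p + q) \<Longrightarrow> upper p f \<in> L2 p"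
  unfolding L2_iff by (auto simp: vec_first_def)

lemma L2_lower:
  assumes "f \<in> L2 (p + q)" shows "lower q f \<in> L2 q"
  unfolding L2_iff
proof (intro conjI ballI allI impI)
  fix i assume i: "i < q"
  show "(\<lambda>\<zeta>. vec_last (f \<zeta>) q $ i) \<in> l2"
  proof (rule l2_cong[OF L2_comp[OF assms, of "p + i"]])
    fix \<zeta> :: complex assume "\<zeta> \<in> sphere 0 1"
    then show "f \<zeta> $ (p + i) = vec_last (f \<zeta>) q $ i"
      using i carrier_vecD[OF L2_carrier[OF assms]] by (simp add: vec_last_def del: mem_sphere_0)
  qed (use i in simp)
qed simp

lemma L2_append:
  assumes "f \<in> L2 p" "g \<in> L2 q" shows "(\<lambda>\<zeta>. f \<zeta> @\<^sub>v g \<zeta>) \<in> L2 (p + q)"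
  unfolding L2_iff
proof (intro conjI ballI allI impI)
  fix \<zeta> :: complex assume "\<zeta> \<in> sphere 0 1"
  then show "f \<zeta> @\<^sub>v g \<zeta> \<in> carrier_vec (p + q)"
    by (intro append_carrier_vec L2_carrier[OF assms(1)] L2_carrier[OF assms(2)])
next
  fix i assume i: "i < p + q"
  show "(\<lambda>\<zeta>. (f \<zeta> @\<^sub>v g \<zeta>) $ i) \<in> l2"
  proof (cases "i < p")
    case True
    show ?thesis
      by (rule l2_cong[OF L2_comp[OF assms(1) True]])
        (simp add: carrier_vecD[OF L2_carrier[OF assms(1)]] carrier_vecD[OF L2_carrier[OF assms(2)]] True i trans_less_add1 del: mem_sphere_0)
  next
    case False
    then have "i - p < q" using i by simp
    from L2_comp[OF assms(2) this] show ?thesis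
      by (rule l2_cong) (use False i in \<open>simp add: carrier_vecD[OF L2_carrier[OF assms(1)]] carrier_vecD[OF L2_carrier[OF assms(2)]] del: mem_sphere_0\<close>)
  qed
qed

lemma cscalar_prod_split:
  fixes x y :: "complex vec"
  assumes "x \<in> carrier_vec (p + q)" "y \<in> carrier_vec (p + q)"
  shows "x \<bullet>c y = vec_first x p \<bullet>c vec_first y p + vec_last x q \<bullet>c vec_last y q"
proof -
  have "conjugate y = conjugate (vec_first y p) @\<^sub>v conjugate (vec_last y q)"
    using assms by (intro eq_vecI) (auto simp: vec_first_def vec_last_def)
  then have "x \<bullet>c y = (vec_first x p @\<^sub>v vec_last x q) \<bullet> (conjugate (vec_first y p) @\<^sub>v conjugate (vec_last y q))"
    using assms by simp
  also have "\<dots> = vec_first x p \<bullet>c vec_first y p + vec_last x q \<bullet>c vec_last y q"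
    by (rule scalar_prod_append[of _ p _ q]) auto
  finally show ?thesis .
qed

lemma L2_inner_split:
  assumes f: "f \<in> L2 (p + q)" and g: "g \<in> L2 (p + q)"
  shows "L2_inner f g = L2_inner (upper p f) (upper p g) + L2_inner (lower q f) (lower q g)"
proof -
  have "(LINT \<theta>|arc. f (cis \<theta>) \<bullet>c g (cis \<theta>))
      = (LINT \<theta>|arc. upper p f (cis \<theta>) \<bullet>c upper p g (cis \<theta>) + lower q f (cis \<theta>) \<bullet>c lower q g (cis \<theta>))"
    by (intro Bochner_Integration.integral_cong refl cscalar_prod_split L2_carrier[OF f] L2_carrier[OF g] cis_range)
  also have "\<dots> = (LINT \<theta>|arc. upper p f (cis \<theta>) \<bullet>c upper p g (cis \<theta>)) + (LINT \<theta>|arc. lower q f (cis \<theta>) \<bullet>c lower q g (cis \<theta>))"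
    by (intro Bochner_Integration.integral_add
        L2_inner_integrable[OF L2_upper[OF f] L2_upper[OF g]] L2_inner_integrable[OF L2_lower[OF f] L2_lower[OF g]])
  finally show ?thesis by (simp add: L2_inner_def add_divide_distrib distrib_left)
qed

lemma L2_inner_vv_scale_cnj:
  assumes "f \<in> L2 k" "g \<in> L2 k"
  shows "L2_inner (vv_scale cnj f) g = L2_inner f (vv_scale (\<lambda>\<zeta>. \<zeta>) g)"
proof -
  have "vv_scale cnj f (cis \<theta>) \<bullet>c g (cis \<theta>) = f (cis \<theta>) \<bullet>c vv_scale (\<lambda>\<zeta>. \<zeta>) g (cis \<theta>)" for \<theta>
    using L2_carrier[OF assms(1) cis_range, of \<theta>] L2_carrier[OF assms(2) cis_range, of \<theta>]
    by (simp add: vv_scale_def cscalar_prod_sum[of _ k] ac_simps)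
  then show ?thesis by (simp add: L2_inner_def)
qed

lemma id_hinf: "(\<lambda>\<zeta>. \<zeta>) \<in> hinf" using minus_const_hinf[of 0] by simp

context kl_pair begin

abbreviation "\<Delta> \<equiv> Delta p q s"
text \<open>
  The components $g = f_1 - S f_2$ and $h = f_2 - S^* f_1$ of $\Delta_s f$.
\<close>

abbreviation "gg f \<equiv> upper p (mv_mult \<Delta> f)"
abbreviation "hh f \<equiv> lower q (mv_mult \<Delta> f)"

lemma Delta_carrier: "\<Delta> \<zeta> \<in> carrier_mat (p + q) (p + q)"
  unfolding Delta_def by (rule four_block_carrier_mat) auto

lemma Delta_self_adjoint: "mat_adjoint (\<Delta> \<zeta>) = \<Delta> \<zeta>"
proof (rule eq_matI)
  fix i j assume "i < dim_row (\<Delta> \<zeta>)" "j < dim_col (\<Delta> \<zeta>)"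
  then have ij: "i < p + q" "j < p + q" using Delta_carrier[of \<zeta>] by auto
  then have l: "\<not> i < p \<Longrightarrow> i - p < q" "\<not> j < p \<Longrightarrow> j - p < q" by auto
  have c: "bdry p q s \<zeta> \<in> carrier_mat p q" by simp
  have "mat_adjoint (\<Delta> \<zeta>) $$ (i, j) = cnj (\<Delta> \<zeta> $$ (j, i))"
    using ij carrier_matD[OF Delta_carrier[of \<zeta>]] by (intro mat_adjoint_index) auto
  also have "\<dots> = \<Delta> \<zeta> $$ (i, j)"
    using ij l carrier_matD[OF c] by (auto simp: Delta_def mat_adjoint_index mat_adjoint_dims)
  finally show "mat_adjoint (\<Delta> \<zeta>) $$ (i, j) = \<Delta> \<zeta> $$ (i, j)" .
qed (use Delta_carrier[of \<zeta>] in auto)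

lemma Delta_LM: "LM (p + q) (p + q) \<Delta>"
  unfolding LM_def
proof (intro conjI ballI allI impI Delta_carrier)
  fix i j assume ij: "i < p + q" "j < p + q"
  have l: "(\<lambda>\<zeta>. S \<zeta> $$ (i', j')) \<in> linf" if "i' < p" "j' < q" for i' j'
    using S that by (auto simp: LM_def)
  have c: "S \<zeta> \<in> carrier_mat p q" for \<zeta> by (simp add: S_def)
  show "(\<lambda>\<zeta>. \<Delta> \<zeta> $$ (i, j)) \<in> linf"
  proof (cases "i < p"; cases "j < p")
    assume a: "i < p" "j < p"
    show ?thesis by (rule linf_cong[OF linf_const[of "if i = j then 1 else 0"]]) (use a ij c in \<open>auto simp: Delta_def\<close>)
  next
    assume a: "i < p" "\<not> j < p"
    have "(\<lambda>\<zeta>. - (S \<zeta> $$ (i, j - p))) \<in> linf" by (rule linf_uminus[OF l]) (use a ij in auto)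
    then show ?thesis by (rule linf_cong) (use a ij carrier_matD[OF c] in \<open>auto simp: Delta_def S_def[symmetric]\<close>)
  next
    assume a: "\<not> i < p" "j < p"
    have "(\<lambda>\<zeta>. - cnj (S \<zeta> $$ (j, i - p))) \<in> linf" by (rule linf_uminus[OF linf_cnj[OF l]]) (use a ij in auto)
    then show ?thesis by (rule linf_cong) (use a ij carrier_matD[OF c] in \<open>auto simp: Delta_def S_def[symmetric] mat_adjoint_index mat_adjoint_dims\<close>)
  next
    assume a: "\<not> i < p" "\<not> j < p"
    show ?thesis by (rule linf_cong[OF linf_const[of "if i = j then 1 else 0"]]) (use a ij carrier_matD[OF c] in \<open>auto simp: Delta_def S_def[symmetric]\<close>)
  qed
qed

lemma Delta_inner_swap:
  assumes "f \<in> L2 (p + q)" "g \<in> L2 (p + q)"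
  shows "L2_inner (mv_mult \<Delta> f) g = L2_inner f (mv_mult \<Delta> g)"
  using L2_inner_adj[OF Delta_LM assms] by (simp add: mvf_adj_def Delta_self_adjoint)

lemma Delta_mult:
  assumes "v \<in> carrier_vec (p + q)"
  shows "vec_first (\<Delta> \<zeta> *\<^sub>v v) p = vec_first v p - S \<zeta> *\<^sub>v vec_last v q" (is ?A)
    and "vec_last (\<Delta> \<zeta> *\<^sub>v v) q = vec_last v q - mat_adjoint (S \<zeta>) *\<^sub>v vec_first v p" (is ?B)
proof -
  have c: "S \<zeta> \<in> carrier_mat p q" by (simp add: S_def)
  note ca = mat_adjoint_carrier[OF c]
  have "\<Delta> \<zeta> *\<^sub>v (vec_first v p @\<^sub>v vec_last v q) = (1\<^sub>m p *\<^sub>v vec_first v p + (- S \<zeta>) *\<^sub>v vec_last v q) @\<^sub>v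
      ((- mat_adjoint (S \<zeta>)) *\<^sub>v vec_first v p + 1\<^sub>m q *\<^sub>v vec_last v q)"
    unfolding Delta_def S_def by (rule four_block_mat_mult_vec) (use c ca in \<open>auto simp: S_def\<close>)
  also have "vec_first v p @\<^sub>v vec_last v q = v" by (rule vec_first_last_append[OF assms])
  finally have e: "\<Delta> \<zeta> *\<^sub>v v = (vec_first v p + (- S \<zeta>) *\<^sub>v vec_last v q) @\<^sub>v
      ((- mat_adjoint (S \<zeta>)) *\<^sub>v vec_first v p + vec_last v q)" by simp
  have n: "(- S \<zeta>) *\<^sub>v vec_last v q = - (S \<zeta> *\<^sub>v vec_last v q)"
    "(- mat_adjoint (S \<zeta>)) *\<^sub>v vec_first v p = - (mat_adjoint (S \<zeta>) *\<^sub>v vec_first v p)"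
    using c ca by (auto simp: uminus_mult_mat_vec)
  show ?A unfolding e n using c ca by (intro eq_vecI) (auto simp: vec_first_def)
  show ?B unfolding e n using c ca by (intro eq_vecI) (auto simp: vec_last_def)
qed

lemma L2_Delta: "f \<in> L2 (p + q) \<Longrightarrow> mv_mult \<Delta> f \<in> L2 (p + q)"
  by (rule L2_mv[OF Delta_LM])

lemma L2_gg: "f \<in> L2 (p + q) \<Longrightarrow> gg f \<in> L2 p" and L2_hh: "f \<in> L2 (p + q) \<Longrightarrow> hh f \<in> L2 q"
  by (rule L2_upper[OF L2_Delta], assumption) (rule L2_lower[OF L2_Delta], assumption)

definition admissible :: "vvf \<Rightarrow> bool" where
  "admissible f \<longleftrightarrow> f \<in> L2 (p + q) \<and> (\<exists>b. spG (gg f) b) \<and> spH (hh f)"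

definition form :: "vvf \<Rightarrow> vvf \<Rightarrow> complex" where
  "form f f' = L2_inner (mv_mult \<Delta> f) f' + L2_inner (\<Gamma> (hh f)) (gg f') + L2_inner (gg f) (\<Gamma> (hh f'))"

text \<open>
  Since $\Delta_s$ is self-adjoint, it can be moved to the second argument, after which the block operator pairs the
  components of $\Delta_s f$ with those of $\Delta_s f'$.
\<close>

lemma P_operator_form:
  assumes f: "admissible f" and f': "admissible f'"
  shows "L2_inner (P_operator p q s bl br f) f' = form f f'"
proof -
  have fL: "f \<in> L2 (p + q)" "f' \<in> L2 (p + q)" using f f' by (auto simp: admissible_def)
  obtain b where b: "spG (gg f) b" using f by (auto simp: admissible_def)
  note dL = L2_Delta[OF fL(1)] L2_Delta[OF fL(2)] and hL = L2_hh[OF fL(1)] L2_hh[OF fL(2)] and gL = L2_gg[OF fL(1)]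
  note GL = H2_perp_L2[OF Gamma(1)[OF hL(1)]] H2_perp_L2[OF Gamma(1)[OF hL(2)]]
  note A = Gamma_adjoint[OF b]
  let ?k = "Gamma_block p q s bl br (mv_mult \<Delta> f)"
  have kL: "?k \<in> L2 (p + q)" unfolding Gamma_block_def by (rule L2_append[OF GL(1) A(1)])
  have up: "upper p ?k \<zeta> = \<Gamma> (hh f) \<zeta>" "lower q ?k \<zeta> = Gamma_left_adj p q s bl br (gg f) \<zeta>" if "\<zeta> \<in> sphere 0 1" for \<zeta>
    unfolding Gamma_block_def using L2_carrier[OF GL(1) that] L2_carrier[OF A(1) that]
    by (auto simp: vec_first_def vec_last_def intro!: eq_vecI)
  have "L2_inner (P_operator p q s bl br f) f' = L2_inner (mv_mult \<Delta> f) f' + L2_inner ?k (mv_mult \<Delta> f')"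
    unfolding P_operator_def L2_inner_add_left[OF dL(1) L2_Delta[OF kL] fL(2)] Delta_inner_swap[OF kL fL(2)] ..
  also have "L2_inner ?k (mv_mult \<Delta> f') = L2_inner (\<Gamma> (hh f)) (gg f') + L2_inner (Gamma_left_adj p q s bl br (gg f)) (hh f')"
    unfolding L2_inner_split[OF kL dL(2)]
    by (rule arg_cong2[where f = "(+)"]; rule L2_inner_sphere_cong; (simp only: up)?)
  also have "L2_inner (Gamma_left_adj p q s bl br (gg f)) (hh f') = L2_inner (gg f) (\<Gamma> (hh f'))"
    using A(2)[OF hL(2)] L2_inner_cnj[OF hL(2) A(1)] L2_inner_cnj[OF GL(2) gL] by simp
  finally show ?thesis by (simp add: form_def)
qed

lemma form_hermitian:
  assumes "admissible f" "admissible f'" shows "form f' f = cnj (form f f')"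
proof -
  have fL: "f \<in> L2 (p + q)" "f' \<in> L2 (p + q)" using assms by (auto simp: admissible_def)
  note dL = L2_Delta[OF fL(1)] L2_Delta[OF fL(2)] and hL = L2_hh[OF fL(1)] L2_hh[OF fL(2)]
    and gL = L2_gg[OF fL(1)] L2_gg[OF fL(2)]
  note GL = H2_perp_L2[OF Gamma(1)[OF hL(1)]] H2_perp_L2[OF Gamma(1)[OF hL(2)]]
  show ?thesis
    unfolding form_def
    using L2_inner_cnj[OF dL(1) fL(2)] Delta_inner_swap[OF fL(2,1)] L2_inner_cnj[OF GL(1) gL(2)] L2_inner_cnj[OF gL(1) GL(2)]
    by simp
qed

text \<open>
  The operator $\Gamma_\ell$ is a choice of preimages up to null sets and hence not visibly linear; linearity of the form
  in its first argument comes from \<open>inner_spG\<close>.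
\<close>

lemma form_linear:
  assumes f: "admissible f1" "admissible f2" "admissible f3" "admissible f'"
    and eq: "\<And>\<zeta>. \<zeta> \<in> sphere 0 1 \<Longrightarrow> f3 \<zeta> = c \<cdot>\<^sub>v f1 \<zeta> + f2 \<zeta>"
  shows "form f3 f' = c * form f1 f' + form f2 f'"
proof -
  have L: "f1 \<in> L2 (p + q)" "f2 \<in> L2 (p + q)" "f3 \<in> L2 (p + q)" "f' \<in> L2 (p + q)" using f by (auto simp: admissible_def)
  obtain b where b: "spG (gg f') b" using f by (auto simp: admissible_def)
  then have bL: "b \<in> L2 q" by (auto simp: spG_def H2_L2)
  let ?c = "\<lambda>_::complex. c"
  have D: "mv_mult \<Delta> f3 \<zeta> = c \<cdot>\<^sub>v mv_mult \<Delta> f1 \<zeta> + mv_mult \<Delta> f2 \<zeta>" if \<zeta>: "\<zeta> \<in> sphere 0 1" for \<zeta>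
    unfolding mv_mult_def eq[OF \<zeta>]
    using mult_add_distrib_mat_vec[OF Delta_carrier smult_carrier_vec[THEN iffD2, OF L2_carrier[OF L(1) \<zeta>]] L2_carrier[OF L(2) \<zeta>]]
      mult_mat_vec[OF Delta_carrier L2_carrier[OF L(1) \<zeta>]] by simp
  have h: "hh f3 \<zeta> = vv_add (vv_scale ?c (hh f1)) (hh f2) \<zeta>" and g: "gg f3 \<zeta> = vv_add (vv_scale ?c (gg f1)) (gg f2) \<zeta>"
    if \<zeta>: "\<zeta> \<in> sphere 0 1" for \<zeta>
    unfolding D[OF \<zeta>] vv_add_def vv_scale_def
    using L2_carrier[OF L2_Delta[OF L(1)] \<zeta>] L2_carrier[OF L2_Delta[OF L(2)] \<zeta>]
    by (auto simp: vec_first_def vec_last_def intro!: eq_vecI)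
  have lin: "L2_inner k3 k = c * L2_inner k1 k + L2_inner k2 k"
    if "k1 \<in> L2 l" "k2 \<in> L2 l" "k \<in> L2 l" "\<And>\<zeta>. \<zeta> \<in> sphere 0 1 \<Longrightarrow> k3 \<zeta> = vv_add (vv_scale ?c k1) k2 \<zeta>" for k1 k2 k3 k l
  proof -
    have "L2_inner k3 k = L2_inner (vv_add (vv_scale ?c k1) k2) k" by (rule L2_inner_sphere_cong[OF that(4) refl])
    then show ?thesis
      using L2_inner_add_left[OF L2_scale[OF linf_const[of c] that(1)] that(2,3)] L2_inner_scale_left[OF that(1,3), of c] by simp
  qed
  have \<Gamma>b: "L2_inner (\<Gamma> (hh k)) (gg f') = L2_inner (hh k) b" if "admissible k" for k
  proof (rule inner_spG[OF Gamma(1) _ _ b])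
    show "hh k \<in> L2 q" "hh k \<in> L2 q" using that by (auto simp: admissible_def L2_hh)
    show "vv_diff (hh k) (mv_mult Sa (\<Gamma> (hh k))) \<in> H2_perp q" using that by (auto simp: admissible_def Gamma_spH)
  qed
  note GL = H2_perp_L2[OF Gamma(1)[OF L2_hh[OF L(4)]]]
  show ?thesis
    unfolding form_def \<Gamma>b[OF f(1)] \<Gamma>b[OF f(2)] \<Gamma>b[OF f(3)]
    using lin[OF L2_Delta[OF L(1)] L2_Delta[OF L(2)] L(4), of "mv_mult \<Delta> f3"] D
      lin[OF L2_hh[OF L(1)] L2_hh[OF L(2)] bL h] lin[OF L2_gg[OF L(1)] L2_gg[OF L(2)] GL g]
    by (simp add: vv_add_def vv_scale_def algebra_simps)
qed

text \<open>
  Write $x = \Gamma_\ell h_e$. Then $y = \overline\zeta (x + c_1)$ may be used in place of $\Gamma_\ell h_f$, because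
  $h_f - S^* y = \overline\zeta (h_e - S^* x) - \overline\zeta c_2$ is orthogonal to $H_2^q$. Moving the factor $\overline\zeta$ to the
  other side turns $\zeta g_f$ into $g_e - g_c$, and similarly $\Delta_s \zeta f = \Delta_s e - \Delta_s c$. After expansion, all terms
  containing $e$ or $x$ cancel.
\<close>

lemma form_displacement:
  assumes e: "admissible e" and f: "admissible f" and c: "c \<in> carrier_vec (p + q)"
    and eq: "\<And>\<zeta>. \<zeta> \<in> sphere 0 1 \<Longrightarrow> e \<zeta> = c + \<zeta> \<cdot>\<^sub>v f \<zeta>"
  shows "form e e - form f f = vec_first c p \<bullet>c vec_first c p - vec_last c q \<bullet>c vec_last c q"
proof -
  let ?c = "\<lambda>_::complex. c" and ?c1 = "\<lambda>_::complex. vec_first c p" and ?c2 = "\<lambda>_::complex. vec_last c q"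
  let ?z = "vv_scale (\<lambda>\<zeta>. \<zeta>)"
  have L: "e \<in> L2 (p + q)" "f \<in> L2 (p + q)" using e f by (auto simp: admissible_def)
  have cL: "?c \<in> L2 (p + q)" "?c1 \<in> L2 p" "?c2 \<in> L2 q"
    by (rule H2_L2[OF H2_const], rule c, (rule H2_L2[OF H2_const], simp)+)
  have c2H: "?c2 \<in> H2 q" "?c1 \<in> H2 p" by (auto intro: H2_const)
  note dL = L2_Delta[OF L(1)] L2_Delta[OF L(2)] L2_Delta[OF cL(1)]
  note gL = L2_gg[OF L(1)] L2_gg[OF L(2)] L2_gg[OF cL(1)] and hL = L2_hh[OF L(1)] L2_hh[OF L(2)] L2_hh[OF cL(1)]
  obtain be bf where b: "spG (gg e) be" "spG (gg f) bf" using e f by (auto simp: admissible_def)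
  have sh: "spH (hh e)" "spH (hh f)" using e f by (auto simp: admissible_def)
  let ?x = "\<Gamma> (hh e)"
  let ?y = "vv_add (vv_scale cnj ?x) (vv_scale cnj ?c1)"
  have x: "?x \<in> H2_perp p" "vv_diff (hh e) (mv_mult Sa ?x) \<in> H2_perp q"
    by (rule Gamma(1)[OF hL(1)], rule Gamma_spH[OF sh(1)])
  note xL = H2_perp_L2[OF x(1)]
  have SxL: "mv_mult Sa ?x \<in> L2 q" by (rule L2_mv[OF Sa xL])
  have y: "?y \<in> H2_perp p"
    by (rule H2_perp_add[OF H2_perp_scale_cnj[OF id_hinf x(1)] H2_perp_cnj_const]) simp
  note yL = H2_perp_L2[OF y]
  have D: "mv_mult \<Delta> e \<zeta> = mv_mult \<Delta> ?c \<zeta> + \<zeta> \<cdot>\<^sub>v mv_mult \<Delta> f \<zeta>" if \<zeta>: "\<zeta> \<in> sphere 0 1" for \<zeta>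
    unfolding mv_mult_def eq[OF \<zeta>]
    using mult_add_distrib_mat_vec[OF Delta_carrier c smult_carrier_vec[THEN iffD2, OF L2_carrier[OF L(2) \<zeta>]]]
      mult_mat_vec[OF Delta_carrier L2_carrier[OF L(2) \<zeta>]] by simp
  have h: "hh e \<zeta> = hh ?c \<zeta> + \<zeta> \<cdot>\<^sub>v hh f \<zeta>" and g: "gg e \<zeta> = gg ?c \<zeta> + \<zeta> \<cdot>\<^sub>v gg f \<zeta>"
    if \<zeta>: "\<zeta> \<in> sphere 0 1" for \<zeta>
    unfolding D[OF \<zeta>] using L2_carrier[OF dL(3) \<zeta>] L2_carrier[OF dL(2) \<zeta>]
    by (auto simp: vec_first_def vec_last_def intro!: eq_vecI)
  have hy: "vv_diff (hh f) (mv_mult Sa ?y) \<in> H2_perp q"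
  proof (rule H2_perp_cong[OF H2_perp_diff[OF H2_perp_scale_cnj[OF id_hinf x(2)] H2_perp_cnj_const[of "vec_last c q" q]]])
    fix \<zeta> :: complex assume \<zeta>: "\<zeta> \<in> sphere 0 1"
    have Sc: "mat_adjoint (S \<zeta>) \<in> carrier_mat q p" using LM_carrier[OF Sa \<zeta>] by (simp add: mvf_adj_def)
    note cs = L2_carrier[OF hL(1) \<zeta>] L2_carrier[OF hL(2) \<zeta>] L2_carrier[OF xL \<zeta>]
    have hc: "hh ?c \<zeta> = vec_last c q - mat_adjoint (S \<zeta>) *\<^sub>v vec_first c p"
      unfolding mv_mult_def by (rule Delta_mult(2)[OF c])
    have zc: "cnj \<zeta> * (\<zeta> * a) = a" for a using sphere_mult_cnj[OF \<zeta>] by (metis mult.assoc mult.commute mult.right_neutral)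
    have Sy: "mv_mult Sa ?y \<zeta> = cnj \<zeta> \<cdot>\<^sub>v (mat_adjoint (S \<zeta>) *\<^sub>v ?x \<zeta>) + cnj \<zeta> \<cdot>\<^sub>v (mat_adjoint (S \<zeta>) *\<^sub>v vec_first c p)"
      unfolding mv_mult_def[of Sa] unfolding mvf_adj_def vv_add_def vv_scale_def
        mult_add_distrib_mat_vec[OF Sc smult_carrier_vec[THEN iffD2, OF cs(3)] smult_carrier_vec[THEN iffD2, OF vec_first_carrier]]
        mult_mat_vec[OF Sc cs(3)] mult_mat_vec[OF Sc vec_first_carrier] ..
    define u w where "u = mat_adjoint (S \<zeta>) *\<^sub>v ?x \<zeta>" and "w = mat_adjoint (S \<zeta>) *\<^sub>v vec_first c p"
    have uw: "u \<in> carrier_vec q" "w \<in> carrier_vec q"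
      unfolding u_def w_def by (rule mult_mat_vec_carrier[OF Sc cs(3)], rule mult_mat_vec_carrier[OF Sc vec_first_carrier])
    show "vv_diff (vv_scale cnj (vv_diff (hh e) (mv_mult Sa ?x))) (vv_scale cnj (\<lambda>_. vec_last c q)) \<zeta> = vv_diff (hh f) (mv_mult Sa ?y) \<zeta>"
      unfolding vv_diff_def unfolding Sy unfolding vv_scale_def unfolding h[OF \<zeta>] hc unfolding mv_mult_def[of Sa]
      unfolding mvf_adj_def unfolding u_def[symmetric] w_def[symmetric]
      using uw cs(2) by (intro eq_vecI) (auto simp: algebra_simps zc sphere_mult_cnj[OF \<zeta>])
  qed simp
  \<comment> \<open>Both elements are solutions of the same problem for $f$, so they have the same inner product with $g_f$.\<close>
  have inf: "L2_inner (\<Gamma> (hh f)) (gg f) = L2_inner ?y (gg f)"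
    using inner_spG[OF Gamma(1)[OF hL(2)] hL(2) Gamma_spH[OF sh(2)] b(2)] inner_spG[OF y hL(2) hy b(2)] by simp
  have zgL: "?z (gg f) \<in> L2 p" by (rule L2_scale[OF hinf_linf[OF id_hinf] gL(2)])
  have zg: "vv_scale (\<lambda>\<zeta>. \<zeta>) (gg f) \<zeta> = vv_diff (gg e) (gg ?c) \<zeta>" if \<zeta>: "\<zeta> \<in> sphere 0 1" for \<zeta>
    unfolding vv_scale_def vv_diff_def g[OF \<zeta>] using L2_carrier[OF gL(2) \<zeta>] L2_carrier[OF gL(3) \<zeta>] by (intro eq_vecI) auto
  have zd: "mv_mult \<Delta> (?z f) \<zeta> = ?z (mv_mult \<Delta> f) \<zeta>" if \<zeta>: "\<zeta> \<in> sphere 0 1" for \<zeta>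
    unfolding mv_mult_def vv_scale_def by (rule mult_mat_vec[OF Delta_carrier L2_carrier[OF L(2) \<zeta>]])
  have gce: "gg ?c \<zeta> = vv_diff ?c1 (mv_mult S ?c2) \<zeta>" for \<zeta>
    unfolding vv_diff_def mv_mult_def by (rule Delta_mult(1)[OF c])
  have hce: "hh ?c \<zeta> = vv_diff ?c2 (mv_mult Sa ?c1) \<zeta>" for \<zeta>
    unfolding vv_diff_def mv_mult_def mvf_adj_def by (rule Delta_mult(2)[OF c])
  have ScL: "mv_mult S ?c2 \<in> L2 p" "mv_mult Sa ?c1 \<in> L2 q"
    by (rule L2_mv[OF S cL(3)], rule L2_mv[OF Sa cL(2)])
  \<comment> \<open>In the $\Gamma_\ell$ part, $c_2$ enters through $\langle S^* x, c_2\rangle = \langle h_e, c_2\rangle$, as $h_e - S^* x$ is orthogonal to constants.\<close>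
  have "L2_inner ?y (gg f) = L2_inner (vv_scale cnj ?x) (gg f) + L2_inner (vv_scale cnj ?c1) (gg f)"
    by (rule L2_inner_add_left[OF H2_perp_L2[OF H2_perp_scale_cnj[OF id_hinf x(1)]] H2_perp_L2[OF H2_perp_cnj_const] gL(2)]) simp
  also have "\<dots> = L2_inner ?x (?z (gg f)) + L2_inner ?c1 (?z (gg f))"
    unfolding L2_inner_vv_scale_cnj[OF xL gL(2)] L2_inner_vv_scale_cnj[OF cL(2) gL(2)] ..
  also have "L2_inner ?x (?z (gg f)) = L2_inner ?x (gg e) - L2_inner ?x (gg ?c)"
    unfolding L2_inner_diff_right[OF gL(1,3) xL, symmetric] by (rule L2_inner_sphere_cong[OF refl zg])
  also have "L2_inner ?c1 (?z (gg f)) = L2_inner ?c1 (gg e) - L2_inner ?c1 (gg ?c)"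
    unfolding L2_inner_diff_right[OF gL(1,3) cL(2), symmetric] by (rule L2_inner_sphere_cong[OF refl zg])
  also have "L2_inner ?x (gg ?c) = L2_inner ?x ?c1 - L2_inner ?x (mv_mult S ?c2)"
    unfolding L2_inner_diff_right[OF cL(2) ScL(1) xL, symmetric] by (rule L2_inner_sphere_cong[OF refl gce])
  also have "L2_inner ?x ?c1 = 0" by (rule H2_perp_inner[OF x(1) c2H(2)])
  also have "L2_inner ?x (mv_mult S ?c2) = L2_inner (mv_mult Sa ?x) ?c2" by (rule L2_inner_adj'[OF S cL(3) xL, symmetric])
  also have "L2_inner (mv_mult Sa ?x) ?c2 = L2_inner (hh e) ?c2"
    using H2_perp_inner[OF x(2) c2H(1)] L2_inner_diff_left[OF hL(1) SxL cL(3)] by simp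
  finally have 1: "L2_inner ?y (gg f) = L2_inner ?x (gg e) + L2_inner (hh e) ?c2 + L2_inner ?c1 (gg e) - L2_inner ?c1 (gg ?c)"
    by simp
  \<comment> \<open>Multiplication by $\zeta$ is isometric and commutes with $\Delta_s$, so $f$ may be replaced by $\zeta f = e - c$.\<close>
  have "L2_inner (mv_mult \<Delta> f) f = L2_inner (mv_mult \<Delta> (?z f)) (?z f)"
  proof -
    have "L2_inner (mv_mult \<Delta> f) f = L2_inner (vv_scale cnj (?z (mv_mult \<Delta> f))) f"
    proof (rule L2_inner_sphere_cong)
      fix \<zeta> :: complex assume \<zeta>: "\<zeta> \<in> sphere 0 1"
      have "cnj \<zeta> * \<zeta> = 1" using sphere_mult_cnj[OF \<zeta>] by (simp add: mult.commute)
      then show "mv_mult \<Delta> f \<zeta> = vv_scale cnj (?z (mv_mult \<Delta> f)) \<zeta>"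
        by (simp add: vv_scale_def smult_smult_assoc)
    qed simp
    also have "\<dots> = L2_inner (?z (mv_mult \<Delta> f)) (?z f)"
      by (rule L2_inner_vv_scale_cnj[OF L2_scale[OF hinf_linf[OF id_hinf] dL(2)] L(2)])
    also have "\<dots> = L2_inner (mv_mult \<Delta> (?z f)) (?z f)" by (rule L2_inner_sphere_cong[OF zd[symmetric] refl])
    finally show ?thesis .
  qed
  also have "\<dots> = L2_inner (vv_diff (mv_mult \<Delta> e) (mv_mult \<Delta> ?c)) (vv_diff e ?c)"
  proof (rule L2_inner_sphere_cong)
    fix \<zeta> :: complex assume \<zeta>: "\<zeta> \<in> sphere 0 1"
    show "mv_mult \<Delta> (?z f) \<zeta> = vv_diff (mv_mult \<Delta> e) (mv_mult \<Delta> ?c) \<zeta>"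
      unfolding zd[OF \<zeta>] unfolding vv_diff_def D[OF \<zeta>] vv_scale_def
      using L2_carrier[OF dL(2) \<zeta>] L2_carrier[OF dL(3) \<zeta>] by (intro eq_vecI) auto
    show "?z f \<zeta> = vv_diff e ?c \<zeta>"
      unfolding vv_diff_def eq[OF \<zeta>] vv_scale_def
      using L2_carrier[OF L(2) \<zeta>] c by (intro eq_vecI) auto
  qed
  also have "\<dots> = L2_inner (mv_mult \<Delta> e) e - L2_inner (mv_mult \<Delta> e) ?c - (L2_inner (mv_mult \<Delta> ?c) e - L2_inner (mv_mult \<Delta> ?c) ?c)"
    unfolding L2_inner_diff_left[OF dL(1,3) L2_diff[OF L(1) cL(1)]] L2_inner_diff_right[OF L(1) cL(1) dL(1)]
      L2_inner_diff_right[OF L(1) cL(1) dL(3)] ..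
  also have "L2_inner (mv_mult \<Delta> e) ?c = L2_inner (gg e) ?c1 + L2_inner (hh e) ?c2"
    by (rule L2_inner_split[OF dL(1) cL(1)])
  also have "L2_inner (mv_mult \<Delta> ?c) e = cnj (L2_inner (mv_mult \<Delta> e) ?c)"
    using Delta_inner_swap[OF cL(1) L(1)] L2_inner_cnj[OF dL(1) cL(1)] by simp
  also have "\<dots> = cnj (L2_inner (gg e) ?c1) + cnj (L2_inner (hh e) ?c2)"
    unfolding L2_inner_split[OF dL(1) cL(1)] by simp
  also have "L2_inner (mv_mult \<Delta> ?c) ?c = L2_inner (gg ?c) ?c1 + L2_inner (hh ?c) ?c2"
    by (rule L2_inner_split[OF dL(3) cL(1)])
  finally have 2: "L2_inner (mv_mult \<Delta> f) f = L2_inner (mv_mult \<Delta> e) e - (L2_inner (gg e) ?c1 + L2_inner (hh e) ?c2)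
      - (cnj (L2_inner (gg e) ?c1) + cnj (L2_inner (hh e) ?c2) - (L2_inner (gg ?c) ?c1 + L2_inner (hh ?c) ?c2))" .
  have 3: "L2_inner (gg e) ?x = cnj (L2_inner ?x (gg e))" "L2_inner (gg f) (\<Gamma> (hh f)) = cnj (L2_inner (\<Gamma> (hh f)) (gg f))"
    "L2_inner ?c1 (gg e) = cnj (L2_inner (gg e) ?c1)" "L2_inner ?c1 (gg ?c) = cnj (L2_inner (gg ?c) ?c1)"
    by (rule L2_inner_cnj[OF xL gL(1)], rule L2_inner_cnj[OF H2_perp_L2[OF Gamma(1)[OF hL(2)]] gL(2)],
        rule L2_inner_cnj[OF gL(1) cL(2)], rule L2_inner_cnj[OF gL(3) cL(2)])
  have "L2_inner (gg ?c) ?c1 = L2_inner ?c1 ?c1 - L2_inner (mv_mult S ?c2) ?c1"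
    unfolding L2_inner_diff_left[OF cL(2) ScL(1) cL(2), symmetric] by (rule L2_inner_sphere_cong[OF gce refl])
  then have 4: "L2_inner (gg ?c) ?c1 = cnj (L2_inner ?c1 ?c1) - cnj (L2_inner ?c1 (mv_mult S ?c2))"
    using L2_inner_cnj[OF cL(2) cL(2)] L2_inner_cnj[OF ScL(1) cL(2)] by simp
  have 6: "cnj (L2_inner (gg ?c) ?c1) = L2_inner ?c1 ?c1 - L2_inner ?c1 (mv_mult S ?c2)"
    unfolding 4 by simp
  have "L2_inner (hh ?c) ?c2 = L2_inner ?c2 ?c2 - L2_inner (mv_mult Sa ?c1) ?c2"
    unfolding L2_inner_diff_left[OF cL(3) ScL(2) cL(3), symmetric] by (rule L2_inner_sphere_cong[OF hce refl])
  then have 5: "L2_inner (hh ?c) ?c2 = L2_inner ?c2 ?c2 - L2_inner ?c1 (mv_mult S ?c2)"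
    using L2_inner_adj'[OF S cL(3) cL(2)] by simp
  have const: "L2_inner (\<lambda>_. a) (\<lambda>_. a) = a \<bullet>c a" for a
    by (simp add: L2_inner_def measure_restrict_space lebesgue_integral_const scaleR_conv_of_real)
  have "form e e - form f f = L2_inner ?c1 ?c1 - L2_inner ?c2 ?c2"
    unfolding form_def 3(1,2) inf 1 2 using 3(3,4) 4 5 6 by simp
  then show ?thesis by (simp add: const)
qed

end

section \<open>The function $F$ on the unit circle\<close>

lemma continuous_on_det:
  assumes "\<And>z. z \<in> K \<Longrightarrow> X z \<in> carrier_mat n n"
    "\<And>i j. i < n \<Longrightarrow> j < n \<Longrightarrow> continuous_on K (\<lambda>z. X z $$ (i, j) :: complex)"
  shows "continuous_on K (\<lambda>z. det (X z))"
proof (rule continuous_on_eq)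
  show "continuous_on K (\<lambda>z. \<Sum>\<pi> \<in> {\<pi>. \<pi> permutes {0..<n}}. signof \<pi> * (\<Prod>i = 0..<n. X z $$ (i, \<pi> i)))"
    by (intro continuous_intros assms(2)) (auto simp: permutes_in_image)
qed (simp add: det_def'[OF assms(1)])

lemma continuous_on_adj_mat:
  assumes X: "\<And>z. z \<in> K \<Longrightarrow> X z \<in> carrier_mat n n"
    "\<And>i j. i < n \<Longrightarrow> j < n \<Longrightarrow> continuous_on K (\<lambda>z. X z $$ (i, j) :: complex)"
    and ij: "i < n" "j < n"
  shows "continuous_on K (\<lambda>z. adj_mat (X z) $$ (i, j))"
proof (rule continuous_on_eq)
  show "continuous_on K (\<lambda>z. (-1) ^ (j + i) * det (mat_delete (X z) j i))"
  proof (intro continuous_intros continuous_on_det[of _ _ "n - 1"])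
    show "mat_delete (X z) j i \<in> carrier_mat (n - 1) (n - 1)" if "z \<in> K" for z
      by (rule mat_delete_carrier[OF X(1)[OF that]])
    fix i' j' assume b: "i' < n - 1" "j' < n - 1"
    show "continuous_on K (\<lambda>z. mat_delete (X z) j i $$ (i', j'))"
    proof (rule continuous_on_eq[OF X(2)])
      show "(if i' < j then i' else Suc i') < n" "(if j' < i then j' else Suc j') < n" using b by auto
      show "X z $$ (if i' < j then i' else Suc i', if j' < i then j' else Suc j') = mat_delete (X z) j i $$ (i', j')" if "z \<in> K" for z
        using X(1)[OF that] b by (simp add: mat_delete_def)
    qed
  qed
  show "(-1) ^ (j + i) * det (mat_delete (X z) j i) = adj_mat (X z) $$ (i, j)" if "z \<in> K" for z
    using X(1)[OF that] ij by (simp add: adj_mat_def cofactor_def)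
qed

lemma mat_inverse_adj_mat:
  fixes A :: "complex mat"
  assumes A: "A \<in> carrier_mat n n" and d: "det A \<noteq> 0"
  shows "the (mat_inverse A) = (1 / det A) \<cdot>\<^sub>m adj_mat A" "the (mat_inverse A) \<in> carrier_mat n n"
    "the (mat_inverse A) * A = 1\<^sub>m n"
proof -
  obtain B where B: "mat_inverse A = Some B"
    using mat_inverse(1)[OF A, of "()"] det_non_zero_imp_unit[OF A d, of "()"] by (cases "mat_inverse A") auto
  have i: "B * A = 1\<^sub>m n" "B \<in> carrier_mat n n" using mat_inverse(2)[OF A B] by auto
  have c: "(1 / det A) \<cdot>\<^sub>m adj_mat A \<in> carrier_mat n n" using adj_mat[OF A] by simp
  have "A * ((1 / det A) \<cdot>\<^sub>m adj_mat A) = (1 / det A) \<cdot>\<^sub>m (A * adj_mat A)"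
    by (rule mult_smult_distrib[OF A adj_mat(1)[OF A]])
  also have "\<dots> = 1\<^sub>m n" unfolding adj_mat(2)[OF A] using d by (intro eq_matI) auto
  finally have r: "A * ((1 / det A) \<cdot>\<^sub>m adj_mat A) = 1\<^sub>m n" .
  have "B = B * (A * ((1 / det A) \<cdot>\<^sub>m adj_mat A))" unfolding r using i by simp
  also have "\<dots> = (B * A) * ((1 / det A) \<cdot>\<^sub>m adj_mat A)" using i A c by (intro assoc_mult_mat[symmetric]) auto
  also have "\<dots> = (1 / det A) \<cdot>\<^sub>m adj_mat A" unfolding i(1) by (rule left_mult_one_mat[OF c])
  finally show "the (mat_inverse A) = (1 / det A) \<cdot>\<^sub>m adj_mat A" using B by simp
  show "the (mat_inverse A) \<in> carrier_mat n n" "the (mat_inverse A) * A = 1\<^sub>m n" using B i by auto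
qed

lemma smult_mat_mult_vec:
  fixes A :: "complex mat"
  assumes "A \<in> carrier_mat n m" "v \<in> carrier_vec m" shows "(a \<cdot>\<^sub>m A) *\<^sub>v v = a \<cdot>\<^sub>v (A *\<^sub>v v)"
  using assms by (intro eq_vecI) auto

lemma eigenvector_on_circle_zero:
  fixes A :: "complex mat"
  assumes A: "A \<in> carrier_mat n n" and sp: "spectrum A \<subseteq> ball 0 1" and k: "norm k = 1"
    and v: "v \<in> carrier_vec n" "A *\<^sub>v v = k \<cdot>\<^sub>v v"
  shows "v = 0\<^sub>v n"
proof (rule ccontr)
  assume "v \<noteq> 0\<^sub>v n"
  then have "k \<in> spectrum A" using A v by (auto simp: spectrum_def eigenvalue_def eigenvector_def)
  then show False using sp k by auto
qed

locale stable_pencil =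
  fixes m n1 n2 :: nat and A1 A2 C :: "complex mat"
  assumes A1: "A1 \<in> carrier_mat n1 n1" and A2: "A2 \<in> carrier_mat n2 n2"
    and spec1: "spectrum A1 \<subseteq> ball 0 1" and spec2: "spectrum A2 \<subseteq> ball 0 1"
    and C: "C \<in> carrier_mat m (n1 + n2)"
begin

abbreviation "n \<equiv> n1 + n2"
abbreviation "M \<equiv> M_mat n1 n2 A1"
abbreviation "N \<equiv> N_mat n1 n2 A2"
abbreviation "F \<equiv> F_fun n1 n2 A1 A2 C"
abbreviation "Fv \<equiv> F_vec n1 n2 A1 A2 C"
abbreviation "W z \<equiv> M - z \<cdot>\<^sub>m N"

lemma MN_carrier: "M \<in> carrier_mat n n" "N \<in> carrier_mat n n"
  unfolding M_mat_def N_mat_def using A1 A2 by auto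

lemma W_carrier: "W z \<in> carrier_mat n n" using MN_carrier by auto

lemma M_append:
  assumes "x \<in> carrier_vec n1" "y \<in> carrier_vec n2" shows "M *\<^sub>v (x @\<^sub>v y) = (A1 *\<^sub>v x) @\<^sub>v y"
  unfolding M_mat_def using mult_mat_vec_split[OF A1 one_carrier_mat assms] assms by simp

lemma N_append:
  assumes "x \<in> carrier_vec n1" "y \<in> carrier_vec n2" shows "N *\<^sub>v (x @\<^sub>v y) = x @\<^sub>v (A2 *\<^sub>v y)"
  unfolding N_mat_def using mult_mat_vec_split[OF one_carrier_mat A2 assms] assms by simp

text \<open>
  A kernel vector consists of eigenvectors of $A_1$ for $z$ and of $A_2$ for $1/z$, and both numbers lie on the
  unit circle.
\<close>

lemma det_pencil:
  assumes z: "norm z = 1" shows "det (W z) \<noteq> 0"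
proof
  assume "det (W z) = 0"
  then obtain v where v: "v \<in> carrier_vec n" "v \<noteq> 0\<^sub>v n" "W z *\<^sub>v v = 0\<^sub>v n"
    using det_0_iff_vec_prod_zero_field[OF W_carrier, of z] by auto
  define x y where "x = vec_first v n1" and "y = vec_last v n2"
  have c: "x \<in> carrier_vec n1" "y \<in> carrier_vec n2" and vxy: "v = x @\<^sub>v y" using v by (auto simp: x_def y_def)
  note ca = mult_mat_vec_carrier[OF A1 c(1)] mult_mat_vec_carrier[OF A2 c(2)]
  have "W z *\<^sub>v v = M *\<^sub>v v - z \<cdot>\<^sub>v (N *\<^sub>v v)"
    using minus_mult_distrib_mat_vec[OF MN_carrier(1) smult_carrier_mat[OF MN_carrier(2)] v(1), of z] MN_carrier v(1)
    by (simp add: smult_mat_mult_vec[OF MN_carrier(2)])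
  then have e: "((A1 *\<^sub>v x) @\<^sub>v y) - z \<cdot>\<^sub>v (x @\<^sub>v (A2 *\<^sub>v y)) = 0\<^sub>v n"
    using v(3) unfolding vxy M_append[OF c] N_append[OF c] by simp
  have "A1 *\<^sub>v x = z \<cdot>\<^sub>v x"
  proof (rule eq_vecI)
    fix i assume "i < dim_vec (z \<cdot>\<^sub>v x)"
    then have i: "i < n1" using c by simp
    then show "(A1 *\<^sub>v x) $ i = (z \<cdot>\<^sub>v x) $ i"
      using arg_cong[OF e, of "\<lambda>w. vec_index w i"] c carrier_vecD[OF ca(1)] carrier_vecD[OF ca(2)] by (simp del: index_mult_mat_vec)
  qed (use c A1 in auto)
  then have x0: "x = 0\<^sub>v n1" by (rule eigenvector_on_circle_zero[OF A1 spec1 z c(1)])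
  have z0: "z \<noteq> 0" using z by auto
  have "A2 *\<^sub>v y = (1 / z) \<cdot>\<^sub>v y"
  proof (rule eq_vecI)
    fix i assume "i < dim_vec ((1 / z) \<cdot>\<^sub>v y)"
    then have i: "i < n2" using c by simp
    then show "(A2 *\<^sub>v y) $ i = ((1 / z) \<cdot>\<^sub>v y) $ i"
      using arg_cong[OF e, of "\<lambda>w. vec_index w (n1 + i)"] c carrier_vecD[OF ca(1)] carrier_vecD[OF ca(2)] z0
      by (simp add: field_simps del: index_mult_mat_vec)
  qed (use c A2 in auto)
  then have "y = 0\<^sub>v n2" using eigenvector_on_circle_zero[OF A2 spec2 _ c(2), of "1 / z"] z by (simp add: norm_divide)
  then have "v = 0\<^sub>v n" unfolding vxy x0 by (intro eq_vecI) auto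
  then show False using v by simp
qed

text \<open>
  By Cramer's rule the entries are continuous on the circle.
\<close>

lemma F_LM: "LM m n F"
proof -
  have F_eq: "F z = C * ((1 / det (W z)) \<cdot>\<^sub>m adj_mat (W z))" if "z \<in> sphere 0 1" for z
    unfolding F_fun_def using mat_inverse_adj_mat(1)[OF W_carrier det_pencil, of z] that by simp
  have cont: "continuous_on (sphere 0 1) (\<lambda>z. W z $$ (i, j))" if "i < n" "j < n" for i j
    using MN_carrier that by (auto intro!: continuous_intros)
  have entry: "continuous_on (sphere 0 1) (\<lambda>z. F z $$ (i, j))" if ij: "i < m" "j < n" for i j
  proof (rule continuous_on_eq)
    show "continuous_on (sphere 0 1) (\<lambda>z. \<Sum>l<n. C $$ (i, l) * (1 / det (W z) * adj_mat (W z) $$ (l, j)))"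
      using det_pencil ij
      by (intro continuous_intros continuous_on_det[of _ _ n] continuous_on_adj_mat[of _ _ n] W_carrier cont) auto
    show "(\<Sum>l<n. C $$ (i, l) * (1 / det (W z) * adj_mat (W z) $$ (l, j))) = F z $$ (i, j)" if "z \<in> sphere 0 1" for z
      unfolding F_eq[OF that]
      using C ij carrier_matD[OF adj_mat(1)[OF W_carrier[of z]]] adj_mat(1)[OF W_carrier[of z]]
      by (subst mult_mat_index[of _ m n _ n]) auto
  qed
  have "F z \<in> carrier_mat m n" if "z \<in> sphere 0 1" for z
    unfolding F_eq[OF that] using C adj_mat(1)[OF W_carrier[of z]] by auto
  then show ?thesis using entry by (auto simp: LM_def intro: linf_continuous)
qed

lemma Fv_L2: "u \<in> carrier_vec n \<Longrightarrow> Fv u \<in> L2 m"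
  using L2_mv[OF F_LM H2_L2[OF H2_const]] by (simp add: F_vec_def mv_mult_def)

lemma Fv_linear:
  assumes "\<zeta> \<in> sphere 0 1" "u \<in> carrier_vec n" "v \<in> carrier_vec n"
  shows "Fv (c \<cdot>\<^sub>v u + v) \<zeta> = c \<cdot>\<^sub>v Fv u \<zeta> + Fv v \<zeta>"
  unfolding F_vec_def
  using mult_add_distrib_mat_vec[OF LM_carrier[OF F_LM assms(1)] smult_carrier_vec[THEN iffD2, OF assms(2)] assms(3)]
    mult_mat_vec[OF LM_carrier[OF F_LM assms(1)] assms(2)] by simp

text \<open>
  This is $F(\zeta)(M - \zeta N) = C$.
\<close>

lemma Fv_displacement:
  assumes \<zeta>: "\<zeta> \<in> sphere 0 1" and u: "u \<in> carrier_vec n"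
  shows "Fv (M *\<^sub>v u) \<zeta> = C *\<^sub>v u + \<zeta> \<cdot>\<^sub>v Fv (N *\<^sub>v u) \<zeta>"
proof -
  let ?B = "the (mat_inverse (W \<zeta>))"
  have d: "det (W \<zeta>) \<noteq> 0" using \<zeta> by (intro det_pencil) simp
  note B = mat_inverse_adj_mat(2,3)[OF W_carrier d]
  have Mu: "M *\<^sub>v u \<in> carrier_vec n" and Nu: "N *\<^sub>v u \<in> carrier_vec n"
    using MN_carrier u by auto
  have F: "F \<zeta> \<in> carrier_mat m n" by (rule LM_carrier[OF F_LM \<zeta>])
  have "F \<zeta> *\<^sub>v (W \<zeta> *\<^sub>v u) = F \<zeta> * W \<zeta> *\<^sub>v u" by (rule assoc_mult_mat_vec[symmetric, OF F W_carrier u])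
  also have "F \<zeta> * W \<zeta> = C" unfolding F_fun_def assoc_mult_mat[OF C B(1) W_carrier] B(2) using C by simp
  finally have 1: "F \<zeta> *\<^sub>v (W \<zeta> *\<^sub>v u) = C *\<^sub>v u" .
  have "W \<zeta> *\<^sub>v u = M *\<^sub>v u - \<zeta> \<cdot>\<^sub>v (N *\<^sub>v u)"
    using minus_mult_distrib_mat_vec[OF MN_carrier(1) smult_carrier_mat[OF MN_carrier(2)] u, of \<zeta>] MN_carrier u
    by (simp add: smult_mat_mult_vec[OF MN_carrier(2)])
  then have "M *\<^sub>v u = W \<zeta> *\<^sub>v u + \<zeta> \<cdot>\<^sub>v (N *\<^sub>v u)"
    using Mu Nu carrier_vecD[OF Mu] carrier_vecD[OF Nu] MN_carrier by (intro eq_vecI) (auto simp del: index_mult_mat_vec)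
  then have "F \<zeta> *\<^sub>v (M *\<^sub>v u) = F \<zeta> *\<^sub>v (W \<zeta> *\<^sub>v u) + F \<zeta> *\<^sub>v (\<zeta> \<cdot>\<^sub>v (N *\<^sub>v u))"
    using mult_add_distrib_mat_vec[OF F mult_mat_vec_carrier[OF W_carrier u] smult_carrier_vec[THEN iffD2, OF Nu]] by simp
  then show ?thesis unfolding F_vec_def 1 mult_mat_vec[OF F Nu] .
qed

end

section \<open>Quadratic forms invariant under a stable matrix\<close>

lemma smult_pow_mat:
  fixes B :: "complex mat"
  assumes B: "B \<in> carrier_mat n n"
  shows "(a \<cdot>\<^sub>m B) ^\<^sub>m k = a ^ k \<cdot>\<^sub>m B ^\<^sub>m k"
proof (induction k)
  case 0
  then show ?case using B by (intro eq_matI) auto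
next
  case (Suc k)
  have Bk: "B ^\<^sub>m k \<in> carrier_mat n n" using B by (rule pow_carrier_mat)
  have "(a \<cdot>\<^sub>m B) ^\<^sub>m Suc k = (a ^ k \<cdot>\<^sub>m B ^\<^sub>m k) * (a \<cdot>\<^sub>m B)" using Suc by simp
  also have "\<dots> = a \<cdot>\<^sub>m (a ^ k \<cdot>\<^sub>m (B ^\<^sub>m k * B))"
    using mult_smult_distrib[OF smult_carrier_mat[OF Bk] B, of "a ^ k" a] mult_smult_assoc_mat[OF Bk B, of "a ^ k"] by simp
  also have "\<dots> = a ^ Suc k \<cdot>\<^sub>m B ^\<^sub>m Suc k" using B Bk by (intro eq_matI) auto
  finally show ?case .
qed

text \<open>
  Dividing $A$ by a number between its spectral radius and $1$ keeps the spectral radius below $1$, so the powers of the quotient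
  stay bounded.
\<close>

lemma stable_powers_tendsto_zero:
  fixes A :: "complex mat"
  assumes A: "A \<in> carrier_mat n n" and sp: "spectrum A \<subseteq> ball 0 1" and x: "x \<in> carrier_vec n" and i: "i < n"
  shows "(\<lambda>k. (A ^\<^sub>m k *\<^sub>v x) $ i) \<longlonglongrightarrow> 0"
proof -
  have n: "n > 0" using i by simp
  have "spectral_radius A \<in> norm ` spectrum A" by (rule spectral_radius_mem_max(1)[OF A n])
  then have r: "0 \<le> spectral_radius A" "spectral_radius A < 1" using sp by auto
  then obtain \<rho> where \<rho>: "spectral_radius A < \<rho>" "\<rho> < 1" using dense by blast
  then have \<rho>0: "\<rho> > 0" using r by simp
  define B where "B = complex_of_real (1 / \<rho>) \<cdot>\<^sub>m A"
  have B: "B \<in> carrier_mat n n" using A by (simp add: B_def)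
  have AB: "A = complex_of_real \<rho> \<cdot>\<^sub>m B" using A \<rho>0 by (intro eq_matI) (auto simp: B_def)
  have "spectral_radius B \<in> norm ` spectrum B" by (rule spectral_radius_mem_max(1)[OF B n])
  then obtain \<mu> v where \<mu>: "spectral_radius B = norm \<mu>" and v: "v \<in> carrier_vec n" "v \<noteq> 0\<^sub>v n" "B *\<^sub>v v = \<mu> \<cdot>\<^sub>v v"
    using B by (auto simp: spectrum_def eigenvalue_def eigenvector_def)
  have "A *\<^sub>v v = complex_of_real \<rho> \<cdot>\<^sub>v (B *\<^sub>v v)" unfolding AB by (rule smult_mat_mult_vec[OF B v(1)])
  then have "A *\<^sub>v v = (complex_of_real \<rho> * \<mu>) \<cdot>\<^sub>v v" unfolding v(3) by (simp add: smult_smult_assoc)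
  then have "complex_of_real \<rho> * \<mu> \<in> spectrum A"
    using A v by (auto simp: spectrum_def eigenvalue_def eigenvector_def)
  then have "norm (complex_of_real \<rho> * \<mu>) \<le> spectral_radius A"
    by (intro spectral_radius_mem_max(2)[OF A n]) auto
  then have "norm (complex_of_real \<rho> * \<mu>) < \<rho>" using \<rho> by linarith
  then have "\<rho> * norm \<mu> < \<rho> * 1" unfolding norm_mult using \<rho>0 by (simp only: norm_of_real abs_of_pos mult_1_right)
  then have "spectral_radius B < 1" unfolding \<mu> using \<rho>0 by (simp only: mult_less_cancel_left_pos)
  from spectral_radius_jnf_norm_bound_less_1_upper_triangular[OF B this]
  obtain c where c: "\<And>k. norm_bound (B ^\<^sub>m k) c" by blast
  let ?K = "\<Sum>j<n. c * norm (x $ j)"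
  have bound: "norm ((A ^\<^sub>m k *\<^sub>v x) $ i) \<le> \<rho> ^ k * ?K" for k
  proof -
    have Bk: "B ^\<^sub>m k \<in> carrier_mat n n" using B by (rule pow_carrier_mat)
    have "(A ^\<^sub>m k *\<^sub>v x) $ i = of_real (\<rho> ^ k) * (\<Sum>j<n. (B ^\<^sub>m k) $$ (i, j) * x $ j)"
      unfolding AB smult_pow_mat[OF B] smult_mat_mult_vec[OF Bk x] 
      using i carrier_vecD[OF mult_mat_vec_carrier[OF Bk x]]
      by (subst index_smult_vec) (simp_all only: mult_mat_vec_index[OF Bk x i] of_real_power)
    then have "norm ((A ^\<^sub>m k *\<^sub>v x) $ i) = \<rho> ^ k * norm (\<Sum>j<n. (B ^\<^sub>m k) $$ (i, j) * x $ j)"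
      using \<rho>0 by (simp add: norm_mult norm_power)
    also have "\<dots> \<le> \<rho> ^ k * (\<Sum>j<n. norm ((B ^\<^sub>m k) $$ (i, j) * x $ j))"
      using \<rho>0 by (intro mult_left_mono norm_sum) auto
    also have "\<dots> \<le> \<rho> ^ k * ?K"
    proof (intro mult_left_mono sum_mono)
      fix j assume "j \<in> {..<n}"
      then have "norm ((B ^\<^sub>m k) $$ (i, j)) \<le> c" using c[of k] Bk i unfolding norm_bound_def carrier_matD[OF Bk] by simp
      then show "norm ((B ^\<^sub>m k) $$ (i, j) * x $ j) \<le> c * norm (x $ j)" by (simp add: norm_mult mult_right_mono)
    qed (use \<rho>0 in simp)
    finally show ?thesis .
  qed
  have "(\<lambda>k. \<rho> ^ k * ?K) \<longlonglongrightarrow> 0 * ?K" using \<rho> \<rho>0 by (intro tendsto_intros LIMSEQ_power_zero) auto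
  then have "(\<lambda>k. \<rho> ^ k * ?K) \<longlonglongrightarrow> 0" by simp
  then show ?thesis
    by (rule Lim_null_comparison[rotated]) (use bound in auto)
qed

text \<open>
  The form takes the same value at $x$ and at $A^k x$, which tends to zero.
\<close>

lemma stable_invariant_form_zero:
  fixes A :: "complex mat" and f :: "complex vec \<Rightarrow> complex"
  assumes A: "A \<in> carrier_mat n n" "spectrum A \<subseteq> ball 0 1"
    and f: "\<And>x. x \<in> carrier_vec n \<Longrightarrow> f x = (\<Sum>i<n. \<Sum>j<n. K i j * x $ j * cnj (x $ i))"
    and inv: "\<And>x. x \<in> carrier_vec n \<Longrightarrow> f (A *\<^sub>v x) = f x"
    and x: "x \<in> carrier_vec n"
  shows "f x = 0"
proof -
  have pow: "f (A ^\<^sub>m k *\<^sub>v y) = f y" if "y \<in> carrier_vec n" for k y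
    using that
  proof (induction k arbitrary: y)
    case 0
    then show ?case using A by simp
  next
    case (Suc k)
    have Ay: "A *\<^sub>v y \<in> carrier_vec n" using A(1) Suc.prems by simp
    have "A ^\<^sub>m Suc k *\<^sub>v y = A ^\<^sub>m k *\<^sub>v (A *\<^sub>v y)"
      using assoc_mult_mat_vec[OF pow_carrier_mat[OF A(1)] A(1) Suc.prems] by simp
    then show ?case using Suc.IH[OF Ay] inv[OF Suc.prems] by simp
  qed
  have "(\<lambda>k. \<Sum>i<n. \<Sum>j<n. K i j * (A ^\<^sub>m k *\<^sub>v x) $ j * cnj ((A ^\<^sub>m k *\<^sub>v x) $ i)) \<longlonglongrightarrow> (\<Sum>i<n. \<Sum>j<n. K i j * 0 * cnj 0)"
    by (intro tendsto_intros stable_powers_tendsto_zero[OF A x]) auto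
  moreover have "(\<Sum>i<n. \<Sum>j<n. K i j * (A ^\<^sub>m k *\<^sub>v x) $ j * cnj ((A ^\<^sub>m k *\<^sub>v x) $ i)) = f x" for k
    using f[OF mult_mat_vec_carrier[OF pow_carrier_mat[OF A(1)] x], of k] pow[OF x, of k] by simp
  ultimately have "(\<lambda>k::nat. f x) \<longlonglongrightarrow> 0" by simp
  then show ?thesis using LIMSEQ_unique[OF tendsto_const] by blast
qed

lemma cscalar_form_sum:
  fixes D :: "complex mat"
  assumes "D \<in> carrier_mat n n" "x \<in> carrier_vec n" "y \<in> carrier_vec n"
  shows "(D *\<^sub>v x) \<bullet>c y = (\<Sum>i<n. \<Sum>j<n. D $$ (i, j) * x $ j * cnj (y $ i))"
  unfolding cscalar_prod_sum[OF assms(3)]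
  by (intro sum.cong refl) (simp add: mult_mat_vec_index[OF assms(1,2)] sum_distrib_right del: index_mult_mat_vec)

lemma cscalar_form_lin:
  fixes D :: "complex mat"
  assumes D: "D \<in> carrier_mat n n" and v: "x \<in> carrier_vec n" "y \<in> carrier_vec n" "z \<in> carrier_vec n"
  shows "(D *\<^sub>v (x + c \<cdot>\<^sub>v y)) \<bullet>c z = (D *\<^sub>v x) \<bullet>c z + c * ((D *\<^sub>v y) \<bullet>c z)" (is ?A)
    and "(D *\<^sub>v z) \<bullet>c (x + c \<cdot>\<^sub>v y) = (D *\<^sub>v z) \<bullet>c x + cnj c * ((D *\<^sub>v z) \<bullet>c y)" (is ?B)
proof -
  have xy: "x + c \<cdot>\<^sub>v y \<in> carrier_vec n" using v by simp
  show ?A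
    unfolding cscalar_form_sum[OF D xy v(3)] cscalar_form_sum[OF D v(1,3)] cscalar_form_sum[OF D v(2,3)]
      sum_distrib_left sum.distrib[symmetric]
    using v by (intro sum.cong refl) (simp add: algebra_simps)
  show ?B
    unfolding cscalar_form_sum[OF D v(3) xy] cscalar_form_sum[OF D v(3,1)] cscalar_form_sum[OF D v(3,2)]
      sum_distrib_left sum.distrib[symmetric]
    using v by (intro sum.cong refl) (simp add: algebra_simps)
qed

lemma cscalar_form_unit_vecs:
  fixes D :: "complex mat"
  assumes D: "D \<in> carrier_mat n n" and ij: "i < n" "j < n"
  shows "(D *\<^sub>v unit_vec n j) \<bullet>c unit_vec n i = D $$ (i, j)"
proof -
  have "conjugate (unit_vec n i) = (unit_vec n i :: complex vec)" by (rule eq_vecI) (auto simp: unit_vec_def)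
  then show ?thesis using D ij by (simp add: scalar_prod_right_unit)
qed

lemma cscalar_form_expand:
  fixes D :: "complex mat"
  assumes "D \<in> carrier_mat n n" "x \<in> carrier_vec n" "y \<in> carrier_vec n"
  shows "(D *\<^sub>v (x + c \<cdot>\<^sub>v y)) \<bullet>c (x + c \<cdot>\<^sub>v y)
    = (D *\<^sub>v x) \<bullet>c x + c * cnj c * ((D *\<^sub>v y) \<bullet>c y) + cnj c * ((D *\<^sub>v x) \<bullet>c y) + c * ((D *\<^sub>v y) \<bullet>c x)"
proof -
  have xy: "x + c \<cdot>\<^sub>v y \<in> carrier_vec n" using assms by simp
  show ?thesis
    unfolding cscalar_form_lin(1)[OF assms xy] cscalar_form_lin(2)[OF assms(1,2,3,2)] cscalar_form_lin(2)[OF assms assms(3)]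
    by (simp add: algebra_simps)
qed

text \<open>
  Polarization, with the coefficients $1$ and $i$.
\<close>

lemma mat_zero_of_form_zero:
  fixes D :: "complex mat"
  assumes D: "D \<in> carrier_mat n n" and q: "\<And>x. x \<in> carrier_vec n \<Longrightarrow> (D *\<^sub>v x) \<bullet>c x = 0"
  shows "D = 0\<^sub>m n n"
proof (rule eq_matI)
  fix i j assume "i < dim_row (0\<^sub>m n n :: complex mat)" "j < dim_col (0\<^sub>m n n :: complex mat)"
  then have ij: "i < n" "j < n" by auto
  let ?e = "unit_vec n :: nat \<Rightarrow> complex vec"
  note c = unit_vec_carrier[of n i] unit_vec_carrier[of n j]
  have exp: "(D *\<^sub>v (?e j + c \<cdot>\<^sub>v ?e i)) \<bullet>c (?e j + c \<cdot>\<^sub>v ?e i)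
     = D $$ (j, j) + c * cnj c * D $$ (i, i) + cnj c * D $$ (i, j) + c * D $$ (j, i)" for c :: complex
    using cscalar_form_expand[OF D c(2,1)] ij by (simp only: cscalar_form_unit_vecs[OF D])
  have d: "D $$ (k, k) = 0" if "k < n" for k using q[OF unit_vec_carrier, of k] cscalar_form_unit_vecs[OF D that that] by simp
  have e: "cnj c * D $$ (i, j) + c * D $$ (j, i) = 0" for c
    using exp[of c] q[of "?e j + c \<cdot>\<^sub>v ?e i"] d ij by simp
  have "D $$ (i, j) + D $$ (j, i) = 0" using e[of 1] by simp
  moreover have "- D $$ (i, j) + D $$ (j, i) = 0"
  proof -
    have "\<i> * (- D $$ (i, j) + D $$ (j, i)) = 0" using e[of \<i>] by (simp add: algebra_simps)
    then show ?thesis by (simp only: mult_eq_0_iff complex_i_not_zero simp_thms)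
  qed
  ultimately show "D $$ (i, j) = 0\<^sub>m n n $$ (i, j)" using ij by (simp add: add_eq_0_iff)
qed (use D in auto)

text \<open>
  By the parallelogram identity the two nonnegative values at $x + y$ and $x - y$ add up to zero.
\<close>

lemma psd_form_zero_of_summands:
  fixes D :: "complex mat"
  assumes D: "D \<in> carrier_mat n n" and psd: "\<And>x. x \<in> carrier_vec n \<Longrightarrow> 0 \<le> (D *\<^sub>v x) \<bullet>c x"
    and x: "x \<in> carrier_vec n" "(D *\<^sub>v x) \<bullet>c x = 0" and y: "y \<in> carrier_vec n" "(D *\<^sub>v y) \<bullet>c y = 0"
  shows "(D *\<^sub>v (x + y)) \<bullet>c (x + y) = 0"
proof -
  let ?m = "x + (-1) \<cdot>\<^sub>v y"
  have p: "x + y = x + 1 \<cdot>\<^sub>v y" by simp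
  have "(D *\<^sub>v (x + y)) \<bullet>c (x + y) + (D *\<^sub>v ?m) \<bullet>c ?m = 2 * ((D *\<^sub>v x) \<bullet>c x) + 2 * ((D *\<^sub>v y) \<bullet>c y)"
    unfolding p cscalar_form_expand[OF D x(1) y(1)] by simp
  then have "(D *\<^sub>v (x + y)) \<bullet>c (x + y) + (D *\<^sub>v ?m) \<bullet>c ?m = 0" using x y by simp
  then show ?thesis using psd[of "x + y"] psd[of ?m] x(1) y(1) by (simp add: add_nonneg_eq_0_iff)
qed

section \<open>The data of a Krein--Langer factorization\<close>

text \<open>
  Both inclusions come from the polynomial multiple of $b^*$ that is analytic: $\prod (\zeta - \alpha_i) H_2 \subseteq b H_2$, and its
  adjoint version.
\<close>

lemma finite_inner_range:
  assumes b: "finite_inner k b"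
  shows "\<exists>as. set as \<subseteq> ball 0 1 \<and>
     (\<forall>y\<in>H2 k. \<exists>a\<in>H2 k. \<forall>\<zeta>\<in>sphere 0 1. prod_list (map (\<lambda>\<alpha>. \<zeta> - \<alpha>) as) \<cdot>\<^sub>v y \<zeta> = b \<zeta> *\<^sub>v a \<zeta>) \<and>
     (\<forall>y\<in>H2_perp k. \<exists>a\<in>H2_perp k. \<forall>\<zeta>\<in>sphere 0 1.
        prod_list (map (\<lambda>\<alpha>. cnj (\<zeta> - \<alpha>)) as) \<cdot>\<^sub>v y \<zeta> = mat_adjoint (b \<zeta>) *\<^sub>v a \<zeta>)"
proof -
  obtain as where as: "set as \<subseteq> ball 0 1" "AM k k (\<lambda>\<zeta>. prod_list (map (\<lambda>\<alpha>. \<zeta> - \<alpha>) as) \<cdot>\<^sub>m mat_adjoint (b \<zeta>))"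
    using b unfolding finite_inner_def by blast
  have A: "AM k k b" and un: "\<And>\<zeta>. \<zeta> \<in> sphere 0 1 \<Longrightarrow> mat_adjoint (b \<zeta>) * b \<zeta> = 1\<^sub>m k" "\<And>\<zeta>. \<zeta> \<in> sphere 0 1 \<Longrightarrow> b \<zeta> * mat_adjoint (b \<zeta>) = 1\<^sub>m k"
    using b unfolding finite_inner_def by blast+
  let ?m = "\<lambda>\<zeta>. prod_list (map (\<lambda>\<alpha>. \<zeta> - \<alpha>) as)"
  let ?X = "\<lambda>\<zeta>. ?m \<zeta> \<cdot>\<^sub>m mat_adjoint (b \<zeta>)"
  have cm: "cnj (?m \<zeta>) = prod_list (map (\<lambda>\<alpha>. cnj (\<zeta> - \<alpha>)) as)" for \<zeta>
    by (induction as) auto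
  have 1: "\<exists>a\<in>H2 k. \<forall>\<zeta>\<in>sphere 0 1. ?m \<zeta> \<cdot>\<^sub>v y \<zeta> = b \<zeta> *\<^sub>v a \<zeta>" if y: "y \<in> H2 k" for y
  proof (intro bexI ballI)
    show "mv_mult ?X y \<in> H2 k" by (rule H2_mv[OF as(2) y])
    fix \<zeta> :: complex assume \<zeta>: "\<zeta> \<in> sphere 0 1"
    note c = AM_carrier[OF A \<zeta>] L2_carrier[OF H2_L2[OF y] \<zeta>]
    note ca = mat_adjoint_carrier[OF c(1)]
    have "b \<zeta> *\<^sub>v mv_mult ?X y \<zeta> = ?m \<zeta> \<cdot>\<^sub>v (b \<zeta> *\<^sub>v (mat_adjoint (b \<zeta>) *\<^sub>v y \<zeta>))"
      unfolding mv_mult_def smult_mat_mult_vec[OF ca c(2)] by (rule mult_mat_vec[OF c(1) mult_mat_vec_carrier[OF ca c(2)]])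
    also have "b \<zeta> *\<^sub>v (mat_adjoint (b \<zeta>) *\<^sub>v y \<zeta>) = y \<zeta>" by (rule unitary_cancel[OF c ca un(2)[OF \<zeta>]])
    finally show "?m \<zeta> \<cdot>\<^sub>v y \<zeta> = b \<zeta> *\<^sub>v mv_mult ?X y \<zeta>" by simp
  qed
  have 2: "\<exists>a\<in>H2_perp k. \<forall>\<zeta>\<in>sphere 0 1. cnj (?m \<zeta>) \<cdot>\<^sub>v y \<zeta> = mat_adjoint (b \<zeta>) *\<^sub>v a \<zeta>" if y: "y \<in> H2_perp k" for y
  proof (intro bexI ballI)
    show "mv_mult (mvf_adj ?X) y \<in> H2_perp k" by (rule H2_perp_adj[OF as(2) y])
    fix \<zeta> :: complex assume \<zeta>: "\<zeta> \<in> sphere 0 1"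
    note c = AM_carrier[OF A \<zeta>] L2_carrier[OF H2_perp_L2[OF y] \<zeta>]
    note ca = mat_adjoint_carrier[OF c(1)]
    have "mat_adjoint (?m \<zeta> \<cdot>\<^sub>m mat_adjoint (b \<zeta>)) = cnj (?m \<zeta>) \<cdot>\<^sub>m b \<zeta>"
      using c(1) by (intro eq_matI) (auto simp: mat_adjoint_index mat_adjoint_dims)
    then have "mat_adjoint (b \<zeta>) *\<^sub>v mv_mult (mvf_adj ?X) y \<zeta> = cnj (?m \<zeta>) \<cdot>\<^sub>v (mat_adjoint (b \<zeta>) *\<^sub>v (b \<zeta> *\<^sub>v y \<zeta>))"
      unfolding mv_mult_def mvf_adj_def
      using smult_mat_mult_vec[OF c] mult_mat_vec[OF ca mult_mat_vec_carrier[OF c]] by simp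
    also have "mat_adjoint (b \<zeta>) *\<^sub>v (b \<zeta> *\<^sub>v y \<zeta>) = y \<zeta>" by (rule unitary_cancel[OF ca c(2,1) un(1)[OF \<zeta>]])
    finally show "cnj (?m \<zeta>) \<cdot>\<^sub>v y \<zeta> = mat_adjoint (b \<zeta>) *\<^sub>v mv_mult (mvf_adj ?X) y \<zeta>" by simp
  qed
  show ?thesis using as(1) 1 2 unfolding cm by blast
qed

lemma kl_pair_of_factorizations:
  assumes s: "s \<in> gen_schur p q \<kappa>" and L: "left_KL p q \<kappa> s bl sl" and R: "right_KL p q \<kappa> s br sr"
  shows "kl_pair p q s bl br (bdry p q sl) (bdry p q sr)"
proof -
  have bl: "blaschke_potapov p \<kappa> bl" and sl: "sl \<in> schur p q" and rl: "\<And>z. z \<in> ball 0 1 \<Longrightarrow> vec_space.rank p (hcat (bl z) (sl z)) = p"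
    using L by (auto simp: left_KL_def)
  have br: "blaschke_potapov q \<kappa> br" and sr: "sr \<in> schur p q"
    and rr: "\<And>z. z \<in> ball 0 1 \<Longrightarrow> vec_space.rank q (hcat (mat_adjoint (br z)) (mat_adjoint (sr z))) = q"
    using R by (auto simp: right_KL_def)
  note Bl = blaschke_potapov_props[OF bl] and Br = blaschke_potapov_props[OF br]
  have lc: "bl z \<in> carrier_mat p p" "sl z \<in> carrier_mat p q" "br z \<in> carrier_mat q q" "sr z \<in> carrier_mat p q" if "z \<in> ball 0 1" for z
    using Bl(2) Br(2) sl sr that by (auto simp: cont_hol_def gen_schur_def)
  note bd = left_KL_boundary[OF s L]
  note AMs = schur_AMv[OF sl] schur_AMv[OF sr]
  show ?thesis
  proof
    show "LM p q (bdry p q s)" by (rule bd(3))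
    show "finite_inner p bl" "finite_inner q br" by (rule Bl(1), rule Br(1))
    show "AM p q (bdry p q sl)" "AM p q (bdry p q sr)" using AMs by (auto simp: AMv_def)
    show "AE \<theta> in arc. bl (cis \<theta>) * bdry p q s (cis \<theta>) = bdry p q sl (cis \<theta>)" by (rule bd(2))
    show "AE \<theta> in arc. bdry p q s (cis \<theta>) * br (cis \<theta>) = bdry p q sr (cis \<theta>)" by (rule right_KL_boundary[OF s bd(1,4) R])
  next
    fix y assume y: "y \<in> H2 p"
    obtain as where as: "set as \<subseteq> ball 0 1"
      and fin: "\<And>y. y \<in> H2 p \<Longrightarrow> \<exists>a\<in>H2 p. \<forall>\<zeta>\<in>sphere 0 1. prod_list (map (\<lambda>\<alpha>. \<zeta> - \<alpha>) as) \<cdot>\<^sub>v y \<zeta> = bl \<zeta> *\<^sub>v a \<zeta>"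
      using finite_inner_range[OF Bl(1)] by auto
    show "\<exists>a\<in>H2 p. \<exists>b\<in>H2 q. \<forall>\<zeta>\<in>sphere 0 1. y \<zeta> = bl \<zeta> *\<^sub>v a \<zeta> + bdry p q sl \<zeta> *\<^sub>v b \<zeta>"
    proof (rule corona_H2[OF cont_hol_AMv[OF Bl(2)] AMs(1) _ as fin y])
      fix \<alpha> :: complex and c :: "complex vec" assume a: "\<alpha> \<in> ball 0 1" and c: "c \<in> carrier_vec p"
      show "\<exists>c1\<in>carrier_vec p. \<exists>c2\<in>carrier_vec q. c = bl \<alpha> *\<^sub>v c1 + sl \<alpha> *\<^sub>v c2"
        by (rule hcat_full_rank_onto[OF lc(1,2)[OF a] rl[OF a] c])
    qed
  next
    fix x assume x: "x \<in> H2_perp q"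
    obtain as where as: "set as \<subseteq> ball 0 1"
      and fin: "\<And>y. y \<in> H2_perp q \<Longrightarrow> \<exists>a\<in>H2_perp q. \<forall>\<zeta>\<in>sphere 0 1.
        prod_list (map (\<lambda>\<alpha>. cnj (\<zeta> - \<alpha>)) as) \<cdot>\<^sub>v y \<zeta> = mat_adjoint (br \<zeta>) *\<^sub>v a \<zeta>"
      using finite_inner_range[OF Br(1)] by auto
    show "\<exists>a\<in>H2_perp q. \<exists>b\<in>H2_perp p. \<forall>\<zeta>\<in>sphere 0 1. x \<zeta> = mat_adjoint (br \<zeta>) *\<^sub>v a \<zeta> + mat_adjoint (bdry p q sr \<zeta>) *\<^sub>v b \<zeta>"
    proof (rule corona_H2_perp[OF cont_hol_AMv[OF Br(2)] AMs(2) _ as fin x])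
      fix \<alpha> :: complex and c :: "complex vec" assume a: "\<alpha> \<in> ball 0 1" and c: "c \<in> carrier_vec q"
      show "\<exists>c1\<in>carrier_vec q. \<exists>c2\<in>carrier_vec p. c = mat_adjoint (br \<alpha>) *\<^sub>v c1 + mat_adjoint (sr \<alpha>) *\<^sub>v c2"
        by (rule hcat_full_rank_onto[OF lc(3,4)[OF a, THEN mat_adjoint_carrier] rr[OF a] c])
    qed
  qed
qed

text \<open>
  The two interpolation conditions are $b_\ell g \in H_2^p$ and $b_r^* h \in (H_2^q)^\perp$.
\<close>

lemma (in kl_pair) admissible_of_interpolation:
  assumes f: "f \<in> L2 (p + q)"
    and l: "mv_mult (\<lambda>\<zeta>. hcat (bl \<zeta>) (- SL \<zeta>)) f \<in> H2 p"
    and r: "mv_mult (\<lambda>\<zeta>. hcat (- mat_adjoint (SR \<zeta>)) (mat_adjoint (br \<zeta>))) f \<in> H2_perp q"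
  shows "admissible f"
  unfolding admissible_def
proof (intro conjI f)
  have gL: "gg f \<in> L2 p" and hL: "hh f \<in> L2 q" by (rule L2_gg[OF f], rule L2_hh[OF f])
  show "\<exists>b. spG (gg f) b"
  proof (rule spG_intro[OF gL], rule H2_AE_cong[OF l])
    show "L2_eq (mv_mult (\<lambda>\<zeta>. hcat (bl \<zeta>) (- SL \<zeta>)) f) (mv_mult bl (gg f))"
      unfolding L2_eq_def using left
    proof eventually_elim
      case (elim \<theta>)
      note c = AM_carrier[OF bl(1) cis_range, of \<theta>] S_carrier[of \<theta>] AM_carrier[OF SL cis_range, of \<theta>] L2_carrier[OF f cis_range, of \<theta>]
      let ?u = "vec_first (f (cis \<theta>)) p" and ?w = "vec_last (f (cis \<theta>)) q"
      have "bl (cis \<theta>) *\<^sub>v (?u - S (cis \<theta>) *\<^sub>v ?w) = bl (cis \<theta>) *\<^sub>v ?u - bl (cis \<theta>) *\<^sub>v (S (cis \<theta>) *\<^sub>v ?w)"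
        using c by (intro mult_minus_distrib_mat_vec[of _ p p]) auto
      also have "bl (cis \<theta>) *\<^sub>v (S (cis \<theta>) *\<^sub>v ?w) = SL (cis \<theta>) *\<^sub>v ?w"
        unfolding elim[symmetric] by (rule assoc_mult_mat_vec[symmetric, OF c(1,2)]) simp
      finally show ?case
        unfolding mv_mult_def Delta_mult(1)[OF c(4)] using c(1,3)
        by (subst hcat_mult_vec[OF c(1) _ c(4)]) (auto simp: uminus_mult_mat_vec)
    qed
  qed (rule mv_mult_carrier[OF AM_LM[OF bl(1)] gL])
  show "spH (hh f)"
  proof (rule spH_intro[OF hL], rule H2_perp_AE_cong[OF r])
    show "L2_eq (mv_mult (\<lambda>\<zeta>. hcat (- mat_adjoint (SR \<zeta>)) (mat_adjoint (br \<zeta>))) f) (mv_mult (mvf_adj br) (hh f))"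
      unfolding L2_eq_def using right
    proof eventually_elim
      case (elim \<theta>)
      note c = AM_carrier[OF br(1) cis_range, of \<theta>] S_carrier[of \<theta>] AM_carrier[OF SR cis_range, of \<theta>] L2_carrier[OF f cis_range, of \<theta>]
      note ca = mat_adjoint_carrier[OF c(1)] mat_adjoint_carrier[OF c(2)] mat_adjoint_carrier[OF c(3)]
      let ?u = "vec_first (f (cis \<theta>)) p" and ?w = "vec_last (f (cis \<theta>)) q"
      have "mat_adjoint (br (cis \<theta>)) *\<^sub>v (?w - mat_adjoint (S (cis \<theta>)) *\<^sub>v ?u)
          = mat_adjoint (br (cis \<theta>)) *\<^sub>v ?w - mat_adjoint (br (cis \<theta>)) *\<^sub>v (mat_adjoint (S (cis \<theta>)) *\<^sub>v ?u)"
        using ca by (intro mult_minus_distrib_mat_vec[of _ q q]) auto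
      also have "mat_adjoint (br (cis \<theta>)) *\<^sub>v (mat_adjoint (S (cis \<theta>)) *\<^sub>v ?u) = mat_adjoint (SR (cis \<theta>)) *\<^sub>v ?u"
        unfolding elim[symmetric] mat_adjoint_mult[OF c(2,1)] by (rule assoc_mult_mat_vec[symmetric, OF ca(1,2)]) simp
      finally have e: "mat_adjoint (br (cis \<theta>)) *\<^sub>v (?w - mat_adjoint (S (cis \<theta>)) *\<^sub>v ?u) = mat_adjoint (br (cis \<theta>)) *\<^sub>v ?w - mat_adjoint (SR (cis \<theta>)) *\<^sub>v ?u" .
      have un: "(- mat_adjoint (SR (cis \<theta>))) *\<^sub>v ?u = - (mat_adjoint (SR (cis \<theta>)) *\<^sub>v ?u)"
        using carrier_matD[OF ca(3)] by (intro uminus_mult_mat_vec) simp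
      have comm: "- a + b = b - a" if "a \<in> carrier_vec q" "b \<in> carrier_vec q" for a b :: "complex vec"
        using that by (intro eq_vecI) auto
      have n: "- mat_adjoint (SR (cis \<theta>)) \<in> carrier_mat q p" using ca(3) by simp
      show ?case
        unfolding mv_mult_def mvf_adj_def Delta_mult(2)[OF c(4)] e hcat_mult_vec[OF n ca(1) c(4)] un
        by (rule comm) (rule mult_mat_vec_carrier[OF ca(3) vec_first_carrier], rule mult_mat_vec_carrier[OF ca(1) vec_last_carrier])
    qed
  qed (rule mv_mult_carrier[OF LM_adj[OF AM_LM[OF br(1)]] hL])
qed

section \<open>The matrix $P_s$ and its displacement equation\<close>

lemma linear_functional_unit_vecs:
  fixes f :: "complex vec \<Rightarrow> complex"
  assumes lin: "\<And>c u v. u \<in> carrier_vec n \<Longrightarrow> v \<in> carrier_vec n \<Longrightarrow> f (c \<cdot>\<^sub>v u + v) = c * f u + f v"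
    and u: "u \<in> carrier_vec n"
  shows "f u = (\<Sum>j<n. u $ j * f (unit_vec n j))"
proof -
  have z: "f (0\<^sub>v n) = 0" using lin[of "0\<^sub>v n" "0\<^sub>v n" 1] by simp
  have "f (vec n (\<lambda>j. if j < k then u $ j else 0)) = (\<Sum>j<k. u $ j * f (unit_vec n j))" if "k \<le> n" for k
    using that
  proof (induction k)
    case 0
    have "vec n (\<lambda>j. if j < (0::nat) then u $ j else 0) = 0\<^sub>v n" by (intro eq_vecI) auto
    then show ?case using z by simp
  next
    case (Suc k)
    have "vec n (\<lambda>j. if j < Suc k then u $ j else 0) = u $ k \<cdot>\<^sub>v unit_vec n k + vec n (\<lambda>j. if j < k then u $ j else 0)"
      using Suc.prems by (intro eq_vecI) (auto simp: unit_vec_def less_Suc_eq)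
    then show ?case using Suc by (simp add: lin)
  qed
  from this[of n] have "f (vec n (\<lambda>j. if j < n then u $ j else 0)) = (\<Sum>j<n. u $ j * f (unit_vec n j))" by simp
  moreover have "vec n (\<lambda>j. if j < n then u $ j else 0) = u" using u by (intro eq_vecI) auto
  ultimately show ?thesis by simp
qed

text \<open>
  Linearity in the first argument and Hermitian symmetry give conjugate linearity in the second.
\<close>

lemma hermitian_form_matrix:
  fixes h :: "complex vec \<Rightarrow> complex vec \<Rightarrow> complex"
  assumes lin: "\<And>c u v w. u \<in> carrier_vec n \<Longrightarrow> v \<in> carrier_vec n \<Longrightarrow> w \<in> carrier_vec n \<Longrightarrow> h (c \<cdot>\<^sub>v u + v) w = c * h u w + h v w"
    and herm: "\<And>u v. u \<in> carrier_vec n \<Longrightarrow> v \<in> carrier_vec n \<Longrightarrow> h v u = cnj (h u v)"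
  shows "\<exists>!X. X \<in> carrier_mat n n \<and> (\<forall>u\<in>carrier_vec n. \<forall>v\<in>carrier_vec n. (X *\<^sub>v u) \<bullet>c v = h u v)"
proof (rule ex1I)
  let ?X = "mat n n (\<lambda>(i, j). h (unit_vec n j) (unit_vec n i))"
  have "(?X *\<^sub>v u) \<bullet>c v = h u v" if u: "u \<in> carrier_vec n" and v: "v \<in> carrier_vec n" for u v
  proof -
    have "h u v = (\<Sum>j<n. u $ j * h (unit_vec n j) v)"
      by (rule linear_functional_unit_vecs[of n "\<lambda>u. h u v"]) (use lin u v in auto)
    also have "\<dots> = (\<Sum>j<n. u $ j * cnj (\<Sum>i<n. v $ i * h (unit_vec n i) (unit_vec n j)))"
    proof (intro sum.cong refl arg_cong2[of _ _ _ _ "(*)"])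
      fix j
      have "h v (unit_vec n j) = (\<Sum>i<n. v $ i * h (unit_vec n i) (unit_vec n j))"
        by (rule linear_functional_unit_vecs[of n "\<lambda>v. h v (unit_vec n j)"]) (use lin v in auto)
      then show "h (unit_vec n j) v = cnj (\<Sum>i<n. v $ i * h (unit_vec n i) (unit_vec n j))"
        using herm[OF v unit_vec_carrier, of j] by simp
    qed
    also have "\<dots> = (\<Sum>j<n. \<Sum>i<n. h (unit_vec n j) (unit_vec n i) * u $ j * cnj (v $ i))"
      by (intro sum.cong refl) (simp add: sum_distrib_left ac_simps herm[OF unit_vec_carrier unit_vec_carrier, symmetric])
    also have "\<dots> = (\<Sum>i<n. \<Sum>j<n. h (unit_vec n j) (unit_vec n i) * u $ j * cnj (v $ i))" by (rule sum.swap)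
    also have "\<dots> = (?X *\<^sub>v u) \<bullet>c v" unfolding cscalar_form_sum[OF mat_carrier u v] by (intro sum.cong refl) auto
    finally show ?thesis by simp
  qed
  then show "?X \<in> carrier_mat n n \<and> (\<forall>u\<in>carrier_vec n. \<forall>v\<in>carrier_vec n. (?X *\<^sub>v u) \<bullet>c v = h u v)" by simp
  fix Y assume Y: "Y \<in> carrier_mat n n \<and> (\<forall>u\<in>carrier_vec n. \<forall>v\<in>carrier_vec n. (Y *\<^sub>v u) \<bullet>c v = h u v)"
  show "Y = ?X"
  proof (rule eq_matI)
    fix i j assume "i < dim_row ?X" "j < dim_col ?X"
    then have "i < n" "j < n" by auto
    then show "Y $$ (i, j) = ?X $$ (i, j)"
      using cscalar_form_unit_vecs[of Y n i j] Y by simp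
  qed (use Y in auto)
qed

text \<open>
  The factors that witness the interpolation conditions need not be the ones chosen in the definition of $P_s$. They
  show that the functions $F u$ are admissible, a property that depends on $S$ alone and so carries over to the chosen factors.
\<close>

lemma (in stable_pencil) P_s_displacement:
  assumes m: "m = p + q" and s: "s \<in> gen_schur p q \<kappa>"
    and L: "left_KL p q \<kappa> s bl sl" and R: "right_KL p q \<kappa> s br sr"
    and int: "\<And>u. u \<in> carrier_vec n \<Longrightarrow> mv_mult (\<lambda>\<zeta>. hcat (bl \<zeta>) (- bdry p q sl \<zeta>)) (Fv u) \<in> H2 p"
      "\<And>u. u \<in> carrier_vec n \<Longrightarrow> mv_mult (\<lambda>\<zeta>. hcat (- mat_adjoint (bdry p q sr \<zeta>)) (mat_adjoint (br \<zeta>))) (Fv u) \<in> H2_perp q"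
  defines "X \<equiv> P_s p q \<kappa> n1 n2 A1 A2 C s"
  shows "X \<in> carrier_mat n n"
    and "u \<in> carrier_vec n \<Longrightarrow> (X *\<^sub>v (M *\<^sub>v u)) \<bullet>c (M *\<^sub>v u) - (X *\<^sub>v (N *\<^sub>v u)) \<bullet>c (N *\<^sub>v u)
       = vec_first (C *\<^sub>v u) p \<bullet>c vec_first (C *\<^sub>v u) p - vec_last (C *\<^sub>v u) q \<bullet>c vec_last (C *\<^sub>v u) q"
proof -
  have FL: "Fv u \<in> L2 (p + q)" if "u \<in> carrier_vec n" for u using Fv_L2[OF that] by (simp add: m)
  interpret W: kl_pair p q s bl br "bdry p q sl" "bdry p q sr" "bdry p q s"
    using kl_pair_of_factorizations[OF s L R] by simp_all
  have adm: "W.admissible (Fv u)" if "u \<in> carrier_vec n" for u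
    by (rule W.admissible_of_interpolation[OF FL[OF that] int(1)[OF that] int(2)[OF that]])
  obtain bl' br' where K: "KL_factors p q \<kappa> s = (bl', br')" by fastforce
  have "\<exists>x. case x of (bl, br) \<Rightarrow> (\<exists>sl. left_KL p q \<kappa> s bl sl) \<and> (\<exists>sr. right_KL p q \<kappa> s br sr)"
    using L R by auto
  from someI_ex[OF this] obtain sl' sr' where LR: "left_KL p q \<kappa> s bl' sl'" "right_KL p q \<kappa> s br' sr'"
    using K unfolding KL_factors_def by auto
  interpret K: kl_pair p q s bl' br' "bdry p q sl'" "bdry p q sr'" "bdry p q s"
    using kl_pair_of_factorizations[OF s LR] by simp_all
  have "\<exists>!X. X \<in> carrier_mat n n \<and> (\<forall>u\<in>carrier_vec n. \<forall>v\<in>carrier_vec n. (X *\<^sub>v u) \<bullet>c v = K.form (Fv u) (Fv v))"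
  proof (rule hermitian_form_matrix)
    show "K.form (Fv (c \<cdot>\<^sub>v u + v)) (Fv w) = c * K.form (Fv u) (Fv w) + K.form (Fv v) (Fv w)"
      if "u \<in> carrier_vec n" "v \<in> carrier_vec n" "w \<in> carrier_vec n" for c u v w
      by (rule K.form_linear) (use that in \<open>auto intro!: adm Fv_linear\<close>)
    show "K.form (Fv v) (Fv u) = cnj (K.form (Fv u) (Fv v))" if "u \<in> carrier_vec n" "v \<in> carrier_vec n" for u v
      by (rule K.form_hermitian[OF adm adm]) (use that in auto)
  qed
  moreover have "K.form (Fv u) (Fv v) = L2_inner (P_operator p q s bl' br' (Fv u)) (Fv v)" if "u \<in> carrier_vec n" "v \<in> carrier_vec n" for u v
    using K.P_operator_form[OF adm[OF that(1)] adm[OF that(2)]] by simp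
  ultimately have "\<exists>!X. X \<in> carrier_mat n n \<and> (\<forall>u\<in>carrier_vec n. \<forall>v\<in>carrier_vec n. (X *\<^sub>v u) \<bullet>c v = L2_inner (P_operator p q s bl' br' (Fv u)) (Fv v))"
    by simp
  from theI'[OF this] have X: "X \<in> carrier_mat n n"
    "\<And>u v. u \<in> carrier_vec n \<Longrightarrow> v \<in> carrier_vec n \<Longrightarrow> (X *\<^sub>v u) \<bullet>c v = L2_inner (P_operator p q s bl' br' (Fv u)) (Fv v)"
    unfolding X_def P_s_def K by auto
  show "X \<in> carrier_mat n n" by (rule X(1))
  assume u: "u \<in> carrier_vec n"
  have Mu: "M *\<^sub>v u \<in> carrier_vec n" and Nu: "N *\<^sub>v u \<in> carrier_vec n" using MN_carrier u by auto
  have Cu: "C *\<^sub>v u \<in> carrier_vec (p + q)" using C u m by simp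
  show "(X *\<^sub>v (M *\<^sub>v u)) \<bullet>c (M *\<^sub>v u) - (X *\<^sub>v (N *\<^sub>v u)) \<bullet>c (N *\<^sub>v u)
       = vec_first (C *\<^sub>v u) p \<bullet>c vec_first (C *\<^sub>v u) p - vec_last (C *\<^sub>v u) q \<bullet>c vec_last (C *\<^sub>v u) q"
    unfolding X(2)[OF Mu Mu] X(2)[OF Nu Nu] K.P_operator_form[OF adm[OF Mu] adm[OF Mu]] K.P_operator_form[OF adm[OF Nu] adm[OF Nu]]
    by (rule K.form_displacement[OF adm[OF Mu] adm[OF Nu] Cu Fv_displacement[OF _ u]])
qed

section \<open>The solution sets coincide\<close>

lemma stable_invariant_form_zero_on_range:
  fixes A D E :: "complex mat"
  assumes A: "A \<in> carrier_mat m m" "spectrum A \<subseteq> ball 0 1" and D: "D \<in> carrier_mat n n" and E: "E \<in> carrier_mat n m"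
    and inv: "\<And>x. x \<in> carrier_vec m \<Longrightarrow> (D *\<^sub>v (E *\<^sub>v (A *\<^sub>v x))) \<bullet>c (E *\<^sub>v (A *\<^sub>v x)) = (D *\<^sub>v (E *\<^sub>v x)) \<bullet>c (E *\<^sub>v x)"
    and x: "x \<in> carrier_vec m"
  shows "(D *\<^sub>v (E *\<^sub>v x)) \<bullet>c (E *\<^sub>v x) = 0"
proof -
  let ?K = "mat_adjoint E * (D * E)"
  note Ea = mat_adjoint_carrier[OF E]
  have DE: "D * E \<in> carrier_mat n m" using D E by simp
  have K: "?K \<in> carrier_mat m m" using Ea DE by simp
  have f: "(D *\<^sub>v (E *\<^sub>v y)) \<bullet>c (E *\<^sub>v y) = (\<Sum>i<m. \<Sum>j<m. ?K $$ (i, j) * y $ j * cnj (y $ i))"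
    if y: "y \<in> carrier_vec m" for y
  proof -
    have "(?K *\<^sub>v y) \<bullet>c y = (mat_adjoint E *\<^sub>v (D *\<^sub>v (E *\<^sub>v y))) \<bullet>c y"
      using assoc_mult_mat_vec[OF Ea DE y] assoc_mult_mat_vec[OF D E y] by simp
    also have "\<dots> = (D *\<^sub>v (E *\<^sub>v y)) \<bullet>c (E *\<^sub>v y)"
      using cscalar_prod_adjoint[OF Ea mult_mat_vec_carrier[OF D mult_mat_vec_carrier[OF E y]] y] by (simp add: mat_adjoint_adjoint)
    finally show "(D *\<^sub>v (E *\<^sub>v y)) \<bullet>c (E *\<^sub>v y) = (\<Sum>i<m. \<Sum>j<m. ?K $$ (i, j) * y $ j * cnj (y $ i))"
      unfolding cscalar_form_sum[OF K y y, symmetric] by simp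
  qed
  show ?thesis
    by (rule stable_invariant_form_zero[where f = "\<lambda>x. (D *\<^sub>v (E *\<^sub>v x)) \<bullet>c (E *\<^sub>v x)" and A = A and n = m, OF A f inv x])
qed

context stable_pencil begin

text \<open>
  The matrices \<open>E1\<close> and \<open>E2\<close> embed the two coordinate subspaces. On the first one $N$ is the identity and
  $M$ acts as $A_1$, on the second one the roles are exchanged.
\<close>

lemma psd_displacement_zero:
  assumes D: "D \<in> carrier_mat n n" and psd: "\<And>x. x \<in> carrier_vec n \<Longrightarrow> 0 \<le> (D *\<^sub>v x) \<bullet>c x"
    and inv: "\<And>u. u \<in> carrier_vec n \<Longrightarrow> (D *\<^sub>v (M *\<^sub>v u)) \<bullet>c (M *\<^sub>v u) = (D *\<^sub>v (N *\<^sub>v u)) \<bullet>c (N *\<^sub>v u)"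
  shows "D = 0\<^sub>m n n"
proof (rule mat_zero_of_form_zero[OF D])
  fix v :: "complex vec" assume v: "v \<in> carrier_vec n"
  define E1 :: "complex mat" where "E1 = mat n n1 (\<lambda>(i, j). if i = j then 1 else 0)"
  define E2 :: "complex mat" where "E2 = mat n n2 (\<lambda>(i, j). if i = n1 + j then 1 else 0)"
  have E: "E1 \<in> carrier_mat n n1" "E2 \<in> carrier_mat n n2" by (auto simp: E1_def E2_def)
  have E1: "E1 *\<^sub>v x = x @\<^sub>v 0\<^sub>v n2" if x: "x \<in> carrier_vec n1" for x :: "complex vec"
  proof (rule eq_vecI)
    fix i assume "i < dim_vec (x @\<^sub>v 0\<^sub>v n2)"
    then have i: "i < n" using x by simp
    have "(E1 *\<^sub>v x) $ i = (\<Sum>j<n1. if j = i then x $ j else 0)"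
      unfolding mult_mat_vec_index[OF E(1) x i] using i by (intro sum.cong refl) (auto simp: E1_def)
    then show "(E1 *\<^sub>v x) $ i = (x @\<^sub>v 0\<^sub>v n2) $ i" using i x by (auto simp del: index_mult_mat_vec)
  qed (use E x in auto)
  have E2: "E2 *\<^sub>v y = 0\<^sub>v n1 @\<^sub>v y" if y: "y \<in> carrier_vec n2" for y :: "complex vec"
  proof (rule eq_vecI)
    fix i assume "i < dim_vec (0\<^sub>v n1 @\<^sub>v y)"
    then have i: "i < n" using y by simp
    have "(E2 *\<^sub>v y) $ i = (\<Sum>j<n2. if j = i - n1 then (if n1 \<le> i then y $ j else 0) else 0)"
      unfolding mult_mat_vec_index[OF E(2) y i] using i by (intro sum.cong refl) (auto simp: E2_def)
    then show "(E2 *\<^sub>v y) $ i = (0\<^sub>v n1 @\<^sub>v y) $ i" using i y by (auto simp del: index_mult_mat_vec)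
  qed (use E y in auto)
  have z: "A1 *\<^sub>v 0\<^sub>v n1 = 0\<^sub>v n1" "A2 *\<^sub>v 0\<^sub>v n2 = 0\<^sub>v n2" using A1 A2 by auto
  have q1: "(D *\<^sub>v (E1 *\<^sub>v x)) \<bullet>c (E1 *\<^sub>v x) = 0" if x: "x \<in> carrier_vec n1" for x
  proof (rule stable_invariant_form_zero_on_range[OF A1 spec1 D E(1) _ x])
    fix y :: "complex vec" assume y: "y \<in> carrier_vec n1"
    have "M *\<^sub>v (y @\<^sub>v 0\<^sub>v n2) = (A1 *\<^sub>v y) @\<^sub>v 0\<^sub>v n2" "N *\<^sub>v (y @\<^sub>v 0\<^sub>v n2) = y @\<^sub>v 0\<^sub>v n2"
      using M_append[OF y zero_carrier_vec] N_append[OF y zero_carrier_vec] z by simp_all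
    then show "(D *\<^sub>v (E1 *\<^sub>v (A1 *\<^sub>v y))) \<bullet>c (E1 *\<^sub>v (A1 *\<^sub>v y)) = (D *\<^sub>v (E1 *\<^sub>v y)) \<bullet>c (E1 *\<^sub>v y)"
      using inv[of "y @\<^sub>v 0\<^sub>v n2"] y unfolding E1[OF mult_mat_vec_carrier[OF A1 y]] E1[OF y] by simp
  qed
  have q2: "(D *\<^sub>v (E2 *\<^sub>v x)) \<bullet>c (E2 *\<^sub>v x) = 0" if x: "x \<in> carrier_vec n2" for x :: "complex vec"
  proof (rule stable_invariant_form_zero_on_range[OF A2 spec2 D E(2) _ x])
    fix y :: "complex vec" assume y: "y \<in> carrier_vec n2"
    have "M *\<^sub>v (0\<^sub>v n1 @\<^sub>v y) = 0\<^sub>v n1 @\<^sub>v y" "N *\<^sub>v (0\<^sub>v n1 @\<^sub>v y) = 0\<^sub>v n1 @\<^sub>v (A2 *\<^sub>v y)"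
      using M_append[OF zero_carrier_vec y] N_append[OF zero_carrier_vec y] z by simp_all
    then show "(D *\<^sub>v (E2 *\<^sub>v (A2 *\<^sub>v y))) \<bullet>c (E2 *\<^sub>v (A2 *\<^sub>v y)) = (D *\<^sub>v (E2 *\<^sub>v y)) \<bullet>c (E2 *\<^sub>v y)"
      using inv[of "0\<^sub>v n1 @\<^sub>v y"] y unfolding E2[OF mult_mat_vec_carrier[OF A2 y]] E2[OF y] by simp
  qed
  let ?x = "vec_first v n1" and ?y = "vec_last v n2"
  have sum: "v = E1 *\<^sub>v ?x + E2 *\<^sub>v ?y"
    unfolding E1[OF vec_first_carrier] E2[OF vec_last_carrier]
    using v by (intro eq_vecI) (auto simp: vec_first_def vec_last_def)
  have "(D *\<^sub>v (E1 *\<^sub>v ?x + E2 *\<^sub>v ?y)) \<bullet>c (E1 *\<^sub>v ?x + E2 *\<^sub>v ?y) = 0"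
    by (rule psd_form_zero_of_summands[OF D psd _ q1 _ q2])
       (rule mult_mat_vec_carrier[OF E(1) vec_first_carrier] vec_first_carrier
          mult_mat_vec_carrier[OF E(2) vec_last_carrier] vec_last_carrier | assumption)+
  then show "(D *\<^sub>v v) \<bullet>c v = 0" by (simp only: sum[symmetric])
qed

end

lemma cscalar_form_conj:
  fixes X Q :: "complex mat"
  assumes X: "X \<in> carrier_mat k n" and Q: "Q \<in> carrier_mat k k" and u: "u \<in> carrier_vec n"
  shows "((mat_adjoint X * Q * X) *\<^sub>v u) \<bullet>c u = (Q *\<^sub>v (X *\<^sub>v u)) \<bullet>c (X *\<^sub>v u)"
proof -
  note Xa = mat_adjoint_carrier[OF X]
  have "(mat_adjoint X * Q * X) *\<^sub>v u = mat_adjoint X *\<^sub>v (Q *\<^sub>v (X *\<^sub>v u))"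
    using assoc_mult_mat_vec[OF mult_carrier_mat[OF Xa Q] X u] assoc_mult_mat_vec[OF Xa Q mult_mat_vec_carrier[OF X u]] by simp
  then show ?thesis
    using cscalar_prod_adjoint[OF Xa mult_mat_vec_carrier[OF Q mult_mat_vec_carrier[OF X u]] u] by (simp add: mat_adjoint_adjoint)
qed

lemma j_pq_form:
  assumes v: "v \<in> carrier_vec (p + q)"
  shows "(j_pq p q *\<^sub>v v) \<bullet>c v = vec_first v p \<bullet>c vec_first v p - vec_last v q \<bullet>c vec_last v q"
proof -
  let ?x = "vec_first v p" and ?y = "vec_last v q"
  have "j_pq p q *\<^sub>v (?x @\<^sub>v ?y) = (1\<^sub>m p *\<^sub>v ?x + 0\<^sub>m p q *\<^sub>v ?y) @\<^sub>v (0\<^sub>m q p *\<^sub>v ?x + (- 1\<^sub>m q) *\<^sub>v ?y)"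
    unfolding j_pq_def by (rule four_block_mat_mult_vec) auto
  also have "\<dots> = ?x @\<^sub>v (- ?y)" by (intro eq_vecI) (auto simp: uminus_mult_mat_vec)
  finally have e: "j_pq p q *\<^sub>v v = ?x @\<^sub>v (- ?y)" using v by simp
  have "vec_first (?x @\<^sub>v (- ?y)) p = ?x" "vec_last (?x @\<^sub>v (- ?y)) q = - ?y"
    by (intro eq_vecI; simp add: vec_first_def vec_last_def)+
  then show ?thesis
    unfolding e using cscalar_prod_split[of "?x @\<^sub>v (- ?y)" p q v] v by simp
qed

theorem corollary3p4:
  fixes p q \<kappa> n1 n2 :: nat and A1 A2 C P :: "complex mat"
  assumes "p \<ge> 1" and "q \<ge> 1" and "n1 + n2 \<ge> 1"
    and "A1 \<in> carrier_mat n1 n1" and "A2 \<in> carrier_mat n2 n2"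
    and "spectrum A1 \<union> spectrum A2 \<subseteq> ball 0 1"
    and "C \<in> carrier_mat (p + q) (n1 + n2)"
    and "P \<in> carrier_mat (n1 + n2) (n1 + n2)" and "mat_adjoint P = P"
    and "mat_adjoint (M_mat n1 n2 A1) * P * M_mat n1 n2 A1
           - mat_adjoint (N_mat n1 n2 A2) * P * N_mat n1 n2 A2
         = mat_adjoint C * j_pq p q * C"
  shows "(\<forall>s \<in> S_hat p q \<kappa> n1 n2 A1 A2 C P. P_s p q \<kappa> n1 n2 A1 A2 C s = P) \<and>
         S_hat p q \<kappa> n1 n2 A1 A2 C P = S_sol p q \<kappa> n1 n2 A1 A2 C P"
proof -
  interpret stable_pencil "p + q" n1 n2 A1 A2 C
    using assms by unfold_locales auto
  have P: "P \<in> carrier_mat n n" by (rule assms(8))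
  have PM: "(P *\<^sub>v (M *\<^sub>v u)) \<bullet>c (M *\<^sub>v u) - (P *\<^sub>v (N *\<^sub>v u)) \<bullet>c (N *\<^sub>v u)
      = vec_first (C *\<^sub>v u) p \<bullet>c vec_first (C *\<^sub>v u) p - vec_last (C *\<^sub>v u) q \<bullet>c vec_last (C *\<^sub>v u) q"
    if u: "u \<in> carrier_vec n" for u
  proof -
    have J: "j_pq p q \<in> carrier_mat (p + q) (p + q)" by (auto simp: j_pq_def)
    have c: "mat_adjoint M * P * M \<in> carrier_mat n n" "mat_adjoint N * P * N \<in> carrier_mat n n"
      using MN_carrier[THEN mat_adjoint_carrier] MN_carrier P by auto
    have "((mat_adjoint M * P * M - mat_adjoint N * P * N) *\<^sub>v u) \<bullet>c u
        = ((mat_adjoint M * P * M) *\<^sub>v u) \<bullet>c u - ((mat_adjoint N * P * N) *\<^sub>v u) \<bullet>c u"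
      using c u by (simp add: minus_mult_distrib_mat_vec[OF c u] minus_scalar_prod_distrib[of _ n])
    also have "\<dots> = (P *\<^sub>v (M *\<^sub>v u)) \<bullet>c (M *\<^sub>v u) - (P *\<^sub>v (N *\<^sub>v u)) \<bullet>c (N *\<^sub>v u)"
      by (simp only: cscalar_form_conj[OF MN_carrier(1) P u] cscalar_form_conj[OF MN_carrier(2) P u])
    finally have "(P *\<^sub>v (M *\<^sub>v u)) \<bullet>c (M *\<^sub>v u) - (P *\<^sub>v (N *\<^sub>v u)) \<bullet>c (N *\<^sub>v u) = ((mat_adjoint C * j_pq p q * C) *\<^sub>v u) \<bullet>c u"
      unfolding assms(10) by simp
    also have "\<dots> = (j_pq p q *\<^sub>v (C *\<^sub>v u)) \<bullet>c (C *\<^sub>v u)" by (rule cscalar_form_conj[OF C J u])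
    finally show ?thesis unfolding j_pq_form[OF mult_mat_vec_carrier[OF C u]] .
  qed
  have eq: "P_s p q \<kappa> n1 n2 A1 A2 C s = P" if "s \<in> S_hat p q \<kappa> n1 n2 A1 A2 C P" for s
  proof -
    let ?X = "P_s p q \<kappa> n1 n2 A1 A2 C s"
    from that obtain bl sl br sr where s: "s \<in> gen_schur p q \<kappa>" and L: "left_KL p q \<kappa> s bl sl" and R: "right_KL p q \<kappa> s br sr"
      and int: "\<And>u. u \<in> carrier_vec n \<Longrightarrow> mv_mult (\<lambda>\<zeta>. hcat (bl \<zeta>) (- bdry p q sl \<zeta>)) (Fv u) \<in> H2 p"
        "\<And>u. u \<in> carrier_vec n \<Longrightarrow> mv_mult (\<lambda>\<zeta>. hcat (- mat_adjoint (bdry p q sr \<zeta>)) (mat_adjoint (br \<zeta>))) (Fv u) \<in> H2_perp q"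
      and le: "loewner_le n ?X P"
      unfolding S_hat_def by blast
    have X: "?X \<in> carrier_mat n n" by (rule P_s_displacement(1)[OF refl s L R int])
    have X2: "(?X *\<^sub>v (M *\<^sub>v u)) \<bullet>c (M *\<^sub>v u) - (?X *\<^sub>v (N *\<^sub>v u)) \<bullet>c (N *\<^sub>v u)
       = vec_first (C *\<^sub>v u) p \<bullet>c vec_first (C *\<^sub>v u) p - vec_last (C *\<^sub>v u) q \<bullet>c vec_last (C *\<^sub>v u) q"
      if u: "u \<in> carrier_vec n" for u
      by (rule P_s_displacement(2)[OF refl s L R int u])
    have D: "P - ?X \<in> carrier_mat n n" by (rule minus_carrier_mat[OF X])
    have diff: "((P - ?X) *\<^sub>v x) \<bullet>c x = (P *\<^sub>v x) \<bullet>c x - (?X *\<^sub>v x) \<bullet>c x" if x: "x \<in> carrier_vec n" for x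
      unfolding minus_mult_distrib_mat_vec[OF P X x] using P X x by (intro minus_scalar_prod_distrib[of _ n]) auto
    have swap: "a - c = b - d" if "a - b = c - d" for a b c d :: complex
      using that by (simp add: diff_eq_eq add_ac)
    have "P - ?X = 0\<^sub>m n n"
    proof (rule psd_displacement_zero[OF D])
      show "0 \<le> ((P - ?X) *\<^sub>v x) \<bullet>c x" if "x \<in> carrier_vec n" for x using le that by (simp add: loewner_le_def)
      fix u :: "complex vec" assume u: "u \<in> carrier_vec n"
      show "((P - ?X) *\<^sub>v (M *\<^sub>v u)) \<bullet>c (M *\<^sub>v u) = ((P - ?X) *\<^sub>v (N *\<^sub>v u)) \<bullet>c (N *\<^sub>v u)"
        unfolding diff[OF mult_mat_vec_carrier[OF MN_carrier(1) u]] diff[OF mult_mat_vec_carrier[OF MN_carrier(2) u]]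
        using trans[OF PM[OF u] X2[OF u, symmetric]] by (rule swap)
    qed
    show ?thesis
    proof (rule eq_matI)
      fix i j assume ij: "i < dim_row P" "j < dim_col P"
      have "(P - ?X) $$ (i, j) = 0" unfolding \<open>P - ?X = 0\<^sub>m n n\<close> using ij P by simp
      then show "?X $$ (i, j) = P $$ (i, j)" using ij P X by simp
    qed (use P X in auto)
  qed
  then show ?thesis by (auto simp: S_sol_def)
qed

end
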